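(* Let $(C,\xi)$ be a contact manifold and let $\{\mathcal{L}_t\}_{t\in I}$ be an isotopy of Legendrians in $C$ over an open interval $I$ which is uniformly displaceable for some Reeb vector field and which can be thickened to an isotopy of Weinstein hypersurfaces $\{(\mathcal{H},\lambda,V,\phi)_t\}_{t\in I}$. Then there exists an isotopy of convex tubular neighborhoods $\{(U,\rho,X)_t\}_{t\in I}$ of $\{\mathcal{L}_t\}$.
   Context: A (singular) Legendrian is a Whitney stratifiable subspace whose top-dimensional strata are smooth Legendrians. An isotopy of Legendrians in $C$ over $I$ is a Whitney stratifiable closed subset $\mathcal{L}_I\subset C\times I$ such that each $\mathcal{L}_t=\mathcal{L}_I\cap(C\times\{t\})$ is a (singular) Legendrian. For a contact form $\alpha$ with Reeb vector field $R_\alpha$ and flow $R_\alpha^s$, $\{\mathcal{L}_t\}$ is uniformly displaceable for $R_\alpha$ if there is $\epsilon>0$, independent of $t$, with $\mathcal{L}_t\cap R_\alpha^s(\mathcal{L}_t)=\emptyset$ for all $0<|s|<\epsilon$ and all $t$. **Weinstein hypersurfaces.** A codimension-1 submanifold $\mathcal{H}$ with boundary in $(C,\xi)$ is a Weinstein hypersurface if there is a contact form $\alpha$ such that $(\mathcal{H},\lambda:=\alpha|_{\mathcal{H}})$ is compatible with a Weinstein (domain) structure: $d\lambda$ is symplectic, and the Liouville vector field $V$ on $\mathcal{H}$ ($\iota_Vd\lambda=\lambda$) is outward transverse to $\partial\mathcal{H}$ and admits a Lyapunov function $\phi:\mathcal{H}\to\mathbb{R}$. It is denoted $(\mathcal{H},\lambda,V,\phi)$,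 and it is a thickening of $\mathcal{L}$ if $\mathcal{L}$ is its skeleton $\bigcap_{T>0}V^{-T}(\mathcal{H})$ ($V^T$ the flow of $V$). An isotopy of Weinstein hypersurfaces is a smooth family $\{(\mathcal{H},\lambda,V,\phi)_t\}$ where the choice of contact form $\alpha_t$ has smooth and bounded variation with $t$; it thickens $\{\mathcal{L}_t\}$ if $\mathcal{H}_t$ is a thickening of $\mathcal{L}_t$ for all $t$. **Convex tubular neighborhoods.** A convex tubular neighborhood of $\mathcal{L}$ is a triple $(U,\rho,X)$: $U=U(\mathcal{L})$ an open tubular neighborhood of $\mathcal{L}$; $\rho:U\to[0,1)$ a $C^1$ function; $X$ a smooth contact vector field on $U$; such that, with $U_r(\mathcal{L})=\{x\in U:\rho(x)<r\}$ for $0<r<1$, one has $\bigcap_r U_r(\mathcal{L})=\mathcal{L}$; the boundaries $\partial U_r(\mathcal{L})$ are $C^1$-smooth and $C^1$-diffeomorphic to each other; $X$ is transverse to all $\partial U_r(\mathcal{L})$; and $d\rho(X)>c\rho$ on $U\setminus\mathcal{L}$ for some constant $c>0$. An isotopy of convex tubular neighborhoods of $\{\mathcal{L}_t\}$ is a one-parameter family $\{(U,\rho,X)_t\}$ of such data for $\mathcal{L}_t$ with a uniform constant $c>0$, where $\bigcup_t U_t\times\{t\}$ is open in $C\times I$, $X_t$ varies smoothly with $t$, and $\rho_t(x)$ is continuous in $(x,t)$. *)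

theory Defs
  imports "HOL-Analysis.Analysis" "HOL-Library.Extended_Nat" "HOL-Library.Disjoint_Sets"
begin

section \<open>Differentiability classes\<close>

text \<open>For open \<open>S\<close>: all iterated directional derivatives of order at most \<open>n\<close> exist, all
  derivatives of order below \<open>n\<close> are Frechet differentiable, and those of order \<open>n\<close> are continuous.\<close>

primrec Cn_on :: "nat \<Rightarrow> ('e::euclidean_space \<Rightarrow> 'f::euclidean_space) \<Rightarrow> 'e set \<Rightarrow> bool" where
  "Cn_on 0 f S \<longleftrightarrow> continuous_on S f"
| "Cn_on (Suc n) f S \<longleftrightarrow>
     (\<forall>x\<in>S. f differentiable (at x)) \<and> (\<forall>v. Cn_on n (\<lambda>x. frechet_derivative f (at x) v) S)"

definition Ck_on :: "enat \<Rightarrow> ('e::euclidean_space \<Rightarrow> 'f::euclidean_space) \<Rightarrow> 'e set \<Rightarrow> bool" where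
  "Ck_on k f S \<longleftrightarrow> (\<forall>n. enat n \<le> k \<longrightarrow> Cn_on n f S)"


section \<open>Manifolds, charts and tangent vectors\<close>

record ('a, 'e) chart =
  cdom :: "'a set"
  cmap :: "'a \<Rightarrow> 'e"

definition cinv :: "('a, 'e) chart \<Rightarrow> 'e \<Rightarrow> 'a" where
  "cinv c = inv_into (cdom c) (cmap c)"

definition is_chart :: "('a::topological_space, 'e::euclidean_space) chart \<Rightarrow> bool" where
  "is_chart c \<longleftrightarrow> open (cdom c) \<and> open (cmap c ` cdom c) \<and>
     homeomorphism (cdom c) (cmap c ` cdom c) (cmap c) (cinv c)"

definition transition_Ck ::
  "enat \<Rightarrow> ('a, 'e::euclidean_space) chart \<Rightarrow> ('a, 'e) chart \<Rightarrow> bool" where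
  "transition_Ck k c d \<longleftrightarrow> Ck_on k (cmap d \<circ> cinv c) (cmap c ` (cdom c \<inter> cdom d))"

definition smooth_atlas :: "('a::topological_space, 'e::euclidean_space) chart set \<Rightarrow> bool" where
  "smooth_atlas A \<longleftrightarrow> (\<forall>c\<in>A. is_chart c) \<and> (\<forall>c\<in>A. \<forall>d\<in>A. transition_Ck \<infinity> c d)"

definition carrier :: "('a, 'e) chart set \<Rightarrow> 'a set" where
  "carrier A = (\<Union>c\<in>A. cdom c)"

text \<open>The maximal \<open>C\<^sup>k\<close> atlas containing the given atlas.\<close>

definition charts ::
  "enat \<Rightarrow> ('a::topological_space, 'e::euclidean_space) chart set \<Rightarrow> ('a, 'e) chart set" where
  "charts k A = {c. is_chart c \<and> cdom c \<subseteq> carrier A \<and>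
     (\<forall>d\<in>A. transition_Ck k c d \<and> transition_Ck k d c)}"

text \<open>The tangent space at \<open>p\<close> is modelled on the whole of \<open>'e\<close>: a tangent vector at \<open>p\<close> is
  identified with its coordinates in one chart \<open>chart_at A p\<close> chosen once and for all at \<open>p\<close>.
  Since that choice need not depend continuously on \<open>p\<close>, regularity of tensor fields is always
  expressed through \<open>coord A c p\<close>, the linear isomorphism from the tangent space at \<open>p\<close> to
  coordinates in the chart \<open>c\<close>, and its inverse \<open>coord_inv A c p\<close>.\<close>

definition chart_at :: "('a, 'e) chart set \<Rightarrow> 'a \<Rightarrow> ('a, 'e) chart" where
  "chart_at A p = (SOME c. c \<in> A \<and> p \<in> cdom c)"

definition coord ::
  "('a, 'e::euclidean_space) chart set \<Rightarrow> ('a, 'e) chart \<Rightarrow> 'a \<Rightarrow> 'e \<Rightarrow> 'e" where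
  "coord A c p =
     frechet_derivative (cmap c \<circ> cinv (chart_at A p)) (at (cmap (chart_at A p) p))"

definition coord_inv ::
  "('a, 'e::euclidean_space) chart set \<Rightarrow> ('a, 'e) chart \<Rightarrow> 'a \<Rightarrow> 'e \<Rightarrow> 'e" where
  "coord_inv A c p = frechet_derivative (cmap (chart_at A p) \<circ> cinv c) (at (cmap c p))"

definition std_atlas :: "('e, 'e) chart set" where
  "std_atlas = {\<lparr>cdom = UNIV, cmap = id\<rparr>}"

definition prod_atlas :: "('a, 'e) chart set \<Rightarrow> real set \<Rightarrow> ('a \<times> real, 'e \<times> real) chart set" where
  "prod_atlas A I = (\<lambda>c. \<lparr>cdom = cdom c \<times> I, cmap = (\<lambda>(x, t). (cmap c x, t))\<rparr>) ` A"

definition Ck_map ::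
  "('b::topological_space, 'f::euclidean_space) chart set \<Rightarrow>
   ('a::topological_space, 'e::euclidean_space) chart set \<Rightarrow> enat \<Rightarrow> 'b set \<Rightarrow> ('b \<Rightarrow> 'a) \<Rightarrow> bool"
  where
  "Ck_map B A k W F \<longleftrightarrow> continuous_on W F \<and> F ` W \<subseteq> carrier A \<and>
     (\<forall>c\<in>B. \<forall>d\<in>A. Ck_on k (cmap d \<circ> F \<circ> cinv c) (cmap c ` {q \<in> W \<inter> cdom c. F q \<in> cdom d}))"

text \<open>On an arbitrary subset \<open>S\<close>, being of class \<open>C\<^sup>k\<close> means having local \<open>C\<^sup>k\<close> extensions.\<close>

definition Ck_map_on ::
  "('b::topological_space, 'f::euclidean_space) chart set \<Rightarrow>
   ('a::topological_space, 'e::euclidean_space) chart set \<Rightarrow> enat \<Rightarrow> 'b set \<Rightarrow> ('b \<Rightarrow> 'a) \<Rightarrow> bool"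
  where
  "Ck_map_on B A k S f \<longleftrightarrow> (\<forall>p\<in>S. \<exists>W F. open W \<and> p \<in> W \<and> W \<subseteq> carrier B \<and>
     Ck_map B A k W F \<and> (\<forall>q\<in>S \<inter> W. F q = f q))"

definition Ck_diffeomorphic ::
  "('a::topological_space, 'e::euclidean_space) chart set \<Rightarrow> enat \<Rightarrow> 'a set \<Rightarrow> 'a set \<Rightarrow> bool" where
  "Ck_diffeomorphic A k S T \<longleftrightarrow> (\<exists>f g. Ck_map_on A A k S f \<and> Ck_map_on A A k T g \<and>
     (\<forall>x\<in>S. f x \<in> T \<and> g (f x) = x) \<and> (\<forall>y\<in>T. g y \<in> S \<and> f (g y) = y))"

text \<open>Differential at \<open>p\<close> of a function defined on \<open>S\<close>. If \<open>S\<close> is a submanifold, possibly with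
  boundary, only its values on vectors tangent to \<open>S\<close> are determined; it is used only there.\<close>

definition differential ::
  "('a, 'e::euclidean_space) chart set \<Rightarrow> 'a set \<Rightarrow> ('a \<Rightarrow> real) \<Rightarrow> 'a \<Rightarrow> 'e \<Rightarrow> real" where
  "differential A S f p = (let c = chart_at A p in
     SOME D. ((f \<circ> cinv c) has_derivative D) (at (cmap c p) within cmap c ` (S \<inter> cdom c)))"


section \<open>Submanifolds\<close>

definition slice_chart ::
  "('a::topological_space, 'e::euclidean_space) chart set \<Rightarrow> enat \<Rightarrow> nat \<Rightarrow> 'a set \<Rightarrow> 'a \<Rightarrow>
   ('a, 'e) chart \<Rightarrow> 'e set \<Rightarrow> bool" where
  "slice_chart A k d S p c W \<longleftrightarrow> c \<in> charts k A \<and> p \<in> cdom c \<and> subspace W \<and> dim W = d \<and>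
     cmap c ` (S \<inter> cdom c) = W \<inter> cmap c ` cdom c"

text \<open>Here \<open>S\<close> is locally the half space of \<open>W\<close> on the side of \<open>u\<close>, and \<open>p\<close> is a boundary point.\<close>

definition bdry_chart ::
  "('a::topological_space, 'e::euclidean_space) chart set \<Rightarrow> enat \<Rightarrow> nat \<Rightarrow> 'a set \<Rightarrow> 'a \<Rightarrow>
   ('a, 'e) chart \<Rightarrow> 'e set \<Rightarrow> 'e \<Rightarrow> bool" where
  "bdry_chart A k d S p c W u \<longleftrightarrow> c \<in> charts k A \<and> p \<in> cdom c \<and> subspace W \<and> dim W = d \<and>
     u \<in> W \<and> u \<noteq> 0 \<and> cmap c p \<bullet> u = 0 \<and>
     cmap c ` (S \<inter> cdom c) = {x \<in> W. 0 \<le> x \<bullet> u} \<inter> cmap c ` cdom c"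

definition submanifold ::
  "('a::topological_space, 'e::euclidean_space) chart set \<Rightarrow> enat \<Rightarrow> nat \<Rightarrow> 'a set \<Rightarrow> bool" where
  "submanifold A k d S \<longleftrightarrow> S \<subseteq> carrier A \<and> (\<forall>p\<in>S. \<exists>c W. slice_chart A k d S p c W)"

definition submanifold_with_boundary ::
  "('a::topological_space, 'e::euclidean_space) chart set \<Rightarrow> enat \<Rightarrow> nat \<Rightarrow> 'a set \<Rightarrow> bool" where
  "submanifold_with_boundary A k d S \<longleftrightarrow> S \<subseteq> carrier A \<and>
     (\<forall>p\<in>S. (\<exists>c W. slice_chart A k d S p c W) \<or> (\<exists>c W u. bdry_chart A k d S p c W u))"

text \<open>The tangent space of a submanifold of class at least \<open>C\<^sup>1\<close>; at boundary points this is the full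
  tangent space, not a half space.\<close>

definition tangent_space ::
  "('a::topological_space, 'e::euclidean_space) chart set \<Rightarrow> 'a set \<Rightarrow> 'a \<Rightarrow> 'e set" where
  "tangent_space A S p = {v. \<exists>d c W. coord A c p v \<in> W \<and>
     (slice_chart A 1 d S p c W \<or> (\<exists>u. bdry_chart A 1 d S p c W u))}"


section \<open>Whitney stratifications\<close>

text \<open>Convergence in the Grassmannian, as convergence of orthogonal projections.\<close>

definition subspaces_tendsto :: "(nat \<Rightarrow> 'e::euclidean_space set) \<Rightarrow> 'e set \<Rightarrow> bool" where
  "subspaces_tendsto T \<tau> \<longleftrightarrow> subspace \<tau> \<and>
     (\<forall>v. (\<lambda>n. closest_point (T n) v) \<longlonglongrightarrow> closest_point \<tau> v)"

text \<open>Whitney's conditions (a) and (b) for the pair of strata \<open>(T, S)\<close> at all points of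
  \<open>S \<inter> closure T\<close>.\<close>

definition whitney_conditions ::
  "('a::topological_space, 'e::euclidean_space) chart set \<Rightarrow> 'a set \<Rightarrow> 'a set \<Rightarrow> bool" where
  "whitney_conditions A T S \<longleftrightarrow>
     (\<forall>c\<in>charts \<infinity> A. \<forall>y\<in>S \<inter> cdom c. \<forall>x \<tau>.
        range x \<subseteq> T \<inter> cdom c \<and> x \<longlonglongrightarrow> y \<and>
        subspaces_tendsto (\<lambda>n. coord A c (x n) ` tangent_space A T (x n)) \<tau> \<longrightarrow>
        coord A c y ` tangent_space A S y \<subseteq> \<tau> \<and>
        (\<forall>z l. range z \<subseteq> S \<inter> cdom c \<and> z \<longlonglongrightarrow> y \<and>
           (\<lambda>n. sgn (cmap c (x n) - cmap c (z n))) \<longlonglongrightarrow> l \<longrightarrow> l \<in> \<tau>))"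

definition whitney_stratification ::
  "('a::topological_space, 'e::euclidean_space) chart set \<Rightarrow> 'a set \<Rightarrow> 'a set set \<Rightarrow> bool" where
  "whitney_stratification A Z \<S> \<longleftrightarrow> partition_on Z \<S> \<and>
     (\<forall>p\<in>Z. \<exists>W. open W \<and> p \<in> W \<and> finite {S \<in> \<S>. S \<inter> W \<noteq> {}}) \<and>
     (\<forall>S\<in>\<S>. \<exists>d. submanifold A \<infinity> d S) \<and>
     (\<forall>S\<in>\<S>. \<forall>T\<in>\<S>. S \<inter> closure T \<noteq> {} \<longrightarrow> S \<subseteq> closure T) \<and>
     (\<forall>S\<in>\<S>. \<forall>T\<in>\<S>. S \<noteq> T \<longrightarrow> whitney_conditions A T S)"

definition whitney_stratifiable ::
  "('a::topological_space, 'e::euclidean_space) chart set \<Rightarrow> 'a set \<Rightarrow> bool" where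
  "whitney_stratifiable A Z \<longleftrightarrow> (\<exists>\<S>. whitney_stratification A Z \<S>)"

definition top_dimensional ::
  "('a::topological_space, 'e::euclidean_space) chart set \<Rightarrow> 'a set set \<Rightarrow> 'a set \<Rightarrow> bool" where
  "top_dimensional A \<S> S \<longleftrightarrow> S \<in> \<S> \<and> (\<exists>d. submanifold A \<infinity> d S \<and>
     (\<forall>T\<in>\<S>. \<forall>d'. submanifold A \<infinity> d' T \<longrightarrow> d' \<le> d))"


section \<open>Vector fields, forms and flows\<close>

text \<open>Time-dependent tensor fields are smooth on an open set \<open>W\<close> of pairs \<open>(p, t)\<close> if their
  coordinate expressions are jointly smooth in space and time.\<close>

definition smooth_vector_field_family ::
  "('a, 'e::euclidean_space) chart set \<Rightarrow> ('a \<times> real) set \<Rightarrow> (real \<Rightarrow> 'a \<Rightarrow> 'e) \<Rightarrow> bool" where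
  "smooth_vector_field_family A W X \<longleftrightarrow> (\<forall>c\<in>A.
     Ck_on \<infinity> (\<lambda>(y, t). coord A c (cinv c y) (X t (cinv c y)))
       {(y, t). y \<in> cmap c ` cdom c \<and> (cinv c y, t) \<in> W})"

definition smooth_vector_field_family_on ::
  "('a::topological_space, 'e::euclidean_space) chart set \<Rightarrow> ('a \<times> real) set \<Rightarrow>
   (real \<Rightarrow> 'a \<Rightarrow> 'e) \<Rightarrow> bool" where
  "smooth_vector_field_family_on A S V \<longleftrightarrow> (\<forall>(p, t)\<in>S. \<exists>W X. open W \<and> (p, t) \<in> W \<and>
     W \<subseteq> carrier A \<times> UNIV \<and> smooth_vector_field_family A W X \<and>
     (\<forall>(q, s)\<in>S \<inter> W. X s q = V s q))"

definition smooth_vector_field_on ::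
  "('a::topological_space, 'e::euclidean_space) chart set \<Rightarrow> 'a set \<Rightarrow> ('a \<Rightarrow> 'e) \<Rightarrow> bool" where
  "smooth_vector_field_on A S V \<longleftrightarrow> smooth_vector_field_family_on A (S \<times> UNIV) (\<lambda>_. V)"

definition smooth_form_family ::
  "('a, 'e::euclidean_space) chart set \<Rightarrow> ('a \<times> real) set \<Rightarrow> (real \<Rightarrow> 'a \<Rightarrow> 'e \<Rightarrow> real) \<Rightarrow> bool"
  where
  "smooth_form_family A W \<alpha> \<longleftrightarrow> (\<forall>(p, t)\<in>W. linear (\<alpha> t p)) \<and> (\<forall>c\<in>A. \<forall>v.
     Ck_on \<infinity> (\<lambda>(y, t). \<alpha> t (cinv c y) (coord_inv A c (cinv c y) v))
       {(y, t). y \<in> cmap c ` cdom c \<and> (cinv c y, t) \<in> W})"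

definition smooth_form ::
  "('a, 'e::euclidean_space) chart set \<Rightarrow> 'a set \<Rightarrow> ('a \<Rightarrow> 'e \<Rightarrow> real) \<Rightarrow> bool" where
  "smooth_form A W \<alpha> \<longleftrightarrow> smooth_form_family A (W \<times> UNIV) (\<lambda>_. \<alpha>)"

text \<open>The exterior derivative of a one-form and its Lie derivative along a vector field, computed in
  the chart \<open>chart_at A p\<close>:
  \<open>d\<alpha>(u, v) = \<partial>\<^sub>u(\<alpha>(v)) - \<partial>\<^sub>v(\<alpha>(u))\<close> for constant \<open>u\<close>, \<open>v\<close>, and
  \<open>(L\<^sub>X \<alpha>)(v) = \<partial>\<^sub>X(\<alpha>(v)) + \<alpha>(\<partial>\<^sub>v X)\<close> for constant \<open>v\<close>.\<close>

definition ext_deriv ::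
  "('a, 'e::euclidean_space) chart set \<Rightarrow> ('a \<Rightarrow> 'e \<Rightarrow> real) \<Rightarrow> 'a \<Rightarrow> 'e \<Rightarrow> 'e \<Rightarrow> real" where
  "ext_deriv A \<alpha> p u v = (let c = chart_at A p;
       a = (\<lambda>w y. \<alpha> (cinv c y) (coord_inv A c (cinv c y) w)) in
     frechet_derivative (a v) (at (cmap c p)) u - frechet_derivative (a u) (at (cmap c p)) v)"

definition lie_deriv ::
  "('a, 'e::euclidean_space) chart set \<Rightarrow> ('a \<Rightarrow> 'e) \<Rightarrow> ('a \<Rightarrow> 'e \<Rightarrow> real) \<Rightarrow> 'a \<Rightarrow> 'e \<Rightarrow> real" where
  "lie_deriv A X \<alpha> p v = (let c = chart_at A p;
       a = (\<lambda>w y. \<alpha> (cinv c y) (coord_inv A c (cinv c y) w));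
       Y = (\<lambda>y. coord A c (cinv c y) (X (cinv c y))) in
     frechet_derivative (a v) (at (cmap c p)) (X p) +
     \<alpha> p (frechet_derivative Y (at (cmap c p)) v))"

definition riemannian_metric ::
  "('a, 'e::euclidean_space) chart set \<Rightarrow> ('a \<Rightarrow> 'e \<Rightarrow> 'e \<Rightarrow> real) \<Rightarrow> bool" where
  "riemannian_metric A g \<longleftrightarrow>
     (\<forall>p\<in>carrier A. bilinear (g p) \<and> (\<forall>u v. g p u v = g p v u) \<and> (\<forall>v. v \<noteq> 0 \<longrightarrow> 0 < g p v v)) \<and>
     (\<forall>c\<in>A. \<forall>u v. Ck_on \<infinity>
        (\<lambda>y. g (cinv c y) (coord_inv A c (cinv c y) u) (coord_inv A c (cinv c y) v))
        (cmap c ` cdom c))"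

text \<open>An integral curve of \<open>V\<close> in \<open>S\<close> on the interval between \<open>0\<close> and \<open>s\<close>, where \<open>s\<close> may be
  negative, with one-sided derivatives at the endpoints.\<close>

definition integral_curve ::
  "('a::topological_space, 'e::euclidean_space) chart set \<Rightarrow> 'a set \<Rightarrow> ('a \<Rightarrow> 'e) \<Rightarrow> real \<Rightarrow>
   (real \<Rightarrow> 'a) \<Rightarrow> bool" where
  "integral_curve A S V s \<gamma> \<longleftrightarrow> continuous_on (closed_segment 0 s) \<gamma> \<and>
     (\<forall>r\<in>closed_segment 0 s. \<gamma> r \<in> S \<and>
       ((\<lambda>h. cmap (chart_at A (\<gamma> r)) (\<gamma> h)) has_vector_derivative V (\<gamma> r))
         (at r within closed_segment 0 s))"

text \<open>The image of \<open>B\<close> under the time-\<open>s\<close> flow of \<open>V\<close> in \<open>S\<close>. The flow may be incomplete: points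
  of \<open>B\<close> whose trajectory does not exist up to time \<open>s\<close> contribute nothing.\<close>

definition flow_image ::
  "('a::topological_space, 'e::euclidean_space) chart set \<Rightarrow> 'a set \<Rightarrow> ('a \<Rightarrow> 'e) \<Rightarrow> real \<Rightarrow>
   'a set \<Rightarrow> 'a set" where
  "flow_image A S V s B = {\<gamma> s | \<gamma>. integral_curve A S V s \<gamma> \<and> \<gamma> 0 \<in> B}"


section \<open>Contact geometry\<close>

definition contact_form_on ::
  "('a, 'e::euclidean_space) chart set \<Rightarrow> 'a set \<Rightarrow> ('a \<Rightarrow> 'e set) \<Rightarrow> ('a \<Rightarrow> 'e \<Rightarrow> real) \<Rightarrow> bool"
  where
  "contact_form_on A W \<xi> \<alpha> \<longleftrightarrow> smooth_form A W \<alpha> \<and>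
     (\<forall>p\<in>W. \<xi> p = {v. \<alpha> p v = 0} \<and> \<xi> p \<noteq> UNIV \<and>
        (\<forall>u\<in>\<xi> p. (\<forall>v\<in>\<xi> p. ext_deriv A \<alpha> p u v = 0) \<longrightarrow> u = 0))"

abbreviation contact_form ::
  "('a, 'e::euclidean_space) chart set \<Rightarrow> ('a \<Rightarrow> 'e set) \<Rightarrow> ('a \<Rightarrow> 'e \<Rightarrow> real) \<Rightarrow> bool" where
  "contact_form A \<equiv> contact_form_on A (carrier A)"

definition contact_structure ::
  "('a::topological_space, 'e::euclidean_space) chart set \<Rightarrow> ('a \<Rightarrow> 'e set) \<Rightarrow> bool" where
  "contact_structure A \<xi> \<longleftrightarrow>
     (\<forall>p\<in>carrier A. \<exists>W \<alpha>. open W \<and> p \<in> W \<and> W \<subseteq> carrier A \<and> contact_form_on A W \<xi> \<alpha>)"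

definition contact_vector_field ::
  "('a::topological_space, 'e::euclidean_space) chart set \<Rightarrow> ('a \<Rightarrow> 'e set) \<Rightarrow> 'a set \<Rightarrow>
   ('a \<Rightarrow> 'e) \<Rightarrow> bool" where
  "contact_vector_field A \<xi> U X \<longleftrightarrow> smooth_vector_field_on A U X \<and>
     (\<forall>W \<alpha>. open W \<and> W \<subseteq> U \<and> contact_form_on A W \<xi> \<alpha> \<longrightarrow>
        (\<exists>f. \<forall>p\<in>W. \<forall>v. lie_deriv A X \<alpha> p v = f p * \<alpha> p v))"

definition reeb_vector_field ::
  "('a, 'e::euclidean_space) chart set \<Rightarrow> ('a \<Rightarrow> 'e \<Rightarrow> real) \<Rightarrow> ('a \<Rightarrow> 'e) \<Rightarrow> bool" where
  "reeb_vector_field A \<alpha> R \<longleftrightarrow>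
     (\<forall>p\<in>carrier A. \<alpha> p (R p) = 1 \<and> (\<forall>v. ext_deriv A \<alpha> p (R p) v = 0))"

definition smooth_legendrian ::
  "('a::topological_space, 'e::euclidean_space) chart set \<Rightarrow> ('a \<Rightarrow> 'e set) \<Rightarrow> 'a set \<Rightarrow> bool" where
  "smooth_legendrian A \<xi> S \<longleftrightarrow>
     (\<exists>n. DIM('e) = 2 * n + 1 \<and> submanifold A \<infinity> n S) \<and> (\<forall>p\<in>S. tangent_space A S p \<subseteq> \<xi> p)"

definition singular_legendrian ::
  "('a::topological_space, 'e::euclidean_space) chart set \<Rightarrow> ('a \<Rightarrow> 'e set) \<Rightarrow> 'a set \<Rightarrow> bool" where
  "singular_legendrian A \<xi> L \<longleftrightarrow> (\<exists>\<S>. whitney_stratification A L \<S> \<and>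
     (\<forall>S. top_dimensional A \<S> S \<longrightarrow> smooth_legendrian A \<xi> S))"

definition slice_at :: "('a \<times> real) set \<Rightarrow> real \<Rightarrow> 'a set" where
  "slice_at LI t = {x. (x, t) \<in> LI}"

definition legendrian_isotopy ::
  "('a::topological_space, 'e::euclidean_space) chart set \<Rightarrow> ('a \<Rightarrow> 'e set) \<Rightarrow> real set \<Rightarrow>
   ('a \<times> real) set \<Rightarrow> bool" where
  "legendrian_isotopy A \<xi> I LI \<longleftrightarrow> closedin (top_of_set (carrier A \<times> I)) LI \<and>
     whitney_stratifiable (prod_atlas A I) LI \<and>
     (\<forall>t\<in>I. singular_legendrian A \<xi> (slice_at LI t))"

definition uniformly_displaceable ::
  "('a::topological_space, 'e::euclidean_space) chart set \<Rightarrow> ('a \<Rightarrow> 'e) \<Rightarrow> real set \<Rightarrow>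
   (real \<Rightarrow> 'a set) \<Rightarrow> bool" where
  "uniformly_displaceable A R I L \<longleftrightarrow> (\<exists>\<epsilon>>0. \<forall>t\<in>I. \<forall>s. 0 < \<bar>s\<bar> \<and> \<bar>s\<bar> < \<epsilon> \<longrightarrow>
     L t \<inter> flow_image A (carrier A) R s (L t) = {})"


section \<open>Weinstein hypersurfaces\<close>

text \<open>\<open>V\<close> is gradient-like for \<open>\<phi>\<close>: \<open>d\<phi>(V) \<ge> \<delta> (|V|\<^sup>2 + |d\<phi>|\<^sup>2)\<close> for some Riemannian metric and some
  positive function \<open>\<delta>\<close>. Metrics on the embedded submanifold \<open>H\<close> are taken to be restrictions of
  metrics on the ambient manifold; the supremum is the dual norm of \<open>d\<phi>\<close> on the tangent space
  of \<open>H\<close>.\<close>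

definition lyapunov_function ::
  "('a::topological_space, 'e::euclidean_space) chart set \<Rightarrow> 'a set \<Rightarrow> ('a \<Rightarrow> 'e) \<Rightarrow>
   ('a \<Rightarrow> real) \<Rightarrow> bool" where
  "lyapunov_function A H V \<phi> \<longleftrightarrow> Ck_map_on A std_atlas \<infinity> H \<phi> \<and>
     (\<exists>g \<delta>. riemannian_metric A g \<and> continuous_on H \<delta> \<and>
       (\<forall>p\<in>H. 0 < \<delta> p \<and>
          differential A H \<phi> p (V p) \<ge> \<delta> p * (g p (V p) (V p) +
            (SUP v\<in>{v \<in> tangent_space A H p. g p v v \<le> 1}. differential A H \<phi> p v)\<^sup>2)))"

definition outward_transverse ::
  "('a::topological_space, 'e::euclidean_space) chart set \<Rightarrow> nat \<Rightarrow> 'a set \<Rightarrow> ('a \<Rightarrow> 'e) \<Rightarrow> bool"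
  where
  "outward_transverse A d H V \<longleftrightarrow>
     (\<forall>p c W u. p \<in> H \<and> bdry_chart A \<infinity> d H p c W u \<longrightarrow> coord A c p (V p) \<bullet> u < 0)"

text \<open>The form \<open>\<lambda>\<close> is \<open>\<alpha>\<close> restricted to vectors tangent to \<open>H\<close>, and \<open>d\<lambda>\<close> is accordingly the
  restriction of \<open>d\<alpha>\<close>. As a Weinstein domain, \<open>H\<close> is compact.\<close>

definition weinstein_hypersurface ::
  "('a::topological_space, 'e::euclidean_space) chart set \<Rightarrow> ('a \<Rightarrow> 'e set) \<Rightarrow>
   ('a \<Rightarrow> 'e \<Rightarrow> real) \<Rightarrow> 'a set \<Rightarrow> ('a \<Rightarrow> 'e) \<Rightarrow> ('a \<Rightarrow> real) \<Rightarrow> bool" where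
  "weinstein_hypersurface A \<xi> \<alpha> H V \<phi> \<longleftrightarrow> contact_form A \<xi> \<alpha> \<and>
     compact H \<and> submanifold_with_boundary A \<infinity> (DIM('e) - 1) H \<and>
     (\<forall>p\<in>H. \<forall>u\<in>tangent_space A H p.
        (\<forall>v\<in>tangent_space A H p. ext_deriv A \<alpha> p u v = 0) \<longrightarrow> u = 0) \<and>
     smooth_vector_field_on A H V \<and>
     (\<forall>p\<in>H. V p \<in> tangent_space A H p \<and>
        (\<forall>v\<in>tangent_space A H p. ext_deriv A \<alpha> p (V p) v = \<alpha> p v)) \<and>
     outward_transverse A (DIM('e) - 1) H V \<and>
     lyapunov_function A H V \<phi>"

definition skeleton ::
  "('a::topological_space, 'e::euclidean_space) chart set \<Rightarrow> 'a set \<Rightarrow> ('a \<Rightarrow> 'e) \<Rightarrow> 'a set" where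
  "skeleton A H V = (\<Inter>T\<in>{0<..}. flow_image A H V (- T) H)"

definition total_space :: "real set \<Rightarrow> (real \<Rightarrow> 'a set) \<Rightarrow> ('a \<times> real) set" where
  "total_space I H = {(x, t). t \<in> I \<and> x \<in> H t}"

text \<open>A smooth family of subsets: smoothly trivial over \<open>I\<close>, with one of its members as fibre.\<close>

definition smooth_subset_family ::
  "('a::topological_space, 'e::euclidean_space) chart set \<Rightarrow> real set \<Rightarrow> (real \<Rightarrow> 'a set) \<Rightarrow> bool"
  where
  "smooth_subset_family A I H \<longleftrightarrow> (\<exists>t0\<in>I. \<exists>\<Psi> \<Psi>'.
     Ck_map_on (prod_atlas A I) A \<infinity> (H t0 \<times> I) \<Psi> \<and>
     Ck_map_on (prod_atlas A I) A \<infinity> (total_space I H) \<Psi>' \<and>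
     (\<forall>t\<in>I. (\<forall>x\<in>H t0. \<Psi> (x, t) \<in> H t \<and> \<Psi>' (\<Psi> (x, t), t) = x) \<and>
             (\<forall>y\<in>H t. \<Psi>' (y, t) \<in> H t0 \<and> \<Psi> (\<Psi>' (y, t), t) = y)))"

text \<open>The last conjunct is the bounded variation of \<open>\<alpha>\<^sub>t\<close>: as \<open>\<alpha>\<^sub>t\<close> and \<open>\<alpha>\<^sub>s\<close> have the same kernel,
  they differ by a function, which is bounded uniformly in \<open>s\<close> and \<open>t\<close> (and, exchanging \<open>s\<close> and \<open>t\<close>,
  bounded away from \<open>0\<close>).\<close>

definition weinstein_isotopy ::
  "('a::topological_space, 'e::euclidean_space) chart set \<Rightarrow> ('a \<Rightarrow> 'e set) \<Rightarrow> real set \<Rightarrow>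
   (real \<Rightarrow> 'a \<Rightarrow> 'e \<Rightarrow> real) \<Rightarrow> (real \<Rightarrow> 'a set) \<Rightarrow> (real \<Rightarrow> 'a \<Rightarrow> 'e) \<Rightarrow> (real \<Rightarrow> 'a \<Rightarrow> real) \<Rightarrow> bool"
  where
  "weinstein_isotopy A \<xi> I \<alpha> H V \<phi> \<longleftrightarrow>
     (\<forall>t\<in>I. weinstein_hypersurface A \<xi> (\<alpha> t) (H t) (V t) (\<phi> t)) \<and>
     smooth_subset_family A I H \<and>
     smooth_vector_field_family_on A (total_space I H) V \<and>
     Ck_map_on (prod_atlas A I) std_atlas \<infinity> (total_space I H) (\<lambda>(x, t). \<phi> t x) \<and>
     smooth_form_family A (carrier A \<times> I) \<alpha> \<and>
     (\<exists>K. \<forall>s\<in>I. \<forall>t\<in>I. \<forall>p\<in>carrier A. \<forall>v. \<bar>\<alpha> t p v\<bar> \<le> K * \<bar>\<alpha> s p v\<bar>)"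


section \<open>Convex tubular neighborhoods\<close>

definition sublevel :: "'a set \<Rightarrow> ('a \<Rightarrow> real) \<Rightarrow> real \<Rightarrow> 'a set" where
  "sublevel U \<rho> r = {x \<in> U. \<rho> x < r}"

text \<open>The constant \<open>c\<close> is an explicit parameter so that it can be chosen uniformly in families.
  Boundaries of sublevel sets are topological frontiers in the ambient manifold; they are required
  to lie in \<open>U\<close>, where the vector field \<open>X\<close> transverse to them is defined.\<close>

definition convex_tubular_neighborhood ::
  "('a::topological_space, 'e::euclidean_space) chart set \<Rightarrow> ('a \<Rightarrow> 'e set) \<Rightarrow> real \<Rightarrow> 'a set \<Rightarrow>
   'a set \<Rightarrow> ('a \<Rightarrow> real) \<Rightarrow> ('a \<Rightarrow> 'e) \<Rightarrow> bool" where
  "convex_tubular_neighborhood A \<xi> c L U \<rho> X \<longleftrightarrow>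
     open U \<and> U \<subseteq> carrier A \<and> L \<subseteq> U \<and>
     (\<forall>x\<in>U. 0 \<le> \<rho> x \<and> \<rho> x < 1) \<and> Ck_map_on A std_atlas 1 U \<rho> \<and>
     contact_vector_field A \<xi> U X \<and>
     (\<Inter>r\<in>{0<..<1}. sublevel U \<rho> r) = L \<and>
     (\<forall>r\<in>{0<..<1}. carrier A \<inter> frontier (sublevel U \<rho> r) \<subseteq> U \<and>
        submanifold A 1 (DIM('e) - 1) (carrier A \<inter> frontier (sublevel U \<rho> r))) \<and>
     (\<forall>r\<in>{0<..<1}. \<forall>s\<in>{0<..<1}. Ck_diffeomorphic A 1
        (carrier A \<inter> frontier (sublevel U \<rho> r)) (carrier A \<inter> frontier (sublevel U \<rho> s))) \<and>
     (\<forall>r\<in>{0<..<1}. \<forall>p\<in>carrier A \<inter> frontier (sublevel U \<rho> r).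
        X p \<notin> tangent_space A (carrier A \<inter> frontier (sublevel U \<rho> r)) p) \<and>
     (\<forall>p\<in>U - L. differential A U \<rho> p (X p) > c * \<rho> p)"

definition convex_tubular_isotopy ::
  "('a::topological_space, 'e::euclidean_space) chart set \<Rightarrow> ('a \<Rightarrow> 'e set) \<Rightarrow> real set \<Rightarrow>
   (real \<Rightarrow> 'a set) \<Rightarrow> (real \<Rightarrow> 'a set) \<Rightarrow> (real \<Rightarrow> 'a \<Rightarrow> real) \<Rightarrow> (real \<Rightarrow> 'a \<Rightarrow> 'e) \<Rightarrow> bool" where
  "convex_tubular_isotopy A \<xi> I L U \<rho> X \<longleftrightarrow>
     (\<exists>c>0. \<forall>t\<in>I. convex_tubular_neighborhood A \<xi> c (L t) (U t) (\<rho> t) (X t)) \<and>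
     open (total_space I U) \<and>
     smooth_vector_field_family A (total_space I U) X \<and>
     continuous_on (total_space I U) (\<lambda>(x, t). \<rho> t x)"

end

theory Submission imports Defs begin

text \<open>The Liouville field of a Weinstein hypersurface expands away from the skeleton inside the
hypersurface. The proof extends it to a contact field of the ambient manifold that expands in the
transverse direction as well, and measures the distance from the skeleton by the time that this field
needs to leave a neighbourhood.

Let \<open>h\<close> be a function on the product with the parameter interval that vanishes
near the skeleta exactly on the hypersurfaces, with derivative one along the Reeb field there
(\<open>global_hamiltonian\<close>). The field \<open>X\<close> with \<open>\<alpha>(X) = h\<close> and \<open>L\<^sub>X \<alpha> = dh(Reeb) \<alpha>\<close> is contact
(\<open>X_contact\<close>). Where \<open>h = 0\<close> it is tangent to the hypersurface and dual to \<open>\<alpha>\<close> there, hence equal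
to the Liouville field (\<open>X_eq_V\<close>). Elsewhere \<open>h\<close> grows exponentially along \<open>X\<close>, because
\<open>dh(X) = dh(Reeb) h\<close> and \<open>dh(Reeb) > 1/2\<close>. Therefore a trajectory that stays near the skeleton for all
positive times lies in the hypersurface, is a Liouville trajectory, and starts in the skeleton
(\<open>staying_in_L\<close>).

Let \<open>\<xi>\<close> be a cutoff with values in \<open>[0, 1]\<close> that vanishes near the skeleta and
equals one away from them. With \<open>\<Phi>\<^sub>s\<close> the flow of \<open>X\<close>, cut off to be complete, put
\<open>R x = \<integral> exp (- N s) \<xi> (\<Phi>\<^sub>s x) ds\<close> over all \<open>s \<ge> 0\<close>. It vanishes exactly on the skeleton
(\<open>R_zero_set\<close>), and it is multiplied by \<open>exp (N s)\<close> as long as the trajectory remains where \<open>\<xi>\<close>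
vanishes. So \<open>dR(X) = N R\<close> near the skeleton; the level sets are regular, transverse to \<open>X\<close>, and
permuted by the flow. The derivative of \<open>\<Phi>\<^sub>s\<close> grows at most exponentially in \<open>s\<close>, so that \<open>R\<close> is
of class $C^1$ once \<open>N\<close> exceeds the rate (\<open>rho_C1\<close>). A large multiple \<open>M R\<close> exceeds one
wherever \<open>\<xi>\<close> is neither zero nor one, so that its sublevel sets within the region where \<open>\<xi>\<close> vanishes
do not reach the edge of this region; they are the neighbourhoods sought (\<open>tube_fibre.convex\<close>).

The fields of all parameters form one field on the product with the interval, whose
flow preserves the fibres, so that continuity in all variables is continuity of one flow. The lower
bounds for \<open>N\<close> and \<open>M\<close> hold near each parameter and are dominated by continuous functions
(\<open>continuous_majorant\<close>). Compactness of the family over compact sets of parameters comes from its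
trivialisation.\<close>

abbreviation "FD f x == frechet_derivative f (at x)"
abbreviation "C1_on == Cn_on (Suc 0)"
lemmas has_derivative_local = has_derivative_transform_within_open
lemmas continuous_on_comp = continuous_on_compose2


section \<open>Calculus of $C^n$ maps\<close>

lemma Cn_on_cong_imp:
 assumes "open S" "!!x. x\<in>S ==> f x = g x" "Cn_on n f S"
 shows "Cn_on n g S"
 using assms(2,3)
proof (induction n arbitrary: f g)
 case 0
 thus ?case by (metis Cn_on.simps(1) continuous_on_cong)
next
 case (Suc n)
 have d: "(f has_derivative FD f x) (at x)" if "x\<in>S" for x
  using Suc.prems(2) that by (simp add: frechet_derivative_works[symmetric])
 have g: "(g has_derivative FD f x) (at x)" if "x\<in>S" for x
  using has_derivative_local[OF d[OF that] \<open>open S\<close> that] Suc.prems(1) by simp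
 have "FD f x v = FD g x v" if "x\<in>S" for x v
  using frechet_derivative_at[OF g[OF that]] by simp
 hence "Cn_on n (%x. FD g x v) S" for v
  using Suc.IH[of "%x. FD f x v" "%x. FD g x v"] Suc.prems(2)
  by simp
 thus ?case using g by (auto simp: differentiable_def)
qed

lemma Cn_on_SucI:
 assumes "open S" "!!x. x\<in>S ==> (f has_derivative D x) (at x)" "!!v. Cn_on n (%x. D x v) S"
 shows "Cn_on (Suc n) f S"
proof -
 have "D x v = FD f x v" if "x\<in>S" for x v
  using frechet_derivative_at[OF assms(2)[OF that]] by simp
 hence "Cn_on n (%x. FD f x v) S" for v
  using Cn_on_cong_imp[OF assms(1) _ assms(3)[of v]] by simp
 thus ?thesis using assms(2) by (auto simp: differentiable_def)
qed

lemma Cn_on_deriv: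
 assumes "Cn_on (Suc n) f S" "x\<in>S"
 shows "(f has_derivative FD f x) (at x)"
 using assms by (simp add: frechet_derivative_works[symmetric])

lemma Cn_on_subset:
 shows "Cn_on n f S ==> T <= S ==> Cn_on n f T"
 by (induction n arbitrary: f) (auto intro: continuous_on_subset)

lemma Cn_on_SucD:
 shows "Cn_on (Suc n) f S ==> Cn_on n f S"
proof (induction n arbitrary: f)
 case 0
 thus ?case
  by (auto intro!: continuous_at_imp_continuous_on differentiable_imp_continuous_within)
next
 case (Suc n)
 thus ?case by (metis Cn_on.simps(2))
qed

lemma Cn_on_le:
 assumes "Cn_on n f S" "m <= n" shows "Cn_on m f S"
 using assms(2,1) by (induction rule: dec_induct) (use Cn_on_SucD in blast)+

lemma Cn_on_continuous:
 assumes "Cn_on n f S" shows "continuous_on S f"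
 using Cn_on_le[OF assms, of 0] by simp

lemma Cn_on_local:
 assumes "!!x. x\<in>S ==> \<exists>T. open T & x\<in>T & Cn_on n f T"
 shows "Cn_on n f S"
 using assms
proof (induction n arbitrary: f)
 case 0
 hence "continuous (at x) f" if "x\<in>S" for x
  using that continuous_on_eq_continuous_at[of _ f] by (metis Cn_on.simps(1))
 thus ?case by (auto intro: continuous_at_imp_continuous_on)
next
 case (Suc n)
 have "\<exists>T. open T & x\<in>T & Cn_on n (%x. FD f x v) T" if "x\<in>S" for x v
  using Suc.prems[OF that] by auto
 hence "Cn_on n (%x. FD f x v) S" for v using Suc.IH by blast
 moreover have "f differentiable (at x)" if "x\<in>S" for x
  using Suc.prems[OF that] by auto
 ultimately show ?case by simp
qed

lemma Cn_on_const: "Cn_on n (%x. c) (S::'a::euclidean_space set)" for c :: "'b::euclidean_space"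
proof (induction n arbitrary: c)
 case (Suc n)
 have "FD (%x::'a. c) x v = 0" for x v
  by (simp add: frechet_derivative_const)
 thus ?case using Suc by simp
qed simp

lemma Cn_on_linear:
 assumes "linear f" shows "Cn_on n f S"
proof (cases n)
 case 0
 thus ?thesis using assms by (simp add: linear_continuous_on linear_conv_bounded_linear)
next
 case (Suc m)
 have d: "(f has_derivative f) (at x)" for x
  using assms by (simp add: bounded_linear_imp_has_derivative linear_conv_bounded_linear)
 hence "FD f x = f" for x
  using frechet_derivative_at by metis
 thus ?thesis using d Suc by (auto simp: differentiable_def Cn_on_const)
qed

lemma Cn_on_id: "Cn_on n (%x. x) (S::'a::euclidean_space set)"
 by (rule Cn_on_linear) (rule linear_id[unfolded id_def])

lemma Cn_on_compose_linear:
 fixes f :: "'a::euclidean_space => 'b::euclidean_space" and L :: "'b => 'c::euclidean_space"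
 assumes "open S" "Cn_on n f S" "linear L"
 shows "Cn_on n (%x. L (f x)) S"
 using assms(2)
proof (induction n arbitrary: f)
 case 0
 have "continuous_on UNIV L" using assms(3) by (simp add: linear_continuous_on linear_conv_bounded_linear)
 thus ?case using 0 continuous_on_comp[of UNIV L S f] by simp
next
 case (Suc n)
 have L: "bounded_linear L" using assms(3) by (simp add: linear_conv_bounded_linear)
 show ?case
 proof (rule Cn_on_SucI[OF assms(1)])
  show "((%x. L (f x)) has_derivative (%v. L (FD f x v))) (at x)"
   if "x\<in>S" for x
   by (rule bounded_linear.has_derivative[OF L Cn_on_deriv[OF Suc.prems that]])
  show "Cn_on n (%x. L (FD f x v)) S" for v
   using Suc by simp
 qed
qed

lemma Cn_on_add:
 assumes "open S" "Cn_on n f S" "Cn_on n g S"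
 shows "Cn_on n (%x. f x + g x) S"
 using assms(2,3)
proof (induction n arbitrary: f g)
 case 0
 thus ?case by (auto intro: continuous_intros)
next
 case (Suc n)
 show ?case
 proof (rule Cn_on_SucI[OF assms(1)])
  show "((%x. f x + g x) has_derivative
    (%v. FD f x v + FD g x v)) (at x)" if "x\<in>S" for x
   using Cn_on_deriv[OF Suc.prems(1) that] Cn_on_deriv[OF Suc.prems(2) that]
   by (rule has_derivative_add)
 qed (use Suc in simp)
qed

lemma Cn_on_sum:
 fixes f :: "'i => 'a::euclidean_space => 'b::euclidean_space"
 assumes "open S" "!!i. i\<in>F ==> Cn_on n (f i) S"
 shows "Cn_on n (%x. \<Sum>i\<in>F. f i x) S"
proof (cases "finite F")
 case True
 thus ?thesis using assms(2)
  by (induction F) (auto intro!: Cn_on_const Cn_on_add[OF assms(1)])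
qed (simp add: Cn_on_const)

lemma Cn_on_bilinear:
 fixes f :: "'a::euclidean_space => 'b::euclidean_space" and g :: "'a => 'c::euclidean_space"
  and B :: "'b => 'c => 'd::euclidean_space"
 assumes "open S" "Cn_on n f S" "Cn_on n g S" "bounded_bilinear B"
 shows "Cn_on n (%x. B (f x) (g x)) S"
 using assms(2,3)
proof (induction n arbitrary: f g)
 case 0
 thus ?case using bounded_bilinear.continuous_on[OF assms(4)] by simp
next
 case (Suc n)
 show ?case
 proof (rule Cn_on_SucI[OF assms(1)])
  show "((%x. B (f x) (g x)) has_derivative
    (%v. B (f x) (FD g x v) + B (FD f x v) (g x))) (at x)"
   if "x\<in>S" for x
   using bounded_bilinear.FDERIV[OF assms(4) Cn_on_deriv[OF Suc.prems(1) that]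
     Cn_on_deriv[OF Suc.prems(2) that]] .
  show "Cn_on n (%x. B (f x) (FD g x v) + B (FD f x v) (g x)) S" for v
   using Suc.prems Cn_on_SucD[OF Suc.prems(1)] Cn_on_SucD[OF Suc.prems(2)]
   by (intro Cn_on_add[OF assms(1)] Suc.IH) auto
 qed
qed

lemmas Cn_on_mult = Cn_on_bilinear[OF _ _ _ bounded_bilinear_mult]
lemmas Cn_on_scaleR = Cn_on_bilinear[OF _ _ _ bounded_bilinear_scaleR]
lemmas Cn_on_inner = Cn_on_bilinear[OF _ _ _ bounded_bilinear_inner]

lemma Cn_on_minus:
 shows "open S ==> Cn_on n f S ==> Cn_on n (%x. - f x) S"
 by (rule Cn_on_compose_linear[where L=uminus]) (auto simp: linear_iff)

lemma Cn_on_diff: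
 assumes "open S" "Cn_on n f S" "Cn_on n g S"
 shows "Cn_on n (%x. f x - g x) S"
 using Cn_on_add[OF assms(1,2) Cn_on_minus[OF assms(1,3)]] by simp

lemma Cn_on_components:
 assumes "open S" "!!b. b\<in>Basis ==> Cn_on n (%x. f x \<bullet> b) S"
 shows "Cn_on n f S"
proof -
 have "Cn_on n (%x. \<Sum>b\<in>Basis. (f x \<bullet> b) *\<^sub>R b) S"
  using assms by (intro Cn_on_sum Cn_on_scaleR Cn_on_const) auto
 thus ?thesis by (simp add: euclidean_representation)
qed

lemma linear_eq_sum_Basis:
 fixes f :: "'a::euclidean_space => 'b::euclidean_space"
 assumes "linear f" shows "f w = (\<Sum>b\<in>Basis. (w \<bullet> b) *\<^sub>R f b)"
proof -
 have "f w = f (\<Sum>b\<in>Basis. (w \<bullet> b) *\<^sub>R b)" by (simp add: euclidean_representation)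
 also have "\<dots> = (\<Sum>b\<in>Basis. (w \<bullet> b) *\<^sub>R f b)"
  by (simp only: linear_sum[OF assms] linear_cmul[OF assms])
 finally show ?thesis .
qed

text \<open>The chain rule is expanded in a basis, so that the induction only meets derivatives in fixed directions.\<close>

lemma Cn_on_compose:
 fixes f :: "'a::euclidean_space => 'b::euclidean_space" and g :: "'b => 'c::euclidean_space"
 assumes "open S" "open T" "Cn_on n f S" "Cn_on n g T" "f ` S <= T"
 shows "Cn_on n (%x. g (f x)) S"
 using assms(3,4)
proof (induction n arbitrary: g)
 case 0
 thus ?case using assms(5) by (auto intro: continuous_on_comp)
next
 case (Suc n)
 let ?Df = "%x. FD f x" and ?Dg = "%y. FD g y"
 have dg: "(g has_derivative ?Dg (f x)) (at (f x))" if "x\<in>S" for x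
  using Cn_on_deriv[OF Suc.prems(2)] assms(5) that by blast
 show ?case
 proof (rule Cn_on_SucI[OF assms(1)])
  show "((%x. g (f x)) has_derivative (%v. \<Sum>b\<in>Basis. (?Df x v \<bullet> b) *\<^sub>R ?Dg (f x) b)) (at x)"
   if "x\<in>S" for x
  proof -
   have lin: "linear (?Dg (f x))" using dg[OF that] has_derivative_linear by blast
   have "?Dg (f x) (?Df x v) = (\<Sum>b\<in>Basis. (?Df x v \<bullet> b) *\<^sub>R ?Dg (f x) b)" for v
    by (rule linear_eq_sum_Basis[OF lin])
   moreover have "((%x. g (f x)) has_derivative (%v. ?Dg (f x) (?Df x v))) (at x)"
    using has_derivative_compose[OF Cn_on_deriv[OF Suc.prems(1) that] dg[OF that]] .
   ultimately show ?thesis by presburger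
  qed
  show "Cn_on n (%x. \<Sum>b\<in>Basis. (?Df x v \<bullet> b) *\<^sub>R ?Dg (f x) b) S" for v
   using Suc.prems Suc.IH[OF Cn_on_SucD[OF Suc.prems(1)], of "%y. ?Dg y b" for b]
   by (intro Cn_on_sum Cn_on_scaleR Cn_on_inner Cn_on_const assms(1)) auto
 qed
qed

lemma Cn_on_Pair:
 fixes f :: "'a::euclidean_space => 'b::euclidean_space" and g :: "'a => 'c::euclidean_space"
 assumes "open S" "Cn_on n f S" "Cn_on n g S"
 shows "Cn_on n (%x. (f x, g x)) S"
proof -
 have "Cn_on n (%x. (f x, 0) + (0, g x)) S"
  using assms by (intro Cn_on_add Cn_on_compose_linear[where f=f and L="%x. (x, 0)"]
    Cn_on_compose_linear[where f=g and L="%x. (0, x)"]) (auto simp: linear_iff)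
 thus ?thesis by simp
qed

lemma Cn_on_fst:
 fixes f :: "'a::euclidean_space => 'b::euclidean_space \<times> 'c::euclidean_space"
 shows "open S ==> Cn_on n f S ==> Cn_on n (%x. fst (f x)) S"
 by (rule Cn_on_compose_linear) (auto simp: linear_iff)

lemma Cn_on_snd:
 fixes f :: "'a::euclidean_space => 'b::euclidean_space \<times> 'c::euclidean_space"
 shows "open S ==> Cn_on n f S ==> Cn_on n (%x. snd (f x)) S"
 by (rule Cn_on_compose_linear) (auto simp: linear_iff)

lemma Cn_on_inverse_real: "Cn_on n (inverse :: real => real) (- {0})"
proof (induction n)
 case 0
 thus ?case by (auto intro!: continuous_intros)
next
 case (Suc n)
 have op: "open (- {0::real})" by auto
 show ?case
 proof (rule Cn_on_SucI[OF op])
  show "(inverse has_derivative (%v. (inverse x * inverse x) * - v)) (at x)" if "x\<in>- {0}" for x :: real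
   using that by (auto intro!: derivative_eq_intros)
  show "Cn_on n (%x. (inverse x * inverse x) * - v) (- {0})" for v :: real
   using Suc by (intro Cn_on_mult op Cn_on_const)
 qed
qed

lemma Cn_on_inverse:
 fixes f :: "'a::euclidean_space => real"
 assumes "open S" "Cn_on n f S" "!!x. x\<in>S ==> f x \<noteq> 0"
 shows "Cn_on n (%x. inverse (f x)) S"
 by (rule Cn_on_compose[OF assms(1) _ assms(2) Cn_on_inverse_real]) (use assms(3) in auto)

lemma Cn_on_frechet:
 shows "Cn_on (Suc n) f S ==> Cn_on n (%x. FD f x v) S"
 by simp

text \<open>For directions that vary with the point, the derivative is expanded in a basis.\<close>

lemma Cn_on_frechet_apply:
 assumes "open S" "Cn_on (Suc n) f S" "Cn_on n w S"
 shows "Cn_on n (%x. FD f x (w x)) S"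
proof -
 have "FD f x (w x) = (\<Sum>b\<in>Basis. (w x \<bullet> b) *\<^sub>R FD f x b)"
  if "x\<in>S" for x
 proof -
  have lin: "linear (FD f x)"
   using Cn_on_deriv[OF assms(2) that] has_derivative_linear by blast
  show ?thesis
   by (rule linear_eq_sum_Basis[OF lin])
 qed
 moreover have "Cn_on n (%x. \<Sum>b\<in>Basis. (w x \<bullet> b) *\<^sub>R FD f x b) S"
  using assms by (intro Cn_on_sum Cn_on_scaleR Cn_on_inner Cn_on_const) auto
 ultimately show ?thesis
  using Cn_on_cong_imp[OF assms(1), of "%x. \<Sum>b\<in>Basis. (w x \<bullet> b) *\<^sub>R FD f x b"
   "%x. FD f x (w x)"] by simp
qed

text \<open>Gram--Schmidt elimination: one of the vectors is split off by projecting everything else onto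
  its orthogonal complement.\<close>

lemma Cn_on_coefficients:
 fixes m :: "'i => 'a::euclidean_space => 'b::euclidean_space"
 assumes S: "open S" and "finite F" "!!b. b\<in>F ==> Cn_on n (m b) S"
  and "!!x d. x\<in>S ==> (\<Sum>b\<in>F. d b *\<^sub>R m b x) = 0 ==> \<forall>b\<in>F. d b = 0"
  and "Cn_on n (%x. \<Sum>b\<in>F. c b x *\<^sub>R m b x) S"
 shows "\<forall>b\<in>F. Cn_on n (c b) S"
 using assms(2-)
proof (induction F arbitrary: m rule: finite_induct)
 case (insert a F)
 let ?w = "%x. \<Sum>b\<in>insert a F. c b x *\<^sub>R m b x"
 define N where "N = (%x. inverse (m a x \<bullet> m a x))"
 define m' where "m' = (%b x. m b x - (N x * (m b x \<bullet> m a x)) *\<^sub>R m a x)"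
 have ma: "m a x \<noteq> 0" if "x\<in>S" for x
 proof
  assume "m a x = 0"
  hence "(\<Sum>b\<in>insert a F. (if b = a then 1 else 0) *\<^sub>R m b x) = 0"
   by (intro sum.neutral) auto
  from insert.prems(2)[OF that this] show False by simp
 qed
 have N: "Cn_on n N S" unfolding N_def
  using insert.prems(1)[of a] ma by (intro Cn_on_inverse Cn_on_inner S) auto
 have "\<forall>b\<in>F. Cn_on n (c b) S"
 proof (rule insert.IH[of m'])
  show "Cn_on n (m' b) S" if "b\<in>F" for b unfolding m'_def
   using insert.prems(1) that by (intro Cn_on_diff Cn_on_scaleR Cn_on_mult Cn_on_inner N S) auto
  show "\<forall>b\<in>F. d b = 0" if x: "x\<in>S" and 0: "(\<Sum>b\<in>F. d b *\<^sub>R m' b x) = 0" for x d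
  proof -
   define k where "k = (\<Sum>b\<in>F. d b * (N x * (m b x \<bullet> m a x)))"
   have "(\<Sum>b\<in>F. d b *\<^sub>R m b x) = k *\<^sub>R m a x"
    using 0 by (simp add: m'_def k_def scaleR_diff_right sum_subtractf scaleR_sum_left)
   moreover have "(\<Sum>b\<in>F. (d(a := - k)) b *\<^sub>R m b x) = (\<Sum>b\<in>F. d b *\<^sub>R m b x)"
    using insert.hyps(2) by (intro sum.cong) auto
   ultimately have "(\<Sum>b\<in>insert a F. (d(a := - k)) b *\<^sub>R m b x) = 0"
    using insert.hyps by simp
   from insert.prems(2)[OF x this] insert.hyps(2) show ?thesis by (metis fun_upd_other insertCI)
  qed
  have "Cn_on n (%x. ?w x - (N x * (?w x \<bullet> m a x)) *\<^sub>R m a x) S"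
   using insert.prems(1)[of a] insert.prems(3) by (intro Cn_on_diff Cn_on_scaleR Cn_on_mult Cn_on_inner N S) auto
  moreover have "?w x - (N x * (?w x \<bullet> m a x)) *\<^sub>R m a x = (\<Sum>b\<in>F. c b x *\<^sub>R m' b x)" if "x\<in>S" for x
  proof -
   have 1: "(\<Sum>b\<in>F. c b x * (N x * (m b x \<bullet> m a x))) = N x * ((\<Sum>b\<in>F. c b x *\<^sub>R m b x) \<bullet> m a x)"
    by (simp add: inner_sum_left sum_distrib_left mult.left_commute)
   have "(\<Sum>b\<in>F. c b x *\<^sub>R m' b x) = (\<Sum>b\<in>F. c b x *\<^sub>R m b x) - (N x * ((\<Sum>b\<in>F. c b x *\<^sub>R m b x) \<bullet> m a x)) *\<^sub>R m a x"
    unfolding 1[symmetric] by (simp add: m'_def scaleR_diff_right sum_subtractf scaleR_sum_left)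
   moreover have "N x * (m a x \<bullet> m a x) = 1" using ma[OF that] by (simp add: N_def)
   ultimately show ?thesis
    using insert.hyps by (simp add: inner_add_left scaleR_add_left distrib_left mult.left_commute[of "N x"])
  qed
  ultimately show "Cn_on n (%x. \<Sum>b\<in>F. c b x *\<^sub>R m' b x) S" by (rule Cn_on_cong_imp[OF S, rotated])
 qed
 moreover define w where "w = ?w"
 moreover have "Cn_on n (c a) S"
 proof (rule Cn_on_cong_imp[OF S])
  show "Cn_on n (%x. N x * ((w x - (\<Sum>b\<in>F. c b x *\<^sub>R m b x)) \<bullet> m a x)) S"
   using insert.prems(1,3)[folded w_def] calculation(1) by (intro Cn_on_mult Cn_on_inner Cn_on_diff Cn_on_sum Cn_on_scaleR N S) auto
 qed (use insert.hyps ma in "simp add: N_def w_def")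
 ultimately show ?case by simp
qed simp

lemma Cn_on_linear_solve:
 fixes M :: "'a::euclidean_space => 'b::euclidean_space => 'b" and v :: "'a => 'b"
 assumes S: "open S" and lin: "!!x. x\<in>S ==> linear (M x)"
  and inj: "!!x w. x\<in>S ==> M x w = 0 ==> w = 0"
  and M: "!!b. b\<in>Basis ==> Cn_on n (%x. M x b) S"
  and beta: "Cn_on n (%x. M x (v x)) S"
 shows "Cn_on n v S"
proof -
 have "\<forall>b\<in>Basis. Cn_on n (%x. v x \<bullet> b) S"
 proof (rule Cn_on_coefficients[OF S finite_Basis M])
  show "\<forall>b\<in>Basis. d b = 0" if x: "x\<in>S" and "(\<Sum>b\<in>Basis. d b *\<^sub>R M x b) = 0" for x d
  proof -
   have "M x (\<Sum>b\<in>Basis. d b *\<^sub>R b) = 0"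
    using that by (simp add: linear_sum[OF lin[OF x]] linear_cmul[OF lin[OF x]])
   hence "(\<Sum>b\<in>Basis. d b *\<^sub>R b) = 0" by (rule inj[OF x])
   thus ?thesis using inner_sum_left_Basis[of _ d] by simp
  qed
  show "Cn_on n (%x. \<Sum>b\<in>Basis. (v x \<bullet> b) *\<^sub>R M x b) S"
   by (rule Cn_on_cong_imp[OF S _ beta]) (rule linear_eq_sum_Basis[OF lin])
 qed
 thus ?thesis using Cn_on_components[OF S] by blast
qed


abbreviation "BD f x \<equiv> Blinfun (FD f x)"

lemma BD_apply:
 "Cn_on (Suc n) f S ==> x\<in>S ==> blinfun_apply (BD f x) = FD f x"
 using Cn_on_deriv by (metis bounded_linear_Blinfun_apply has_derivative_bounded_linear)

lemma BD_has_derivative: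
 "Cn_on (Suc n) f S ==> x\<in>S ==> (f has_derivative blinfun_apply (BD f x)) (at x)"
 using Cn_on_deriv by (simp only: BD_apply)

lemma BD_eqI: "(f has_derivative blinfun_apply D) (at x) ==> BD f x = D"
 using frechet_derivative_at by (metis blinfun_apply_inverse)

lemma BD_continuous:
 assumes "Cn_on (Suc n) f S" shows "continuous_on S (BD f)"
proof (rule continuous_on_blinfun_componentwise)
 show "continuous_on S (%x. blinfun_apply (BD f x) v)" for v
  using Cn_on_continuous[OF Cn_on_frechet[OF assms, of v]]
  by (rule continuous_on_eq) (simp add: BD_apply[OF assms])
qed

lemma C1_on_blinfunI:
 assumes "open S" "!!x. x\<in>S ==> (f has_derivative blinfun_apply (D x)) (at x)" "continuous_on S D"
 shows "C1_on f S"
 by (rule Cn_on_SucI[OF assms(1,2)]) (use assms(3) in \<open>auto intro!: continuous_intros\<close>)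

lemma BD_bounded_on_compact:
 assumes "C1_on f S" "compact C" "C <= S"
 obtains L where "0 <= L" "!!y. y\<in>C ==> norm (BD f y) <= L"
proof -
 have "bounded (BD f ` C)"
  by (intro compact_imp_bounded compact_continuous_image continuous_on_subset[OF BD_continuous[OF assms(1)] assms(3)] assms(2))
 thus ?thesis using that unfolding bounded_pos by (metis imageI less_imp_le)
qed

lemma frechet_derivative_fst:
 fixes f :: "'a::euclidean_space \<times> 'b::euclidean_space => 'c::euclidean_space"
 assumes "f differentiable (at (y, t))"
 shows "(%y. f (y, t)) differentiable (at y)"
  and "FD (%y. f (y, t)) y u = FD f (y, t) (u, 0)"
proof -
 have "((%y. (y, t)) has_derivative (%u. (u, 0))) (at y)"
  by (auto intro!: derivative_eq_intros)
 hence d: "((%y. f (y, t)) has_derivative (%u. FD f (y, t) (u, 0))) (at y)"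
  using has_derivative_compose[of "%y. (y, t)" "%u. (u, 0)" y UNIV f] assms
  by (simp add: frechet_derivative_works)
 thus "(%y. f (y, t)) differentiable (at y)" by (auto simp: differentiable_def)
 show "FD (%y. f (y, t)) y u = FD f (y, t) (u, 0)"
  using frechet_derivative_at[OF d] by (metis)
qed

lemma derivative_along_line:
 fixes g :: "'a::euclidean_space => real"
 assumes "g differentiable (at (p + s *\<^sub>R u))"
 shows "((%s. g (p + s *\<^sub>R u)) has_real_derivative FD g (p + s *\<^sub>R u) u) (at s)"
proof -
 have 1: "(g has_derivative FD g (p + s *\<^sub>R u)) (at (p + s *\<^sub>R u))"
  using assms by (simp add: frechet_derivative_works)
 have "((%s. p + s *\<^sub>R u) has_derivative (%k. k *\<^sub>R u)) (at s)"
  by (auto intro!: derivative_eq_intros)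
 from has_derivative_compose[OF this 1] show ?thesis
  using linear_cmul[OF has_derivative_linear[OF 1]]
  by (simp add: has_field_derivative_def mult_commute_abs)
qed

text \<open>Applying the mean value theorem in both directions turns the mixed second difference, which is
  symmetric in \<open>u\<close> and \<open>v\<close>, into an iterated derivative at a nearby point.\<close>

lemma second_difference:
 fixes f :: "'a::euclidean_space => real"
 assumes f: "Cn_on (Suc (Suc 0)) f S" and h: "0 < h"
  and S: "!!s t. 0 <= s ==> s <= h ==> 0 <= t ==> t <= h ==> x + s *\<^sub>R u + t *\<^sub>R v\<in>S"
 shows "\<exists>s t. 0 < s & s < h & 0 < t & t < h &
  f (x + h *\<^sub>R u + h *\<^sub>R v) - f (x + h *\<^sub>R u) - f (x + h *\<^sub>R v) + f x
  = h * h * FD (%y. FD f y u) (x + s *\<^sub>R u + t *\<^sub>R v) v"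
proof -
 let ?P = "%y. FD f y u"
 have S': "(x + t *\<^sub>R v) + s *\<^sub>R u\<in>S" "x + s *\<^sub>R u\<in>S" if "0 <= s" "s <= h" "0 <= t" "t <= h" for s t
  using S[OF that] S[OF that(1,2), of 0] h by (simp_all add: ac_simps)
 have "((%s. f (x + h *\<^sub>R v + s *\<^sub>R u) - f (x + s *\<^sub>R u)) has_real_derivative
   ?P (x + h *\<^sub>R v + s *\<^sub>R u) - ?P (x + s *\<^sub>R u)) (at s)" if "0 <= s" "s <= h" for s
  using S'[OF that, of h] h f by (intro DERIV_diff derivative_along_line) auto
 from MVT2[OF h this] obtain s where s: "0 < s" "s < h" "f (x + h *\<^sub>R v + h *\<^sub>R u) - f (x + h *\<^sub>R u) - (f (x + h *\<^sub>R v) - f x)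
   = h * (?P (x + h *\<^sub>R v + s *\<^sub>R u) - ?P (x + s *\<^sub>R u))" by auto
 have "((%t. ?P (x + s *\<^sub>R u + t *\<^sub>R v)) has_real_derivative
   FD ?P (x + s *\<^sub>R u + t *\<^sub>R v) v) (at t)" if "0 <= t" "t <= h" for t
  using S[OF _ _ that, of s] s f by (intro derivative_along_line) auto
 from MVT2[OF h this] obtain t where "0 < t" "t < h" "?P (x + s *\<^sub>R u + h *\<^sub>R v) - ?P (x + s *\<^sub>R u)
   = h * FD ?P (x + s *\<^sub>R u + t *\<^sub>R v) v" by auto
 thus ?thesis using s by (intro exI[of _ s] exI[of _ t]) (simp add: ac_simps)
qed

lemma second_derivative_symmetric_real:
 fixes f :: "'a::euclidean_space => real"
 assumes S: "open S" "x\<in>S" and f: "Cn_on (Suc (Suc 0)) f S"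
 shows "FD (%y. FD f y u) x v =
     FD (%y. FD f y v) x u"
proof -
 let ?D = "%u v y. FD (%y. FD f y u) y v"
 have "\<bar>?D u v x - ?D v u x\<bar> < e" if "e > 0" for e
 proof -
  have lim: "\<exists>d>0. \<forall>y. dist y x < d --> dist (?D u v y) (?D u v x) < e / 2" for u v
  proof -
   have "continuous_on S (?D u v)" using f by simp
   hence "isCont (?D u v) x" using S by (simp add: continuous_on_eq_continuous_at)
   thus ?thesis using that unfolding continuous_at_eps_delta by (meson half_gt_zero)
  qed
  obtain d1 d2 d3 where d: "d1 > 0" "!!y. dist y x < d1 ==> dist (?D u v y) (?D u v x) < e / 2"
    "d2 > 0" "!!y. dist y x < d2 ==> dist (?D v u y) (?D v u x) < e / 2" "d3 > 0" "ball x d3 <= S"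
   using lim[of u v] lim[of v u] S open_contains_ball[of S] by blast
  define h where "h = min d1 (min d2 d3) / (norm u + norm v + 1)"
  have nn: "norm u + norm v + 1 > 0" by (simp add: add_nonneg_pos)
  have h: "h > 0" "h * (norm u + norm v + 1) = min d1 (min d2 d3)" using d nn by (simp_all add: h_def)
  have near: "norm (s *\<^sub>R u + t *\<^sub>R v) < min d1 (min d2 d3)" if "0 <= s" "s <= h" "0 <= t" "t <= h" for s t
  proof -
   have "norm (s *\<^sub>R u + t *\<^sub>R v) <= s * norm u + t * norm v"
    using norm_triangle_ineq[of "s *\<^sub>R u" "t *\<^sub>R v"] that by simp
   also have "\<dots> <= h * norm u + h * norm v" using that by (intro add_mono mult_right_mono) auto
   also have "\<dots> < h * (norm u + norm v + 1)" using h(1) by (simp add: algebra_simps)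
   finally show ?thesis unfolding h(2) .
  qed
  have close: "dist (x + s *\<^sub>R u + t *\<^sub>R v) x < min d1 (min d2 d3)" "dist (x + t *\<^sub>R v + s *\<^sub>R u) x < min d1 (min d2 d3)"
   if "0 <= s" "s <= h" "0 <= t" "t <= h" for s t
   using near[OF that] by (simp_all add: dist_norm ac_simps)
  have inS: "x + s *\<^sub>R u + t *\<^sub>R v\<in>S" "x + t *\<^sub>R v + s *\<^sub>R u\<in>S" if "0 <= s" "s <= h" "0 <= t" "t <= h" for s t
   using close[OF that] d(6) by (auto simp: dist_commute subset_iff)
  obtain s t where 1: "0 < s" "s < h" "0 < t" "t < h"
    "f (x + h *\<^sub>R u + h *\<^sub>R v) - f (x + h *\<^sub>R u) - f (x + h *\<^sub>R v) + f x = h * h * ?D u v (x + s *\<^sub>R u + t *\<^sub>R v)"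
   using second_difference[OF f h(1) inS(1)] by blast
  obtain s' t' where 2: "0 < s'" "s' < h" "0 < t'" "t' < h"
    "f (x + h *\<^sub>R v + h *\<^sub>R u) - f (x + h *\<^sub>R v) - f (x + h *\<^sub>R u) + f x = h * h * ?D v u (x + s' *\<^sub>R v + t' *\<^sub>R u)"
   using second_difference[OF f h(1) inS(2)] by blast
  have 3: "x + h *\<^sub>R v + h *\<^sub>R u = x + h *\<^sub>R u + h *\<^sub>R v" by simp
  have "h * h * ?D u v (x + s *\<^sub>R u + t *\<^sub>R v) = h * h * ?D v u (x + s' *\<^sub>R v + t' *\<^sub>R u)"
   using 1(5) 2(5)[unfolded 3] by linarith
  hence "?D u v (x + s *\<^sub>R u + t *\<^sub>R v) = ?D v u (x + s' *\<^sub>R v + t' *\<^sub>R u)" using h(1) by simp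
  moreover have "dist (?D u v (x + s *\<^sub>R u + t *\<^sub>R v)) (?D u v x) < e / 2"
   by (rule d(2)) (use close(1)[of s t] 1 in simp)
  moreover have "dist (?D v u (x + s' *\<^sub>R v + t' *\<^sub>R u)) (?D v u x) < e / 2"
   by (rule d(4)) (use close(2)[of t' s'] 2 in simp)
  ultimately show ?thesis unfolding dist_real_def by linarith
 qed
 from this[of "\<bar>?D u v x - ?D v u x\<bar>"] show ?thesis by fastforce
qed

lemma frechet_derivative_inner_const:
 fixes f :: "'a::euclidean_space => 'b::euclidean_space"
 assumes "f differentiable (at x)"
 shows "FD (%x. f x \<bullet> b) x v = FD f x v \<bullet> b"
proof -
 have "((%x. f x \<bullet> b) has_derivative (%v. FD f x v \<bullet> b)) (at x)"
  using assms by (auto intro!: has_derivative_inner_left simp: frechet_derivative_works)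
 from frechet_derivative_at[OF this] show ?thesis by metis
qed

lemma second_derivative_symmetric:
 fixes f :: "'a::euclidean_space => 'b::euclidean_space"
 assumes S: "open S" "x\<in>S" and f: "Cn_on (Suc (Suc 0)) f S"
 shows "FD (%y. FD f y u) x v =
     FD (%y. FD f y v) x u"
proof (rule euclidean_eqI)
 fix b :: 'b
 let ?g = "%x. f x \<bullet> b"
 have g: "Cn_on (Suc (Suc 0)) ?g S" using f by (intro Cn_on_inner S Cn_on_const)
 have df: "f differentiable (at y)" if "y\<in>S" for y using f that by simp
 have D: "((%y. FD f y w) has_derivative FD (%y. FD f y w) x) (at x)" for w
  by (rule Cn_on_deriv[where n=0, OF _ S(2)]) (use f in simp)
 have "FD (%y. FD ?g y u) x v
   = FD (%y. FD f y u) x v \<bullet> b" for u v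
 proof -
  have "((%y. FD f y u \<bullet> b) has_derivative
    (%v. FD (%y. FD f y u) x v \<bullet> b)) (at x)"
   by (rule has_derivative_inner_left[OF D])
  hence "((%y. FD ?g y u) has_derivative
    (%v. FD (%y. FD f y u) x v \<bullet> b)) (at x)"
   by (rule has_derivative_local[OF _ S])
    (simp add: frechet_derivative_inner_const[OF df])
  from frechet_derivative_at[OF this] show ?thesis by metis
 qed
 thus "FD (%y. FD f y u) x v \<bullet> b =
     FD (%y. FD f y v) x u \<bullet> b"
  using second_derivative_symmetric_real[OF S g, of u v] by simp
qed

section \<open>Smooth bump functions\<close>

text \<open>The derivative of \<open>flat k\<close> is a combination of \<open>flat (k + 1)\<close> and \<open>flat (k + 2)\<close>; the family is closed under
 differentiation, which gives smoothness by induction.\<close>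

definition flat :: "nat => real => real" where
 "flat k x = (if 0 < x then exp (- inverse x) * inverse x ^ k else 0)"

lemma flat_tendsto_0: "(flat k \<longlongrightarrow> 0) (at 0)"
proof -
 have "((%x::real. inverse x ^ k / exp (inverse x)) \<longlongrightarrow> 0) (at_right 0)"
  by (rule filterlim_compose[OF tendsto_power_div_exp_0 filterlim_inverse_at_top_right])
 hence "(flat k \<longlongrightarrow> 0) (at_right 0)"
  by (rule Lim_transform_eventually)
   (auto simp: flat_def eventually_at_right_field exp_minus field_simps intro!: exI[of _ 1])
 moreover have "(flat k \<longlongrightarrow> 0) (at_left 0)"
  by (rule Lim_transform_eventually[OF tendsto_const])
   (auto simp: flat_def eventually_at_left_field intro!: exI[of _ "-1"])
 ultimately show ?thesis by (simp add: filterlim_split_at)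
qed

lemma flat_has_derivative: "(flat k has_real_derivative flat (k + 2) x - real k * flat (k + 1) x) (at x)"
proof -
 consider "x > 0" | "x < 0" | "x = 0" by linarith
 thus ?thesis
 proof cases
  case 1
  have "((%x. exp (- inverse x) * inverse x ^ k) has_real_derivative
    exp (- inverse x) * inverse x ^ (k + 2) - real k * (exp (- inverse x) * inverse x ^ (k + 1))) (at x)"
  proof (cases k)
   case 0
   thus ?thesis using 1 by (auto intro!: derivative_eq_intros simp: power2_eq_square field_simps)
  next
   case (Suc m)
   have i: "(inverse has_real_derivative - ((inverse x)\<^sup>2)) (at x)"
    using 1 by (auto intro!: derivative_eq_intros simp: power2_eq_square)
   have e: "((%x. exp (- inverse x)) has_real_derivative exp (- inverse x) * (inverse x)\<^sup>2) (at x)"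
    using DERIV_fun_exp[OF DERIV_minus[OF i]] by simp
   have "((%x. exp (- inverse x) * inverse x ^ Suc m) has_real_derivative
     exp (- inverse x) * (inverse x)\<^sup>2 * inverse x ^ Suc m
     + (1 + real m) * (- ((inverse x)\<^sup>2) * inverse x ^ m) * exp (- inverse x)) (at x)"
    by (rule DERIV_mult[OF e DERIV_power_Suc[OF i]])
   moreover have "exp (- inverse x) * (inverse x)\<^sup>2 * inverse x ^ Suc m
     + (1 + real m) * (- ((inverse x)\<^sup>2) * inverse x ^ m) * exp (- inverse x)
     = exp (- inverse x) * inverse x ^ (Suc m + 2) - real (Suc m) * (exp (- inverse x) * inverse x ^ (Suc m + 1))"
    by (simp add: power2_eq_square algebra_simps)
   ultimately show ?thesis using Suc by metis
  qed
  hence "(flat k has_real_derivative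
    exp (- inverse x) * inverse x ^ (k + 2) - real k * (exp (- inverse x) * inverse x ^ (k + 1))) (at x)"
   by (rule has_field_derivative_transform_within_open[where S="{0<..}"]) (use 1 in "auto simp: flat_def")
  thus ?thesis using 1 by (simp add: flat_def)
 next
  case 2
  have "((%x. 0) has_real_derivative 0) (at x)" by simp
  hence "(flat k has_real_derivative 0) (at x)"
   by (rule has_field_derivative_transform_within_open[where S="{..<0}"]) (use 2 in "auto simp: flat_def")
  thus ?thesis using 2 by (simp add: flat_def)
 next
  case 3
  have "(%h. (flat k (0 + h) - flat k 0) / h) = flat (k + 1)"
   by (auto simp: flat_def fun_eq_iff field_simps)
  thus ?thesis
   using 3 flat_tendsto_0[of "k + 1"] by (simp add: DERIV_def) (simp add: flat_def)
 qed
qed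

lemma Cn_on_flat: "Cn_on n (flat k) UNIV"
proof (induction n arbitrary: k)
 case 0
 thus ?case
  using DERIV_isCont[OF flat_has_derivative[of k]] by (simp add: continuous_at_imp_continuous_on)
next
 case (Suc n)
 show ?case
 proof (rule Cn_on_SucI)
  show "(flat k has_derivative (*) (flat (k + 2) x - real k * flat (k + 1) x)) (at x)" for x
   using flat_has_derivative by (simp add: has_field_derivative_def)
  show "Cn_on n (%x. (flat (k + 2) x - real k * flat (k + 1) x) * v) UNIV" for v
   by (intro Cn_on_mult Cn_on_diff Cn_on_const Suc) auto
 qed auto
qed

text \<open>Zero up to the argument \<open>0\<close> and one from the argument \<open>1\<close> on; the denominator is positive because one of
 \<open>x\<close> and \<open>1 - x\<close> is.\<close>

definition smooth_step :: "real => real" where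
 "smooth_step x = flat 0 x * inverse (flat 0 x + flat 0 (1 - x))"

lemma flat_nonneg: "0 <= flat k x" by (simp add: flat_def)

lemma flat_denominator_pos: "0 < flat 0 x + flat 0 (1 - x)"
 by (auto simp: flat_def add_nonneg_pos add_pos_nonneg)

lemma smooth_step_range: "0 <= smooth_step x" "smooth_step x <= 1"
 using flat_denominator_pos[of x] flat_nonneg[of 0 x] flat_nonneg[of 0 "1 - x"]
 by (auto simp: smooth_step_def field_simps)

lemma smooth_step_0: "x <= 0 ==> smooth_step x = 0" by (simp add: smooth_step_def flat_def)

lemma smooth_step_1: "1 <= x ==> smooth_step x = 1"
 by (simp add: smooth_step_def flat_def)

lemma Cn_on_smooth_step: "Cn_on n smooth_step UNIV"
proof -
 have "Cn_on n (%x. flat 0 (1 - x)) (UNIV :: real set)"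
  by (rule Cn_on_compose[where f="%x. 1 - x" and g="flat 0" and T=UNIV])
   (auto intro!: Cn_on_flat Cn_on_diff Cn_on_const Cn_on_id)
 thus ?thesis unfolding smooth_step_def
  using flat_denominator_pos
  by (intro Cn_on_mult Cn_on_inverse Cn_on_add Cn_on_flat) (auto simp: less_le)
qed

text \<open>One on the ball of radius \<open>r\<close> and zero outside the ball of radius \<open>2 r\<close>; the square of the distance
 is used because it is smooth at the centre.\<close>

definition ball_bump :: "'e::euclidean_space => real => 'e => real" where
 "ball_bump y0 r y = smooth_step ((4 * r\<^sup>2 - (y - y0) \<bullet> (y - y0)) * inverse (3 * r\<^sup>2))"

lemma Cn_on_ball_bump: "Cn_on n (ball_bump y0 r) UNIV"
 unfolding ball_bump_def
 by (rule Cn_on_compose[where g=smooth_step and T=UNIV])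
  (intro Cn_on_smooth_step Cn_on_mult Cn_on_inner Cn_on_diff Cn_on_const Cn_on_id open_UNIV subset_UNIV)+

lemma ball_bump_range: "0 <= ball_bump y0 r y" "ball_bump y0 r y <= 1"
 by (simp_all add: ball_bump_def smooth_step_range)

lemma ball_bump_1: assumes "r > 0" "dist y y0 <= r" shows "ball_bump y0 r y = 1"
proof -
 have "(y - y0) \<bullet> (y - y0) <= r\<^sup>2"
  using assms by (simp add: dot_square_norm dist_norm power_mono)
 thus ?thesis using assms(1) unfolding ball_bump_def
  by (intro smooth_step_1) (simp add: field_simps)
qed

lemma ball_bump_0: assumes "r > 0" "dist y y0 \<ge> 2 * r" shows "ball_bump y0 r y = 0"
proof -
 have "(2 * r)\<^sup>2 <= (y - y0) \<bullet> (y - y0)"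
  using assms by (metis dist_norm dot_square_norm less_imp_le mult_nonneg_nonneg power_mono zero_le_numeral)
 thus ?thesis using assms(1) unfolding ball_bump_def
  by (intro smooth_step_0) (simp add: field_simps mult_nonpos_nonneg power2_eq_square)
qed


section \<open>Charts and transition maps\<close>

abbreviation cimg :: "('a, 'e) chart => 'e set" where "cimg c \<equiv> cmap c ` cdom c"

lemma is_chartD:
 assumes "is_chart c"
 shows "open (cdom c)" "open (cimg c)" "x\<in>cdom c ==> cinv c (cmap c x) = x"
  "y\<in>cimg c ==> cmap c (cinv c y) = y" "y\<in>cimg c ==> cinv c y\<in>cdom c"
  "continuous_on (cdom c) (cmap c)" "continuous_on (cimg c) (cinv c)"
 using assms unfolding is_chart_def homeomorphism_def by auto

lemma chart_open_image:
 assumes "is_chart c" "open U"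
 shows "open (cmap c ` (U Int cdom c))"
proof -
 have "cmap c ` (U Int cdom c) = cimg c Int cinv c -` U"
  using is_chartD[OF assms(1)] by force
 thus ?thesis
  using continuous_open_preimage[OF is_chartD(7,2)[OF assms(1)] assms(2)] by simp
qed

lemma chart_open_preimage:
 assumes "is_chart c" "open V"
 shows "open (cdom c Int cmap c -` V)"
 using continuous_open_preimage[OF is_chartD(6,1)[OF assms(1)] assms(2)] .

definition tr :: "('a, 'e::euclidean_space) chart => ('a, 'e) chart => 'a => 'e => 'e" where
 "tr c d p = FD (cmap d o cinv c) (cmap c p)"

lemma coord_eq_tr: "coord A c p = tr (chart_at A p) c p"
 by (simp add: coord_def tr_def)

lemma coord_inv_eq_tr: "coord_inv A c p = tr c (chart_at A p) p"
 by (simp add: coord_inv_def tr_def)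

definition mfun :: "('a::topological_space, 'e::euclidean_space) chart set => nat => ('a => 'b::euclidean_space) => 'a set => bool"
 where "mfun A n f W \<longleftrightarrow> (\<forall>c\<in>A. Cn_on n (%y. f (cinv c y)) (cmap c ` (W Int cdom c)))"

text \<open>Functions whose sum is one only on a neighbourhood \<open>G\<close> of \<open>Z\<close>. Only finitely many
 of the supports meet a sublevel set of \<open>e\<close>, which yields compact supports over compact sets of parameters.\<close>

locale subordinate_partition =
 fixes A :: "('a::t2_space, 'e::euclidean_space) chart set" and Z :: "'a set" and e :: "'a => real" and O' :: "'a => 'a set"
  and S :: "(nat \<times> 'a) set" and \<theta> :: "nat \<times> 'a => 'a => real" and C G
 assumes G: "open G" "Z <= G" "G <= carrier A"
  and C: "!!k. k\<in>S ==> snd k\<in>Z & compact (C k) & C k <= O' (snd k) Int carrier A"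
  and \<theta>: "!!k n W. k\<in>S ==> mfun A n (\<theta> k) W" "!!k q. 0 <= \<theta> k q" "!!k q. k\<in>S ==> q\<notin>C k ==> \<theta> k q = 0"
  and loc: "!!q. q\<in>carrier A ==> \<exists>V F. open V & q\<in>V & finite F & F <= S & (\<forall>q'\<in>V. \<forall>k\<in>S. q'\<in>C k --> k\<in>F)"
  and one: "!!q. q\<in>G ==> (\<Sum>k\<in>{k\<in>S. q\<in>C k}. \<theta> k q) = 1"
  and le: "!!q. (\<Sum>k\<in>{k\<in>S. q\<in>C k}. \<theta> k q) <= 1"
  and fin: "!!r. finite {k\<in>S. \<exists>q\<in>C k. e q <= r}"

locale manifold =
 fixes A :: "('a::t2_space, 'e::euclidean_space) chart set"
 assumes atlas: "smooth_atlas A"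
begin

lemma is_chart: "c\<in>A ==> is_chart c"
 using atlas by (auto simp: smooth_atlas_def)

lemma charts_is_chart: "c\<in>charts k A ==> is_chart c"
 by (auto simp: charts_def)

lemmas chartD = is_chartD[OF is_chart]
lemmas charts_chartD = is_chartD[OF charts_is_chart]
lemmas open_image = chart_open_image[OF is_chart]

lemma atlas_charts: "c\<in>A ==> c\<in>charts k A"
 using atlas unfolding smooth_atlas_def charts_def carrier_def transition_Ck_def Ck_on_def by force

lemma charts_mono: "c\<in>charts k A ==> l <= k ==> c\<in>charts l A"
 unfolding charts_def transition_Ck_def Ck_on_def by (auto intro: order_trans)

lemma charts_cdom: "c\<in>charts k A ==> cdom c <= carrier A"
 by (auto simp: charts_def)

lemma cdom_carrier: "c\<in>A ==> cdom c <= carrier A"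
 by (auto simp: carrier_def)

lemma carrierE:
 assumes "p\<in>carrier A" obtains c where "c\<in>A" "p\<in>cdom c"
 using assms by (auto simp: carrier_def)

lemma open_carrier: "open (carrier A)"
 unfolding carrier_def using is_chart is_chartD(1) by blast

lemma chart_at: "p\<in>carrier A ==> chart_at A p\<in>A & p\<in>cdom (chart_at A p)"
 unfolding chart_at_def carrier_def by (rule someI_ex) auto

lemma Cn_transition_atlas:
 assumes "c\<in>charts k A" "d\<in>A" "enat n <= k"
 shows "Cn_on n (cmap d o cinv c) (cmap c ` (cdom c Int cdom d))"
  "Cn_on n (cmap c o cinv d) (cmap d ` (cdom c Int cdom d))"
 using assms unfolding charts_def transition_Ck_def Ck_on_def by (auto simp: Int_commute)

lemma Cn_transition:
 assumes c: "c\<in>charts k A" and d: "d\<in>charts k A" and n: "enat n <= k"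
 shows "Cn_on n (cmap d o cinv c) (cmap c ` (cdom c Int cdom d))"
proof (rule Cn_on_local)
 fix y assume "y\<in>cmap c ` (cdom c Int cdom d)"
 then obtain p where p: "p\<in>cdom c" "p\<in>cdom d" "y = cmap c p" by auto
 obtain a where a: "a\<in>A" "p\<in>cdom a" using charts_cdom[OF c] p carrierE by blast
 note ca = chartD[OF a(1)] and cc = charts_chartD[OF c]
  and cd = charts_chartD[OF d]
 define U where "U = cdom c Int cdom d Int cdom a"
 have U: "open U" "p\<in>U" using ca cc cd p a by (auto simp: U_def)
 have oc: "open (cmap c ` (U Int cdom c))" by (rule chart_open_image[OF charts_is_chart[OF c] U(1)])
 have oa: "open (cmap a ` (U Int cdom a))" by (rule open_image[OF a(1) U(1)])
 have "Cn_on n (%y. (cmap d o cinv a) ((cmap a o cinv c) y)) (cmap c ` (U Int cdom c))"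
 proof (rule Cn_on_compose[OF oc oa, where f="cmap a o cinv c" and g="cmap d o cinv a"])
  show "Cn_on n (cmap a o cinv c) (cmap c ` (U Int cdom c))"
   by (rule Cn_on_subset[OF Cn_transition_atlas(1)[OF c a(1) n]]) (auto simp: U_def)
  show "Cn_on n (cmap d o cinv a) (cmap a ` (U Int cdom a))"
   by (rule Cn_on_subset[OF Cn_transition_atlas(2)[OF d a(1) n]]) (auto simp: U_def)
  show "(cmap a o cinv c) ` cmap c ` (U Int cdom c) <= cmap a ` (U Int cdom a)"
   using cc by (auto simp: U_def)
 qed
 hence "Cn_on n (cmap d o cinv c) (cmap c ` (U Int cdom c))"
  by (rule Cn_on_cong_imp[OF oc, rotated]) (use cc ca in "auto simp: U_def")
 thus "\<exists>T. open T & y\<in>T & Cn_on n (cmap d o cinv c) T"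
  using oc U(2) p by blast
qed

lemma Cn_transition_A: "c\<in>A ==> d\<in>A ==> Cn_on n (cmap d o cinv c) (cmap c ` (cdom c Int cdom d))"
 by (rule Cn_transition[where k=\<infinity>]) (auto intro: atlas_charts)

lemma tr_derivative:
 assumes "c\<in>charts 1 A" "d\<in>charts 1 A" "p\<in>cdom c" "p\<in>cdom d"
 shows "((cmap d o cinv c) has_derivative tr c d p) (at (cmap c p))"
 unfolding tr_def
proof (rule Cn_on_deriv)
 show "C1_on (cmap d o cinv c) (cmap c ` (cdom c Int cdom d))"
  by (rule Cn_transition[OF assms(1,2)]) (simp add: one_enat_def)
qed (use assms in auto)

lemma tr_linear:
 assumes "c\<in>charts 1 A" "d\<in>charts 1 A" "p\<in>cdom c" "p\<in>cdom d"
 shows "linear (tr c d p)"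
 using tr_derivative[OF assms] has_derivative_linear by blast

lemma tr_chain:
 assumes c: "c\<in>charts 1 A" and d: "d\<in>charts 1 A" and e: "e\<in>charts 1 A"
  and p: "p\<in>cdom c" "p\<in>cdom d" "p\<in>cdom e"
 shows "tr d e p (tr c d p v) = tr c e p v"
proof -
 note cc = charts_chartD[OF c] and cd = charts_chartD[OF d]
 have 1: "((cmap d o cinv c) has_derivative tr c d p) (at (cmap c p))" using assms tr_derivative by blast
 have "(cmap d o cinv c) (cmap c p) = cmap d p" using cc p by simp
 hence 2: "((cmap e o cinv d) has_derivative tr d e p) (at ((cmap d o cinv c) (cmap c p)))"
  using tr_derivative[OF d e] p by simp
 have "((cmap e o cinv d) o (cmap d o cinv c) has_derivative tr d e p o tr c d p) (at (cmap c p))"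
  by (rule diff_chain_at[OF 1 2])
 hence "((cmap e o cinv c) has_derivative tr d e p o tr c d p) (at (cmap c p))"
 proof (rule has_derivative_transform_within_open)
  show "open (cmap c ` (cdom d Int cdom c))" by (rule chart_open_image[OF charts_is_chart[OF c] cd(1)])
 qed (use p cc cd in auto)
 thus ?thesis using frechet_derivative_at[of "cmap e o cinv c"] unfolding tr_def by (metis comp_apply)
qed

lemma tr_refl:
 assumes c: "c\<in>charts 1 A" and p: "p\<in>cdom c"
 shows "tr c c p v = v"
proof -
 note cc = charts_chartD[OF c]
 have "((%y. y) has_derivative (%v. v)) (at (cmap c p))" by simp
 hence "((cmap c o cinv c) has_derivative (%v. v)) (at (cmap c p))"
  by (rule has_derivative_local[OF _ cc(2)]) (use p cc in auto)
 thus ?thesis using frechet_derivative_at[of "cmap c o cinv c"] unfolding tr_def by metis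
qed

lemma chart_at_1: "p\<in>carrier A ==> chart_at A p\<in>charts 1 A"
 using chart_at atlas_charts by blast

lemma coord_linear: "c\<in>charts 1 A ==> p\<in>cdom c ==> linear (coord A c p)"
 using charts_cdom[of c 1] chart_at[of p] chart_at_1 unfolding coord_eq_tr
 by (intro tr_linear) auto

lemma coord_inv_linear: "c\<in>charts 1 A ==> p\<in>cdom c ==> linear (coord_inv A c p)"
 using charts_cdom[of c 1] chart_at[of p] chart_at_1 unfolding coord_inv_eq_tr
 by (intro tr_linear) auto

lemma coord_coord_inv [simp]: "c\<in>charts 1 A ==> p\<in>cdom c ==> coord A c p (coord_inv A c p v) = v"
 using charts_cdom[of c 1] chart_at[of p] chart_at_1[of p] unfolding coord_inv_eq_tr coord_eq_tr
 by (subst tr_chain) (auto simp: tr_refl)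

lemma coord_inv_coord [simp]: "c\<in>charts 1 A ==> p\<in>cdom c ==> coord_inv A c p (coord A c p v) = v"
 using charts_cdom[of c 1] chart_at[of p] chart_at_1[of p] unfolding coord_inv_eq_tr coord_eq_tr
 by (subst tr_chain) (auto simp: tr_refl)

lemma tr_coord:
 "c\<in>charts 1 A ==> d\<in>charts 1 A ==> p\<in>cdom c ==> p\<in>cdom d ==> tr c d p (coord A c p v) = coord A d p v"
 using charts_cdom[of c 1] chart_at[of p] chart_at_1[of p] unfolding coord_eq_tr
 by (intro tr_chain) auto

lemma coord_chart_at: "p\<in>carrier A ==> coord A (chart_at A p) p v = v"
 unfolding coord_eq_tr using chart_at chart_at_1 by (intro tr_refl) auto

lemma coord_inv_chart_at: "p\<in>carrier A ==> coord_inv A (chart_at A p) p v = v"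
 unfolding coord_inv_eq_tr using chart_at chart_at_1 by (intro tr_refl) auto

section \<open>Functions of class $C^n$ on a manifold\<close>

lemma mfunD:
 assumes "mfun A n f W" "open W" "c\<in>charts \<infinity> A"
 shows "Cn_on n (%y. f (cinv c y)) (cmap c ` (W Int cdom c))"
proof (rule Cn_on_local)
 fix y assume "y\<in>cmap c ` (W Int cdom c)"
 then obtain p where p: "p\<in>W" "p\<in>cdom c" "y = cmap c p" by auto
 obtain a where a: "a\<in>A" "p\<in>cdom a" using charts_cdom[OF assms(3)] p carrierE by blast
 note ca = chartD[OF a(1)] and cc = charts_chartD[OF assms(3)]
 define U where "U = cdom c Int cdom a Int W"
 have U: "open U" "p\<in>U" using ca cc p a assms(2) by (auto simp: U_def)
 have oc: "open (cmap c ` (U Int cdom c))" by (rule chart_open_image[OF charts_is_chart[OF assms(3)] U(1)])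
 have oa: "open (cmap a ` (U Int cdom a))" by (rule open_image[OF a(1) U(1)])
 have "Cn_on n (%y. f (cinv a ((cmap a o cinv c) y))) (cmap c ` (U Int cdom c))"
 proof (rule Cn_on_compose[OF oc oa, where f="cmap a o cinv c" and g="%y. f (cinv a y)"])
  show "Cn_on n (cmap a o cinv c) (cmap c ` (U Int cdom c))"
   by (rule Cn_on_subset[OF Cn_transition_atlas(1)[OF assms(3) a(1)]]) (auto simp: U_def)
  show "Cn_on n (%y. f (cinv a y)) (cmap a ` (U Int cdom a))"
   using assms(1) a(1) unfolding mfun_def by (rule_tac Cn_on_subset) (auto simp: U_def)
  show "(cmap a o cinv c) ` cmap c ` (U Int cdom c) <= cmap a ` (U Int cdom a)"
   using cc by (auto simp: U_def)
 qed
 hence "Cn_on n (%y. f (cinv c y)) (cmap c ` (U Int cdom c))"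
  by (rule Cn_on_cong_imp[OF oc, rotated]) (use cc ca in "auto simp: U_def")
 thus "\<exists>T. open T & y\<in>T & Cn_on n (%y. f (cinv c y)) T"
  using oc U(2) p by blast
qed

text \<open>One chart around every point is enough, since the transition maps are smooth.\<close>

lemma mfunI:
 assumes "!!p. p\<in>W ==> p\<in>carrier A ==> \<exists>a U. a\<in>charts \<infinity> A & open U & p\<in>U & p\<in>cdom a
  & Cn_on n (%y. f (cinv a y)) (cmap a ` (U Int cdom a))"
 shows "mfun A n f W"
 unfolding mfun_def
proof (intro ballI Cn_on_local)
 fix c y assume c: "c\<in>A" and "y\<in>cmap c ` (W Int cdom c)"
 then obtain p where p: "p\<in>W" "p\<in>cdom c" "y = cmap c p" by auto
 hence "p\<in>carrier A" using c cdom_carrier by blast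
 then obtain a V where a: "a\<in>charts \<infinity> A" "open V" "p\<in>V" "p\<in>cdom a"
  "Cn_on n (%y. f (cinv a y)) (cmap a ` (V Int cdom a))"
  using assms[OF p(1)] by blast
 note ca = charts_chartD[OF a(1)] and cc = chartD[OF c]
 define U where "U = cdom c Int cdom a Int V"
 have U: "open U" "p\<in>U" using ca cc p a by (auto simp: U_def)
 have oc: "open (cmap c ` (U Int cdom c))" by (rule open_image[OF c U(1)])
 have oa: "open (cmap a ` (U Int cdom a))" by (rule chart_open_image[OF charts_is_chart[OF a(1)] U(1)])
 have "Cn_on n (%y. f (cinv a ((cmap a o cinv c) y))) (cmap c ` (U Int cdom c))"
 proof (rule Cn_on_compose[OF oc oa, where f="cmap a o cinv c" and g="%y. f (cinv a y)"])
  show "Cn_on n (cmap a o cinv c) (cmap c ` (U Int cdom c))"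
   by (rule Cn_on_subset[OF Cn_transition_atlas(2)[OF a(1) c]]) (auto simp: U_def)
  show "Cn_on n (%y. f (cinv a y)) (cmap a ` (U Int cdom a))"
   by (rule Cn_on_subset[OF a(5)]) (auto simp: U_def)
  show "(cmap a o cinv c) ` cmap c ` (U Int cdom c) <= cmap a ` (U Int cdom a)"
   using cc by (auto simp: U_def)
 qed
 hence "Cn_on n (%y. f (cinv c y)) (cmap c ` (U Int cdom c))"
  by (rule Cn_on_cong_imp[OF oc, rotated]) (use cc ca in "auto simp: U_def")
 thus "\<exists>T. open T & y\<in>T & Cn_on n (%y. f (cinv c y)) T"
  using oc U(2) p by blast
qed

lemma mfun_local:
 assumes "!!p. p\<in>W ==> p\<in>carrier A ==> \<exists>U. open U & p\<in>U & mfun A n f U"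
 shows "mfun A n f W"
 using assms carrierE atlas_charts[of _ \<infinity>] unfolding mfun_def[of A n f] by (intro mfunI[unfolded mfun_def]) metis

lemma mfun_subset: "mfun A n f W ==> V <= W ==> mfun A n f V"
 unfolding mfun_def by (meson Cn_on_subset Int_mono image_mono order_refl)

lemma mfun_cong:
 assumes "mfun A n f W" "open W" "!!p. p\<in>W ==> f p = g p" shows "mfun A n g W"
 unfolding mfun_def
proof
 fix c assume c: "c\<in>A"
 show "Cn_on n (%y. g (cinv c y)) (cmap c ` (W Int cdom c))"
  by (rule Cn_on_cong_imp[OF open_image[OF c assms(2)], of "%y. f (cinv c y)"])
   (use assms c chartD[OF c] in "auto simp: mfun_def")
qed

lemma mfun_const: "mfun A n (%p. k) W"
 by (simp add: mfun_def Cn_on_const)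

lemma mfun_bilinear:
 assumes "mfun A n f W" "mfun A n g W" "open W" "bounded_bilinear B" shows "mfun A n (%p. B (f p) (g p)) W"
 unfolding mfun_def
proof
 fix c assume c: "c\<in>A"
 show "Cn_on n (%y. B (f (cinv c y)) (g (cinv c y))) (cmap c ` (W Int cdom c))"
  by (rule Cn_on_bilinear[OF open_image[OF c assms(3)] _ _ assms(4)])
   (use assms c in "simp_all add: mfun_def")
qed

lemma mfun_mult: "mfun A n f W ==> mfun A n g W ==> open W ==> mfun A n (%p. f p * g p :: real) W"
 by (rule mfun_bilinear[OF _ _ _ bounded_bilinear_mult])

lemma mfun_diff: "mfun A n f W ==> mfun A n g W ==> open W ==> mfun A n (%p. f p - g p) W"
 unfolding mfun_def by (intro ballI Cn_on_diff chart_open_image is_chart) simp_all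

lemma mfun_sum: "(!!i. i\<in>F ==> mfun A n (f i) W) ==> open W ==> mfun A n (%p. \<Sum>i\<in>F. f i p) W"
 unfolding mfun_def by (intro ballI Cn_on_sum chart_open_image is_chart) simp_all

lemma mfun_compose:
 assumes "mfun A n f W" "open W" "Cn_on n g UNIV" shows "mfun A n (%p. g (f p)) W"
 unfolding mfun_def
proof
 fix c assume c: "c\<in>A"
 show "Cn_on n (%y. g (f (cinv c y))) (cmap c ` (W Int cdom c))"
  by (rule Cn_on_compose[OF open_image[OF c assms(2)] open_UNIV _ assms(3)])
   (use assms c in "simp_all add: mfun_def")
qed

lemma mfun_le: "mfun A n f W ==> m <= n ==> mfun A m f W"
 unfolding mfun_def using Cn_on_le by blast

lemma mfun_continuous:
 assumes "mfun A n f W" "open W" "W <= carrier A" shows "continuous_on W f"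
proof (rule continuous_at_imp_continuous_on, rule ballI)
 fix p assume p: "p\<in>W"
 then obtain c where c: "c\<in>A" "p\<in>cdom c" using assms(3) carrierE by blast
 note cc = chartD[OF c(1)]
 have 1: "continuous_on (cmap c ` (W Int cdom c)) (%y. f (cinv c y))"
  using assms(1) c(1) Cn_on_continuous unfolding mfun_def by blast
 have "continuous_on (W Int cdom c) (%p. f (cinv c (cmap c p)))"
  by (rule continuous_on_comp[OF 1 continuous_on_subset[OF cc(6)]]) auto
 hence "continuous_on (W Int cdom c) f"
  by (rule continuous_on_eq) (use cc in auto)
 thus "isCont f p"
  using p c cc(1) assms(2) by (simp add: continuous_on_eq_continuous_at open_Int)
qed

lemma mfun_zero_extension:
 assumes "mfun A n f W" "open W" "closed C" "C <= W" "!!p. p\<notin>C ==> f p = 0"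
 shows "mfun A n f V"
proof (rule mfun_local)
 fix p
 show "\<exists>U. open U & p\<in>U & mfun A n f U"
 proof (cases "p\<in>C")
  case True thus ?thesis using assms by blast
 next
  case False
  have "mfun A n f (- C)"
   by (rule mfun_cong[OF mfun_const[of n 0]]) (use assms in auto)
  thus ?thesis using False assms(3) by blast
 qed
qed

section \<open>Partitions of unity\<close>

lemma bump_exists:
 assumes "p\<in>carrier A" "open U" "p\<in>U"
 obtains \<beta> :: "'a => real" and K N where "!!n W. mfun A n \<beta> W" "!!q. 0 <= \<beta> q" "compact K" "K <= U Int carrier A"
  "!!q. q\<notin>K ==> \<beta> q = 0" "open N" "p\<in>N" "N <= K" "!!q. q\<in>N ==> \<beta> q = 1"
proof -
 obtain c where c: "c\<in>A" "p\<in>cdom c" using assms carrierE by blast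
 note cc = chartD[OF c(1)]
 have "open (cmap c ` (U Int cdom c))" by (rule open_image[OF c(1) assms(2)])
 then obtain r where r: "r > 0" "cball (cmap c p) r <= cmap c ` (U Int cdom c)"
  using assms(3) c open_contains_cball by (metis IntI imageI)
 define K where "K = cinv c ` cball (cmap c p) r"
 define \<beta> where "\<beta> = (%q. if q\<in>cdom c then ball_bump (cmap c p) (r/2) (cmap c q) else 0)"
 define N where "N = cdom c Int cmap c -` ball (cmap c p) (r/2)"
 have K: "compact K" unfolding K_def
  by (rule compact_continuous_image[OF continuous_on_subset[OF cc(7)]]) (use r in auto)
 have KU: "K <= U Int cdom c"
 proof
  fix q assume "q\<in>K"
  then obtain y where y: "y\<in>cball (cmap c p) r" "q = cinv c y" by (auto simp: K_def)
  then obtain x where "x\<in>U Int cdom c" "y = cmap c x" using r(2) by blast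
  thus "q\<in>U Int cdom c" using y cc(3) by simp
 qed
 have \<beta>0: "\<beta> q = 0" if "q\<notin>K" for q
 proof (cases "q\<in>cdom c")
  case True
  hence "cmap c q\<notin>cball (cmap c p) r" using that cc unfolding K_def by (metis imageI)
  thus ?thesis using True r by (simp add: \<beta>_def ball_bump_0 dist_commute)
 qed (simp add: \<beta>_def)
 have "mfun A n \<beta> (cdom c)" for n
 proof (rule mfunI, intro exI conjI)
  fix q assume q: "q\<in>cdom c"
  show "c\<in>charts \<infinity> A" using c atlas_charts by blast
  show "Cn_on n (%y. \<beta> (cinv c y)) (cmap c ` (cdom c Int cdom c))"
   by (rule Cn_on_cong_imp[of _ "ball_bump (cmap c p) (r/2)"])
    (use cc in "auto simp: \<beta>_def intro: Cn_on_subset[OF Cn_on_ball_bump]")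
 qed (use cc in auto)
 hence sm: "mfun A n \<beta> W" for n W
  by (rule mfun_zero_extension[OF _ cc(1) compact_imp_closed[OF K]]) (use KU \<beta>0 in auto)
 show ?thesis
 proof (rule that[OF sm _ K _ \<beta>0])
  show "K <= U Int carrier A" using KU cdom_carrier[OF c(1)] by blast
  show "open N" unfolding N_def by (rule chart_open_preimage[OF is_chart[OF c(1)]]) auto
  show "p\<in>N" using c r by (simp add: N_def)
  have "q\<in>cinv c ` cball (cmap c p) r" if "q\<in>N" for q
   using that cc(3) r by (intro image_eqI[of _ _ "cmap c q"]) (auto simp: N_def dist_commute)
  thus "N <= K" by (auto simp: K_def)
  show "0 <= \<beta> q" for q by (simp add: \<beta>_def ball_bump_range)
  show "\<beta> q = 1" if "q\<in>N" for q
   using that r by (auto simp: N_def \<beta>_def dist_commute intro!: ball_bump_1)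
 qed
qed

text \<open>A smooth function on the whole line that equals the reciprocal for \<open>s \<ge> 1/2\<close>. It is used to divide by
 functions that are positive only near the set of interest.\<close>

definition cutoff_inverse :: "real => real" where
 "cutoff_inverse s = smooth_step (4 * s - 1) * inverse s"

lemma cutoff_inverse_nonneg: "s \<ge> 0 ==> cutoff_inverse s \<ge> 0"
 by (simp add: cutoff_inverse_def smooth_step_range)

lemma cutoff_inverse_eq: "s \<ge> 1/2 ==> cutoff_inverse s = inverse s"
 by (simp add: cutoff_inverse_def smooth_step_1)

lemma Cn_on_cutoff_inverse: "Cn_on n cutoff_inverse UNIV"
proof (rule Cn_on_local)
 fix s :: real
 have "Cn_on n cutoff_inverse {1/8<..}"
  unfolding cutoff_inverse_def
  by (intro Cn_on_mult Cn_on_inverse Cn_on_id Cn_on_compose[where g=smooth_step and T=UNIV and f="%s. 4 * s - 1"]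
    Cn_on_smooth_step Cn_on_diff Cn_on_const) auto
 moreover have "Cn_on n cutoff_inverse {..<1/4}"
  by (rule Cn_on_cong_imp[OF _ _ Cn_on_const[of n 0]]) (auto simp: cutoff_inverse_def smooth_step_0)
 ultimately show "\<exists>T. open T & s\<in>T & Cn_on n cutoff_inverse T"
  using exI[of "%T. open T & s\<in>T & Cn_on n cutoff_inverse T" "{..<1/4}"]
   exI[of "%T. open T & s\<in>T & Cn_on n cutoff_inverse T" "{1/8<..}"]
  by (cases "s < 1/4") auto
qed

lemma mfun_locally_finite_sum:
 assumes g: "!!k. k\<in>S ==> mfun A n (g k) (carrier A)" "!!k q. k\<in>S ==> q\<notin>C k ==> g k q = 0"
  and loc: "!!q. q\<in>carrier A ==> \<exists>V F. open V & q\<in>V & finite F & F <= S & (\<forall>q'\<in>V. \<forall>k\<in>S. q'\<in>C k --> k\<in>F)"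
 shows "mfun A n (%q. \<Sum>k\<in>{k\<in>S. q\<in>C k}. g k q) (carrier A)"
proof (rule mfun_local)
 fix q assume q: "q\<in>carrier A"
 then obtain V F where V: "open V" "q\<in>V" "finite F" "F <= S" "\<forall>q'\<in>V. \<forall>k\<in>S. q'\<in>C k --> k\<in>F"
  using loc[OF q] by (elim exE conjE) (rule that)
 let ?V = "V Int carrier A"
 have o: "open ?V" using V(1) open_carrier by blast
 have "mfun A n (%p. \<Sum>k\<in>F. g k p) ?V"
  by (rule mfun_sum[OF mfun_subset[OF g(1)] o]) (use V(4) in auto)
 hence "mfun A n (%q. \<Sum>k\<in>{k\<in>S. q\<in>C k}. g k q) ?V"
 proof (rule mfun_cong[OF _ o])
  fix p assume "p\<in>?V"
  thus "(\<Sum>k\<in>F. g k p) = (\<Sum>k\<in>{k\<in>S. p\<in>C k}. g k p)"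
   by (intro sum.mono_neutral_right V(3)) (use V(4,5) g(2) in blast)+
 qed
 thus "\<exists>U. open U & q\<in>U & mfun A n (%q. \<Sum>k\<in>{k\<in>S. q\<in>C k}. g k q) U" using o V(2) q by blast
qed

text \<open>Near a closed set \<open>Z\<close> that is exhausted by the compact sets \<open>Z \<inter> {e \<le> r}\<close>, bump functions are
  chosen for the compact layers between consecutive integer values of \<open>e\<close>. Bumps of layer \<open>n\<close> are
  supported where \<open>e\<close> lies between \<open>n - 1\<close> and \<open>n + 2\<close>, so that the family is locally finite.\<close>

lemma partition_near:
 fixes e :: "'a => real" and O' :: "'a => 'a set"
 assumes Z: "Z <= carrier A" and e: "continuous_on (carrier A) e" "!!p. p\<in>carrier A ==> 0 <= e p"
  and comp: "!!r. compact (Z Int {p\<in>carrier A. e p <= r})"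
  and cover: "!!z. z\<in>Z ==> open (O' z) & z\<in>O' z"
 obtains S \<theta> C G where "subordinate_partition A Z e O' S \<theta> C G"
proof -
 have oe: "open {p\<in>carrier A. a < e p & e p < b}" for a b
 proof -
  have "{p\<in>carrier A. a < e p & e p < b} = carrier A Int e -` {a<..<b}" by auto
  thus ?thesis using continuous_open_preimage[OF e(1) open_carrier open_greaterThanLessThan] by simp
 qed
 define P where "P z n \<beta> K N \<longleftrightarrow> (\<forall>m W. mfun A m (\<beta>::'a => real) W) & (\<forall>q. 0 <= \<beta> q) & compact K &
   K <= (O' z Int {p\<in>carrier A. real n - 1 < e p & e p < real n + 2}) Int carrier A &
   (\<forall>q. q\<notin>K --> \<beta> q = 0) & open N & z\<in>N & N <= K & (\<forall>q\<in>N. \<beta> q = 1)" for z n \<beta> K N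
 have "\<exists>\<beta> K N. P z n \<beta> K N" if z: "z\<in>Z" "real n <= e z" "e z <= real n + 1" for z n
 proof -
  let ?U = "O' z Int {p\<in>carrier A. real n - 1 < e p & e p < real n + 2}"
  have U: "z\<in>carrier A" "open ?U" "z\<in>?U" using Z cover[OF z(1)] z oe by auto
  show ?thesis
  proof (rule bump_exists[OF U], goal_cases)
   case (1 \<beta> K N)
   show ?case unfolding P_def
    by (rule exI[of _ \<beta>], rule exI[of _ K], rule exI[of _ N]) (intro conjI allI impI ballI 1)
  qed
 qed
 hence "\<forall>n z. \<exists>\<beta> K N. z\<in>Z & real n <= e z & e z <= real n + 1 --> P z n \<beta> K N" by blast
 then obtain \<beta> K N where "\<forall>n z. z\<in>Z & real n <= e z & e z <= real n + 1 --> P z n (\<beta> n z) (K n z) (N n z)"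
  by metis
 hence b: "P z n (\<beta> n z) (K n z) (N n z)" if "z\<in>Z" "real n <= e z" "e z <= real n + 1" for z n
  using that by blast
 note b = b[unfolded P_def]
 define Zn where "Zn n = Z Int {p\<in>carrier A. real n <= e p & e p <= real n + 1}" for n :: nat
 have cZ: "compact (Zn n)" for n
 proof -
  have "Zn n = (Z Int {p\<in>carrier A. e p <= real n + 1}) - {p\<in>carrier A. -1 < e p & e p < real n}"
   using e(2) by (fastforce simp: Zn_def)
  thus ?thesis using compact_diff[OF comp oe] by simp
 qed
 have "\<exists>F. finite F & F <= Zn n & Zn n <= (\<Union>z\<in>F. N n z)" for n
 proof -
  have "Zn n <= \<Union> (N n ` Zn n)" "!!B. B\<in>N n ` Zn n ==> open B" using b by (auto simp: Zn_def)
  then obtain D where "D <= N n ` Zn n" "finite D" "Zn n <= \<Union> D" by (metis compactE[OF cZ])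
  thus ?thesis by (metis finite_subset_image)
 qed
 then obtain F where F: "!!n. finite (F n)" "!!n. F n <= Zn n" "!!n. Zn n <= (\<Union>z\<in>F n. N n z)" by metis
 define S where "S = {(n, z). z\<in>F n}"
 define C where "C k = K (fst k) (snd k)" for k :: "nat \<times> 'a"
 define \<psi> where "\<psi> k = (if k\<in>S then \<beta> (fst k) (snd k) else (%_. 0))" for k :: "nat \<times> 'a"
 have bS: "(\<forall>m W. mfun A m (\<psi> k) W) & (\<forall>q. 0 <= \<psi> k q) & compact (C k) &
   C k <= O' (snd k) Int {p\<in>carrier A. real (fst k) - 1 < e p & e p < real (fst k) + 2} &
   (\<forall>q. q\<notin>C k --> \<psi> k q = 0) & open (N (fst k) (snd k)) & N (fst k) (snd k) <= C k &
   (\<forall>q\<in>N (fst k) (snd k). \<psi> k q = 1) & snd k\<in>Z"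
  if "k\<in>S" for k
 proof -
  have "snd k\<in>Zn (fst k)" using that F(2)[of "fst k"] by (auto simp: S_def)
  hence z: "snd k\<in>Z" "real (fst k) <= e (snd k)" "e (snd k) <= real (fst k) + 1"
   by (auto simp: Zn_def)
  have \<psi>: "\<psi> k = \<beta> (fst k) (snd k)" using that by (simp add: \<psi>_def)
  show ?thesis unfolding \<psi> C_def using b[OF z] z(1) by blast
 qed
 have \<psi>0: "0 <= \<psi> k q" for k q
 proof (cases "k\<in>S")
  case True thus ?thesis using bS by blast
 qed (simp add: \<psi>_def)
 have \<psi>z: "\<psi> k q = 0" if "k\<in>S" "q\<notin>C k" for k q using bS that by blast
 have \<psi>s: "mfun A n (\<psi> k) W" if "k\<in>S" for n k W using bS that by blast
 have finS: "finite {k\<in>S. real (fst k) <= r}" for r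
 proof (rule finite_subset)
  show "{k\<in>S. real (fst k) <= r} <= (\<Union>n\<in>{n. n <= nat \<lfloor>r\<rfloor>}. Pair n ` F n)"
  proof
   fix k assume k: "k\<in>{k\<in>S. real (fst k) <= r}"
   hence "fst k <= nat \<lfloor>r\<rfloor>" by (intro le_nat_floor) simp
   moreover have "snd k\<in>F (fst k)" using k by (auto simp: S_def)
   ultimately show "k\<in>(\<Union>n\<in>{n. n <= nat \<lfloor>r\<rfloor>}. Pair n ` F n)"
    by (intro UN_I[of "fst k"] image_eqI[of _ _ "snd k"]) auto
  qed
 qed (use F(1) in auto)
 have loc: "\<exists>V F'. open V & q\<in>V & V <= carrier A & finite F' & F' <= S & (\<forall>q'\<in>V. \<forall>k\<in>S. q'\<in>C k --> k\<in>F')"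
  if q: "q\<in>carrier A" for q
 proof (intro exI conjI ballI impI)
  let ?F = "{k\<in>S. real (fst k) <= e q + 2}"
  show "open {p\<in>carrier A. e q - 1 < e p & e p < e q + 1}" by (rule oe)
  show "q\<in>{p\<in>carrier A. e q - 1 < e p & e p < e q + 1}" using q by simp
  show "finite ?F" by (rule finS)
  fix q' k assume "q'\<in>{p\<in>carrier A. e q - 1 < e p & e p < e q + 1}" "k\<in>S" "q'\<in>C k"
  hence "e q' < e q + 1" "real (fst k) - 1 < e q'" "k\<in>S" using bS[of k] by auto
  thus "k\<in>?F" by simp
 qed auto
 define s where "s q = (\<Sum>k\<in>{k\<in>S. q\<in>C k}. \<psi> k q)" for q
 have sF: "s q' = (\<Sum>k\<in>F'. \<psi> k q')" if "finite F'" "F' <= S" "\<forall>q'\<in>V. \<forall>k\<in>S. q'\<in>C k --> k\<in>F'" "q'\<in>V" for q' V F'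
  unfolding s_def
 proof (rule sum.mono_neutral_left)
  show "\<forall>k\<in>F' - {k\<in>S. q'\<in>C k}. \<psi> k q' = 0" using that(2) \<psi>z by blast
 qed (use that in auto)
 have s0: "0 <= s q" for q unfolding s_def by (intro sum_nonneg \<psi>0)
 have smooth_s: "mfun A n s (carrier A)" for n
  unfolding s_def[abs_def] by (rule mfun_locally_finite_sum[OF \<psi>s \<psi>z]) (use loc in meson)+
 define G where "G = {p\<in>carrier A. 1/2 < s p}"
 have "G = carrier A Int s -` {1/2<..}" by (auto simp: G_def)
 hence oG: "open G"
  using continuous_open_preimage[OF mfun_continuous[OF smooth_s[of 0] open_carrier order_refl] open_carrier open_greaterThan]
  by simp
 have ZG: "Z <= G"
 proof
  fix z assume z: "z\<in>Z"
  define n where "n = nat \<lfloor>e z\<rfloor>"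
  have "0 <= e z" "z\<in>carrier A" using z Z e(2)[of z] by auto
  hence "real n <= e z" "e z <= real n + 1" unfolding n_def by linarith+
  hence "z\<in>Zn n" using z \<open>z\<in>carrier A\<close> by (simp add: Zn_def)
  then obtain x where x: "x\<in>F n" "z\<in>N n x" using F(3)[of n] by blast
  hence k: "(n, x)\<in>S" by (simp add: S_def)
  have "z\<in>carrier A" using z Z by blast
  then obtain V F' where V: "open V" "z\<in>V" "finite F'" "F' <= S" "\<forall>q'\<in>V. \<forall>k\<in>S. q'\<in>C k --> k\<in>F'"
   using loc by meson
  have "z\<in>C (n, x)" using bS[OF k] x(2) by auto
  hence "(n, x)\<in>F'" using V(5,2) k by blast
  hence "\<psi> (n, x) z <= s z" unfolding sF[OF V(3-5,2)] using V(3) \<psi>0 by (intro member_le_sum) auto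
  moreover have "\<psi> (n, x) z = 1" using bS[OF k] x by auto
  ultimately show "z\<in>G" using \<open>z\<in>carrier A\<close> by (simp add: G_def)
 qed
 define \<theta> where "\<theta> k q = (if k\<in>S then cutoff_inverse (s q) * \<psi> k q else 0)" for k q
 have \<theta>s: "(\<Sum>k\<in>{k\<in>S. q\<in>C k}. \<theta> k q) = cutoff_inverse (s q) * s q" for q
  unfolding s_def sum_distrib_left by (rule sum.cong) (auto simp: \<theta>_def s_def)
 show ?thesis
 proof (rule that, unfold_locales)
  show "G <= carrier A" by (auto simp: G_def)
  show "snd k\<in>Z & compact (C k) & C k <= O' (snd k) Int carrier A" if "k\<in>S" for k
   using bS[OF that] by blast
  show "mfun A n (\<theta> k) W" if "k\<in>S" for k n W
  proof -
   have "mfun A n (\<theta> k) (carrier A)"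
    unfolding \<theta>_def using that
    by (simp add: mfun_mult mfun_compose[OF smooth_s open_carrier Cn_on_cutoff_inverse] open_carrier \<psi>s)
   thus ?thesis
    by (rule mfun_zero_extension[OF _ open_carrier compact_imp_closed])
     (use bS[OF that] \<psi>z in "auto simp: \<theta>_def")
  qed
  show "0 <= \<theta> k q" for k q by (simp add: \<theta>_def \<psi>0 s0 cutoff_inverse_nonneg)
  show "\<theta> k q = 0" if "k\<in>S" "q\<notin>C k" for k q using \<psi>z[OF that] by (simp add: \<theta>_def)
  show "\<exists>V F. open V & q\<in>V & finite F & F <= S & (\<forall>q'\<in>V. \<forall>k\<in>S. q'\<in>C k --> k\<in>F)" if "q\<in>carrier A" for q
   using loc[OF that] by meson
  show "(\<Sum>k\<in>{k\<in>S. q\<in>C k}. \<theta> k q) = 1" if "q\<in>G" for q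
   using that by (simp add: \<theta>s G_def cutoff_inverse_eq)
  show "(\<Sum>k\<in>{k\<in>S. q\<in>C k}. \<theta> k q) <= 1" for q
   using smooth_step_range[of "4 * s q - 1"] by (cases "s q = 0") (auto simp: \<theta>s cutoff_inverse_def mult.assoc)
  show "finite {k\<in>S. \<exists>q\<in>C k. e q <= r}" for r
   by (rule finite_subset[OF _ finS[of "r + 1"]]) (use bS in force)
 qed (fact oG ZG)+
qed

end

section \<open>The product of a manifold with an interval\<close>

definition pchart :: "real set => ('a, 'e) chart => ('a \<times> real, 'e \<times> real) chart" where
 "pchart I c = \<lparr>cdom = cdom c \<times> I, cmap = (%(x, t). (cmap c x, t))\<rparr>"

lemma prod_atlas_eq: "prod_atlas A I = pchart I ` A"
 by (simp add: prod_atlas_def pchart_def)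

lemma pchart_simps [simp]:
 "cdom (pchart I c) = cdom c \<times> I" "cmap (pchart I c) (x, t) = (cmap c x, t)"
 by (simp_all add: pchart_def)

lemma pchart_image: "cmap (pchart I c) ` (S \<times> T) = (cmap c ` S) \<times> T"
 by (force simp: pchart_def)

lemma pchart_cinv:
 assumes "is_chart c" "y\<in>cimg c" "t\<in>I"
 shows "cinv (pchart I c) (y, t) = (cinv c y, t)"
proof -
 note cc = is_chartD[OF assms(1)]
 have "inj_on (cmap (pchart I c)) (cdom (pchart I c))"
  using cc(3) by (auto simp: inj_on_def) metis
 hence "cinv (pchart I c) (cmap (pchart I c) (cinv c y, t)) = (cinv c y, t)"
  unfolding cinv_def[of "pchart I c"] by (rule inv_into_f_f) (use assms cc in auto)
 thus ?thesis using cc assms by simp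
qed

lemma is_chart_pchart:
 assumes "is_chart c" "open I" shows "is_chart (pchart I c)"
proof -
 note cc = is_chartD[OF assms(1)]
 have img: "cimg (pchart I c) = cimg c \<times> I" by (simp add: pchart_image)
 show ?thesis unfolding is_chart_def homeomorphism_def
 proof (intro conjI)
  show "open (cdom (pchart I c))" using cc assms by (auto intro: open_Times)
  show "open (cimg (pchart I c))" unfolding img using cc assms by (auto intro: open_Times)
  have "continuous_on (cdom c \<times> I) (%q. (cmap c (fst q), snd q))"
   by (intro continuous_intros continuous_on_comp[OF cc(6)]) auto
  thus "continuous_on (cdom (pchart I c)) (cmap (pchart I c))"
   by (simp add: pchart_def case_prod_unfold)
  have "continuous_on (cimg c \<times> I) (%q. (cinv c (fst q), snd q))"
   by (intro continuous_intros continuous_on_comp[OF cc(7)]) auto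
  hence co: "continuous_on (cimg c \<times> I) (cinv (pchart I c))"
   by (rule continuous_on_eq) (auto simp: pchart_cinv[OF assms(1)])
  thus "continuous_on (cimg (pchart I c)) (cinv (pchart I c))" unfolding img .
  have "cinv (pchart I c) ` (cimg c \<times> I) = cdom c \<times> I"
   using cc by (force simp: pchart_cinv[OF assms(1)])
  thus "cinv (pchart I c) ` cimg (pchart I c) = cdom (pchart I c)" unfolding img by simp
  show "\<forall>x\<in>cdom (pchart I c). cinv (pchart I c) (cmap (pchart I c) x) = x"
   using cc by (auto simp: pchart_cinv[OF assms(1)])
  show "\<forall>y\<in>cimg (pchart I c). cmap (pchart I c) (cinv (pchart I c) y) = y"
   unfolding img using cc by (auto simp: pchart_cinv[OF assms(1)])
 qed auto
qed

context manifold begin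

lemma carrier_prod: "carrier (prod_atlas A I) = carrier A \<times> I"
 by (auto simp: carrier_def prod_atlas_eq)

lemma smooth_atlas_prod:
 assumes "open I" shows "smooth_atlas (prod_atlas A I)"
 unfolding smooth_atlas_def prod_atlas_eq
proof (intro conjI ballI)
 show "is_chart c" if "c\<in>pchart I ` A" for c using that is_chart is_chart_pchart assms by auto
 fix c' d' assume "c'\<in>pchart I ` A" "d'\<in>pchart I ` A"
 then obtain c d where c: "c\<in>A" "c' = pchart I c" and d: "d\<in>A" "d' = pchart I d" by auto
 note cc = chartD[OF c(1)] and cd = chartD[OF d(1)]
 let ?U = "cmap c ` (cdom c Int cdom d)"
 have oU: "open ?U" using open_image[OF c(1) cd(1)] by (simp add: Int_commute)
 have o: "open (?U \<times> I)" using oU assms by (rule open_Times)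
 show "transition_Ck \<infinity> c' d'"
  unfolding transition_Ck_def Ck_on_def
 proof (intro allI impI)
  fix n
  have "Cn_on n (%q. ((cmap d o cinv c) (fst q), snd q)) (?U \<times> I)"
   by (intro Cn_on_Pair o Cn_on_compose[OF o oU, of n fst "cmap d o cinv c"] Cn_transition_A c d
     Cn_on_fst Cn_on_snd Cn_on_id) auto
  hence "Cn_on n (cmap d' o cinv c') (?U \<times> I)"
   by (rule Cn_on_cong_imp[OF o, rotated])
    (use cc in "auto simp: c d pchart_cinv[OF is_chart[OF c(1)]]")
  moreover have "cmap c' ` (cdom c' Int cdom d') = ?U \<times> I"
   using pchart_image[of I c "cdom c Int cdom d" I] by (simp add: c d Times_Int_Times)
  ultimately show "Cn_on n (cmap d' o cinv c') (cmap c' ` (cdom c' Int cdom d'))" by simp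
 qed
qed

end


section \<open>Short-time flows in Euclidean space\<close>

lemma vector_derivative_bound:
 fixes f :: "real => 'e::real_normed_vector"
 assumes "convex J" "!!s. s\<in>J ==> (f has_vector_derivative f' s) (at s within J)"
  "!!s. s\<in>J ==> norm (f' s) <= B" "a\<in>J" "b\<in>J"
 shows "norm (f b - f a) <= B * \<bar>b - a\<bar>"
proof -
 have o: "onorm (%h. h *\<^sub>R v) <= norm v" for v :: 'e
  by (rule onorm_le) (simp add: mult.commute)
 show ?thesis
  using differentiable_bound[OF assms(1), of f "%s h. h *\<^sub>R f' s" B b a] assms(2-5) order_trans[OF o assms(3)]
  by (simp add: has_vector_derivative_def)
qed

lemma vector_derivative_continuous_on:
 assumes "!!s. s\<in>J ==> (f has_vector_derivative f' s) (at s within J)"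
 shows "continuous_on J f"
 unfolding continuous_on_eq_continuous_within
proof
 fix s assume "s\<in>J"
 show "continuous (at s within J) f" by (rule has_vector_derivative_continuous[OF assms[OF \<open>s\<in>J\<close>]])
qed

text \<open>A differential inequality of Gronwall type; on a short interval the supremum of the left-hand
  side can be absorbed.\<close>

lemma short_time_bound:
 fixes f :: "real => 'e::real_normed_vector"
 assumes J: "compact J" "convex J" "a\<in>J" "s\<in>J" "!!r. r\<in>J ==> \<bar>r - a\<bar> <= \<tau>"
  and L: "L * \<tau> <= 1/2" "0 <= L" "0 <= c"
  and f: "!!s. s\<in>J ==> (f has_vector_derivative f' s) (at s within J)"
  and b: "!!s. s\<in>J ==> norm (f' s) <= L * norm (f s) + c"
 shows "norm (f s) <= 2 * (norm (f a) + c * \<tau>)"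
proof -
 have "continuous_on J (%s. norm (f s))" by (intro continuous_on_norm vector_derivative_continuous_on[OF f])
 then obtain m where m: "m\<in>J" "!!r. r\<in>J ==> norm (f r) <= norm (f m)"
  using continuous_attains_sup[of J "%s. norm (f s)"] J by auto
 have "norm (f' r) <= L * norm (f m) + c" if "r\<in>J" for r
  using b[OF that] mult_left_mono[OF m(2)[OF that] L(2)] by linarith
 hence "norm (f m - f a) <= (L * norm (f m) + c) * \<bar>m - a\<bar>"
  using J m by (intro vector_derivative_bound[OF _ f]) auto
 also have "\<dots> <= (L * norm (f m) + c) * \<tau>" using L J m by (intro mult_left_mono) auto
 also have "\<dots> = (L * \<tau>) * norm (f m) + c * \<tau>" by (simp add: algebra_simps)
 also have "\<dots> <= 1/2 * norm (f m) + c * \<tau>" using L by (intro add_right_mono mult_right_mono) auto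
 finally have "norm (f m) <= 2 * (norm (f a) + c * \<tau>)"
  using norm_triangle_ineq2[of "f m" "f a"] by simp
 thus ?thesis using m(2)[OF J(4)] by simp
qed

text \<open>The Picard operator acts on bounded continuous functions on the whole line, extended from the interval by
 clamping; it is a contraction because \<open>L * T \<le> 1/2\<close>. Banach-space values allow the variational equation.\<close>

lemma picard:
 fixes f :: "real => 'e::banach => 'e"
 assumes T: "0 <= T" "0 <= L" "L * T <= 1/2"
  and cont: "continuous_on ({-T..T} \<times> UNIV) (%(s, y). f s y)"
  and lip: "!!s y z. s\<in>{-T..T} ==> norm (f s y - f s z) <= L * norm (y - z)"
 shows "\<exists>\<gamma>. \<gamma> 0 = x & (\<forall>s\<in>{-T..T}. (\<gamma> has_vector_derivative f s (\<gamma> s)) (at s within {-T..T}))"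
proof -
 define F where "F \<gamma> s = f s (apply_bcontfun \<gamma> s)" for \<gamma> :: "real \<Rightarrow>\<^sub>C 'e" and s
 have cF: "continuous_on {-T..T} (F \<gamma>)" for \<gamma>
 proof -
  have "continuous_on {-T..T} (%s. (%(s, y). f s y) (s, apply_bcontfun \<gamma> s))"
   by (rule continuous_on_comp[OF cont]) (auto intro!: continuous_intros)
  thus ?thesis by (simp add: F_def)
 qed
 define J where "J \<gamma> s = x + (integral {-T..s} (F \<gamma>) - integral {-T..0} (F \<gamma>))" for \<gamma> s
 have dJ: "(J \<gamma> has_vector_derivative F \<gamma> s) (at s within {-T..T})" if "s\<in>{-T..T}" for \<gamma> s
  unfolding J_def using integral_has_vector_derivative[OF cF that]
  by (auto intro!: derivative_eq_intros)
 have J0: "J \<gamma> 0 = x" for \<gamma> by (simp add: J_def)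
 have "\<exists>g. (\<forall>s\<in>{-T..T}. apply_bcontfun g s = J \<gamma> s) & (\<forall>s. apply_bcontfun g s = J \<gamma> (clamp (-T) T s))" for \<gamma>
  using continuous_on_cbox_bcontfunE[of "-T" T "J \<gamma>"] vector_derivative_continuous_on[OF dJ] by (metis cbox_interval)
 then obtain P where P: "!!\<gamma> s. s\<in>{-T..T} ==> apply_bcontfun (P \<gamma>) s = J \<gamma> s"
  "!!\<gamma> s. apply_bcontfun (P \<gamma>) s = J \<gamma> (clamp (-T) T s)" by metis
 have "dist (P \<gamma>) (P \<eta>) <= 1/2 * dist \<gamma> \<eta>" for \<gamma> \<eta>
 proof (rule dist_bound)
  fix s
  have c: "clamp (-T) T s\<in>{-T..T}" using clamp_in_interval[of "-T" T s] T by simp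
  have "norm ((J \<gamma> (clamp (-T) T s) - J \<eta> (clamp (-T) T s)) - (J \<gamma> 0 - J \<eta> 0)) <= (L * dist \<gamma> \<eta>) * \<bar>clamp (-T) T s - 0\<bar>"
  proof (rule vector_derivative_bound)
   show "((%s. J \<gamma> s - J \<eta> s) has_vector_derivative F \<gamma> s - F \<eta> s) (at s within {-T..T})" if "s\<in>{-T..T}" for s
    using dJ that by (intro has_vector_derivative_diff) auto
   show "norm (F \<gamma> s - F \<eta> s) <= L * dist \<gamma> \<eta>" if "s\<in>{-T..T}" for s
    using lip[OF that, of "apply_bcontfun \<gamma> s" "apply_bcontfun \<eta> s"]
     mult_left_mono[OF dist_bounded[of \<gamma> s \<eta>] T(2)]
    by (simp add: F_def dist_norm)
  qed (use c T in auto)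
  also have "\<dots> <= (L * dist \<gamma> \<eta>) * T" using c T by (intro mult_left_mono) auto
  also have "\<dots> = (L * T) * dist \<gamma> \<eta>" by simp
  also have "\<dots> <= 1/2 * dist \<gamma> \<eta>" using T by (intro mult_right_mono) auto
  finally show "dist (apply_bcontfun (P \<gamma>) s) (apply_bcontfun (P \<eta>) s) <= 1/2 * dist \<gamma> \<eta>"
   by (simp add: P(2) J0 dist_norm)
 qed
 hence "\<exists>!\<gamma>. P \<gamma> = \<gamma>" by (intro banach_fix_type[of "1/2"]) auto
 then obtain \<gamma> where \<gamma>: "P \<gamma> = \<gamma>" by blast
 have "(J \<gamma> has_vector_derivative f s (J \<gamma> s)) (at s within {-T..T})" if "s\<in>{-T..T}" for s
  using dJ[OF that, of \<gamma>] P(1)[OF that, of \<gamma>] by (simp add: F_def \<gamma>)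
 thus ?thesis using J0 by blast
qed

lemma continuous_on_Lipschitz_param:
 fixes f :: "real => 'e::real_normed_vector => 'f::real_normed_vector"
 assumes c: "!!y. continuous_on J (%s. f s y)"
  and lip: "!!s y z. s\<in>J ==> norm (f s y - f s z) <= K * norm (y - z)" and K: "0 <= K"
 shows "continuous_on (J \<times> UNIV) (%(s, y). f s y)"
proof -
 have "((%q. f (fst q) (snd q)) \<longlongrightarrow> f s y) (at (s, y) within J \<times> UNIV)" if s: "s\<in>J" for s y
 proof -
  let ?F = "at (s, y) within J \<times> UNIV"
  have "continuous_on (J \<times> UNIV) (%q. f (fst q) y)"
   by (rule continuous_on_comp[OF c]) (auto intro!: continuous_intros)
  hence 1: "((%q. f (fst q) y) \<longlongrightarrow> f s y) ?F"
   using s by (auto simp: continuous_on_def)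
  have t: "((%q. K * norm (snd q - y)) \<longlongrightarrow> K * norm (y - y)) ?F"
   using tendsto_snd[OF tendsto_ident_at[of "(s,y)" "J \<times> UNIV"]] by (intro tendsto_intros) simp
  have "((%q. f (fst q) (snd q) - f (fst q) y) \<longlongrightarrow> 0) ?F"
  proof (rule Lim_null_comparison)
   show "\<forall>\<^sub>F q in ?F. norm (f (fst q) (snd q) - f (fst q) y) <= K * norm (snd q - y)"
    unfolding eventually_at_filter by (rule always_eventually) (auto intro: lip)
   show "((%q. K * norm (snd q - y)) \<longlongrightarrow> 0) ?F" using t by simp
  qed
  from tendsto_add[OF this 1] show ?thesis by simp
 qed
 thus ?thesis by (auto simp: continuous_on_def case_prod_unfold)
qed

text \<open>Differentiability of the flow: the solution of the variational equation, a curve of linear maps,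
  is the derivative, since the derivative of the vector field is Lipschitz.\<close>

lemma euclidean_flow:
 fixes g :: "'e::euclidean_space => 'e" and Dg :: "'e => 'e \<Rightarrow>\<^sub>L 'e"
 assumes T: "0 < T" "0 <= L" "L * T <= 1/2"
  and g: "!!y. (g has_derivative blinfun_apply (Dg y)) (at y)" and L: "!!y. norm (Dg y) <= L"
  and C: "!!y z. norm (Dg y - Dg z) <= C * norm (y - z)" "0 <= C"
 obtains \<phi> :: "real => 'e => 'e" and \<psi> :: "real => 'e => 'e \<Rightarrow>\<^sub>L 'e" where
  "!!y. \<phi> 0 y = y"
  "!!s y. s\<in>{-T..T} ==> ((%s. \<phi> s y) has_vector_derivative g (\<phi> s y)) (at s within {-T..T})"
  "!!s y. s\<in>{-T..T} ==> norm (\<phi> s y - y) <= 2 * norm (g y) * T"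
  "continuous_on ({-T..T} \<times> UNIV) (%(s, y). \<phi> s y)"
  "!!s y. s\<in>{-T..T} ==> (\<phi> s has_derivative blinfun_apply (\<psi> s y)) (at y)"
  "continuous_on ({-T..T} \<times> UNIV) (%(s, y). \<psi> s y)"
  "!!s y. s\<in>{-T..T} ==> norm (\<psi> s y) <= 2"
proof -
 let ?J = "{-T..T}"
 have lip: "norm (g y - g z) <= L * norm (y - z)" for y z
  by (rule differentiable_bound[of UNIV g "%y. blinfun_apply (Dg y)"])
   (use g L in "auto simp: norm_blinfun.rep_eq[symmetric]")
 have contg: "continuous_on UNIV g"
  using g by (auto intro!: continuous_at_imp_continuous_on has_derivative_continuous)
 have "\<exists>\<gamma>. \<gamma> 0 = y & (\<forall>s\<in>?J. (\<gamma> has_vector_derivative g (\<gamma> s)) (at s within ?J))" for y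
  using picard[of T L "%s. g"] T lip
  by (simp add: case_prod_unfold continuous_on_comp[OF contg] continuous_on_snd continuous_on_id)
 then obtain \<Phi> where \<Phi>: "!!y. \<Phi> y 0 = y"
  "!!y s. s\<in>?J ==> (\<Phi> y has_vector_derivative g (\<Phi> y s)) (at s within ?J)" by metis
 define \<phi> where "\<phi> s y = \<Phi> y s" for s y
 have \<phi>0: "\<phi> 0 y = y" for y by (simp add: \<phi>_def \<Phi>)
 have d\<phi>: "((%s. \<phi> s y) has_vector_derivative g (\<phi> s y)) (at s within ?J)" if "s\<in>?J" for s y
  using \<Phi>(2)[OF that] by (simp add: \<phi>_def)
 have bnd: "norm (f s) <= 2 * (norm (f 0) + c * T)"
  if "s\<in>?J" "0 <= c" "!!s. s\<in>?J ==> (f has_vector_derivative f' s) (at s within ?J)"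
   "!!s. s\<in>?J ==> norm (f' s) <= L * norm (f s) + c" for f f' :: "real => 'b::real_normed_vector" and c s
  by (rule short_time_bound[of ?J 0 s T L c f f']) (use that T in auto)
 have c\<phi>: "continuous_on ?J (%s. \<phi> s y)" for y
  by (rule vector_derivative_continuous_on[OF d\<phi>])
 have lip\<phi>: "norm (\<phi> s y - \<phi> s z) <= 2 * norm (y - z)" if s: "s\<in>?J" for s y z
  using bnd[OF s, of 0 "%s. \<phi> s y - \<phi> s z" "%s. g (\<phi> s y) - g (\<phi> s z)"]
  by (simp add: has_vector_derivative_diff d\<phi> lip \<phi>0)
 have move: "norm (\<phi> s y - y) <= 2 * norm (g y) * T" if s: "s\<in>?J" for s y
 proof -
  have "norm (g (\<phi> r y)) <= L * norm (\<phi> r y - y) + norm (g y)" for r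
   using lip[of "\<phi> r y" y] norm_triangle_ineq2[of "g (\<phi> r y)" "g y"] by linarith
  hence "norm (\<phi> s y - y) <= 2 * (norm (\<phi> 0 y - y) + norm (g y) * T)"
   by (intro bnd[OF s, of _ "%s. \<phi> s y - y" "%s. g (\<phi> s y)"]) (auto intro!: derivative_eq_intros d\<phi>)
  thus ?thesis by (simp add: \<phi>0)
 qed
 have joint\<phi>: "continuous_on (?J \<times> UNIV) (%(s, y). \<phi> s y)"
  by (rule continuous_on_Lipschitz_param[OF c\<phi> lip\<phi>]) auto
 have contD: "continuous_on UNIV Dg"
  by (rule lipschitz_on_continuous_on[OF lipschitz_onI[of _ _ C]]) (use C in "auto simp: dist_norm")
 have compL: "norm (Dg y o\<^sub>L B) <= L * norm B" for y and B :: "'e \<Rightarrow>\<^sub>L 'e"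
  using norm_blinfun_compose[of "Dg y" B] mult_right_mono[OF L norm_ge_zero[of B]] by (rule order_trans)
 have "\<exists>\<gamma>. \<gamma> 0 = id_blinfun & (\<forall>s\<in>?J. (\<gamma> has_vector_derivative (Dg (\<phi> s y) o\<^sub>L \<gamma> s)) (at s within ?J))" for y
 proof (rule picard[of T L "%s B. Dg (\<phi> s y) o\<^sub>L B"])
  have "continuous_on (?J \<times> UNIV) (%q. \<phi> (fst q) y)"
   by (rule continuous_on_comp[OF c\<phi>]) (auto intro!: continuous_intros)
  from continuous_on_comp[OF contD this]
  have "continuous_on (?J \<times> UNIV) (%q. Dg (\<phi> (fst q) y) o\<^sub>L snd q)"
   by (intro bounded_bilinear.continuous_on[OF bounded_bilinear_blinfun_compose] continuous_intros) auto
  thus "continuous_on (?J \<times> UNIV) (%(s, B). Dg (\<phi> s y) o\<^sub>L B)" by (simp add: case_prod_unfold)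
  show "norm ((Dg (\<phi> s y) o\<^sub>L A) - (Dg (\<phi> s y) o\<^sub>L B)) <= L * norm (A - B)" for s and A B :: "'e \<Rightarrow>\<^sub>L 'e"
   using compL[of _ "A - B"] by (simp add: bounded_bilinear.diff_right[OF bounded_bilinear_blinfun_compose])
 qed (use T in auto)
 then obtain \<Psi> where \<Psi>: "!!y. \<Psi> y 0 = id_blinfun"
  "!!y s. s\<in>?J ==> (\<Psi> y has_vector_derivative (Dg (\<phi> s y) o\<^sub>L \<Psi> y s)) (at s within ?J)" by metis
 define \<psi> where "\<psi> s y = \<Psi> y s" for s y
 have \<psi>0: "\<psi> 0 y = id_blinfun" for y by (simp add: \<psi>_def \<Psi>)
 have d\<psi>: "((%s. \<psi> s y) has_vector_derivative (Dg (\<phi> s y) o\<^sub>L \<psi> s y)) (at s within ?J)" if "s\<in>?J" for s y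
  using \<Psi>(2)[OF that] by (simp add: \<psi>_def)
 have b\<psi>: "norm (\<psi> s y) <= 2" if s: "s\<in>?J" for s y
  using bnd[OF s order_refl d\<psi>[of _ y]] compL norm_blinfun_id_le[where 'a='e] by (fastforce simp: \<psi>0)
 have lip\<psi>: "norm (\<psi> s y - \<psi> s z) <= (8 * C * T) * norm (y - z)" if s: "s\<in>?J" for s y z
 proof -
  have "norm (\<psi> s y - \<psi> s z) <= 2 * (norm (\<psi> 0 y - \<psi> 0 z) + (C * (2 * norm (y - z)) * 2) * T)"
  proof (rule bnd[OF s])
   fix r assume r: "r\<in>?J"
   show "((%s. \<psi> s y - \<psi> s z) has_vector_derivative (Dg (\<phi> r y) o\<^sub>L \<psi> r y) - (Dg (\<phi> r z) o\<^sub>L \<psi> r z)) (at r within ?J)"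
    by (intro has_vector_derivative_diff d\<psi> r)
   have eq: "(Dg (\<phi> r y) o\<^sub>L \<psi> r y) - (Dg (\<phi> r z) o\<^sub>L \<psi> r z)
    = (Dg (\<phi> r y) o\<^sub>L (\<psi> r y - \<psi> r z)) + ((Dg (\<phi> r y) - Dg (\<phi> r z)) o\<^sub>L \<psi> r z)"
    by (intro blinfun_eqI) (simp add: blinfun.bilinear_simps)
   have "norm ((Dg (\<phi> r y) - Dg (\<phi> r z)) o\<^sub>L \<psi> r z) <= C * (2 * norm (y - z)) * 2"
    using C(2) by (intro order_trans[OF norm_blinfun_compose] mult_mono order_trans[OF C(1)] mult_left_mono lip\<phi>[OF r] b\<psi>[OF r]) auto
   thus "norm ((Dg (\<phi> r y) o\<^sub>L \<psi> r y) - (Dg (\<phi> r z) o\<^sub>L \<psi> r z)) <= L * norm (\<psi> r y - \<psi> r z) + C * (2 * norm (y - z)) * 2"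
    unfolding eq by (intro norm_triangle_le add_mono compL)
  qed (use C in auto)
  thus ?thesis by (simp add: \<psi>0 algebra_simps)
 qed
 have joint\<psi>: "continuous_on (?J \<times> UNIV) (%(s, y). \<psi> s y)"
  by (rule continuous_on_Lipschitz_param[OF vector_derivative_continuous_on[OF d\<psi>] lip\<psi>]) (use C T in auto)
 have quad: "norm (g z - g y - Dg y (z - y)) <= C * norm (z - y) * norm (z - y)" for y z
 proof -
  have "norm ((g z - Dg y z) - (g y - Dg y y)) <= (C * norm (z - y)) * norm (z - y)"
  proof (rule differentiable_bound[where f="%w. g w - Dg y w" and f'="%w. blinfun_apply (Dg w - Dg y)" and S="cball y (norm (z - y))"])
   fix w assume w: "w\<in>cball y (norm (z - y))"
   show "((%w. g w - Dg y w) has_derivative blinfun_apply (Dg w - Dg y)) (at w within cball y (norm (z - y)))"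
    by (auto intro!: derivative_eq_intros has_derivative_at_withinI[OF g[of w]] simp: blinfun.bilinear_simps)
   show "onorm (blinfun_apply (Dg w - Dg y)) <= C * norm (z - y)"
    unfolding norm_blinfun.rep_eq[symmetric] using w C(2)
    by (intro order_trans[OF C(1)] mult_left_mono) (auto simp: dist_norm norm_minus_commute)
  qed (auto simp: dist_norm norm_minus_commute)
  thus ?thesis by (simp add: blinfun.bilinear_simps algebra_simps)
 qed
 have err: "norm (\<phi> s z - \<phi> s y - \<psi> s y (z - y)) <= (8 * C * T) * norm (z - y) * norm (z - y)" if s: "s\<in>?J" for s y z
 proof -
  have "norm (\<phi> s z - \<phi> s y - \<psi> s y (z - y)) <= 2 * (norm (\<phi> 0 z - \<phi> 0 y - \<psi> 0 y (z - y)) + (C * (2 * norm (z - y)) * (2 * norm (z - y))) * T)"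
  proof (rule bnd[OF s])
   fix r assume r: "r\<in>?J"
   show "((%s. \<phi> s z - \<phi> s y - \<psi> s y (z - y)) has_vector_derivative
     g (\<phi> r z) - g (\<phi> r y) - Dg (\<phi> r y) (\<psi> r y (z - y))) (at r within ?J)"
    using bounded_linear.has_vector_derivative[OF blinfun.bounded_linear_left d\<psi>[OF r]]
    by (intro has_vector_derivative_diff d\<phi> r) simp
   have eq: "g (\<phi> r z) - g (\<phi> r y) - Dg (\<phi> r y) (\<psi> r y (z - y))
     = Dg (\<phi> r y) (\<phi> r z - \<phi> r y - \<psi> r y (z - y)) + (g (\<phi> r z) - g (\<phi> r y) - Dg (\<phi> r y) (\<phi> r z - \<phi> r y))"
    by (simp add: blinfun.bilinear_simps)
   have "norm (Dg (\<phi> r y) v) <= L * norm v" for v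
    by (rule order_trans[OF norm_blinfun mult_right_mono[OF L norm_ge_zero]])
   moreover have "norm (g (\<phi> r z) - g (\<phi> r y) - Dg (\<phi> r y) (\<phi> r z - \<phi> r y)) <= C * (2 * norm (z - y)) * (2 * norm (z - y))"
    using C(2) by (intro order_trans[OF quad] mult_mono lip\<phi>[OF r] mult_nonneg_nonneg) auto
   ultimately show "norm (g (\<phi> r z) - g (\<phi> r y) - Dg (\<phi> r y) (\<psi> r y (z - y)))
     <= L * norm (\<phi> r z - \<phi> r y - \<psi> r y (z - y)) + C * (2 * norm (z - y)) * (2 * norm (z - y))"
    unfolding eq by (intro norm_triangle_le add_mono)
  qed (use C in auto)
  thus ?thesis by (simp add: \<phi>0 \<psi>0 algebra_simps)
 qed
 have der: "(\<phi> s has_derivative blinfun_apply (\<psi> s y)) (at y)" if s: "s\<in>?J" for s y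
  unfolding has_derivative_iff_norm
 proof (intro conjI blinfun.bounded_linear_right)
  have lim: "((%z. (8 * C * T) * norm (z - y)) \<longlongrightarrow> 0) (at y)"
   by (auto intro!: tendsto_eq_intros)
  show "((%z. norm (\<phi> s z - \<phi> s y - \<psi> s y (z - y)) / norm (z - y)) \<longlongrightarrow> 0) (at y)"
  proof (rule Lim_null_comparison[OF always_eventually lim], rule allI)
   fix z
   show "norm (norm (\<phi> s z - \<phi> s y - \<psi> s y (z - y)) / norm (z - y)) <= 8 * C * T * norm (z - y)"
    using err[OF s, of z y] C T by (cases "z = y") (auto simp: divide_simps)
  qed
 qed
 show ?thesis by (rule that[of \<phi> \<psi>]) (use \<phi>0 d\<phi> move joint\<phi> der joint\<psi> b\<psi> in auto)
qed

lemma bounded_derivative_compact_support: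
 fixes f :: "'a::euclidean_space => 'b::euclidean_space"
 assumes f: "C1_on f UNIV" and K: "compact K" "!!x. x\<notin>K ==> f x = 0"
 obtains L where "0 <= L" "!!y. norm (BD f y) <= L" "!!y. y\<notin>K ==> FD f y = (%v. 0)"
proof -
 have z: "BD f y = 0" if "y\<notin>K" for y
 proof (rule BD_eqI)
  have "((%x::'a. 0::'b) has_derivative blinfun_apply 0) (at y)" by (simp add: zero_blinfun.rep_eq)
  thus "(f has_derivative blinfun_apply 0) (at y)"
   by (rule has_derivative_local[of _ _ _ _ "- K"]) (use that K compact_imp_closed in auto)
 qed
 obtain L where "0 <= L" "!!y. y\<in>K ==> norm (BD f y) <= L"
  using BD_bounded_on_compact[OF f K(1) subset_UNIV] by blast
 moreover have "FD f y = (%v. 0)" if "y\<notin>K" for y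
  using BD_apply[OF f UNIV_I, of y] z[OF that] by (simp add: zero_blinfun.rep_eq)
 ultimately show ?thesis using z by (intro that[of L]) (metis norm_zero)+
qed

lemma Lipschitz_derivative_compact_support:
 assumes f: "Cn_on (Suc (Suc 0)) f UNIV" and K: "compact K" "!!x. x\<notin>K ==> f x = 0"
 obtains C where "0 <= C" "!!y z. norm (BD f y - BD f z) <= C * norm (y - z)"
proof -
 have z: "FD f y v = 0" if "y\<notin>K" for y v
  using bounded_derivative_compact_support[OF Cn_on_SucD[OF f] K] that by metis
 have "\<exists>B\<ge>0. \<forall>y z. norm (FD f y b - FD f z b) <= B * norm (y - z)" for b
 proof -
  let ?f = "%y. FD f y b"
  have 1: "C1_on ?f UNIV" using f by simp
  obtain L where L: "0 <= L" "!!y. norm (BD ?f y) <= L"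
   by (rule bounded_derivative_compact_support[OF 1 K(1) z]) (assumption | rule that)+
  have "norm (?f y - ?f z) <= L * norm (y - z)" for y z
   by (rule differentiable_bound[of UNIV ?f "%y. blinfun_apply (BD ?f y)"])
    (use BD_has_derivative[OF 1] L in "auto simp: norm_blinfun.rep_eq[symmetric]")
  thus ?thesis using L by blast
 qed
 then obtain B where B: "!!b. 0 <= B b"
  "!!b y z. norm (FD f y b - FD f z b) <= B b * norm (y - z)" by metis
 show ?thesis
 proof (rule that[of "\<Sum>b\<in>Basis. B b"])
  show "0 <= (\<Sum>b\<in>Basis. B b)" by (rule sum_nonneg) (use B in auto)
  show "norm (BD f y - BD f z) <= (\<Sum>b\<in>Basis. B b) * norm (y - z)" for y z
   unfolding sum_distrib_right
   by (intro order_trans[OF norm_blinfun_euclidean_le] sum_mono) (simp add: blinfun.diff_left BD_apply[OF f] B)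
 qed
qed


section \<open>Integral curves on a manifold\<close>

definition vf_coord :: "('a, 'e::euclidean_space) chart set => ('a => 'e) => ('a, 'e) chart => 'e => 'e" where
 "vf_coord A Y c y = coord A c (cinv c y) (Y (cinv c y))"

definition icurve :: "('a::topological_space, 'e::euclidean_space) chart set => ('a => 'e) => real set => (real => 'a) => bool" where
 "icurve A Y J \<gamma> \<longleftrightarrow> continuous_on J \<gamma> & (\<forall>s\<in>J. \<gamma> s\<in>carrier A &
   (\<forall>c\<in>A. \<gamma> s\<in>cdom c -->
    ((%h. cmap c (\<gamma> h)) has_vector_derivative coord A c (\<gamma> s) (Y (\<gamma> s))) (at s within J)))"

lemma continuous_on_nhd:
 fixes \<gamma> :: "real => 'a::topological_space"
 assumes "continuous_on J \<gamma>" "s\<in>J" "open U" "\<gamma> s\<in>U"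
 obtains \<delta> where "\<delta> > 0" "!!h. h\<in>J ==> \<bar>h - s\<bar> < \<delta> ==> \<gamma> h\<in>U"
proof -
 have "(\<gamma> \<longlongrightarrow> \<gamma> s) (at s within J)" using assms by (auto simp: continuous_on_def)
 hence "\<forall>\<^sub>F h in at s within J. \<gamma> h\<in>U" using assms topological_tendstoD by blast
 then obtain d where "d > 0" "!!h. h\<in>J ==> h \<noteq> s ==> dist h s < d ==> \<gamma> h\<in>U"
  unfolding eventually_at by blast
 thus ?thesis using that[of d] assms(4) by (metis dist_real_def)
qed

lemma has_vector_derivative_transform_near:
 fixes f g :: "real => 'e::real_normed_vector"
 assumes "(f has_vector_derivative f') (at s within J)" "s\<in>J" "\<delta> > 0"
  "!!h. h\<in>J ==> \<bar>h - s\<bar> < \<delta> ==> f h = g h"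
 shows "(g has_vector_derivative f') (at s within J)"
 using assms(1) unfolding has_vector_derivative_def
proof (rule has_derivative_transform_eventually)
 show "\<forall>\<^sub>F h in at s within J. f h = g h"
  unfolding eventually_at using assms(3,4) by (metis dist_real_def)
qed (use assms in auto)

lemma has_vector_derivative_within_near:
 fixes f :: "real => 'e::real_normed_vector"
 assumes "(f has_vector_derivative f') (at s within J')" "\<delta> > 0"
  "!!h. h\<in>J ==> \<bar>h - s\<bar> < \<delta> ==> h\<in>J'"
 shows "(f has_vector_derivative f') (at s within J)"
proof -
 have "(f has_vector_derivative f') (at s within (J Int ball s \<delta>))"
  by (rule has_vector_derivative_within_subset[OF assms(1)]) (use assms(3) in \<open>auto simp: dist_real_def\<close>)
 moreover have "at s within (J Int ball s \<delta>) = at s within J"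
  using assms(2) by (intro at_within_nhd[of s "ball s \<delta>"]) auto
 ultimately show ?thesis by simp
qed

lemma C1_Lipschitz_cball:
 assumes f: "C1_on f S" and S: "cball y0 r <= S"
 obtains L where "0 <= L" "!!y z. y\<in>cball y0 r ==> z\<in>cball y0 r ==> norm (f y - f z) <= L * norm (y - z)"
proof -
 obtain B where B: "0 <= B" "!!y. y\<in>cball y0 r ==> norm (BD f y) <= B"
  by (rule BD_bounded_on_compact[OF f compact_cball S]) (assumption | rule that)+
 show ?thesis
 proof (rule that[OF B(1)])
  show "norm (f y - f z) <= B * norm (y - z)" if "y\<in>cball y0 r" "z\<in>cball y0 r" for y z
   by (rule differentiable_bound[OF convex_cball[of y0 r] has_derivative_at_withinI[OF BD_has_derivative[OF f]] _ that])
    (use B(2) S in \<open>auto simp: norm_blinfun.rep_eq[symmetric]\<close>)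
 qed
qed

context manifold begin

text \<open>A velocity computed in one chart gives the velocity in every other one, so that integral curves may be
 checked in a single chart at each time.\<close>

lemma change_chart:
 assumes c: "c\<in>charts 1 A" "d\<in>charts 1 A" and \<gamma>: "continuous_on J \<gamma>" "s\<in>J" "\<gamma> s\<in>cdom c" "\<gamma> s\<in>cdom d"
  and der: "((%h. cmap c (\<gamma> h)) has_vector_derivative v) (at s within J)"
 shows "((%h. cmap d (\<gamma> h)) has_vector_derivative tr c d (\<gamma> s) v) (at s within J)"
proof -
 note cc = charts_chartD[OF c(1)]
 have *: "((cmap d o cinv c) o (%h. cmap c (\<gamma> h)) has_vector_derivative tr c d (\<gamma> s) v) (at s within J)"
  by (rule vector_derivative_diff_chain_within[OF der has_derivative_at_withinI[OF tr_derivative]]) (use c \<gamma> in auto)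
 obtain \<delta> where \<delta>: "\<delta> > 0" "!!h. h\<in>J ==> \<bar>h - s\<bar> < \<delta> ==> \<gamma> h\<in>cdom c"
  using continuous_on_nhd[OF \<gamma>(1,2) cc(1) \<gamma>(3)] by blast
 show ?thesis
  by (rule has_vector_derivative_transform_near[OF * \<gamma>(2)]) (use \<delta> cc(3) in auto)
qed

lemma icurveI:
 assumes "continuous_on J \<gamma>" "!!s. s\<in>J ==> \<exists>c\<in>A. \<gamma> s\<in>cdom c &
    ((%h. cmap c (\<gamma> h)) has_vector_derivative coord A c (\<gamma> s) (Y (\<gamma> s))) (at s within J)"
 shows "icurve A Y J \<gamma>"
 unfolding icurve_def
proof (intro conjI ballI impI assms(1))
 fix s assume s: "s\<in>J"
 then obtain c where c: "c\<in>A" "\<gamma> s\<in>cdom c"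
  "((%h. cmap c (\<gamma> h)) has_vector_derivative coord A c (\<gamma> s) (Y (\<gamma> s))) (at s within J)" using assms(2) by blast
 thus "\<gamma> s\<in>carrier A" using cdom_carrier by blast
 fix d assume d: "d\<in>A" "\<gamma> s\<in>cdom d"
 have cd: "c\<in>charts 1 A" "d\<in>charts 1 A" using c d atlas_charts by auto
 show "((%h. cmap d (\<gamma> h)) has_vector_derivative coord A d (\<gamma> s) (Y (\<gamma> s))) (at s within J)"
  using change_chart[OF cd assms(1) s c(2) d(2) c(3)] tr_coord[OF cd c(2) d(2)] by simp
qed

lemma icurve_subset:
 assumes "icurve A Y J \<gamma>" "J' <= J" shows "icurve A Y J' \<gamma>"
 using assms unfolding icurve_def
 by (meson continuous_on_subset has_vector_derivative_within_subset subsetD)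

lemma icurve_shift:
 assumes "icurve A Y J \<gamma>" "!!s. s\<in>J' ==> s + a\<in>J" shows "icurve A Y J' (%s. \<gamma> (s + a))"
 unfolding icurve_def
proof (intro conjI ballI impI)
 show "continuous_on J' (%s. \<gamma> (s + a))"
  using assms unfolding icurve_def by (auto intro!: continuous_on_comp[of J \<gamma>] continuous_intros)
 fix s assume s: "s\<in>J'"
 show "\<gamma> (s + a)\<in>carrier A" using assms s by (auto simp: icurve_def)
 fix c assume c: "c\<in>A" "\<gamma> (s + a)\<in>cdom c"
 have "((%h. cmap c (\<gamma> h)) has_vector_derivative coord A c (\<gamma> (s + a)) (Y (\<gamma> (s + a)))) (at (s + a) within J)"
  using assms s c by (auto simp: icurve_def)
 hence 1: "((%h. cmap c (\<gamma> h)) has_vector_derivative coord A c (\<gamma> (s + a)) (Y (\<gamma> (s + a)))) (at (s + a) within (%s. s + a) ` J')"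
  by (rule has_vector_derivative_within_subset) (use assms in auto)
 have 2: "((%h. h + a) has_vector_derivative 1) (at s within J')"
  by (auto intro!: derivative_eq_intros)
 show "((%h. cmap c (\<gamma> (h + a))) has_vector_derivative coord A c (\<gamma> (s + a)) (Y (\<gamma> (s + a)))) (at s within J')"
  using vector_diff_chain_within[OF 2 1] by (simp add: o_def)
qed

lemma icurve_cong:
 assumes "icurve A Y J \<gamma>" "!!s. s\<in>J ==> \<gamma> s = \<eta> s" shows "icurve A Y J \<eta>"
 unfolding icurve_def
proof (intro conjI ballI impI)
 show "continuous_on J \<eta>" using assms continuous_on_cong[of J J \<gamma> \<eta>] by (simp add: icurve_def)
 fix s assume s: "s\<in>J"
 show "\<eta> s\<in>carrier A" using assms s by (auto simp: icurve_def)
 fix c assume c: "c\<in>A" "\<eta> s\<in>cdom c"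
 show "((%h. cmap c (\<eta> h)) has_vector_derivative coord A c (\<eta> s) (Y (\<eta> s))) (at s within J)"
  by (rule has_vector_derivative_transform_near[of "%h. cmap c (\<gamma> h)" _ _ _ 1])
   (use assms s c in "auto simp: icurve_def")
qed

lemma icurve_glue:
 assumes \<gamma>: "icurve A Y {a..b} \<gamma>" and \<eta>: "icurve A Y {c..d} \<eta>" and o: "a <= c" "c < b" "b <= d"
  and eq: "!!s. s\<in>{c..b} ==> \<gamma> s = \<eta> s"
 shows "icurve A Y {a..d} (%s. if s <= b then \<gamma> s else \<eta> s)"
proof -
 define \<mu> where "\<mu> = (%s. if s <= b then \<gamma> s else \<eta> s)"
 have 1: "icurve A Y {a..b} \<mu>" by (rule icurve_cong[OF \<gamma>]) (simp add: \<mu>_def)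
 have 2: "icurve A Y {c..d} \<mu>" by (rule icurve_cong[OF \<eta>]) (use eq in "auto simp: \<mu>_def")
 have un: "{a..b} \<union> {c..d} = {a..d}" using o by auto
 have "continuous_on ({a..b} \<union> {c..d}) \<mu>"
  using 1 2 by (intro continuous_on_closed_Un) (auto simp: icurve_def)
 hence "continuous_on {a..d} \<mu>" by (simp only: un)
 hence "icurve A Y {a..d} \<mu>"
 proof (rule icurveI)
  fix s assume s: "s\<in>{a..d}"
  show "\<exists>e\<in>A. \<mu> s\<in>cdom e & ((%h. cmap e (\<mu> h)) has_vector_derivative coord A e (\<mu> s) (Y (\<mu> s))) (at s within {a..d})"
  proof (cases "s < b")
   case True
   hence s': "s\<in>{a..b}" using s by auto
   then obtain e where e: "e\<in>A" "\<mu> s\<in>cdom e" using 1 carrierE unfolding icurve_def by metis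
   hence "((%h. cmap e (\<mu> h)) has_vector_derivative coord A e (\<mu> s) (Y (\<mu> s))) (at s within {a..b})"
    using 1 s' by (auto simp: icurve_def)
   hence "((%h. cmap e (\<mu> h)) has_vector_derivative coord A e (\<mu> s) (Y (\<mu> s))) (at s within {a..d})"
    by (rule has_vector_derivative_within_near[of _ _ _ _ "b - s"]) (use True in auto)
   thus ?thesis using e by blast
  next
   case False
   hence s': "s\<in>{c..d}" using s o by auto
   then obtain e where e: "e\<in>A" "\<mu> s\<in>cdom e" using 2 carrierE unfolding icurve_def by metis
   hence "((%h. cmap e (\<mu> h)) has_vector_derivative coord A e (\<mu> s) (Y (\<mu> s))) (at s within {c..d})"
    using 2 s' by (auto simp: icurve_def)
   hence "((%h. cmap e (\<mu> h)) has_vector_derivative coord A e (\<mu> s) (Y (\<mu> s))) (at s within {a..d})"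
    by (rule has_vector_derivative_within_near[of _ _ _ _ "b - c"]) (use False o in auto)
   thus ?thesis using e by blast
  qed
 qed
 thus ?thesis by (simp add: \<mu>_def)
qed

end

text \<open>Class $C^2$ makes the derivative of the field locally Lipschitz, which is what differentiability of the
 flow requires.\<close>

locale cs_field = manifold A for A :: "('a::t2_space, 'e::euclidean_space) chart set" +
 fixes Y :: "'a => 'e" and K :: "'a set"
 assumes compact_K: "compact K" and K_carrier: "K <= carrier A"
  and Y_zero: "!!p. p\<in>carrier A ==> p\<notin>K ==> Y p = 0"
  and Y_C2: "!!c. c\<in>A ==> Cn_on (Suc (Suc 0)) (vf_coord A Y c) (cimg c)"
begin

lemma icurve_unique_local:
 assumes \<gamma>: "icurve A Y J \<gamma>" and \<eta>: "icurve A Y J \<eta>" and J: "is_interval J" "s0\<in>J" "\<gamma> s0 = \<eta> s0"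
 shows "\<exists>\<delta>>0. \<forall>s\<in>J. \<bar>s - s0\<bar> < \<delta> --> \<gamma> s = \<eta> s"
proof -
 have "\<gamma> s0\<in>carrier A" using \<gamma> J by (auto simp: icurve_def)
 then obtain c where c: "c\<in>A" "\<gamma> s0\<in>cdom c" by (rule carrierE)
 note cc = chartD[OF c(1)]
 let ?Y = "vf_coord A Y c" and ?y0 = "cmap c (\<gamma> s0)"
 obtain r where r: "r > 0" "cball ?y0 r <= cimg c"
  using cc(2) c open_contains_cball by (metis imageI)
 obtain L where L: "0 <= L" "!!y z. y\<in>cball ?y0 r ==> z\<in>cball ?y0 r ==> norm (?Y y - ?Y z) <= L * norm (y - z)"
  by (rule C1_Lipschitz_cball[OF Cn_on_SucD[OF Y_C2[OF c(1)]] r(2)]) (assumption | rule that)+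
 define O' where "O' = cdom c Int cmap c -` ball ?y0 r"
 have cont: "continuous_on J \<gamma>" "continuous_on J \<eta>" using \<gamma> \<eta> by (auto simp: icurve_def)
 have O': "open O'" "\<gamma> s0\<in>O'" using r c by (auto simp: O'_def intro!: chart_open_preimage is_chart)
 obtain \<delta>1 where \<delta>1: "\<delta>1 > 0" "!!h. h\<in>J ==> \<bar>h - s0\<bar> < \<delta>1 ==> \<gamma> h\<in>O'"
  by (rule continuous_on_nhd[OF cont(1) J(2) O']) (rule that)
 obtain \<delta>2 where \<delta>2: "\<delta>2 > 0" "!!h. h\<in>J ==> \<bar>h - s0\<bar> < \<delta>2 ==> \<eta> h\<in>O'"
  by (rule continuous_on_nhd[OF cont(2) J(2) O'(1) O'(2)[unfolded J(3)]]) (rule that)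
 define \<delta> where "\<delta> = min (min \<delta>1 \<delta>2) (1 / (2 * (L + 1)))"
 have \<delta>: "\<delta> > 0" using \<delta>1 \<delta>2 L by (simp add: \<delta>_def)
 have "\<gamma> s = \<eta> s" if s: "s\<in>J" "\<bar>s - s0\<bar> < \<delta>" for s
 proof -
  have seg: "h\<in>J" "\<gamma> h\<in>O'" "\<eta> h\<in>O'" if h: "h\<in>closed_segment s0 s" for h
  proof -
   show "h\<in>J"
    using closed_segment_subset[OF J(2) s(1) is_interval_convex[OF J(1)]] h by blast
   moreover have "\<bar>h - s0\<bar> < \<delta>" using h s(2) by (auto simp: closed_segment_eq_real_ivl split: if_splits)
   ultimately show "\<gamma> h\<in>O'" "\<eta> h\<in>O'" using \<delta>1 \<delta>2 by (auto simp: \<delta>_def)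
  qed
  have "norm (cmap c (\<gamma> s) - cmap c (\<eta> s)) <= 2 * (norm (cmap c (\<gamma> s0) - cmap c (\<eta> s0)) + 0 * \<bar>s - s0\<bar>)"
  proof (rule short_time_bound[of "closed_segment s0 s" s0 s "\<bar>s - s0\<bar>" L])
   fix h assume h: "h\<in>closed_segment s0 s"
   have sub: "closed_segment s0 s <= J" using seg by blast
   have "((%h. cmap c (\<gamma> h)) has_vector_derivative coord A c (\<gamma> h) (Y (\<gamma> h))) (at h within J)"
    "((%h. cmap c (\<eta> h)) has_vector_derivative coord A c (\<eta> h) (Y (\<eta> h))) (at h within J)"
    using \<gamma> \<eta> seg[OF h] c by (auto simp: icurve_def O'_def)
   thus "((%h. cmap c (\<gamma> h) - cmap c (\<eta> h)) has_vector_derivative ?Y (cmap c (\<gamma> h)) - ?Y (cmap c (\<eta> h))) (at h within closed_segment s0 s)"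
    using has_vector_derivative_within_subset[OF _ sub] seg[OF h] cc(3)
    by (intro has_vector_derivative_diff) (auto simp: vf_coord_def O'_def)
   show "norm (?Y (cmap c (\<gamma> h)) - ?Y (cmap c (\<eta> h))) <= L * norm (cmap c (\<gamma> h) - cmap c (\<eta> h)) + 0"
    unfolding add_0_right using seg[OF h] by (intro L) (auto simp: O'_def)
  next
   have "L * \<bar>s - s0\<bar> <= L * (1 / (2 * (L + 1)))" using s L by (intro mult_left_mono) (auto simp: \<delta>_def)
   also have "\<dots> <= 1/2" using L by (simp add: field_simps)
   finally show "L * \<bar>s - s0\<bar> <= 1/2" .
  qed (use L in "auto simp: closed_segment_eq_real_ivl convex_closed_segment split: if_splits")
  hence "cmap c (\<gamma> s) - cmap c (\<eta> s) = 0" using J(3) by simp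
  moreover have "s\<in>closed_segment s0 s" by auto
  ultimately show "\<gamma> s = \<eta> s" using seg[of s] cc(3) unfolding O'_def by (metis IntD1 eq_iff_diff_eq_0)
 qed
 thus ?thesis using \<delta> by blast
qed

text \<open>The set of times at which two integral curves agree is open by the local statement, closed by continuity,
 and therefore the whole interval.\<close>

lemma icurve_unique:
 assumes \<gamma>: "icurve A Y J \<gamma>" and \<eta>: "icurve A Y J \<eta>" and J: "is_interval J" "s0\<in>J" "\<gamma> s0 = \<eta> s0" and s: "s\<in>J"
 shows "\<gamma> s = \<eta> s"
proof -
 let ?E = "{s\<in>J. \<gamma> s = \<eta> s}"
 have "openin (top_of_set J) ?E"
  unfolding openin_euclidean_subtopology_iff
 proof (intro conjI ballI)
  fix x assume "x\<in>?E"
  thus "\<exists>e>0. \<forall>x'\<in>J. dist x' x < e --> x'\<in>?E"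
   using icurve_unique_local[OF \<gamma> \<eta> J(1), of x] by (auto simp: dist_real_def)
 qed auto
 moreover have "openin (top_of_set J) (J - ?E)"
  unfolding openin_euclidean_subtopology_iff
 proof (intro conjI ballI)
  fix x assume x: "x\<in>J - ?E"
  then obtain U V where UV: "open U" "open V" "\<gamma> x\<in>U" "\<eta> x\<in>V" "U Int V = {}"
   using hausdorff[of "\<gamma> x" "\<eta> x"] by auto
  obtain d1 where d1: "d1 > 0" "!!h. h\<in>J ==> \<bar>h - x\<bar> < d1 ==> \<gamma> h\<in>U"
   using x UV \<gamma> unfolding icurve_def by (auto intro: continuous_on_nhd[of J \<gamma> x U])
  obtain d2 where d2: "d2 > 0" "!!h. h\<in>J ==> \<bar>h - x\<bar> < d2 ==> \<eta> h\<in>V"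
   using x UV \<eta> unfolding icurve_def by (auto intro: continuous_on_nhd[of J \<eta> x V])
  show "\<exists>e>0. \<forall>x'\<in>J. dist x' x < e --> x'\<in>J - ?E"
  proof (intro exI[of _ "min d1 d2"] conjI ballI impI)
   fix x' assume "x'\<in>J" "dist x' x < min d1 d2"
   hence "\<gamma> x'\<in>U" "\<eta> x'\<in>V" using d1 d2 by (auto simp: dist_real_def)
   thus "x'\<in>J - ?E" using UV(5) \<open>x'\<in>J\<close> by auto
  qed (use d1 d2 in auto)
 qed auto
 hence "closedin (top_of_set J) ?E" by (simp add: closedin_def)
 ultimately have "?E = {} \<or> ?E = J"
  using J(1) is_interval_connected connected_clopen by blast
 thus ?thesis using J s by auto
qed

end


section \<open>$C^k$ maps between manifolds\<close>

lemma continuous_on_locally: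
 fixes f :: "'x::t2_space => 'y::topological_space"
 assumes "!!x. x\<in>X ==> \<exists>U. open U & x\<in>U & continuous_on (X Int U) f"
 shows "continuous_on X f"
 unfolding continuous_on_eq_continuous_within
proof
 fix x assume x: "x\<in>X"
 then obtain U where U: "open U" "x\<in>U" "continuous_on (X Int U) f" using assms by blast
 have "at x within X = at x within (X Int U)"
  by (rule at_within_nhd[OF U(2,1)]) auto
 moreover have "continuous (at x within (X Int U)) f"
  using U x by (auto simp: continuous_on_eq_continuous_within)
 ultimately show "continuous (at x within X) f" by simp
qed

text \<open>Smoothness is defined with all charts; by smoothness of transition maps, one pair of charts around each
 point suffices.\<close>

lemma Ck_mapI:
 fixes F :: "'b::t2_space => 'a::t2_space"
 assumes B: "smooth_atlas B" and A: "smooth_atlas A" and W: "open W" "W <= carrier B"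
  and loc: "!!p. p\<in>W ==> \<exists>c\<in>charts \<infinity> B. \<exists>d\<in>charts \<infinity> A. \<exists>U. open U & p\<in>U & p\<in>cdom c & F ` (U Int cdom c) <= cdom d &
   (\<forall>n. enat n <= k --> Cn_on n (cmap d o F o cinv c) (cmap c ` (U Int cdom c)))"
 shows "Ck_map B A k W F"
proof -
 interpret B: manifold B by unfold_locales (rule B)
 interpret A: manifold A by unfold_locales (rule A)
 have cont: "continuous_on W F"
 proof (rule continuous_on_locally)
  fix p assume p: "p\<in>W"
  obtain c d U where c: "c\<in>charts \<infinity> B" "d\<in>charts \<infinity> A" "open U" "p\<in>U" "p\<in>cdom c"
   "F ` (U Int cdom c) <= cdom d" "\<forall>n. enat n <= k --> Cn_on n (cmap d o F o cinv c) (cmap c ` (U Int cdom c))"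
   using loc[OF p] by (elim bexE exE conjE) (rule that)
  have "enat 0 <= k" by (simp add: zero_enat_def[symmetric])
  hence c7: "continuous_on (cmap c ` (U Int cdom c)) (cmap d o F o cinv c)" using c(7) by (metis Cn_on.simps(1))
  note cc = is_chartD[OF B.charts_is_chart[OF c(1)]] and cd = is_chartD[OF A.charts_is_chart[OF c(2)]]
  have 1: "continuous_on (U Int cdom c) (%q. (cmap d o F o cinv c) (cmap c q))"
   by (rule continuous_on_comp[OF c7]) (use cc(6) in \<open>auto intro: continuous_on_subset\<close>)
  have "continuous_on (U Int cdom c) (%q. cinv d ((cmap d o F o cinv c) (cmap c q)))"
   by (rule continuous_on_comp[OF cd(7) 1]) (use c(6) cc in auto)
  hence "continuous_on (U Int cdom c) F"
   by (rule continuous_on_eq) (use c(6) cc cd in auto)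
  hence "continuous_on (W Int (U Int cdom c)) F" by (rule continuous_on_subset) auto
  thus "\<exists>V. open V & p\<in>V & continuous_on (W Int V) F" using c cc(1) by blast
 qed
 have FW: "F ` W <= carrier A"
 proof
  fix x assume "x\<in>F ` W"
  then obtain p where p: "p\<in>W" "x = F p" by auto
  obtain d where "d\<in>charts \<infinity> A" "F p\<in>cdom d"
   using loc[OF p(1)] by blast
  thus "x\<in>carrier A" using A.charts_cdom p by blast
 qed
 show ?thesis unfolding Ck_map_def Ck_on_def
 proof (intro conjI cont FW ballI allI impI)
  fix b a n assume b: "b\<in>B" and a: "a\<in>A" and n: "enat n <= k"
  note cb = is_chartD[OF B.is_chart[OF b]] and ca = is_chartD[OF A.is_chart[OF a]]
  show "Cn_on n (cmap a o F o cinv b) (cmap b ` {q\<in>W Int cdom b. F q\<in>cdom a})"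
  proof (rule Cn_on_local)
   fix y assume "y\<in>cmap b ` {q\<in>W Int cdom b. F q\<in>cdom a}"
   then obtain p where p: "p\<in>W" "p\<in>cdom b" "F p\<in>cdom a" "y = cmap b p" by auto
   obtain c d U where c: "c\<in>charts \<infinity> B" "d\<in>charts \<infinity> A" "open U" "p\<in>U" "p\<in>cdom c"
    "F ` (U Int cdom c) <= cdom d" "\<forall>n. enat n <= k --> Cn_on n (cmap d o F o cinv c) (cmap c ` (U Int cdom c))"
    using loc[OF p(1)] by (elim bexE exE conjE) (rule that)
   have c7: "Cn_on n (cmap d o F o cinv c) (cmap c ` (U Int cdom c))" using c(7) n by blast
   note cc = is_chartD[OF B.charts_is_chart[OF c(1)]] and cd = is_chartD[OF A.charts_is_chart[OF c(2)]]
   define V where "V = {q\<in>W. F q\<in>cdom a} Int U Int cdom c Int cdom b"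
   have "open {q\<in>W. F q\<in>cdom a}"
    using continuous_open_preimage[OF cont W(1) ca(1)] by (simp add: Int_def vimage_def)
   hence V: "open V" "p\<in>V" using c cc cb p by (auto simp: V_def)
   have ob: "open (cmap b ` (V Int cdom b))" by (rule chart_open_image[OF B.is_chart[OF b] V(1)])
   have oc: "open (cmap c ` (V Int cdom c))" by (rule chart_open_image[OF B.charts_is_chart[OF c(1)] V(1)])
   have od: "open (cmap d ` (cdom a Int cdom d))" by (rule chart_open_image[OF A.charts_is_chart[OF c(2)] ca(1)])
   have 1: "Cn_on n (cmap c o cinv b) (cmap b ` (V Int cdom b))"
    by (rule Cn_on_subset[OF B.Cn_transition[OF B.atlas_charts[OF b] c(1)]]) (auto simp: V_def)
   have 2: "Cn_on n (%y. (cmap d o F o cinv c) ((cmap c o cinv b) y)) (cmap b ` (V Int cdom b))"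
    by (rule Cn_on_compose[OF ob oc 1 Cn_on_subset[OF c7]]) (use cb in "auto simp: V_def")
   have 3: "Cn_on n (cmap a o cinv d) (cmap d ` (cdom a Int cdom d))"
    by (rule Cn_on_subset[OF A.Cn_transition[OF c(2) A.atlas_charts[OF a]]]) auto
   have "Cn_on n (%y. (cmap a o cinv d) ((cmap d o F o cinv c) ((cmap c o cinv b) y))) (cmap b ` (V Int cdom b))"
    by (rule Cn_on_compose[OF ob od 2 3]) (use cb cc c(6) in \<open>auto simp: V_def\<close>)
   hence "Cn_on n (cmap a o F o cinv b) (cmap b ` (V Int cdom b))"
    by (rule Cn_on_cong_imp[OF ob, rotated]) (use cb cc cd c(6) in \<open>auto simp: V_def image_subset_iff\<close>)
   thus "\<exists>T. open T & y\<in>T & Cn_on n (cmap a o F o cinv b) T"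
    using ob V p by blast
  qed
 qed
qed

lemma Ck_mapD:
 fixes F :: "'b::t2_space => 'a::t2_space"
 assumes B: "smooth_atlas B" and A: "smooth_atlas A" and F: "Ck_map B A k W F" and W: "open W"
  and c: "c\<in>charts \<infinity> B" and d: "d\<in>charts \<infinity> A" and n: "enat n <= k"
 shows "Cn_on n (cmap d o F o cinv c) (cmap c ` {q\<in>W Int cdom c. F q\<in>cdom d})"
  and "open {q\<in>W Int cdom c. F q\<in>cdom d}"
proof -
 interpret B: manifold B by unfold_locales (rule B)
 interpret A: manifold A by unfold_locales (rule A)
 note cc = is_chartD[OF B.charts_is_chart[OF c]] and cd = is_chartD[OF A.charts_is_chart[OF d]]
 have cont: "continuous_on W F" and FW: "F ` W <= carrier A" using F by (auto simp: Ck_map_def)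
 have pre: "open {q\<in>W. F q\<in>S}" if "open S" for S
  using continuous_open_preimage[OF cont W that] by (simp add: Int_def vimage_def)
 have "{q\<in>W Int cdom c. F q\<in>cdom d} = {q\<in>W. F q\<in>cdom d} Int cdom c" by auto
 thus "open {q\<in>W Int cdom c. F q\<in>cdom d}" using pre[OF cd(1)] cc(1) by auto
 show "Cn_on n (cmap d o F o cinv c) (cmap c ` {q\<in>W Int cdom c. F q\<in>cdom d})"
 proof (rule Cn_on_local)
  fix y assume "y\<in>cmap c ` {q\<in>W Int cdom c. F q\<in>cdom d}"
  then obtain p where p: "p\<in>W" "p\<in>cdom c" "F p\<in>cdom d" "y = cmap c p" by auto
  obtain b where b: "b\<in>B" "p\<in>cdom b" using p(2) B.charts_cdom[OF c] B.carrierE by blast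
  obtain a where a: "a\<in>A" "F p\<in>cdom a" using p(3) A.charts_cdom[OF d] A.carrierE by blast
  note cb = is_chartD[OF B.is_chart[OF b(1)]] and ca = is_chartD[OF A.is_chart[OF a(1)]]
  define V where "V = {q\<in>W. F q\<in>cdom a Int cdom d} Int cdom c Int cdom b"
  have V: "open V" "p\<in>V" using cc cb p a b pre[of "cdom a Int cdom d"] ca cd by (auto simp: V_def)
  have ob: "open (cmap b ` (V Int cdom b))" by (rule chart_open_image[OF B.is_chart[OF b(1)] V(1)])
  have oc: "open (cmap c ` (V Int cdom c))" by (rule chart_open_image[OF B.charts_is_chart[OF c(1)] V(1)])
  have oa: "open (cmap a ` (cdom d Int cdom a))" by (rule chart_open_image[OF A.is_chart[OF a(1)] cd(1)])
  have F0: "Cn_on n (cmap a o F o cinv b) (cmap b ` {q\<in>W Int cdom b. F q\<in>cdom a})"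
   using F n a b by (auto simp: Ck_map_def Ck_on_def)
  have 1: "Cn_on n (cmap b o cinv c) (cmap c ` (V Int cdom c))"
   by (rule Cn_on_subset[OF B.Cn_transition[OF c B.atlas_charts[OF b(1)]]]) (auto simp: V_def)
  have 2: "Cn_on n (%y. (cmap a o F o cinv b) ((cmap b o cinv c) y)) (cmap c ` (V Int cdom c))"
   by (rule Cn_on_compose[OF oc ob 1 Cn_on_subset[OF F0]]) (use cc in "auto simp: V_def")
  have 3: "Cn_on n (cmap d o cinv a) (cmap a ` (cdom d Int cdom a))"
   by (rule Cn_on_subset[OF A.Cn_transition[OF A.atlas_charts[OF a(1)] d]]) auto
  have "Cn_on n (%y. (cmap d o cinv a) ((cmap a o F o cinv b) ((cmap b o cinv c) y))) (cmap c ` (V Int cdom c))"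
   by (rule Cn_on_compose[OF oc oa 2 3]) (use cb cc in "auto simp: V_def")
  hence "Cn_on n (cmap d o F o cinv c) (cmap c ` (V Int cdom c))"
   by (rule Cn_on_cong_imp[OF oc, rotated]) (use cb cc ca in "auto simp: V_def")
  thus "\<exists>T. open T & y\<in>T & Cn_on n (cmap d o F o cinv c) T"
   using oc V p by blast
 qed
qed

lemma Ck_map_compose:
 fixes F :: "'b::t2_space => 'a::t2_space" and G :: "'a => 'c::t2_space"
 assumes B: "smooth_atlas B" and A: "smooth_atlas A" and D: "smooth_atlas D"
  and F: "Ck_map B A k W F" and W: "open W" "W <= carrier B" and G: "Ck_map A D k V G" and V: "open V" "F ` W <= V"
 shows "Ck_map B D k W (%x. G (F x))"
proof (rule Ck_mapI[OF B D W])
 interpret B: manifold B by unfold_locales (rule B)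
 interpret A: manifold A by unfold_locales (rule A)
 interpret D: manifold D by unfold_locales (rule D)
 fix p assume p: "p\<in>W"
 obtain b where b: "b\<in>B" "p\<in>cdom b" using p W B.carrierE by blast
 have FGc: "F ` W <= carrier A" "G ` V <= carrier D" using F G by (simp_all add: Ck_map_def)
 hence "F p\<in>carrier A" "G (F p)\<in>carrier D" using p V by blast+
 then obtain a d where a: "a\<in>A" "F p\<in>cdom a" and d: "d\<in>D" "G (F p)\<in>cdom d"
  using A.carrierE D.carrierE by metis
 note cb = is_chartD[OF B.is_chart[OF b(1)]] and ca = is_chartD[OF A.is_chart[OF a(1)]] and cd = is_chartD[OF D.is_chart[OF d(1)]]
 have contF: "continuous_on W F" and contG: "continuous_on V G" using F G by (auto simp: Ck_map_def)
 have oV: "open {q\<in>V. G q\<in>cdom d}"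
  using continuous_open_preimage[OF contG V(1) cd(1)] by (simp add: Int_def vimage_def)
 define U where "U = {q\<in>W. F q\<in>cdom a Int {q\<in>V. G q\<in>cdom d}}"
 have oU: "open U" unfolding U_def
  using continuous_open_preimage[OF contF W(1) open_Int[OF ca(1) oV]]
  unfolding vimage_def Int_def by simp
 have pU: "p\<in>U" using p a d V by (auto simp: U_def)
 have ob: "open (cmap b ` (U Int cdom b))" by (rule chart_open_image[OF B.is_chart[OF b(1)] oU])
 have oa: "open (cmap a ` ({q\<in>V. G q\<in>cdom d} Int cdom a))" by (rule chart_open_image[OF A.is_chart[OF a(1)] oV])
 have "Cn_on n (cmap d o (%x. G (F x)) o cinv b) (cmap b ` (U Int cdom b))" if n: "enat n <= k" for n
 proof -
  have 1: "Cn_on n (cmap a o F o cinv b) (cmap b ` (U Int cdom b))"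
   by (rule Cn_on_subset[of _ _ "cmap b ` {q\<in>W Int cdom b. F q\<in>cdom a}"])
    (use F n a b in "auto simp: Ck_map_def Ck_on_def U_def")
  have 2: "Cn_on n (cmap d o G o cinv a) (cmap a ` ({q\<in>V. G q\<in>cdom d} Int cdom a))"
   by (rule Cn_on_subset[of _ _ "cmap a ` {q\<in>V Int cdom a. G q\<in>cdom d}"])
    (use G n a d in "auto simp: Ck_map_def Ck_on_def")
  have "Cn_on n (%y. (cmap d o G o cinv a) ((cmap a o F o cinv b) y)) (cmap b ` (U Int cdom b))"
   by (rule Cn_on_compose[OF ob oa 1 2]) (use cb in "auto simp: U_def")
  thus ?thesis
   by (rule Cn_on_cong_imp[OF ob, rotated]) (use cb ca in "auto simp: U_def")
 qed
 thus "\<exists>c\<in>charts \<infinity> B. \<exists>d\<in>charts \<infinity> D. \<exists>U. open U & p\<in>U & p\<in>cdom c & (%x. G (F x)) ` (U Int cdom c) <= cdom d &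
   (\<forall>n. enat n <= k --> Cn_on n (cmap d o (%x. G (F x)) o cinv c) (cmap c ` (U Int cdom c)))"
  using B.atlas_charts[OF b(1)] D.atlas_charts[OF d(1)] oU pU b(2)
  by (intro bexI[of _ b] bexI[of _ d] exI[of _ U]) (auto simp: U_def)
qed

lemma std_atlas_simps: "cinv \<lparr>cdom = UNIV, cmap = id\<rparr> = id" "carrier (std_atlas :: ('e, 'e) chart set) = UNIV"
proof -
 have "(cinv \<lparr>cdom = UNIV, cmap = id\<rparr> :: 'b => 'b) = inv id" by (simp add: cinv_def)
 thus "cinv \<lparr>cdom = UNIV, cmap = id\<rparr> = (id :: 'b => 'b)" by simp
qed (simp add: carrier_def std_atlas_def)

lemma (in manifold) Ck_map_std_iff:
 fixes f :: "'a => 'b::euclidean_space"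
 assumes "open W" "W <= carrier A"
 shows "Ck_map A std_atlas k W f \<longleftrightarrow> (\<forall>n. enat n <= k --> mfun A n f W)"
proof -
 have "(\<forall>n. enat n <= k --> mfun A n f W) ==> continuous_on W f"
  using mfun_continuous[OF _ assms] i0_lb zero_enat_def by metis
 moreover have "{q\<in>W. q\<in>cdom c} = W Int cdom c" for c :: "('a, 'e) chart" by auto
 ultimately show ?thesis
  by (auto simp: Ck_map_def Ck_on_def std_atlas_simps std_atlas_def mfun_def o_def carrier_def)
qed

section \<open>The flow of a compactly supported vector field\<close>

text \<open>A flow box is the flow in a chart, for points of a ball and short times, together with its derivative. The
 radius is doubled to contain the moving point and doubled again for the bump function used to build it.\<close>

record (overloaded) ('a, 'e::real_normed_vector) flow_box =
 fb_chart :: "('a, 'e) chart"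
 fb_center :: 'e
 fb_radius :: real
 fb_flow :: "real => 'e => 'e"
 fb_deriv :: "real => 'e => 'e \<Rightarrow>\<^sub>L 'e"

definition fb_ball :: "('a, 'e::euclidean_space) flow_box => 'e set" where
 "fb_ball i = ball (fb_center i) (fb_radius i)"

definition fb_ball2 :: "('a, 'e::euclidean_space) flow_box => 'e set" where
 "fb_ball2 i = ball (fb_center i) (2 * fb_radius i)"

definition fb_nbh :: "('a, 'e::euclidean_space) flow_box => 'a set" where
 "fb_nbh i = cdom (fb_chart i) Int cmap (fb_chart i) -` fb_ball i"

context cs_field begin

definition is_flow_box :: "real => ('a, 'e) flow_box => bool" where
 "is_flow_box T i \<longleftrightarrow> fb_chart i\<in>A & fb_radius i > 0 &
   cball (fb_center i) (4 * fb_radius i) <= cimg (fb_chart i) &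
   (\<forall>z\<in>fb_ball i. fb_flow i 0 z = z & (\<forall>s\<in>{-T..T}. fb_flow i s z\<in>fb_ball2 i &
    ((%s. fb_flow i s z) has_vector_derivative vf_coord A Y (fb_chart i) (fb_flow i s z)) (at s within {-T..T}) &
    (fb_flow i s has_derivative blinfun_apply (fb_deriv i s z)) (at z) & norm (fb_deriv i s z) <= 2)) &
   continuous_on ({-T..T} \<times> fb_ball i) (%(s, z). fb_flow i s z) &
   continuous_on ({-T..T} \<times> fb_ball i) (%(s, z). fb_deriv i s z)"

lemma is_flow_box_le: assumes "is_flow_box T i" "T' <= T" shows "is_flow_box T' i"
proof -
 have sub: "{-T'..T'} <= {-T..T}" using assms(2) by auto
 thus ?thesis using assms(1) unfolding is_flow_box_def
  by (meson Sigma_mono continuous_on_subset has_vector_derivative_within_subset order_refl subsetD)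
qed

lemma flow_box_exists:
 assumes "p\<in>carrier A"
 shows "\<exists>i T. 0 < T & is_flow_box T i & p\<in>fb_nbh i"
proof -
 obtain c where c: "c\<in>A" "p\<in>cdom c" using assms by (rule carrierE)
 note cc = chartD[OF c(1)]
 define y where "y = cmap c p"
 let ?Y = "vf_coord A Y c"
 obtain r0 where r0: "r0 > 0" "cball y r0 <= cimg c"
  using cc(2) c open_contains_cball unfolding y_def by (metis imageI)
 define r where "r = r0 / 4"
 have r: "r > 0" "cball y (4 * r) <= cimg c" using r0 by (auto simp: r_def)
 define g where "g z = (if z\<in>cimg c then ball_bump y (2 * r) z *\<^sub>R ?Y z else 0)" for z
 have g0: "g z = 0" if "z\<notin>cball y (4 * r)" for z
  using that r by (auto simp: g_def dist_commute intro!: ball_bump_0)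
 have g1: "g z = ?Y z" if "z\<in>ball y (2 * r)" for z
 proof -
  have "z\<in>cimg c" using that r by (auto simp: subset_iff)
  moreover have "ball_bump y (2 * r) z = 1" using that r by (intro ball_bump_1) (auto simp: dist_commute)
  ultimately show ?thesis by (simp add: g_def)
 qed
 have g2: "Cn_on (Suc (Suc 0)) g UNIV"
 proof (rule Cn_on_local)
  fix z :: 'e
  have "Cn_on (Suc (Suc 0)) (%z. ball_bump y (2 * r) z *\<^sub>R ?Y z) (cimg c)"
   by (intro Cn_on_scaleR cc Y_C2 c Cn_on_subset[OF Cn_on_ball_bump]) auto
  hence a: "Cn_on (Suc (Suc 0)) g (cimg c)"
   by (rule Cn_on_cong_imp[OF cc(2), rotated]) (simp add: g_def)
  have b: "Cn_on (Suc (Suc 0)) g (- cball y (4 * r))"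
   by (rule Cn_on_cong_imp[OF _ _ Cn_on_const[of _ 0]]) (use g0 in auto)
  show "\<exists>T. open T & z\<in>T & Cn_on (Suc (Suc 0)) g T"
  proof (cases "z\<in>cball y (4 * r)")
   case True thus ?thesis using a r cc(2) by blast
  next
   case False
   have "open (- cball y (4 * r))" by auto
   thus ?thesis using b False by blast
  qed
 qed
 obtain L where L: "0 <= L" "!!y. norm (BD g y) <= L"
  by (rule bounded_derivative_compact_support[OF Cn_on_SucD[OF g2] compact_cball[of y "4 * r"] g0]) (assumption | rule that)+
 obtain C where C: "0 <= C" "!!y z. norm (BD g y - BD g z) <= C * norm (y - z)"
  by (rule Lipschitz_derivative_compact_support[OF g2 compact_cball[of y "4 * r"] g0]) (assumption | rule that)+
 have "bounded (g ` cball y (4 * r))"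
  by (intro compact_imp_bounded compact_continuous_image continuous_on_subset[OF Cn_on_continuous[OF g2]]) auto
 then obtain B where B: "B > 0" "!!z. z\<in>cball y (4 * r) ==> norm (g z) <= B" unfolding bounded_pos by blast
 have B': "norm (g z) <= B" for z using B g0[of z] by (cases "z\<in>cball y (4 * r)") auto
 define T where "T = min (1 / (2 * (L + 1))) (r / (2 * B))"
 have T: "0 < T" "L * T <= 1/2" "2 * B * T <= r"
 proof -
  show "0 < T" using L B r by (simp add: T_def)
  have "L * T <= L * (1 / (2 * (L + 1)))" using L by (intro mult_left_mono) (auto simp: T_def)
  also have "\<dots> <= 1/2" using L by (simp add: field_simps)
  finally show "L * T <= 1/2" .
  have "2 * B * T <= 2 * B * (r / (2 * B))" using B by (intro mult_left_mono) (auto simp: T_def)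
  thus "2 * B * T <= r" using B by simp
 qed
 obtain \<phi> :: "real => 'e => 'e" and \<psi> :: "real => 'e => 'e \<Rightarrow>\<^sub>L 'e" where F:
  "!!y. \<phi> 0 y = y"
  "!!s y. s\<in>{-T..T} ==> ((%s. \<phi> s y) has_vector_derivative g (\<phi> s y)) (at s within {-T..T})"
  "!!s y. s\<in>{-T..T} ==> norm (\<phi> s y - y) <= 2 * norm (g y) * T"
  "continuous_on ({-T..T} \<times> UNIV) (%(s, y). \<phi> s y)"
  "!!s y. s\<in>{-T..T} ==> (\<phi> s has_derivative blinfun_apply (\<psi> s y)) (at y)"
  "continuous_on ({-T..T} \<times> UNIV) (%(s, y). \<psi> s y)"
  "!!s y. s\<in>{-T..T} ==> norm (\<psi> s y) <= 2"
  by (rule euclidean_flow[OF T(1) L(1) T(2) BD_has_derivative[OF g2 UNIV_I] L(2) C(2,1)]) (rule that)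
 have in2: "\<phi> s z\<in>ball y (2 * r)" if "z\<in>ball y r" "s\<in>{-T..T}" for s z
 proof -
  have "norm (\<phi> s z - z) <= 2 * norm (g z) * T" by (rule F(3)[OF that(2)])
  also have "\<dots> <= 2 * B * T" using B' T by (intro mult_right_mono) auto
  also have "\<dots> <= r" by fact
  finally have "dist (\<phi> s z) z <= r" by (simp add: dist_norm)
  thus ?thesis using that(1) dist_triangle[of y "\<phi> s z" z] by (simp add: dist_commute)
 qed
 have c\<phi>: "continuous_on ({-T..T} \<times> ball y r) (%(s, z). \<phi> s z)"
  by (rule continuous_on_subset[OF F(4)]) auto
 have c\<psi>: "continuous_on ({-T..T} \<times> ball y r) (%(s, z). \<psi> s z)"
  by (rule continuous_on_subset[OF F(6)]) auto
 define i where "i = \<lparr>fb_chart = c, fb_center = y, fb_radius = r, fb_flow = \<phi>, fb_deriv = \<psi>\<rparr>"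
 have "is_flow_box T i"
  unfolding is_flow_box_def i_def fb_ball_def fb_ball2_def flow_box.select_convs
 proof (intro conjI ballI allI)
  fix s z assume sz: "z\<in>ball y r" "s\<in>{-T..T}"
  show "((%s. \<phi> s z) has_vector_derivative ?Y (\<phi> s z)) (at s within {-T..T})"
   using F(2)[OF sz(2), of z] g1[OF in2[OF sz]] by simp
 qed (use c r F(1,5,7) in2 c\<phi> c\<psi> in simp_all)
 moreover have "p\<in>fb_nbh i" using c r by (simp add: fb_nbh_def fb_ball_def i_def y_def)
 ultimately show ?thesis using T by blast
qed

lemma open_fb_nbh: "is_flow_box T i ==> open (fb_nbh i)"
 unfolding fb_nbh_def fb_ball_def is_flow_box_def by (intro chart_open_preimage is_chart) auto

lemma flow_box_cover:
 assumes "compact K'" "K' <= carrier A"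
 obtains S T where "finite S" "0 < T" "!!i. i\<in>S ==> is_flow_box T i" "K' <= (\<Union>i\<in>S. fb_nbh i)"
proof -
 define P where "P = {(i, T). 0 < T & is_flow_box T i}"
 have "K' <= (\<Union>x\<in>P. fb_nbh (fst x))"
 proof
  fix p assume "p\<in>K'"
  then obtain i T where "0 < T" "is_flow_box T i" "p\<in>fb_nbh i" using flow_box_exists assms(2) by blast
  thus "p\<in>(\<Union>x\<in>P. fb_nbh (fst x))" by (intro UN_I[of "(i, T)"]) (auto simp: P_def)
 qed
 moreover have "open (fb_nbh (fst x))" if "x\<in>P" for x using that open_fb_nbh by (auto simp: P_def)
 ultimately obtain D where D: "D <= P" "finite D" "K' <= (\<Union>x\<in>D. fb_nbh (fst x))"
  using compactE_image[OF assms(1), of P "%x. fb_nbh (fst x)"] by blast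
 define T where "T = Min (insert 1 (snd ` D))"
 have T: "0 < T" using D(1,2) by (auto simp: T_def P_def)
 have "is_flow_box T i" if i: "i\<in>fst ` D" for i
 proof -
  obtain T' where T': "(i, T')\<in>D" using i by force
  hence "T <= T'" unfolding T_def using D(2) by (intro Min_le) force+
  thus ?thesis using T' D(1) is_flow_box_le by (auto simp: P_def)
 qed
 thus ?thesis using that[of "fst ` D" T] D T by auto
qed

lemma flow_box_icurve:
 assumes i: "is_flow_box T i" and q: "q\<in>fb_nbh i" and T: "0 <= T"
 shows "icurve A Y {-T..T} (%s. cinv (fb_chart i) (fb_flow i s (cmap (fb_chart i) q)))"
  and "s\<in>{-T..T} ==> fb_flow i s (cmap (fb_chart i) q)\<in>cimg (fb_chart i)"
  and "cinv (fb_chart i) (fb_flow i 0 (cmap (fb_chart i) q)) = q"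
proof -
 let ?\<gamma> = "%s. cinv (fb_chart i) (fb_flow i s (cmap (fb_chart i) q))"
 let ?c = "fb_chart i" and ?z = "cmap (fb_chart i) q"
 have c: "?c\<in>A" and z: "?z\<in>fb_ball i" and qc: "q\<in>cdom ?c" using i q by (auto simp: is_flow_box_def fb_nbh_def)
 note cc = chartD[OF c]
 show inimg: "fb_flow i s ?z\<in>cimg ?c" if "s\<in>{-T..T}" for s
 proof -
  have "fb_flow i s ?z\<in>fb_ball2 i" using i z that by (auto simp: is_flow_box_def)
  hence "fb_flow i s ?z\<in>cball (fb_center i) (4 * fb_radius i)"
   using i by (auto simp: fb_ball2_def is_flow_box_def)
  thus ?thesis using i unfolding is_flow_box_def by blast
 qed
 have d: "((%s. fb_flow i s ?z) has_vector_derivative vf_coord A Y ?c (fb_flow i s ?z)) (at s within {-T..T})" if "s\<in>{-T..T}" for s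
  using i z that by (auto simp: is_flow_box_def)
 show "icurve A Y {-T..T} ?\<gamma>"
 proof (rule icurveI)
  show "continuous_on {-T..T} ?\<gamma>"
   by (rule continuous_on_comp[OF cc(7) vector_derivative_continuous_on[OF d]]) (use inimg in auto)
  fix s assume s: "s\<in>{-T..T}"
  have "((%h. cmap ?c (?\<gamma> h)) has_vector_derivative vf_coord A Y ?c (fb_flow i s ?z)) (at s within {-T..T})"
   by (rule has_vector_derivative_transform_near[OF d[OF s] s zero_less_one]) (use cc(4) inimg in auto)
  thus "\<exists>c\<in>A. ?\<gamma> s\<in>cdom c & ((%h. cmap c (?\<gamma> h)) has_vector_derivative coord A c (?\<gamma> s) (Y (?\<gamma> s))) (at s within {-T..T})"
   using c cc(5)[OF inimg[OF s]] by (auto simp: vf_coord_def)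
 qed
 show "?\<gamma> 0 = q" using i z cc(3)[OF qc] by (auto simp: is_flow_box_def)
qed

lemma icurve_const:
 assumes "q\<in>carrier A" "Y q = 0" shows "icurve A Y J (%_. q)"
proof (rule icurveI)
 obtain c where c: "c\<in>A" "q\<in>cdom c" using assms carrierE by blast
 hence "coord A c q (Y q) = 0" using assms(2) linear_0[OF coord_linear] atlas_charts by auto
 thus "\<exists>c\<in>A. q\<in>cdom c & ((%h. cmap c q) has_vector_derivative coord A c q (Y q)) (at s within J)" for s
  using c by auto
qed auto

text \<open>Compactness of the support gives one existence time for all starting points; outside the support the
 constant curves are integral curves.\<close>

lemma icurve_exists_short: "\<exists>T>0. \<forall>q\<in>carrier A. \<exists>\<gamma>. icurve A Y {-T..T} \<gamma> & \<gamma> 0 = q"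
proof -
 obtain S T where S: "finite S" "0 < T" "!!i. i\<in>S ==> is_flow_box T i" "K <= (\<Union>i\<in>S. fb_nbh i)"
  by (rule flow_box_cover[OF compact_K K_carrier]) (rule that)
 have "\<exists>\<gamma>. icurve A Y {-T..T} \<gamma> & \<gamma> 0 = q" if q: "q\<in>carrier A" for q
 proof (cases "q\<in>K")
  case True
  then obtain i where i: "i\<in>S" "q\<in>fb_nbh i" using S by blast
  show ?thesis using flow_box_icurve(1,3)[OF S(3)[OF i(1)] i(2)] S(2) by (metis less_imp_le)
 next
  case False
  thus ?thesis using icurve_const Y_zero q by blast
 qed
 thus ?thesis using S by blast
qed

lemma icurve_exists: "q\<in>carrier A ==> \<exists>\<gamma>. icurve A Y {-R..R} \<gamma> & \<gamma> 0 = q"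
proof -
 assume q: "q\<in>carrier A"
 obtain T where T: "T > 0" "!!q. q\<in>carrier A ==> \<exists>\<gamma>. icurve A Y {-T..T} \<gamma> & \<gamma> 0 = q"
  using icurve_exists_short by blast
 have "\<exists>\<gamma>. icurve A Y {- (T + real n * T) .. T + real n * T} \<gamma> & \<gamma> 0 = q" for n
 proof (induction n)
  case 0
  thus ?case using T(2)[OF q] by simp
 next
  case (Suc n)
  define a where "a = T + real n * T"
  have a: "T <= a" using T by (simp add: a_def)
  obtain \<gamma> where \<gamma>: "icurve A Y {-a..a} \<gamma>" "\<gamma> 0 = q" using Suc a_def by blast
  have "\<gamma> a\<in>carrier A" using \<gamma> a T by (auto simp: icurve_def)
  then obtain \<eta> where \<eta>: "icurve A Y {-T..T} \<eta>" "\<eta> 0 = \<gamma> a" using T by blast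
  have \<eta>': "icurve A Y {a - T..a + T} (%s. \<eta> (s + (- a)))" by (rule icurve_shift[OF \<eta>(1)]) auto
  have eq1: "\<gamma> s = \<eta> (s + (- a))" if "s\<in>{a - T..a}" for s
   by (rule icurve_unique[of "{a - T..a}" _ _ a, OF icurve_subset[OF \<gamma>(1)] icurve_subset[OF \<eta>']])
    (use a T \<eta> that in "auto simp: is_interval_1")
  define \<mu> where "\<mu> = (%s. if s <= a then \<gamma> s else \<eta> (s + (- a)))"
  have \<mu>: "icurve A Y {-a..a + T} \<mu>" unfolding \<mu>_def
   by (rule icurve_glue[OF \<gamma>(1) \<eta>' _ _ _ eq1]) (use a T in auto)
  have "\<mu> (-a)\<in>carrier A" using \<mu> a T by (auto simp: icurve_def)
  then obtain \<nu> where \<nu>: "icurve A Y {-T..T} \<nu>" "\<nu> 0 = \<mu> (-a)" using T by blast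
  have \<nu>': "icurve A Y {-a - T..-a + T} (%s. \<nu> (s + a))" by (rule icurve_shift[OF \<nu>(1)]) auto
  have eq2: "\<nu> (s + a) = \<mu> s" if "s\<in>{-a..-a + T}" for s
   by (rule icurve_unique[of "{-a..-a + T}" _ _ "-a", OF icurve_subset[OF \<nu>'] icurve_subset[OF \<mu>]])
    (use a T \<nu> that in "auto simp: is_interval_1")
  have g1: "icurve A Y {-a - T..a + T} (%s. if s <= -a + T then \<nu> (s + a) else \<mu> s)"
   by (rule icurve_glue[OF \<nu>' \<mu> _ _ _ eq2]) (use a T in auto)
  have g2: "(%s. if s <= -a + T then \<nu> (s + a) else \<mu> s) 0 = q"
  proof (cases "0 <= -a + T")
   case True
   thus ?thesis using eq2[of 0] a T \<gamma>(2) by (simp add: \<mu>_def)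
  qed (use a T \<gamma>(2) in \<open>simp add: \<mu>_def\<close>)
  have e: "T + real (Suc n) * T = a + T" "- (a + T) = -a - T"
   by (simp_all add: a_def algebra_simps)
  show ?case using g1 g2 unfolding e by (intro exI conjI)
 qed
 note ex = this
 obtain n where n: "R < real n * T" using reals_Archimedean3[OF T(1)] by blast
 obtain \<gamma> where \<gamma>: "icurve A Y {- (T + real n * T) .. T + real n * T} \<gamma>" "\<gamma> 0 = q" using ex by blast
 have "{-R..R} <= {- (T + real n * T) .. T + real n * T}" using n T(1) by auto
 thus ?thesis using icurve_subset[OF \<gamma>(1)] \<gamma>(2) by blast
qed

text \<open>The value at time \<open>s\<close> of an integral curve on \<open>[-|s|, |s|]\<close>; by uniqueness the choice does not matter.\<close>

definition flow :: "real => 'a => 'a" where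
 "flow s q = (SOME \<gamma>. icurve A Y {-\<bar>s\<bar>..\<bar>s\<bar>} \<gamma> & \<gamma> 0 = q) s"

lemma flow_eq:
 assumes \<gamma>: "icurve A Y J \<gamma>" "is_interval J" "0\<in>J" "s\<in>J" "\<gamma> 0 = q"
 shows "flow s q = \<gamma> s"
proof -
 have q: "q\<in>carrier A" using \<gamma> by (auto simp: icurve_def)
 define \<eta> where "\<eta> = (SOME \<gamma>. icurve A Y {-\<bar>s\<bar>..\<bar>s\<bar>} \<gamma> & \<gamma> 0 = q)"
 have \<eta>: "icurve A Y {-\<bar>s\<bar>..\<bar>s\<bar>} \<eta>" "\<eta> 0 = q" using someI_ex[OF icurve_exists[OF q]] unfolding \<eta>_def by auto
 have "\<eta> s = \<gamma> s"
  by (rule icurve_unique[of "J Int {-\<bar>s\<bar>..\<bar>s\<bar>}" _ _ 0, OF icurve_subset[OF \<eta>(1)] icurve_subset[OF \<gamma>(1)]])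
   (use \<gamma> \<eta> in "auto intro!: is_interval_Int is_interval_cc")
 thus ?thesis by (simp add: flow_def \<eta>_def)
qed

lemma flow_icurve:
 assumes q: "q\<in>carrier A" shows "icurve A Y UNIV (%s. flow s q)"
proof -
 have loc: "icurve A Y {-R..R} (%s. flow s q)" for R
 proof -
  obtain \<gamma> where \<gamma>: "icurve A Y {-R..R} \<gamma>" "\<gamma> 0 = q" using icurve_exists[OF q] by blast
  show ?thesis by (rule icurve_cong[OF \<gamma>(1)]) (use flow_eq[OF \<gamma>(1) _ _ _ \<gamma>(2)] in \<open>auto simp: is_interval_cc\<close>)
 qed
 show ?thesis
 proof (rule icurveI)
  show "continuous_on UNIV (%s. flow s q)"
  proof (rule continuous_on_locally)
   fix s :: real
   have "continuous_on {-(\<bar>s\<bar>+1)..\<bar>s\<bar>+1} (%s. flow s q)" using loc[of "\<bar>s\<bar>+1"] unfolding icurve_def by blast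
   hence "continuous_on (UNIV Int {-(\<bar>s\<bar>+1)<..<\<bar>s\<bar>+1}) (%s. flow s q)" by (rule continuous_on_subset) auto
   thus "\<exists>U. open U & s\<in>U & continuous_on (UNIV Int U) (%s. flow s q)"
    by (intro exI[of _ "{-(\<bar>s\<bar>+1)<..<\<bar>s\<bar>+1}"]) auto
  qed
  fix s :: real
  have l: "icurve A Y {-(\<bar>s\<bar>+1)..\<bar>s\<bar>+1} (%s. flow s q)" by (rule loc)
  have sI: "s\<in>{-(\<bar>s\<bar>+1)..\<bar>s\<bar>+1}" by auto
  have "flow s q\<in>carrier A" using l sI unfolding icurve_def by blast
  then obtain c where c: "c\<in>A" "flow s q\<in>cdom c" using carrierE by blast
  hence "((%h. cmap c (flow h q)) has_vector_derivative coord A c (flow s q) (Y (flow s q))) (at s within {-(\<bar>s\<bar>+1)..\<bar>s\<bar>+1})"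
   using l sI unfolding icurve_def by blast
  hence "((%h. cmap c (flow h q)) has_vector_derivative coord A c (flow s q) (Y (flow s q))) (at s)"
   by (rule has_vector_derivative_within_near[of _ _ _ _ 1]) auto
  thus "\<exists>c\<in>A. flow s q\<in>cdom c & ((%h. cmap c (flow h q)) has_vector_derivative coord A c (flow s q) (Y (flow s q))) (at s)"
   using c by blast
 qed
qed

lemma flow_0 [simp]: "q\<in>carrier A ==> flow 0 q = q"
 using icurve_exists[of q 1] flow_eq[of "{-1..1}" _ 0 q] by (auto simp: is_interval_cc)

lemma flow_carrier [simp]: "q\<in>carrier A ==> flow s q\<in>carrier A"
 using flow_icurve[of q] unfolding icurve_def by blast

lemma flow_add: assumes q: "q\<in>carrier A" shows "flow (s + r) q = flow s (flow r q)"
proof -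
 have "icurve A Y UNIV (%s. flow (s + r) q)" by (rule icurve_shift[OF flow_icurve[OF q]]) auto
 from flow_eq[OF this, of s "flow r q"] show ?thesis by (simp add: q)
qed

lemma flow_minus: "q\<in>carrier A ==> flow (- s) (flow s q) = q"
 using flow_add[of q "-s" s] by simp

lemma flow_outside: "q\<in>carrier A ==> q\<notin>K ==> flow s q = q"
 using flow_eq[OF icurve_const[of q UNIV]] Y_zero by auto

lemma flow_K: "q\<in>K ==> flow s q\<in>K"
 using flow_outside[of "flow s q" "-s"] flow_minus[of q s] K_carrier by (metis flow_carrier subsetD)

lemma flow_box_flow:
 assumes i: "is_flow_box T i" and q: "q\<in>fb_nbh i" and s: "s\<in>{-T..T}"
 shows "flow s q = cinv (fb_chart i) (fb_flow i s (cmap (fb_chart i) q))"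
 using flow_box_icurve[OF i q] s by (intro flow_eq[of "{-T..T}"]) (auto simp: is_interval_cc)

lemma flow_continuous_short: "\<exists>T>0. continuous_on ({-T..T} \<times> carrier A) (%(s, q). flow s q)"
proof -
 obtain S T where S: "finite S" "0 < T" "!!i. i\<in>S ==> is_flow_box T i" "K <= (\<Union>i\<in>S. fb_nbh i)"
  by (rule flow_box_cover[OF compact_K K_carrier]) (rule that)
 have "continuous_on ({-T..T} \<times> carrier A) (%(s, q). flow s q)"
 proof (rule continuous_on_locally)
  fix x assume x: "x\<in>{-T..T} \<times> carrier A"
  obtain s q where sq: "x = (s, q)" by (cases x)
  show "\<exists>U. open U & x\<in>U & continuous_on (({-T..T} \<times> carrier A) Int U) (%(s, q). flow s q)"
  proof (cases "q\<in>K")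
   case True
   then obtain i where i: "i\<in>S" "q\<in>fb_nbh i" using S by blast
   note fb = S(3)[OF i(1)]
   let ?c = "fb_chart i"
   have c: "?c\<in>A" using fb by (simp add: is_flow_box_def)
   note cc = chartD[OF c]
   have sub: "fb_nbh i <= cdom ?c" by (auto simp: fb_nbh_def)
   have f: "continuous_on ({-T..T} \<times> fb_ball i) (%(s, z). fb_flow i s z)" using fb by (simp add: is_flow_box_def)
   have "continuous_on ({-T..T} \<times> fb_nbh i) (%x. cmap ?c (snd x))"
    by (rule continuous_on_comp[OF cc(6)]) (use sub in "auto intro!: continuous_intros")
   hence "continuous_on ({-T..T} \<times> fb_nbh i) (%x. (fst x, cmap ?c (snd x)))"
    by (intro continuous_intros)
   hence "continuous_on ({-T..T} \<times> fb_nbh i) (%x. (%(s, z). fb_flow i s z) (fst x, cmap ?c (snd x)))"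
    by (rule continuous_on_comp[OF f]) (auto simp: fb_nbh_def)
   hence "continuous_on ({-T..T} \<times> fb_nbh i) (%x. cinv ?c (fb_flow i (fst x) (cmap ?c (snd x))))"
    by (intro continuous_on_comp[OF cc(7)]) (use flow_box_icurve(2)[OF fb] S(2) in \<open>auto simp: case_prod_unfold\<close>)
   hence "continuous_on ({-T..T} \<times> fb_nbh i) (%(s, q). flow s q)"
    by (rule continuous_on_eq) (use flow_box_flow[OF fb] in auto)
   hence "continuous_on (({-T..T} \<times> carrier A) Int (UNIV \<times> fb_nbh i)) (%(s, q). flow s q)"
    by (rule continuous_on_subset) auto
   thus ?thesis using i(2) sq open_fb_nbh[OF fb] by (intro exI[of _ "UNIV \<times> fb_nbh i"]) (auto intro: open_Times)
  next
   case False
   have "continuous_on ({-T..T} \<times> (carrier A - K)) (%(s, q). flow s q)"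
    by (rule continuous_on_eq[OF continuous_on_snd[OF continuous_on_id]]) (auto simp: flow_outside)
   hence "continuous_on (({-T..T} \<times> carrier A) Int (UNIV \<times> (carrier A - K))) (%(s, q). flow s q)"
    by (rule continuous_on_subset) auto
   moreover have "open (carrier A - K)" using open_carrier compact_imp_closed[OF compact_K] by (rule open_Diff)
   ultimately show ?thesis using False x sq by (intro exI[of _ "UNIV \<times> (carrier A - K)"]) (auto intro: open_Times)
  qed
 qed
 thus ?thesis using S by blast
qed

text \<open>Continuity for short times is propagated by the group law; the same device serves for differentiability.\<close>

lemma flow_continuous_space: "continuous_on (carrier A) (flow s)"
proof -
 obtain T where T: "T > 0" "continuous_on ({-T..T} \<times> carrier A) (%(s, q). flow s q)"
  using flow_continuous_short by blast
 have short: "continuous_on (carrier A) (flow r)" if "r\<in>{-T..T}" for r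
 proof -
  have "continuous_on (carrier A) (%q. (%(s, q). flow s q) (r, q))"
   by (rule continuous_on_comp[OF T(2)]) (use that in "auto intro!: continuous_intros")
  thus ?thesis by simp
 qed
 obtain n where n: "\<bar>s\<bar> < real n * T" using reals_Archimedean3[OF T(1)] by blast
 have n0: "n \<noteq> 0" using n by (intro notI) simp
 define r where "r = s / real n"
 have "\<bar>r\<bar> <= T" using n n0 by (simp add: r_def abs_divide field_simps)
 hence r: "r\<in>{-T..T}" by auto
 have "continuous_on (carrier A) (flow (real m * r))" for m
 proof (induction m)
  case 0
  show ?case by (rule continuous_on_eq[OF continuous_on_id]) simp
 next
  case (Suc m)
  have "continuous_on (carrier A) (%q. flow r (flow (real m * r) q))"
   by (rule continuous_on_comp[OF short[OF r] Suc]) auto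
  thus ?case by (rule continuous_on_eq) (simp add: flow_add[symmetric] algebra_simps)
 qed
 from this[of n] show ?thesis using n0 by (simp add: r_def)
qed

lemma flow_continuous: "continuous_on (UNIV \<times> carrier A) (%(s, q). flow s q)"
proof (rule continuous_on_locally)
 fix x :: "real \<times> 'a" assume x: "x\<in>UNIV \<times> carrier A"
 obtain T where T: "T > 0" "continuous_on ({-T..T} \<times> carrier A) (%(s, q). flow s q)"
  using flow_continuous_short by blast
 define U where "U = {fst x - T<..<fst x + T} \<times> (UNIV :: 'a set)"
 have "continuous_on ((UNIV \<times> carrier A) Int U) (%y. flow (fst x) (snd y))"
  by (rule continuous_on_comp[OF flow_continuous_space]) (auto intro!: continuous_intros)
 hence "continuous_on ((UNIV \<times> carrier A) Int U) (%y. (fst y - fst x, flow (fst x) (snd y)))"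
  by (intro continuous_intros)
 hence "continuous_on ((UNIV \<times> carrier A) Int U) (%y. (%(s, q). flow s q) (fst y - fst x, flow (fst x) (snd y)))"
  by (rule continuous_on_comp[OF T(2)]) (auto simp: U_def)
 hence "continuous_on ((UNIV \<times> carrier A) Int U) (%(s, q). flow s q)"
  by (rule continuous_on_eq) (auto simp: flow_add[symmetric])
 moreover have "open U" "x\<in>U" using T by (auto simp: U_def mem_Times_iff intro!: open_Times)
 ultimately show "\<exists>U. open U & x\<in>U & continuous_on ((UNIV \<times> carrier A) Int U) (%(s, q). flow s q)" by blast
qed

lemma flow_box_C1:
 assumes i: "is_flow_box T i" and s: "s\<in>{-T..T}"
 shows "C1_on (fb_flow i s) (fb_ball i)"
proof (rule C1_on_blinfunI)
 show "open (fb_ball i)" by (simp add: fb_ball_def)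
 show "(fb_flow i s has_derivative blinfun_apply (fb_deriv i s z)) (at z)" if "z\<in>fb_ball i" for z
  using i s that by (auto simp: is_flow_box_def)
 have "continuous_on ({-T..T} \<times> fb_ball i) (%(s, z). fb_deriv i s z)" using i by (auto simp: is_flow_box_def)
 hence "continuous_on (fb_ball i) (%z. (%(s, z). fb_deriv i s z) (s, z))"
  by (rule continuous_on_comp) (use s in "auto intro!: continuous_intros")
 thus "continuous_on (fb_ball i) (fb_deriv i s)" by simp
qed

lemma flow_C1: "Ck_map A A 1 (carrier A) (flow s)"
proof -
 obtain S T where S: "finite S" "0 < T" "!!i. i\<in>S ==> is_flow_box T i" "K <= (\<Union>i\<in>S. fb_nbh i)"
  by (rule flow_box_cover[OF compact_K K_carrier]) (rule that)
 have short: "Ck_map A A 1 (carrier A) (flow r)" if r: "r\<in>{-T..T}" for r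
 proof (rule Ck_mapI[OF atlas atlas open_carrier order_refl])
  fix p assume p: "p\<in>carrier A"
  show "\<exists>c\<in>charts \<infinity> A. \<exists>d\<in>charts \<infinity> A. \<exists>U. open U & p\<in>U & p\<in>cdom c & flow r ` (U Int cdom c) <= cdom d &
   (\<forall>n. enat n <= 1 --> Cn_on n (cmap d o flow r o cinv c) (cmap c ` (U Int cdom c)))"
  proof (cases "p\<in>K")
   case True
   then obtain i where i: "i\<in>S" "p\<in>fb_nbh i" using S by blast
   note fb = S(3)[OF i(1)]
   let ?c = "fb_chart i"
   have c: "?c\<in>A" using fb by (simp add: is_flow_box_def)
   note cc = chartD[OF c]
   have img: "cmap ?c ` (fb_nbh i Int cdom ?c) <= fb_ball i" by (auto simp: fb_nbh_def)
   have o: "open (cmap ?c ` (fb_nbh i Int cdom ?c))" by (rule open_image[OF c open_fb_nbh[OF fb]])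
   have "C1_on (fb_flow i r) (cmap ?c ` (fb_nbh i Int cdom ?c))"
    by (rule Cn_on_subset[OF flow_box_C1[OF fb r] img])
   hence C1: "C1_on (cmap ?c o flow r o cinv ?c) (cmap ?c ` (fb_nbh i Int cdom ?c))"
    by (rule Cn_on_cong_imp[OF o, rotated])
     (use flow_box_flow[OF fb _ r] flow_box_icurve(2)[OF fb _ _ r] S(2) cc in auto)
   have "Cn_on n (cmap ?c o flow r o cinv ?c) (cmap ?c ` (fb_nbh i Int cdom ?c))" if "enat n <= 1" for n
    by (rule Cn_on_le[OF C1]) (use that in "simp add: one_enat_def")
   moreover have "flow r ` (fb_nbh i Int cdom ?c) <= cdom ?c"
    using flow_box_flow[OF fb _ r] flow_box_icurve(2)[OF fb _ _ r] S(2) cc by auto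
   ultimately show ?thesis
    using atlas_charts[OF c, of \<infinity>] open_fb_nbh[OF fb] i(2)
    by (intro bexI[of _ ?c] exI[of _ "fb_nbh i"]) (auto simp: fb_nbh_def)
  next
   case False
   obtain c where c: "c\<in>A" "p\<in>cdom c" using p by (rule carrierE)
   note cc = chartD[OF c(1)]
   let ?U = "carrier A - K"
   have oU: "open ?U" using open_carrier compact_imp_closed[OF compact_K] by (rule open_Diff)
   have "Cn_on n (cmap c o flow r o cinv c) (cmap c ` (?U Int cdom c))" for n
    by (rule Cn_on_cong_imp[OF open_image[OF c(1) oU] _ Cn_on_id])
     (auto simp: cc(3) flow_outside)
   moreover have "flow r ` (?U Int cdom c) <= cdom c" by (auto simp: flow_outside)
   ultimately show ?thesis
    using atlas_charts[OF c(1), of \<infinity>] oU c(2) p False by (intro bexI[of _ c] exI[of _ ?U]) auto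
  qed
 qed
 obtain n where n: "\<bar>s\<bar> < real n * T" using reals_Archimedean3[OF S(2)] by blast
 have n0: "n \<noteq> 0" using n by (intro notI) simp
 define r where "r = s / real n"
 have "\<bar>r\<bar> <= T" using n n0 by (simp add: r_def abs_divide field_simps)
 hence r: "r\<in>{-T..T}" by auto
 have zero: "(0::real)\<in>{-T..T}" using S by auto
 have cong: "Ck_map A A 1 (carrier A) F ==> (!!q. q\<in>carrier A ==> F q = G q) ==> Ck_map A A 1 (carrier A) G" for F G :: "'a => 'a"
 proof -
  assume F: "Ck_map A A 1 (carrier A) F" and eq: "!!q. q\<in>carrier A ==> F q = G q"
  have "Ck_on 1 (cmap d o G o cinv c) (cmap c ` {q\<in>carrier A Int cdom c. G q\<in>cdom d})"
   if cd: "c\<in>A" "d\<in>A" for c d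
  proof -
   note o = Ck_mapD(2)[OF atlas atlas F open_carrier atlas_charts[OF cd(1)] atlas_charts[OF cd(2)], of 0]
   have S: "{q\<in>carrier A Int cdom c. G q\<in>cdom d} = {q\<in>carrier A Int cdom c. F q\<in>cdom d}" using eq by auto
   have o': "open (cmap c ` {q\<in>carrier A Int cdom c. F q\<in>cdom d})"
   proof -
    have "{q\<in>carrier A Int cdom c. F q\<in>cdom d} = {q\<in>carrier A Int cdom c. F q\<in>cdom d} Int cdom c" by auto
    thus ?thesis using open_image[OF cd(1) o]
     by (simp add: zero_enat_def[symmetric])
   qed
   show ?thesis unfolding S Ck_on_def
   proof (intro allI impI)
    fix n assume "enat n <= 1"
    hence "Cn_on n (cmap d o F o cinv c) (cmap c ` {q\<in>carrier A Int cdom c. F q\<in>cdom d})"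
     using F cd by (auto simp: Ck_map_def Ck_on_def)
    thus "Cn_on n (cmap d o G o cinv c) (cmap c ` {q\<in>carrier A Int cdom c. F q\<in>cdom d})"
     by (rule Cn_on_cong_imp[OF o', rotated]) (use eq is_chartD(3)[OF is_chart[OF cd(1)]] in auto)
   qed
  qed
  thus "Ck_map A A 1 (carrier A) G"
   using F eq continuous_on_cong[of "carrier A" "carrier A" F G] unfolding Ck_map_def by auto
 qed
 have "Ck_map A A 1 (carrier A) (flow (real m * r))" for m
 proof (induction m)
  case 0
  show ?case using short[OF zero] by simp
 next
  case (Suc m)
  have "Ck_map A A 1 (carrier A) (%q. flow r (flow (real m * r) q))"
   by (rule Ck_map_compose[OF atlas atlas atlas Suc open_carrier order_refl short[OF r] open_carrier]) auto
  thus ?case by (rule cong) (simp add: flow_add[symmetric] algebra_simps)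
 qed
 from this[of n] show ?thesis using n0 by (simp add: r_def)
qed

end


section \<open>Discounted exit time\<close>

text \<open>The Weierstrass test applies to the series of derivatives in the operator norm.\<close>

lemma C1_series:
 fixes f :: "nat => 'a::euclidean_space => real"
 assumes f: "!!n. C1_on (f n) (ball y0 r)"
  and b: "!!n y. y\<in>ball y0 r ==> norm (BD (f n) y) <= a n"
  and a: "summable a" and g: "!!y. y\<in>ball y0 r ==> (%n. f n y) sums g y"
 shows "C1_on g (ball y0 r)"
proof (cases "ball y0 r = {}")
 case True
 show ?thesis unfolding True by simp
next
 case False
 then obtain x0 where x0: "x0\<in>ball y0 r" by blast
 let ?B = "ball y0 r"
 define D where "D y = (\<Sum>n. BD (f n) y)" for y
 have lim: "uniform_limit ?B (%n y. \<Sum>i<n. BD (f i) y) D sequentially"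
  unfolding D_def by (rule Weierstrass_m_test[OF b a])
 have ev: "\<forall>\<^sub>F n in sequentially. \<forall>y\<in>?B. \<forall>v. norm ((\<Sum>i<n. BD (f i) y v) - D y v) <= e * norm v" if "e > 0" for e
  using uniform_limitD[OF lim that]
 proof eventually_elim
  case (elim n)
  show ?case
  proof (intro ballI allI)
   fix y v assume "y\<in>?B"
   hence "norm ((\<Sum>i<n. BD (f i) y) - D y) <= e" using elim by (simp add: dist_norm less_imp_le)
   from order_trans[OF norm_blinfun mult_right_mono[OF this norm_ge_zero[of v]]]
   show "norm ((\<Sum>i<n. BD (f i) y v) - D y v) <= e * norm v" by (simp add: blinfun.bilinear_simps blinfun.sum_left)
  qed
 qed
 have "\<exists>g'. \<forall>y\<in>?B. (%n. f n y) sums g' y & (g' has_derivative blinfun_apply (D y)) (at y within ?B)"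
 proof (rule has_derivative_series[where f'="%n y. blinfun_apply (BD (f n) y)" and x=x0 and l="g x0"])
  show "(f n has_derivative blinfun_apply (BD (f n) y)) (at y within ?B)" if "y\<in>?B" for n y
   by (rule has_derivative_at_withinI[OF BD_has_derivative[OF f that]])
 qed (use ev x0 g[OF x0] in simp_all)
 then obtain g' where gg: "\<forall>y\<in>?B. (%n. f n y) sums g' y & (g' has_derivative blinfun_apply (D y)) (at y within ?B)" ..
 note g' = bspec[OF gg, THEN conjunct1] bspec[OF gg, THEN conjunct2]
 show ?thesis
 proof (rule C1_on_blinfunI[OF open_ball])
  fix y assume y: "y\<in>?B"
  have "(g' has_derivative blinfun_apply (D y)) (at y)" using g'(2)[OF y] unfolding at_within_open[OF y open_ball] .
  thus "(g has_derivative blinfun_apply (D y)) (at y)"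
   by (rule has_derivative_local[OF _ open_ball y]) (rule sums_unique2[OF g'(1) g])
 next
  show "continuous_on ?B D"
   by (rule uniform_limit_theorem[OF _ lim]) (use BD_continuous[OF f] in "auto intro!: always_eventually continuous_on_sum")
 qed
qed

lemma finite_uniform_bound:
 fixes P :: "'i => real => bool"
 assumes "finite S" "!!i. i\<in>S ==> \<exists>M. P i M" and mono: "!!i M N. P i M ==> M <= N ==> P i N"
 shows "\<exists>M>0. \<forall>i\<in>S. P i M"
 using assms(1,2)
proof (induction S rule: finite_induct)
 case (insert a S)
 then obtain M M' where "M > 0" "\<forall>i\<in>S. P i M" "P a M'" by blast
 thus ?case using mono[of _ M "max M M'"] mono[of a M' "max M M'"] by (intro exI[of _ "max M M'"]) auto
qed (auto intro: exI[of _ 1])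

locale discounted = cs_field A Y K for A :: "('a::t2_space, 'e::euclidean_space) chart set" and Y K +
 fixes \<xi> :: "'a => real"
 assumes \<xi>_C1: "mfun A 1 \<xi> (carrier A)" and \<xi>_range: "!!q. 0 <= \<xi> q" "!!q. \<xi> q <= 1"
begin

definition W :: "real => 'a => real => real" where
 "W N q s = exp (- N * s) * \<xi> (flow s q)"

text \<open>The integral over all positive times, written as a limit over the integers; the integrand is
 bounded by \<open>exp (- N * s)\<close>.\<close>

definition rho :: "real => 'a => real" where
 "rho N q = lim (%n. integral {0..real n} (W N q))"

lemma W_joint: "continuous_on ((UNIV \<times> carrier A) \<times> UNIV) (%((N, q), s). W N q s)"
proof -
 have \<xi>: "continuous_on (carrier A) \<xi>" by (rule mfun_continuous[OF \<xi>_C1 open_carrier order_refl])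
 have "continuous_on ((UNIV \<times> carrier A) \<times> UNIV) (%x. (%(s, q). flow s q) (snd x, snd (fst x)))"
  by (rule continuous_on_comp[OF flow_continuous]) (auto intro!: continuous_intros)
 hence "continuous_on ((UNIV \<times> carrier A) \<times> UNIV) (%x. \<xi> (flow (snd x) (snd (fst x))))"
  by (intro continuous_on_comp[OF \<xi>]) auto
 hence "continuous_on ((UNIV \<times> carrier A) \<times> UNIV) (%x. exp (- fst (fst x) * snd x) * \<xi> (flow (snd x) (snd (fst x))))"
  by (intro continuous_intros)
 thus ?thesis by (simp add: W_def case_prod_unfold)
qed

lemma W_continuous: "q\<in>carrier A ==> continuous_on X (W N q)"
 using continuous_on_comp[OF W_joint, of X "%s. ((N, q), s)"]
  continuous_on_Pair[OF continuous_on_const[of X "(N, q)"] continuous_on_id] by auto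

lemma W_integrable: "q\<in>carrier A ==> W N q integrable_on {a..b}"
 by (intro integrable_continuous_real W_continuous)

lemma W_nonneg: "0 <= W N q s" by (simp add: W_def \<xi>_range)

lemma W_integral_combine:
 "q\<in>carrier A ==> a <= c ==> c <= b ==> integral {a..c} (W N q) + integral {c..b} (W N q) = integral {a..b} (W N q)"
 by (rule Henstock_Kurzweil_Integration.integral_combine[OF _ _ W_integrable])

lemma W_integral_bound:
 assumes "q\<in>carrier A" "0 < N" "a <= b" shows "integral {a..b} (W N q) <= exp (- N * a) / N"
proof -
 have I: "((%s. exp (- N * s)) has_integral (- exp (- N * b) / N - - exp (- N * a) / N)) {a..b}"
  by (rule fundamental_theorem_of_calculus[OF assms(3)])
   (use assms in "auto intro!: derivative_eq_intros simp: has_real_derivative_iff_has_vector_derivative[symmetric]")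
 have "integral {a..b} (W N q) <= integral {a..b} (%s. exp (- N * s))"
  by (rule integral_le[OF W_integrable[OF assms(1)] has_integral_integrable[OF I]])
   (use \<xi>_range in "simp add: W_def mult_left_le")
 also have "\<dots> = - exp (- N * b) / N - - exp (- N * a) / N" using I by (rule integral_unique)
 also have "\<dots> <= exp (- N * a) / N" using assms by simp
 finally show ?thesis .
qed

lemma rho_lim:
 assumes q: "q\<in>carrier A" and N: "0 < N"
 shows "(%n. integral {0..real n} (W N q)) \<longlonglongrightarrow> rho N q"
proof -
 have inc: "incseq (%n. integral {0..real n} (W N q))"
 proof (rule incseq_SucI)
  fix n
  show "integral {0..real n} (W N q) <= integral {0..real (Suc n)} (W N q)"
   using W_integral_combine[OF q, of 0 "real n" "real (Suc n)" N]
    integral_nonneg[OF W_integrable[OF q], of "real n" "real (Suc n)" N] W_nonneg by auto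
 qed
 have "\<forall>n. integral {0..real n} (W N q) <= 1 / N" using W_integral_bound[OF q N, of 0] by simp
 hence "convergent (%n. integral {0..real n} (W N q))"
  unfolding convergent_def by (rule incseq_convergent[OF inc]) blast
 thus ?thesis unfolding rho_def by (simp add: convergent_LIMSEQ_iff)
qed

lemma rho_bounds:
 assumes q: "q\<in>carrier A" and N: "0 < N" and r: "0 <= r"
 shows "integral {0..r} (W N q) <= rho N q" "rho N q <= integral {0..r} (W N q) + exp (- N * r) / N"
proof -
 have ev: "\<forall>\<^sub>F n in sequentially. r <= real n" using eventually_ge_at_top[of "nat \<lceil>r\<rceil>"] by eventually_elim linarith
 show "integral {0..r} (W N q) <= rho N q"
 proof (rule tendsto_lowerbound[OF rho_lim[OF q N]])
  show "\<forall>\<^sub>F n in sequentially. integral {0..r} (W N q) <= integral {0..real n} (W N q)"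
   using ev
  proof eventually_elim
   case (elim n)
   show ?case using W_integral_combine[OF q r elim, of N] integral_nonneg[OF W_integrable[OF q], of r n N] W_nonneg by auto
  qed
 qed auto
 show "rho N q <= integral {0..r} (W N q) + exp (- N * r) / N"
 proof (rule tendsto_upperbound[OF rho_lim[OF q N]])
  show "\<forall>\<^sub>F n in sequentially. integral {0..real n} (W N q) <= integral {0..r} (W N q) + exp (- N * r) / N"
   using ev
  proof eventually_elim
   case (elim n)
   show ?case using W_integral_combine[OF q r elim, of N] W_integral_bound[OF q N elim] by linarith
  qed
 qed auto
qed

lemma rho_nonneg: "q\<in>carrier A ==> 0 < N ==> 0 <= rho N q"
 using rho_bounds(1)[of q N 0] by simp

lemma exp_tail_tendsto:
 assumes "0 < N" "0 < T" shows "(%n. exp (- N * (real n * T)) / N) \<longlonglongrightarrow> 0"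
proof -
 have "(%n. exp (- N * T) ^ n / N) \<longlonglongrightarrow> 0 / N"
  by (intro tendsto_divide LIMSEQ_realpow_zero) (use assms in auto)
 thus ?thesis by (simp add: exp_of_nat_mult[symmetric] ac_simps)
qed

text \<open>Shifting the variable of integration: the value at the point reached after time \<open>r\<close> is the rest of the
 integral, rescaled by the discount.\<close>

lemma rho_flow:
 assumes q: "q\<in>carrier A" and N: "0 < N" and r: "0 <= r"
 shows "rho N (flow r q) = exp (N * r) * (rho N q - integral {0..r} (W N q))"
proof -
 have I: "integral {0..real n} (W N (flow r q)) = exp (N * r) * (integral {0..r + real n} (W N q) - integral {0..r} (W N q))" for n
 proof -
  have "integral {0..real n} (W N (flow r q)) = integral {0..real n} (%s. exp (N * r) * W N q (s + r))"
   by (rule integral_cong) (simp add: W_def flow_add[OF q] exp_add[symmetric] algebra_simps)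
  also have "\<dots> = exp (N * r) * integral {r - r..(r + real n) - r} (%s. W N q (s + r))" by simp
  also have "integral {r - r..(r + real n) - r} (%s. W N q (s + r)) = integral {r..r + real n} (W N q)"
   by (rule integral_shift_real_ivl)
  also have "\<dots> = integral {0..r + real n} (W N q) - integral {0..r} (W N q)"
   using W_integral_combine[OF q r, of "r + real n" N] by simp
  finally show ?thesis .
 qed
 have "(%n. integral {0..r + real n} (W N q)) \<longlonglongrightarrow> rho N q"
 proof (rule tendsto_sandwich[OF always_eventually always_eventually])
  show "(%n. rho N q - exp (- N * (real n * 1)) / N) \<longlonglongrightarrow> rho N q"
   using tendsto_diff[OF tendsto_const exp_tail_tendsto[OF N zero_less_one]] by simp
  show "\<forall>n. rho N q - exp (- N * (real n * 1)) / N <= integral {0..r + real n} (W N q)"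
  proof
   fix n
   have "exp (- N * (r + real n)) / N <= exp (- N * real n) / N" using N r by (simp add: divide_right_mono)
   thus "rho N q - exp (- N * (real n * 1)) / N <= integral {0..r + real n} (W N q)"
    using rho_bounds(2)[OF q N, of "r + real n"] r by simp
  qed
  show "\<forall>n. integral {0..r + real n} (W N q) <= rho N q" using rho_bounds(1)[OF q N] r by simp
 qed simp
 hence "(%n. integral {0..real n} (W N (flow r q))) \<longlonglongrightarrow> exp (N * r) * (rho N q - integral {0..r} (W N q))"
  unfolding I by (intro tendsto_intros)
 moreover have "(%n. integral {0..real n} (W N (flow r q))) \<longlonglongrightarrow> rho N (flow r q)"
  using rho_lim[OF flow_carrier[OF q] N] .
 ultimately show ?thesis by (rule LIMSEQ_unique[rotated])
qed

lemma rho_flow_free: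
 assumes q: "q\<in>carrier A" and N: "0 < N" and z: "!!s. s\<in>closed_segment 0 r ==> \<xi> (flow s q) = 0"
 shows "rho N (flow r q) = exp (N * r) * rho N q"
proof (cases "0 <= r")
 case True
 have "integral {0..r} (W N q) = integral {0..r} (%_. 0)"
  by (rule integral_cong) (use z True in "simp add: W_def closed_segment_eq_real_ivl")
 thus ?thesis using rho_flow[OF q N True] by simp
next
 case False
 have "integral {0..-r} (W N (flow r q)) = integral {0..-r} (%_. 0)"
  by (rule integral_cong) (use z False in "simp add: W_def flow_add[OF q, symmetric] closed_segment_eq_real_ivl")
 hence "rho N q = exp (N * - r) * rho N (flow r q)"
  using rho_flow[OF flow_carrier[OF q] N, of "-r" r] False flow_minus[OF q, of r] by simp
 thus ?thesis by (simp add: exp_minus)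
qed

lemma rho_eq_0_iff:
 assumes q: "q\<in>carrier A" and N: "0 < N"
 shows "rho N q = 0 \<longleftrightarrow> (\<forall>s\<ge>0. \<xi> (flow s q) = 0)"
proof
 assume z: "rho N q = 0"
 show "\<forall>s\<ge>0. \<xi> (flow s q) = 0"
 proof (intro allI impI)
  fix s :: real assume s: "0 <= s"
  have "integral {0..s + 1} (W N q) = 0"
   using rho_bounds(1)[OF q N, of "s + 1"] s z integral_nonneg[OF W_integrable[OF q], of 0 "s + 1" N] W_nonneg by auto
  hence "W N q s = 0"
   using integral_eq_0_iff[OF W_continuous[OF q], of 0 "s + 1" N] W_nonneg s by auto
  thus "\<xi> (flow s q) = 0" by (simp add: W_def)
 qed
next
 assume "\<forall>s\<ge>0. \<xi> (flow s q) = 0"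
 hence "integral {0..real n} (W N q) = integral {0..real n} (%_. 0)" for n
  by (intro integral_cong) (simp add: W_def)
 thus "rho N q = 0" by (simp add: rho_def)
qed

lemma rho_continuous: "continuous_on ({0<..} \<times> carrier A) (%(N, q). rho N q)"
proof (rule continuous_on_locally)
 fix x :: "real \<times> 'a" assume x: "x\<in>{0<..} \<times> carrier A"
 define N0 where "N0 = fst x / 2"
 have N0: "N0 > 0" using x by (auto simp: N0_def)
 let ?X = "{N0<..} \<times> carrier A"
 have c: "continuous_on ?X (%x. integral (cbox 0 (real n)) (%s. W (fst x) (snd x) s))" for n
 proof (rule integral_continuous_on_param)
  show "continuous_on (?X \<times> cbox 0 (real n)) (%(x, s). W (fst x) (snd x) s)"
   using continuous_on_subset[OF W_joint, of "?X \<times> cbox 0 (real n)"] by (auto simp: case_prod_unfold)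
 qed
 have "continuous_on ?X (%(N, q). rho N q)"
 proof (rule uniform_limit_theorem[where F=sequentially and f="%n x. integral {0..real n} (W (fst x) (snd x))"])
  show "\<forall>\<^sub>F n in sequentially. continuous_on ?X (%x. integral {0..real n} (W (fst x) (snd x)))"
   using c by (simp add: cbox_interval)
  show "uniform_limit ?X (%n x. integral {0..real n} (W (fst x) (snd x))) (%(N, q). rho N q) sequentially"
  proof (rule uniform_limitI)
   fix e :: real assume e: "e > 0"
   have "\<forall>\<^sub>F n in sequentially. exp (- N0 * (real n * 1)) / N0 < e"
    using order_tendstoD(2)[OF exp_tail_tendsto[OF N0 zero_less_one] e] .
   thus "\<forall>\<^sub>F n in sequentially. \<forall>x\<in>?X. dist (integral {0..real n} (W (fst x) (snd x))) ((%(N, q). rho N q) x) < e"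
   proof eventually_elim
    case (elim n)
    show ?case
    proof
     fix x assume x: "x\<in>?X"
     hence N: "N0 < fst x" "0 < fst x" and q: "snd x\<in>carrier A" using N0 by auto
     have "exp (- fst x * real n) / fst x <= exp (- N0 * real n) / N0"
      using N N0 by (intro frac_le) (auto intro!: mult_right_mono)
     hence "exp (- fst x * real n) / fst x < e" using elim by simp
     thus "dist (integral {0..real n} (W (fst x) (snd x))) ((%(N, q). rho N q) x) < e"
      using rho_bounds[OF q N(2), of "real n"] by (simp add: case_prod_unfold dist_real_def)
    qed
   qed
  qed
 qed simp
 hence "continuous_on (({0<..} \<times> carrier A) Int ({N0<..} \<times> UNIV)) (%(N, q). rho N q)"
  by (rule continuous_on_subset) auto
 moreover have "open ({N0<..} \<times> (UNIV::'a set))" by (intro open_Times) auto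
 moreover have "x\<in>{N0<..} \<times> UNIV" using x by (auto simp: N0_def mem_Times_iff)
 ultimately show "\<exists>U. open U & x\<in>U & continuous_on (({0<..} \<times> carrier A) Int U) (%(N, q). rho N q)" by blast
qed

text \<open>In a finite family of flow boxes, composition with the time \<open>T\<close> flow enlarges derivatives by a bounded
 factor \<open>M\<close>. Cut into pieces of length \<open>T\<close>, the integral becomes a series whose \<open>n\<close>-th term has derivative
 of order \<open>(exp (- N * T) * M) ^ n\<close>; a discount rate above \<open>ln M / T\<close> makes it converge in $C^1$.\<close>

definition loc :: "('a, 'e) flow_box => ('a => real) => 'e => real" where
 "loc i g y = g (cinv (fb_chart i) y)"

definition C1_bound :: "('a, 'e) flow_box set => real => ('a => real) => bool" where
 "C1_bound S G g \<longleftrightarrow> (\<forall>i\<in>S. C1_on (loc i g) (fb_ball i) & (\<forall>y\<in>fb_ball i. norm (BD (loc i g) y) <= G))"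

lemma open_fb_ball: "open (fb_ball i)" by (simp add: fb_ball_def)

lemma flow_box_chart:
 assumes "is_flow_box T i"
 shows "fb_chart i\<in>A" "cball (fb_center i) (4 * fb_radius i) <= cimg (fb_chart i)"
  "fb_ball2 i <= cball (fb_center i) (4 * fb_radius i)"
  "y\<in>fb_ball i ==> y\<in>cimg (fb_chart i)" "y\<in>fb_ball i ==> cinv (fb_chart i) y\<in>carrier A"
  "y\<in>fb_ball i ==> cinv (fb_chart i) y\<in>fb_nbh i" "y\<in>fb_ball i ==> cmap (fb_chart i) (cinv (fb_chart i) y) = y"
proof -
 show c: "fb_chart i\<in>A" and r: "cball (fb_center i) (4 * fb_radius i) <= cimg (fb_chart i)"
  and "fb_ball2 i <= cball (fb_center i) (4 * fb_radius i)" using assms by (auto simp: is_flow_box_def fb_ball2_def)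
 note cc = chartD[OF c]
 assume y: "y\<in>fb_ball i"
 thus i: "y\<in>cimg (fb_chart i)" using assms r by (auto simp: fb_ball_def is_flow_box_def subset_iff)
 show "cinv (fb_chart i) y\<in>carrier A" "cinv (fb_chart i) y\<in>fb_nbh i" "cmap (fb_chart i) (cinv (fb_chart i) y) = y"
  using i y cc cdom_carrier[OF c] by (auto simp: fb_nbh_def)
qed

lemma C1_bound_cong:
 assumes S: "!!i. i\<in>S ==> is_flow_box T i" and "!!q. q\<in>carrier A ==> g q = h q" "C1_bound S G h"
 shows "C1_bound S G g"
 unfolding C1_bound_def
proof (intro ballI conjI)
 fix j assume j: "j\<in>S"
 have h: "C1_on (loc j h) (fb_ball j)" "!!y. y\<in>fb_ball j ==> norm (BD (loc j h) y) <= G"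
  using assms(3) j by (auto simp: C1_bound_def)
 have e: "loc j h y = loc j g y" if "y\<in>fb_ball j" for y
  using assms(2) flow_box_chart(5)[OF S[OF j] that] by (simp add: loc_def)
 show "C1_on (loc j g) (fb_ball j)" by (rule Cn_on_cong_imp[OF open_fb_ball e h(1)])
 fix y assume y: "y\<in>fb_ball j"
 have "(loc j g has_derivative blinfun_apply (BD (loc j h) y)) (at y)"
  by (rule has_derivative_local[OF BD_has_derivative[OF h(1) y] open_fb_ball y e])
 from BD_eqI[OF this] show "norm (BD (loc j g) y) <= G" using h(2)[OF y] by simp
qed

text \<open>A point of a box flows either within \<open>K\<close>, which the boxes cover, or not at all; in both cases it arrives in a
 box of the family, and the factor is bounded by the derivatives of the transition maps on compact sets and of the flow in the boxes.\<close>

lemma C1_bound_flow: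
 assumes S: "finite S" "0 < T" "!!i. i\<in>S ==> is_flow_box T i" "K <= (\<Union>i\<in>S. fb_nbh i)"
 obtains M where "0 < M" "!!g G. 0 <= G ==> C1_bound S G g ==> C1_bound S (M * G) (%q. g (flow T q))"
proof -
 note fb = flow_box_chart[OF S(3)]
 define Q where "Q i = cinv (fb_chart i) ` cball (fb_center i) (2 * fb_radius i)" for i :: "('a, 'e) flow_box"
 have Q: "compact (Q i)" "Q i <= cdom (fb_chart i)" if i: "i\<in>S" for i
 proof -
  note cc = chartD[OF fb(1)[OF i]]
  have sub: "cball (fb_center i) (2 * fb_radius i) <= cimg (fb_chart i)"
   using fb(2)[OF i] S(3)[OF i] by (auto simp: subset_iff is_flow_box_def)
  show "compact (Q i)" unfolding Q_def
   by (rule compact_continuous_image[OF continuous_on_subset[OF cc(7) sub]]) auto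
  show "Q i <= cdom (fb_chart i)" using sub cc(5) by (auto simp: Q_def)
 qed
 define \<tau> where "\<tau> i j = cmap (fb_chart j) o cinv (fb_chart i)" for i j :: "('a, 'e) flow_box"
 have \<tau>: "C1_on (\<tau> i j) (cmap (fb_chart i) ` (cdom (fb_chart i) Int cdom (fb_chart j)))" if "i\<in>S" "j\<in>S" for i j
  unfolding \<tau>_def by (rule Cn_transition_A[OF fb(1)[OF that(1)] fb(1)[OF that(2)]])
 have "\<exists>M>0. \<forall>ij\<in>S \<times> S. \<forall>p\<in>Q (fst ij) Int Q (snd ij). norm (BD (\<tau> (fst ij) (snd ij)) (cmap (fb_chart (fst ij)) p)) <= M"
 proof (rule finite_uniform_bound)
  fix ij assume "ij\<in>S \<times> S"
  then obtain i j where ij: "ij = (i, j)" "i\<in>S" "j\<in>S" by blast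
  note cc = chartD[OF fb(1)[OF ij(2)]]
  have "compact (Q i Int Q j)" by (rule compact_Int_closed[OF Q(1)[OF ij(2)] compact_imp_closed[OF Q(1)[OF ij(3)]]])
  hence "compact (cmap (fb_chart i) ` (Q i Int Q j))"
   by (rule compact_continuous_image[OF continuous_on_subset[OF cc(6)], rotated]) (use Q(2)[OF ij(2)] in auto)
  from BD_bounded_on_compact[OF \<tau>[OF ij(2,3)] this] Q(2)[OF ij(2)] Q(2)[OF ij(3)]
  obtain L where "!!y. y\<in>cmap (fb_chart i) ` (Q i Int Q j) ==> norm (BD (\<tau> i j) y) <= L" by blast
  thus "\<exists>M. \<forall>p\<in>Q (fst ij) Int Q (snd ij). norm (BD (\<tau> (fst ij) (snd ij)) (cmap (fb_chart (fst ij)) p)) <= M"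
   unfolding ij(1) fst_conv snd_conv by blast
 qed (use S(1) in \<open>auto intro: order_trans\<close>)
 then obtain M where M: "M > 0" "!!i j p. i\<in>S ==> j\<in>S ==> p\<in>Q i Int Q j ==> norm (BD (\<tau> i j) (cmap (fb_chart i) p)) <= M"
  by force
 show ?thesis
 proof (rule that[of "M * 2"])
  fix g G assume G: "0 <= G" "C1_bound S G g"
  show "C1_bound S (M * 2 * G) (%q. g (flow T q))"
   unfolding C1_bound_def
  proof
   fix i assume i: "i\<in>S"
   let ?c = "fb_chart i" and ?g = "loc i (%q. g (flow T q))"
   note cc = chartD[OF fb(1)[OF i]]
   have TT: "T\<in>{-T..T}" using S(2) by auto
   have "\<exists>U. open U & y\<in>U & C1_on ?g U & norm (BD ?g y) <= M * 2 * G" if y: "y\<in>fb_ball i" for y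
   proof -
    define p where "p = cinv ?c (fb_flow i T y)"
    have fl: "flow T (cinv ?c z) = cinv ?c (fb_flow i T z)" "fb_flow i T z\<in>fb_ball2 i" "fb_flow i T z\<in>cimg ?c" if "z\<in>fb_ball i" for z
     using flow_box_flow[OF S(3)[OF i] fb(6)[OF i that] TT] fb(7)[OF i that] S(3)[OF i] that TT
      flow_box_icurve(2)[OF S(3)[OF i] fb(6)[OF i that] _ TT] S(2)
     by (auto simp: is_flow_box_def)
    have "\<exists>j\<in>S. p\<in>fb_nbh j"
    proof (cases "cinv ?c y\<in>K")
     case True
     hence "flow T (cinv ?c y)\<in>K" by (rule flow_K)
     thus ?thesis using S(4) fl(1)[OF y] by (auto simp: p_def)
    next
     case False
     hence "flow T (cinv ?c y) = cinv ?c y" using fb(5)[OF i y] flow_outside by blast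
     thus ?thesis using fb(6)[OF i y] fl(1)[OF y] i by (auto simp: p_def)
    qed
    then obtain j where j: "j\<in>S" "p\<in>fb_nbh j" by blast
    let ?d = "fb_chart j"
    note cd = chartD[OF fb(1)[OF j(1)]]
    have oI: "open (cmap ?c ` (fb_nbh j Int cdom ?c))" by (rule open_image[OF fb(1)[OF i] open_fb_nbh[OF S(3)[OF j(1)]]])
    define U where "U = fb_ball i Int fb_flow i T -` (cmap ?c ` (fb_nbh j Int cdom ?c))"
    have C1: "C1_on (fb_flow i T) (fb_ball i)" by (rule flow_box_C1[OF S(3)[OF i] TT])
    have oU: "open U" unfolding U_def
     by (rule continuous_open_preimage[OF Cn_on_continuous[OF C1] open_fb_ball oI])
    have pd: "p\<in>cdom ?c" "p\<in>cdom ?d" "cmap ?c p = fb_flow i T y" "cmap ?d p\<in>fb_ball j"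
     using fl[OF y] cc j(2) by (auto simp: p_def fb_nbh_def)
    have yU: "y\<in>U" using y j(2) pd by (force simp: U_def)
    have sub: "cmap ?c ` (fb_nbh j Int cdom ?c) <= cmap ?c ` (cdom ?c Int cdom ?d)" by (auto simp: fb_nbh_def)
    have 1: "C1_on (%z. \<tau> i j (fb_flow i T z)) U"
     by (rule Cn_on_compose[OF oU oI Cn_on_subset[OF C1] Cn_on_subset[OF \<tau>[OF i j(1)] sub]]) (auto simp: U_def)
    have gj: "C1_on (loc j g) (fb_ball j)" "!!y. y\<in>fb_ball j ==> norm (BD (loc j g) y) <= G"
     using G(2) j(1) by (auto simp: C1_bound_def)
    have U2: "cinv ?c (fb_flow i T z)\<in>fb_nbh j" if "z\<in>U" for z
     using that cc(3) by (auto simp: U_def)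
    have 2: "C1_on (%z. loc j g (\<tau> i j (fb_flow i T z))) U"
     by (rule Cn_on_compose[OF oU open_fb_ball 1 gj(1)]) (use U2 in "auto simp: fb_nbh_def \<tau>_def")
    have eq: "loc j g (\<tau> i j (fb_flow i T z)) = ?g z" if "z\<in>U" for z
     using U2[OF that] that fl(1) cd(3) by (auto simp: loc_def fb_nbh_def U_def \<tau>_def)
    have d1: "(fb_flow i T has_derivative blinfun_apply (fb_deriv i T y)) (at y)" "norm (fb_deriv i T y) <= 2"
     using S(3)[OF i] y TT by (auto simp: is_flow_box_def)
    have d2: "(\<tau> i j has_derivative blinfun_apply (BD (\<tau> i j) (cmap ?c p))) (at (fb_flow i T y))"
     using BD_has_derivative[OF \<tau>[OF i j(1)] imageI[OF IntI[OF pd(1,2)]]] by (simp only: pd(3))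
    have d3: "(loc j g has_derivative blinfun_apply (BD (loc j g) (cmap ?d p))) (at (\<tau> i j (fb_flow i T y)))"
     using BD_has_derivative[OF gj(1) pd(4)] by (simp add: p_def \<tau>_def)
    let ?D = "BD (loc j g) (cmap ?d p) o\<^sub>L (BD (\<tau> i j) (cmap ?c p) o\<^sub>L fb_deriv i T y)"
    have "((%z. loc j g (\<tau> i j (fb_flow i T z))) has_derivative blinfun_apply ?D) (at y)"
     using has_derivative_compose[OF has_derivative_compose[OF d1(1) d2] d3] by (simp add: blinfun_compose.rep_eq o_def)
    hence "(?g has_derivative blinfun_apply ?D) (at y)"
     by (rule has_derivative_local[OF _ oU yU eq])
    hence D: "BD ?g y = ?D" by (rule BD_eqI)
    have "p\<in>Q i" using fl(2)[OF y] by (auto simp: p_def Q_def fb_ball2_def)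
    moreover have "p\<in>Q j" using pd(4) cd(3)[OF pd(2)] S(3)[OF j(1)] unfolding Q_def fb_ball_def
     by (intro image_eqI[of _ _ "cmap ?d p"]) (auto simp: is_flow_box_def)
    ultimately have "norm (BD (\<tau> i j) (cmap ?c p)) <= M" using M(2)[OF i j(1)] by blast
    hence "norm (BD ?g y) <= G * (M * 2)" unfolding D using gj(2)[OF pd(4)] d1(2) M(1) G(1)
     by (intro order_trans[OF norm_blinfun_compose] mult_mono) auto
    thus ?thesis using oU yU Cn_on_cong_imp[OF oU eq 2] by (auto simp: ac_simps)
   qed
   thus "C1_on ?g (fb_ball i) & (\<forall>y\<in>fb_ball i. norm (BD ?g y) <= M * 2 * G)"
    by (intro conjI Cn_on_local ballI) blast+
  qed
 qed (use M in simp)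
qed

lemma C1_bound_integral:
 assumes S: "finite S" "0 < T" "!!i. i\<in>S ==> is_flow_box T i" and N: "0 < N"
 obtains B where "0 <= B" "C1_bound S B (%q. integral {0..T} (W N q))"
proof -
 note fb = flow_box_chart[OF S(3)]
 have \<xi>C: "C1_on (loc i \<xi>) (cimg (fb_chart i))" if "i\<in>S" for i
  using \<xi>_C1 fb(1)[OF that] cdom_carrier[OF fb(1)[OF that]] unfolding mfun_def loc_def[abs_def]
  by (metis Int_absorb1 One_nat_def)
 have "\<exists>X>0. \<forall>i\<in>S. \<forall>y\<in>cball (fb_center i) (4 * fb_radius i). norm (BD (loc i \<xi>) y) <= X"
 proof (rule finite_uniform_bound[OF S(1)])
  show "\<exists>X. \<forall>y\<in>cball (fb_center i) (4 * fb_radius i). norm (BD (loc i \<xi>) y) <= X" if "i\<in>S" for i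
   by (rule BD_bounded_on_compact[OF \<xi>C[OF that] compact_cball fb(2)[OF that]]) blast
 qed (auto intro: order_trans)
 then obtain X where X: "X > 0" "!!i y. i\<in>S ==> y\<in>cball (fb_center i) (4 * fb_radius i) ==> norm (BD (loc i \<xi>) y) <= X"
  by blast
 show ?thesis
 proof (rule that[of "X * 2 * T"])
  show "C1_bound S (X * 2 * T) (%q. integral {0..T} (W N q))"
   unfolding C1_bound_def
  proof
   fix i assume i: "i\<in>S"
   let ?c = "fb_chart i" and ?g = "loc i (%q. integral {0..T} (W N q))"
   note box = S(3)[OF i]
   have fl: "W N (cinv ?c z) s = exp (- N * s) * loc i \<xi> (fb_flow i s z)"
     "fb_flow i s z\<in>cball (fb_center i) (4 * fb_radius i)" "fb_flow i s z\<in>cimg ?c"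
    if "z\<in>fb_ball i" "s\<in>{0..T}" for z s
   proof -
    show "W N (cinv ?c z) s = exp (- N * s) * loc i \<xi> (fb_flow i s z)"
     using flow_box_flow[OF box fb(6)[OF i that(1)], of s] fb(7)[OF i that(1)] that by (simp add: W_def loc_def)
    have "fb_flow i s z\<in>fb_ball2 i" using box that unfolding is_flow_box_def by auto
    thus "fb_flow i s z\<in>cball (fb_center i) (4 * fb_radius i)" "fb_flow i s z\<in>cimg ?c"
     using fb(2,3)[OF i] by blast+
   qed
   define D where "D y s = exp (- N * s) *\<^sub>R (BD (loc i \<xi>) (fb_flow i s y) o\<^sub>L fb_deriv i s y)" for y s
   have dW: "((%y. W N (cinv ?c y) s) has_derivative blinfun_apply (D y s)) (at y)" if y: "y\<in>fb_ball i" and s: "s\<in>{0..T}" for y s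
   proof -
    have "(fb_flow i s has_derivative blinfun_apply (fb_deriv i s y)) (at y)" using box y s unfolding is_flow_box_def by auto
    from has_derivative_mult_right[OF has_derivative_compose[OF this BD_has_derivative[OF \<xi>C[OF i] fl(3)[OF y s]]]]
    have "((%y. exp (- N * s) * loc i \<xi> (fb_flow i s y)) has_derivative blinfun_apply (D y s)) (at y)"
     unfolding D_def by (simp add: blinfun_compose.rep_eq scaleR_blinfun.rep_eq o_def)
    thus ?thesis
     by (rule has_derivative_local[OF _ open_fb_ball y]) (use fl(1)[OF _ s] in simp)
   qed
   have bD: "norm (D y s) <= X * 2" if y: "y\<in>fb_ball i" and s: "s\<in>{0..T}" for y s
   proof -
    have "norm (fb_deriv i s y) <= 2" using box y s unfolding is_flow_box_def by auto
    hence "norm (BD (loc i \<xi>) (fb_flow i s y) o\<^sub>L fb_deriv i s y) <= X * 2"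
     using X(1) X(2)[OF i fl(2)[OF y s]] by (intro order_trans[OF norm_blinfun_compose] mult_mono) auto
    moreover have "exp (- N * s) <= 1" using N s by auto
    ultimately show ?thesis unfolding D_def norm_scaleR using mult_mono[of "exp (- N * s)" 1] by auto
   qed
   have contD: "continuous_on (fb_ball i \<times> cbox 0 T) (%(y, s). D y s)"
   proof -
    let ?J = "fb_ball i \<times> cbox 0 T"
    have sw: "continuous_on ?J (%x. (snd x, fst x))" by (intro continuous_intros)
    have sw2: "(%x. (snd x, fst x)) ` ?J <= {-T..T} \<times> fb_ball i" by auto
    have "continuous_on ({-T..T} \<times> fb_ball i) (%(s, z). fb_flow i s z)"
     "continuous_on ({-T..T} \<times> fb_ball i) (%(s, z). fb_deriv i s z)" using box by (auto simp: is_flow_box_def)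
    from this[THEN continuous_on_comp, OF sw sw2]
    have f: "continuous_on ?J (%x. fb_flow i (snd x) (fst x))"
     and g: "continuous_on ?J (%x. fb_deriv i (snd x) (fst x))" by simp_all
    have "(%x. fb_flow i (snd x) (fst x)) ` ?J <= cimg ?c" using fl(3) by auto
    from continuous_on_comp[OF BD_continuous[OF \<xi>C[OF i]] f this] g
    have "continuous_on ?J (%x. exp (- N * snd x) *\<^sub>R (BD (loc i \<xi>) (fb_flow i (snd x) (fst x)) o\<^sub>L fb_deriv i (snd x) (fst x)))"
     by (intro continuous_intros bounded_bilinear.continuous_on[OF bounded_bilinear_blinfun_compose])
    thus ?thesis by (simp add: D_def case_prod_unfold)
   qed
   have der: "(?g has_derivative blinfun_apply (integral (cbox 0 T) (D y))) (at y)" if y: "y\<in>fb_ball i" for y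
   proof -
    have "((%y. integral (cbox 0 T) (W N (cinv ?c y))) has_derivative blinfun_apply (integral (cbox 0 T) (D y))) (at y within fb_ball i)"
    proof (rule leibniz_rule[OF _ _ contD y])
     show "((%y. W N (cinv ?c y) s) has_derivative blinfun_apply (D y s)) (at y within fb_ball i)"
      if "y\<in>fb_ball i" "s\<in>cbox 0 T" for y s using has_derivative_at_withinI[OF dW] that by simp
     show "W N (cinv ?c y) integrable_on cbox 0 T" if "y\<in>fb_ball i" for y
      using W_integrable[OF fb(5)[OF i that]] by simp
    qed (simp add: fb_ball_def)
    moreover have "?g = (%y. integral (cbox 0 T) (W N (cinv ?c y)))" by (simp add: loc_def fun_eq_iff)
    ultimately show ?thesis by (simp only: at_within_open[OF y open_fb_ball])
   qed
   have "C1_on ?g (fb_ball i)"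
    by (rule C1_on_blinfunI[OF open_fb_ball der integral_continuous_on_param[OF contD]])
   moreover have "norm (BD ?g y) <= X * 2 * T" if y: "y\<in>fb_ball i" for y
   proof -
    have "continuous_on {0..T} (%s. (%(y, s). D y s) (y, s))"
     by (rule continuous_on_comp[OF contD]) (use y in "auto intro!: continuous_intros")
    hence "norm (integral {0..T} (D y)) <= X * 2 * (T - 0)"
     using bD[OF y] S(2) by (intro integral_bound) auto
    thus ?thesis unfolding BD_eqI[OF der[OF y]] by simp
   qed
   ultimately show "C1_on ?g (fb_ball i) & (\<forall>y\<in>fb_ball i. norm (BD ?g y) <= X * 2 * T)" by blast
  qed
 qed (use X S(2) in simp)
qed

lemma rho_C1:
 assumes K': "compact K'" "K <= K'" "K' <= carrier A"
 obtains N0 \<Omega> where "0 < N0" "open \<Omega>" "K' <= \<Omega>" "\<Omega> <= carrier A" "!!N. N0 <= N ==> mfun A 1 (rho N) \<Omega>"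
proof -
 obtain S T where S: "finite S" "0 < T" "!!i. i\<in>S ==> is_flow_box T i" "K' <= (\<Union>i\<in>S. fb_nbh i)"
  by (rule flow_box_cover[OF K'(1,3)]) (rule that)
 have KS: "K <= (\<Union>i\<in>S. fb_nbh i)" using K'(2) S(4) by blast
 note fb = flow_box_chart[OF S(3)]
 obtain M where M: "0 < M" "!!g G. 0 <= G ==> C1_bound S G g ==> C1_bound S (M * G) (%q. g (flow T q))"
  by (rule C1_bound_flow[OF S(1-3) KS]) (assumption | rule that)+
 \<comment> \<open>chosen so that \<open>exp (- N * T) * M \<le> 1/2\<close>\<close>
 define N0 where "N0 = max 1 (ln (2 * M) / T)"
 have "mfun A 1 (rho N) (\<Union>i\<in>S. fb_nbh i)" if N: "N0 <= N" for N
 proof (rule mfunI)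
  fix p assume "p\<in>(\<Union>i\<in>S. fb_nbh i)"
  then obtain i where i: "i\<in>S" "p\<in>fb_nbh i" by blast
  let ?c = "fb_chart i"
  have N1: "0 < N" using N by (simp add: N0_def)
  obtain B where B: "0 <= B" "C1_bound S B (%q. integral {0..T} (W N q))"
   by (rule C1_bound_integral[OF S(1-3) N1]) (assumption | rule that)+
  have small: "exp (- N * T) * M <= 1/2"
  proof -
   have "ln (2 * M) <= N * T" using N S(2) by (simp add: N0_def pos_divide_le_eq)
   hence "2 * M <= exp (N * T)" using M(1) by (metis exp_le_cancel_iff exp_ln mult_pos_pos zero_less_numeral)
   thus ?thesis by (simp add: exp_minus field_simps)
  qed
  define g where "g n q = integral {0..T} (W N (flow (real n * T) q))" for n q
  have g_bound: "C1_bound S (M ^ n * B) (g n)" for n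
  proof (induction n)
   case 0
   have "C1_bound S B (g 0)"
    by (rule C1_bound_cong[of S T _ "%q. integral {0..T} (W N q)"]) (use S(3) B(2) in \<open>auto simp: g_def\<close>)
   thus ?case by simp
  next
   case (Suc n)
   have "C1_bound S (M * (M ^ n * B)) (%q. g n (flow T q))" using M(1) B(1) by (intro M(2) Suc) auto
   moreover have "g (Suc n) q = g n (flow T q)" if "q\<in>carrier A" for q
    using that by (simp add: g_def flow_add[symmetric] algebra_simps)
   ultimately have "C1_bound S (M * (M ^ n * B)) (g (Suc n))"
    using C1_bound_cong[of S T "g (Suc n)" "%q. g n (flow T q)"] S(3) by blast
   thus ?case by (simp add: ac_simps)
  qed
  have "C1_on (loc i (rho N)) (ball (fb_center i) (fb_radius i))"
  proof (rule C1_series[where f="%n y. exp (- N * T) ^ n * loc i (g n) y" and a="%n. (1/2) ^ n * B"])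
   have gi: "C1_on (loc i (g n)) (fb_ball i)" "!!y. y\<in>fb_ball i ==> norm (BD (loc i (g n)) y) <= M ^ n * B" for n
    using g_bound[of n] i(1) by (auto simp: C1_bound_def)
   show "C1_on (%y. exp (- N * T) ^ n * loc i (g n) y) (ball (fb_center i) (fb_radius i))" for n
    using gi(1)[of n] by (intro Cn_on_mult Cn_on_const) (auto simp: fb_ball_def)
   show "summable (%n. (1 / 2) ^ n * B)" by (intro summable_mult2 summable_geometric) auto
   fix y assume "y\<in>ball (fb_center i) (fb_radius i)"
   hence y: "y\<in>fb_ball i" by (simp add: fb_ball_def)
   show "norm (BD (%y. exp (- N * T) ^ n * loc i (g n) y) y) <= (1/2) ^ n * B" for n
   proof -
    have "((%y. exp (- N * T) ^ n * loc i (g n) y) has_derivative blinfun_apply (exp (- N * T) ^ n *\<^sub>R BD (loc i (g n)) y)) (at y)"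
     using has_derivative_mult_right[OF BD_has_derivative[OF gi(1) y]] by (simp add: scaleR_blinfun.rep_eq)
    hence "norm (BD (%y. exp (- N * T) ^ n * loc i (g n) y) y) = exp (- N * T) ^ n * norm (BD (loc i (g n)) y)"
     by (simp add: BD_eqI)
    also have "\<dots> <= exp (- N * T) ^ n * (M ^ n * B)" by (intro mult_left_mono gi(2)[OF y]) simp
    also have "\<dots> = (exp (- N * T) * M) ^ n * B" by (simp add: power_mult_distrib)
    also have "\<dots> <= (1/2) ^ n * B" using small M(1) B(1) by (intro mult_right_mono power_mono) auto
    finally show ?thesis .
   qed
   let ?q = "cinv ?c y"
   have q: "?q\<in>carrier A" by (rule fb(5)[OF i(1) y])
   have part: "(\<Sum>n<m. exp (- N * T) ^ n * loc i (g n) y) = integral {0..real m * T} (W N ?q)" for m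
   proof (induction m)
    case (Suc m)
    have "exp (- N * T) ^ m * loc i (g m) y = integral {0..T} (%s. exp (- N * T) ^ m * W N (flow (real m * T) ?q) s)"
     by (simp add: loc_def g_def)
    also have "\<dots> = integral {0..T} (%s. W N ?q (s + real m * T))"
     by (rule integral_cong) (simp add: W_def flow_add[OF q] exp_of_nat_mult[symmetric] exp_add[symmetric] algebra_simps)
    also have "\<dots> = integral {real m * T - real m * T..(real m * T + T) - real m * T} (%s. W N ?q (s + real m * T))" by simp
    also have "\<dots> = integral {real m * T..real m * T + T} (W N ?q)" by (rule integral_shift_real_ivl)
    finally show ?case
     using Suc W_integral_combine[OF q, of 0 "real m * T" "real m * T + T" N] S(2) by (simp add: algebra_simps)
   qed simp
   have "(%m. integral {0..real m * T} (W N ?q)) \<longlonglongrightarrow> rho N ?q"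
   proof (rule tendsto_sandwich[OF always_eventually always_eventually])
    show "(%m. rho N ?q - exp (- N * (real m * T)) / N) \<longlonglongrightarrow> rho N ?q"
     using tendsto_diff[OF tendsto_const exp_tail_tendsto[OF N1 S(2)]] by simp
    show "\<forall>m. rho N ?q - exp (- N * (real m * T)) / N <= integral {0..real m * T} (W N ?q)"
     using rho_bounds(2)[OF q N1] S(2) by (simp add: diff_le_eq)
    show "\<forall>m. integral {0..real m * T} (W N ?q) <= rho N ?q" using rho_bounds(1)[OF q N1] S(2) by simp
   qed simp
   thus "(%n. exp (- N * T) ^ n * loc i (g n) y) sums loc i (rho N) y"
    unfolding sums_def part by (simp add: loc_def)
  qed
  hence C1: "Cn_on 1 (%y. rho N (cinv ?c y)) (cmap ?c ` (fb_nbh i Int cdom ?c))"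
   unfolding loc_def[abs_def] One_nat_def by (rule Cn_on_subset) (auto simp: fb_nbh_def fb_ball_def)
  show "\<exists>a U. a\<in>charts \<infinity> A & open U & p\<in>U & p\<in>cdom a & Cn_on 1 (%y. rho N (cinv a y)) (cmap a ` (U Int cdom a))"
   using C1 atlas_charts[OF fb(1)[OF i(1)]] open_fb_nbh[OF S(3)[OF i(1)]] i(2)
   by (intro exI[of _ ?c] exI[of _ "fb_nbh i"]) (auto simp: fb_nbh_def)
 qed
 moreover have "(\<Union>i\<in>S. fb_nbh i) <= carrier A" using fb(1) cdom_carrier unfolding fb_nbh_def by blast
 moreover have "open (\<Union>i\<in>S. fb_nbh i)" using S(3) open_fb_nbh by blast
 ultimately show ?thesis using that[of N0 "\<Union>i\<in>S. fb_nbh i"] S(4) by (auto simp: N0_def)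
qed

end


section \<open>Linear algebra of contact forms\<close>

lemma FD_eqI: "(f has_derivative D) (at x) ==> FD f x v = D v"
 by (simp add: frechet_derivative_at[symmetric])

lemma Cn_on_slice:
 fixes F :: "'a::euclidean_space \<times> 'b::euclidean_space => 'c::euclidean_space"
 assumes "Cn_on n F (S \<times> J)" "open S" "open J" "t\<in>J" shows "Cn_on n (%y. F (y, t)) S"
proof -
 have 1: "Cn_on n (%y. (y, t)) S" by (intro Cn_on_Pair assms(2) Cn_on_id Cn_on_const)
 show ?thesis by (rule Cn_on_compose[OF assms(2) open_Times[OF assms(2,3)] 1 assms(1)]) (use assms(4) in auto)
qed

text \<open>For a contact form \<open>\<beta>\<close> with \<open>\<omega> = d\<beta>\<close> the form \<open>\<omega> + \<beta> \<otimes> \<beta>\<close> is nondegenerate: pairing a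
 vector with itself gives the square of its value under \<open>\<beta>\<close>, so a vector that pairs to zero with all others lies
 in the kernel of \<open>\<beta>\<close>, where \<open>\<omega>\<close> is nondegenerate. Prescribing the pairing of a field with it thus determines the field;
 this covers the Reeb field and all contact Hamiltonian fields.\<close>

lemma contact_solve:
 fixes \<beta> :: "'e::euclidean_space => real" and \<omega> :: "'e => 'e => real"
 assumes \<beta>: "linear \<beta>" and \<omega>: "bilinear \<omega>" "!!u v. \<omega> u v = - \<omega> v u"
  and nd: "!!u. \<beta> u = 0 ==> (!!v. \<beta> v = 0 ==> \<omega> u v = 0) ==> u = 0"
 shows "(!!v. \<omega> w v + \<beta> w * \<beta> v = 0) ==> w = 0"
  and "linear \<gamma> ==> \<exists>w. \<forall>v. \<omega> w v + \<beta> w * \<beta> v = \<gamma> v"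
proof -
 show inj: "w = 0" if w: "!!v. \<omega> w v + \<beta> w * \<beta> v = 0" for w
 proof -
  have "\<omega> w w = 0" using \<omega>(2)[of w w] by simp
  hence "\<beta> w = 0" using w[of w] by simp
  thus ?thesis using w by (intro nd) auto
 qed
 assume \<gamma>: "linear \<gamma>"
 define M where "M w = (\<Sum>b\<in>Basis. (\<omega> w b + \<beta> w * \<beta> b) *\<^sub>R b)" for w
 have Mb: "M w \<bullet> b = \<omega> w b + \<beta> w * \<beta> b" if "b\<in>Basis" for w b
  using that by (simp add: M_def inner_sum_left inner_Basis if_distrib cong: if_cong)
 have ext: "\<omega> w v + \<beta> w * \<beta> v = \<gamma> v" if eq: "!!b. b\<in>Basis ==> \<omega> w b + \<beta> w * \<beta> b = \<gamma> b" and "linear \<gamma>" for w v and \<gamma> :: "'e => real"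
 proof -
  have "linear (%v. \<omega> w v + \<beta> w * \<beta> v)"
   using \<omega>(1) \<beta> by (simp add: bilinear_def linear_iff algebra_simps)
  thus ?thesis using linear_eq_stdbasis[OF _ \<open>linear \<gamma>\<close> eq] by metis
 qed
 have linM: "linear M"
  using bilinear_ladd[OF \<omega>(1)] bilinear_lmul[OF \<omega>(1)] linear_add[OF \<beta>] linear_cmul[OF \<beta>]
  by (intro linearI) (simp_all add: M_def sum.distrib[symmetric] scaleR_sum_right algebra_simps)
 have "inj M"
 proof (subst linear_injective_0[OF linM], intro allI impI)
  fix w assume "M w = 0"
  hence "\<omega> w v + \<beta> w * \<beta> v = 0" for v
   using ext[of w "%_. 0" v] Mb[of _ w] by (simp add: linear_zero)
  thus "w = 0" by (rule inj)
 qed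
 hence "surj M" using linear_injective_imp_surjective[OF linM] by blast
 then obtain w where w: "M w = (\<Sum>b\<in>Basis. \<gamma> b *\<^sub>R b)" by (metis surjD)
 have "\<omega> w b + \<beta> w * \<beta> b = \<gamma> b" if "b\<in>Basis" for b
  using Mb[OF that, of w] that unfolding w by (simp add: inner_sum_left inner_Basis if_distrib cong: if_cong)
 thus "\<exists>w. \<forall>v. \<omega> w v + \<beta> w * \<beta> v = \<gamma> v" using ext \<gamma> by blast
qed

section \<open>Derivatives of functions and forms in charts\<close>

text \<open>The differential in the preferred chart at the point, which is also the chart by which tangent vectors are
 identified with vectors of the model space.\<close>

definition Dfun :: "('a, 'e::euclidean_space) chart set => ('a => real) => 'a => 'e => real" where
 "Dfun A f p v = FD (%y. f (cinv (chart_at A p) y)) (cmap (chart_at A p) p) v"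

context manifold begin

lemma Dfun_chart:
 assumes f: "mfun A (Suc 0) f U" "open U" "p\<in>U" and c: "c\<in>charts \<infinity> A" "p\<in>cdom c"
 shows "Dfun A f p v = FD (%y. f (cinv c y)) (cmap c p) (coord A c p v)"
  and "((%y. f (cinv c y)) has_derivative FD (%y. f (cinv c y)) (cmap c p)) (at (cmap c p))"
proof -
 have p: "p\<in>carrier A" using c charts_cdom by blast
 let ?d = "chart_at A p"
 have d: "?d\<in>A" "p\<in>cdom ?d" using chart_at[OF p] by auto
 note cd = chartD[OF d(1)] and cc = charts_chartD[OF c(1)]
 show 1: "((%y. f (cinv c y)) has_derivative FD (%y. f (cinv c y)) (cmap c p)) (at (cmap c p))"
  by (rule Cn_on_deriv[OF mfunD[OF f(1,2) c(1)]]) (use f c in auto)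
 have c1: "c\<in>charts 1 A" using charts_mono[OF c(1), of 1] by simp
 have d1: "?d\<in>charts 1 A" using atlas_charts[OF d(1)] .
 have "((cmap c o cinv ?d) has_derivative tr ?d c p) (at (cmap ?d p))" by (rule tr_derivative[OF d1 c1 d(2) c(2)])
 hence "((%y. f (cinv c ((cmap c o cinv ?d) y))) has_derivative (%v. FD (%y. f (cinv c y)) (cmap c p) (tr ?d c p v))) (at (cmap ?d p))"
  by (rule has_derivative_compose) (use 1 cd(3)[OF d(2)] in simp)
 hence "((%y. f (cinv ?d y)) has_derivative (%v. FD (%y. f (cinv c y)) (cmap c p) (tr ?d c p v))) (at (cmap ?d p))"
  by (rule has_derivative_local[OF _ open_image[OF d(1) cc(1)]]) (use c d cd cc in auto)
 from FD_eqI[OF this, of v] show "Dfun A f p v = FD (%y. f (cinv c y)) (cmap c p) (coord A c p v)"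
  unfolding Dfun_def coord_eq_tr .
qed

lemma Dfun_linear:
 assumes "mfun A (Suc 0) f U" "open U" "p\<in>U" "p\<in>carrier A" shows "linear (Dfun A f p)"
proof -
 have d: "chart_at A p\<in>charts \<infinity> A" "p\<in>cdom (chart_at A p)" using chart_at[OF assms(4)] atlas_charts by auto
 have "Dfun A f p = FD (%y. f (cinv (chart_at A p) y)) (cmap (chart_at A p) p)"
  by (simp add: Dfun_def fun_eq_iff)
 thus ?thesis using has_derivative_linear[OF Dfun_chart(2)[OF assms(1-3) d]] by simp
qed

definition fcoef :: "('a, 'e) chart => ('a => 'e => real) => 'e => 'e => real" where
 "fcoef c \<beta> v y = \<beta> (cinv c y) (coord_inv A c (cinv c y) v)"

definition dcoef :: "('a, 'e) chart => ('a => 'e => real) => 'e => 'e => 'e => real" where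
 "dcoef c \<beta> y u v = FD (fcoef c \<beta> v) y u - FD (fcoef c \<beta> u) y v"

lemma smooth_formD:
 assumes "smooth_form A W \<beta>"
 shows "q\<in>W ==> linear (\<beta> q)" "c\<in>A ==> open W ==> Cn_on n (fcoef c \<beta> v) (cmap c ` (W Int cdom c))"
proof -
 show "q\<in>W ==> linear (\<beta> q)" using assms unfolding smooth_form_def smooth_form_family_def by auto
 assume c: "c\<in>A" and W: "open W"
 note cc = chartD[OF c]
 let ?S = "cmap c ` (W Int cdom c)"
 have S: "{(y, t::real). y\<in>cimg c & (cinv c y, t)\<in>W \<times> UNIV} = ?S \<times> UNIV" using cc by force
 have o: "open ?S" by (rule open_image[OF c W])
 have "Ck_on \<infinity> (%(y, t::real). \<beta> (cinv c y) (coord_inv A c (cinv c y) v)) {(y, t::real). y\<in>cimg c & (cinv c y, t)\<in>W \<times> UNIV}"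
  using assms c unfolding smooth_form_def smooth_form_family_def by blast
 hence "Cn_on n (%(y, t::real). fcoef c \<beta> v y) (?S \<times> UNIV)"
  unfolding S Ck_on_def fcoef_def by simp
 from Cn_on_slice[OF this o open_UNIV, of 0] show "Cn_on n (fcoef c \<beta> v) ?S" by simp
qed

lemma fcoef_sum:
 assumes "linear (\<beta> (cinv c y))" "c\<in>A" "y\<in>cimg c"
 shows "fcoef c \<beta> v y = (\<Sum>b\<in>Basis. (v \<bullet> b) * fcoef c \<beta> b y)"
proof -
 have "linear (coord_inv A c (cinv c y))"
  by (rule coord_inv_linear[OF atlas_charts[OF assms(2)] is_chartD(5)[OF is_chart[OF assms(2)] assms(3)]])
 from linear_compose[OF this assms(1)] have "linear (%v. fcoef c \<beta> v y)"
  unfolding fcoef_def by (simp add: o_def)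
 from linear_eq_sum_Basis[OF this, of v] show ?thesis by simp
qed

lemma fcoef_frechet_sum:
 assumes \<beta>: "smooth_form A W \<beta>" "open W" and c: "c\<in>A" and y: "y\<in>cmap c ` (W Int cdom c)"
 shows "FD (fcoef c \<beta> v) y u = (\<Sum>b\<in>Basis. (v \<bullet> b) * FD (fcoef c \<beta> b) y u)"
proof -
 have o: "open (cmap c ` (W Int cdom c))" by (rule open_image[OF c \<beta>(2)])
 have d: "(fcoef c \<beta> b has_derivative FD (fcoef c \<beta> b) y) (at y)" for b
  by (rule Cn_on_deriv[OF smooth_formD(2)[OF \<beta>(1) c \<beta>(2), of "Suc 0"] y])
 have "((%y. \<Sum>b\<in>Basis. (v \<bullet> b) * fcoef c \<beta> b y) has_derivative (%u. \<Sum>b\<in>Basis. (v \<bullet> b) * FD (fcoef c \<beta> b) y u)) (at y)"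
  by (intro has_derivative_sum has_derivative_mult_right d)
 hence "(fcoef c \<beta> v has_derivative (%u. \<Sum>b\<in>Basis. (v \<bullet> b) * FD (fcoef c \<beta> b) y u)) (at y)"
 proof (rule has_derivative_local[OF _ o y])
  fix z assume z: "z\<in>cmap c ` (W Int cdom c)"
  hence "cinv c z\<in>W" "z\<in>cimg c" using is_chartD(3)[OF is_chart[OF c]] by auto
  thus "(\<Sum>b\<in>Basis. (v \<bullet> b) * fcoef c \<beta> b z) = fcoef c \<beta> v z"
   using fcoef_sum[of \<beta> c z v] smooth_formD(1)[OF \<beta>(1)] c by simp
 qed
 from FD_eqI[OF this, of u] show ?thesis .
qed

lemma dcoef_bilinear:
 assumes \<beta>: "smooth_form A W \<beta>" "open W" and c: "c\<in>A" and y: "y\<in>cmap c ` (W Int cdom c)"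
 shows "bilinear (dcoef c \<beta> y)" "dcoef c \<beta> y u v = - dcoef c \<beta> y v u"
proof -
 have 1: "linear (FD (fcoef c \<beta> b) y)" for b
  using Cn_on_deriv[OF smooth_formD(2)[OF \<beta>(1) c \<beta>(2), of "Suc 0"] y] has_derivative_linear by blast
 have 2: "linear (%v. FD (fcoef c \<beta> v) y u)" for u
 proof -
  have eq: "(%v. FD (fcoef c \<beta> v) y u) = (%v. \<Sum>b\<in>Basis. (v \<bullet> b) * FD (fcoef c \<beta> b) y u)"
   by (rule ext) (rule fcoef_frechet_sum[OF assms])
  show ?thesis unfolding eq
   by (intro linearI) (simp_all add: inner_add_left distrib_right sum.distrib sum_distrib_left mult.assoc)
 qed
 show "bilinear (dcoef c \<beta> y)"
  unfolding bilinear_def dcoef_def by (intro conjI allI linear_compose_sub 1 2)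
qed (simp add: dcoef_def)

text \<open>Naturality of the exterior derivative under a change of charts; the second derivatives of the
  transition map cancel by symmetry.\<close>

lemma ext_deriv_chart:
 assumes \<beta>: "smooth_form A W \<beta>" "open W" and p: "p\<in>W" and c: "c\<in>A" "p\<in>cdom c"
 shows "ext_deriv A \<beta> p u v = dcoef c \<beta> (cmap c p) (coord A c p u) (coord A c p v)"
proof -
 have pc: "p\<in>carrier A" using c cdom_carrier by blast
 let ?d = "chart_at A p"
 have d: "?d\<in>A" "p\<in>cdom ?d" using chart_at[OF pc] by auto
 note cd = chartD[OF d(1)] and cc = chartD[OF c(1)]
 have ch: "c\<in>charts 1 A" "?d\<in>charts 1 A" using c d atlas_charts by auto
 let ?\<tau> = "cmap c o cinv ?d" and ?z = "cmap ?d p" and ?y = "cmap c p"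
 define U where "U = cmap ?d ` (W Int cdom c Int cdom ?d)"
 have oU: "open U" unfolding U_def by (rule open_image[OF d(1)]) (use \<beta>(2) cc(1) in auto)
 have zU: "?z\<in>U" using p c d by (auto simp: U_def)
 have \<tau>2: "Cn_on (Suc (Suc 0)) ?\<tau> U"
  by (rule Cn_on_subset[OF Cn_transition_A[OF d(1) c(1)]]) (auto simp: U_def)
 have \<tau>U: "?\<tau> z\<in>cmap c ` (W Int cdom c)" if "z\<in>U" for z using that cd(3) by (auto simp: U_def)
 have D\<tau>: "(?\<tau> has_derivative FD ?\<tau> z) (at z)" if "z\<in>U" for z
  by (rule Cn_on_deriv[OF \<tau>2 that])
 have D2: "((%z. FD ?\<tau> z v) has_derivative FD (%z. FD ?\<tau> z v) ?z) (at ?z)" for v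
  by (rule Cn_on_deriv[OF _ zU, where n=0]) (use \<tau>2 in simp)
 have y: "?y\<in>cmap c ` (W Int cdom c)" "?\<tau> ?z = ?y" using p c d cd by auto
 have Da: "(fcoef c \<beta> b has_derivative FD (fcoef c \<beta> b) ?y) (at ?y)" for b
  by (rule Cn_on_deriv[OF smooth_formD(2)[OF \<beta>(1) c(1) \<beta>(2), of "Suc 0"] y(1)])
 have eq: "fcoef ?d \<beta> v z = (\<Sum>b\<in>Basis. (FD ?\<tau> z v \<bullet> b) * fcoef c \<beta> b (?\<tau> z))" if z: "z\<in>U" for v z
 proof -
  obtain q where q: "q\<in>W" "q\<in>cdom c" "q\<in>cdom ?d" "z = cmap ?d q" using z by (auto simp: U_def)
  have t: "FD ?\<tau> z v = tr ?d c q v" by (simp add: tr_def q)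
  have i: "cinv ?d z = q" "cinv c (?\<tau> z) = q" using q cd(3) cc(3) by auto
  have "coord_inv A ?d q v = coord_inv A c q (tr ?d c q v)"
   using charts_cdom[OF ch(1)] chart_at[of q] chart_at_1[of q] q ch
   unfolding coord_inv_eq_tr by (subst tr_chain) auto
  hence "fcoef ?d \<beta> v z = fcoef c \<beta> (FD ?\<tau> z v) (?\<tau> z)"
   unfolding fcoef_def i t by simp
  also have "\<dots> = (\<Sum>b\<in>Basis. (FD ?\<tau> z v \<bullet> b) * fcoef c \<beta> b (?\<tau> z))"
   using q i(2) by (intro fcoef_sum[OF _ c(1)]) (auto simp: smooth_formD(1)[OF \<beta>(1)] cd(3))
  finally show ?thesis .
 qed
 let ?D2 = "%v u. FD (%z. FD ?\<tau> z v) ?z u" and ?D = "FD ?\<tau> ?z"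
 have der: "FD (fcoef ?d \<beta> v) ?z u =
   (\<Sum>b\<in>Basis. (?D v \<bullet> b) * FD (fcoef c \<beta> b) ?y (?D u) + (?D2 v u \<bullet> b) * fcoef c \<beta> b ?y)" for u v
 proof -
  have "((%z. \<Sum>b\<in>Basis. (FD ?\<tau> z v \<bullet> b) * fcoef c \<beta> b (?\<tau> z)) has_derivative
    (%u. \<Sum>b\<in>Basis. (?D v \<bullet> b) * FD (fcoef c \<beta> b) ?y (?D u) + (?D2 v u \<bullet> b) * fcoef c \<beta> b (?\<tau> ?z))) (at ?z)"
  proof (intro has_derivative_sum has_derivative_mult)
   fix b
   show "((%z. FD ?\<tau> z v \<bullet> b) has_derivative (%u. ?D2 v u \<bullet> b)) (at ?z)"
    by (rule has_derivative_inner_left[OF D2])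
   show "((%z. fcoef c \<beta> b (?\<tau> z)) has_derivative (%u. FD (fcoef c \<beta> b) ?y (?D u))) (at ?z)"
    by (rule has_derivative_compose[OF D\<tau>[OF zU]]) (use Da y(2) in simp)
  qed
  hence "(fcoef ?d \<beta> v has_derivative
    (%u. \<Sum>b\<in>Basis. (?D v \<bullet> b) * FD (fcoef c \<beta> b) ?y (?D u) + (?D2 v u \<bullet> b) * fcoef c \<beta> b (?\<tau> ?z))) (at ?z)"
   by (rule has_derivative_local[OF _ oU zU]) (simp add: eq)
  from FD_eqI[OF this, of u] show ?thesis unfolding y(2) .
 qed
 have sym: "?D2 v u = ?D2 u v" by (rule second_derivative_symmetric[OF oU zU \<tau>2])
 have co: "coord A c p w = ?D w" for w by (simp add: coord_def)
 have "ext_deriv A \<beta> p u v = FD (fcoef ?d \<beta> v) ?z u - FD (fcoef ?d \<beta> u) ?z v"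
  by (simp add: ext_deriv_def Let_def fcoef_def[abs_def])
 also have "\<dots> = (\<Sum>b\<in>Basis. (?D v \<bullet> b) * FD (fcoef c \<beta> b) ?y (?D u)) -
   (\<Sum>b\<in>Basis. (?D u \<bullet> b) * FD (fcoef c \<beta> b) ?y (?D v))"
  unfolding der by (simp add: sum.distrib sym)
 also have "\<dots> = dcoef c \<beta> ?y (?D u) (?D v)"
  unfolding dcoef_def by (simp only: fcoef_frechet_sum[OF \<beta> c(1) y(1), of "?D u"] fcoef_frechet_sum[OF \<beta> c(1) y(1), of "?D v"])
 finally show ?thesis by (simp add: co)
qed

end

section \<open>Contact Hamiltonian vector fields\<close>

locale contact_family = manifold A for A :: "('a::t2_space, 'e::euclidean_space) chart set" +
 fixes \<zeta> :: "'a => 'e set" and I :: "real set" and \<alpha> :: "real => 'a => 'e => real"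
 assumes I: "open I" and contact: "!!t. t\<in>I ==> contact_form A \<zeta> (\<alpha> t)"
  and smooth_\<alpha>: "smooth_form_family A (carrier A \<times> I) \<alpha>"
begin

lemma form_smooth: "t\<in>I ==> smooth_form A (carrier A) (\<alpha> t)"
 using contact by (auto simp: contact_form_on_def)

lemma form_linear: "t\<in>I ==> p\<in>carrier A ==> linear (\<alpha> t p)"
 using smooth_formD(1)[OF form_smooth] .

lemma form_kernel: "t\<in>I ==> p\<in>carrier A ==> \<zeta> p = {v. \<alpha> t p v = 0}"
 using contact by (auto simp: contact_form_on_def)

lemma form_nonzero: "t\<in>I ==> p\<in>carrier A ==> \<exists>v. \<alpha> t p v \<noteq> 0"
 using contact unfolding contact_form_on_def by blast

lemma form_nondegenerate:
 "t\<in>I ==> p\<in>carrier A ==> \<alpha> t p u = 0 ==> (!!v. \<alpha> t p v = 0 ==> ext_deriv A (\<alpha> t) p u v = 0) ==> u = 0"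
 using contact unfolding contact_form_on_def by blast

lemma ext_deriv_bilinear:
 assumes "t\<in>I" "p\<in>carrier A"
 shows "bilinear (ext_deriv A (\<alpha> t) p)" "ext_deriv A (\<alpha> t) p u v = - ext_deriv A (\<alpha> t) p v u"
proof -
 obtain c where c: "c\<in>A" "p\<in>cdom c" using assms carrierE by blast
 have y: "cmap c p\<in>cmap c ` (carrier A Int cdom c)" using c assms by auto
 note E = ext_deriv_chart[OF form_smooth[OF assms(1)] open_carrier assms(2) c]
 note B = dcoef_bilinear[OF form_smooth[OF assms(1)] open_carrier c(1) y]
 have l: "linear (coord A c p)" using coord_linear atlas_charts[OF c(1)] c(2) by blast
 show "ext_deriv A (\<alpha> t) p u v = - ext_deriv A (\<alpha> t) p v u" unfolding E by (rule B(2))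
 show "bilinear (ext_deriv A (\<alpha> t) p)"
  using B(1) unfolding bilinear_def E
  using linear_compose[OF l] by (auto simp: o_def)
qed

lemma solve:
 assumes "t\<in>I" "p\<in>carrier A"
 shows "(!!v. ext_deriv A (\<alpha> t) p w v + \<alpha> t p w * \<alpha> t p v = 0) ==> w = 0"
  and "linear \<gamma> ==> \<exists>w. \<forall>v. ext_deriv A (\<alpha> t) p w v + \<alpha> t p w * \<alpha> t p v = \<gamma> v"
proof -
 note prem = form_linear[OF assms] ext_deriv_bilinear(1)[OF assms] ext_deriv_bilinear(2)[OF assms]
 have nd: "u = 0" if "\<alpha> t p u = 0" "!!v. \<alpha> t p v = 0 ==> ext_deriv A (\<alpha> t) p u v = 0" for u
  using form_nondegenerate[OF assms that] .
 show "w = 0" if "!!v. ext_deriv A (\<alpha> t) p w v + \<alpha> t p w * \<alpha> t p v = 0"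
  by (rule contact_solve(1)[OF prem nd that]) auto
 show "\<exists>w. \<forall>v. ext_deriv A (\<alpha> t) p w v + \<alpha> t p w * \<alpha> t p v = \<gamma> v" if "linear \<gamma>"
  by (rule contact_solve(2)[OF prem nd that]) auto
qed

text \<open>The conditions \<open>\<alpha> (Reeb) = 1\<close> and \<open>d\<alpha> (Reeb, -) = 0\<close>, combined into one equation.\<close>

definition Reeb :: "real => 'a => 'e" where
 "Reeb t p = (SOME w. \<forall>v. ext_deriv A (\<alpha> t) p w v + \<alpha> t p w * \<alpha> t p v = \<alpha> t p v)"

lemma Reeb_eq:
 assumes "t\<in>I" "p\<in>carrier A"
 shows "ext_deriv A (\<alpha> t) p (Reeb t p) v + \<alpha> t p (Reeb t p) * \<alpha> t p v = \<alpha> t p v"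
 using someI_ex[OF solve(2)[OF assms form_linear[OF assms]]] unfolding Reeb_def by blast

lemma Reeb:
 assumes "t\<in>I" "p\<in>carrier A"
 shows "\<alpha> t p (Reeb t p) = 1" "ext_deriv A (\<alpha> t) p (Reeb t p) v = 0"
proof -
 let ?R = "Reeb t p"
 have e: "ext_deriv A (\<alpha> t) p ?R v = (1 - \<alpha> t p ?R) * \<alpha> t p v" for v
  using Reeb_eq[OF assms, of v] by (simp add: algebra_simps)
 have "ext_deriv A (\<alpha> t) p ?R ?R = 0" using ext_deriv_bilinear(2)[OF assms, of ?R ?R] by simp
 hence "\<alpha> t p ?R = 1 \<or> \<alpha> t p ?R = 0" using e[of ?R] by auto
 moreover have False if z: "\<alpha> t p ?R = 0"
 proof -
  have "?R = 0" by (rule form_nondegenerate[OF assms z]) (simp add: e)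
  hence "\<alpha> t p v = 0" for v
   using e[of v] z bilinear_lzero[OF ext_deriv_bilinear(1)[OF assms], of v] by simp
  thus False using form_nonzero[OF assms] by blast
 qed
 ultimately show R: "\<alpha> t p ?R = 1" by blast
 show "ext_deriv A (\<alpha> t) p ?R v = 0" using e[of v] R by simp
qed

lemma form_coef_smooth: "c\<in>A ==> Cn_on n (%(y, t). fcoef c (\<alpha> t) v y) (cimg c \<times> I)"
proof -
 assume c: "c\<in>A"
 have S: "{(y, t). y\<in>cimg c & (cinv c y, t)\<in>carrier A \<times> I} = cimg c \<times> I"
  using is_chartD(5)[OF is_chart[OF c]] cdom_carrier[OF c] by auto
 have "Ck_on \<infinity> (%(y, t). \<alpha> t (cinv c y) (coord_inv A c (cinv c y) v)) {(y, t). y\<in>cimg c & (cinv c y, t)\<in>carrier A \<times> I}"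
  using smooth_\<alpha> c unfolding smooth_form_family_def by blast
 thus ?thesis unfolding S Ck_on_def fcoef_def by simp
qed

lemma open_cimg_I: "c\<in>A ==> open (cimg c \<times> I)"
 using is_chartD(2)[OF is_chart] I by (auto intro: open_Times)

lemma partial_eq:
 assumes "c\<in>A" "y\<in>cimg c" "t\<in>I"
 shows "FD (fcoef c (\<alpha> t) v) y u = FD (%(y, t). fcoef c (\<alpha> t) v y) (y, t) (u, 0)"
proof -
 have "(%(y, t). fcoef c (\<alpha> t) v y) differentiable (at (y, t))"
  by (rule differentiableI[OF Cn_on_deriv[OF form_coef_smooth[OF assms(1)]]]) (use assms(2,3) in auto)
 from frechet_derivative_fst(2)[OF this, of u] show ?thesis by simp
qed

lemma dcoef_smooth:
 assumes c: "c\<in>A" shows "Cn_on n (%(y, t). dcoef c (\<alpha> t) y u v) (cimg c \<times> I)"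
proof (rule Cn_on_cong_imp[OF open_cimg_I[OF c]])
 show "Cn_on n (%x. FD (%(y, t). fcoef c (\<alpha> t) v y) x (u, 0)
   - FD (%(y, t). fcoef c (\<alpha> t) u y) x (v, 0)) (cimg c \<times> I)"
  by (intro Cn_on_diff Cn_on_frechet form_coef_smooth c open_cimg_I)
qed (auto simp: dcoef_def partial_eq[OF c])

text \<open>In coordinates the field solves a linear system whose matrix is that of \<open>d\<alpha> + \<alpha> \<otimes> \<alpha>\<close>, and solutions of
 linear systems are as smooth as the coefficients.\<close>

lemma solution_smooth:
 fixes Z :: "real => 'a => 'e" and g :: "'e => 'e \<times> real => real"
 assumes c: "c\<in>A"
  and Z: "!!p t v. p\<in>cdom c ==> t\<in>I ==>
    ext_deriv A (\<alpha> t) p (Z t p) v + \<alpha> t p (Z t p) * \<alpha> t p v = g (coord A c p v) (cmap c p, t)"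
  and g: "!!b. b\<in>Basis ==> Cn_on n (g b) (cimg c \<times> I)"
 shows "Cn_on n (%(y, t). coord A c (cinv c y) (Z t (cinv c y))) (cimg c \<times> I)"
proof (rule Cn_on_linear_solve[OF open_cimg_I[OF c], where M="%(y, t) w. \<Sum>b\<in>Basis. (dcoef c (\<alpha> t) y w b + fcoef c (\<alpha> t) w y * fcoef c (\<alpha> t) b y) *\<^sub>R b"])
 note cc = chartD[OF c]
 let ?M = "%(y, t) w. \<Sum>b\<in>Basis. (dcoef c (\<alpha> t) y w b + fcoef c (\<alpha> t) w y * fcoef c (\<alpha> t) b y) *\<^sub>R b"
 have c1: "c\<in>charts 1 A" by (rule atlas_charts[OF c])
 have pt: "cinv c y\<in>cdom c" "cinv c y\<in>carrier A" "cmap c (cinv c y) = y" "y\<in>cmap c ` (carrier A Int cdom c)" if "y\<in>cimg c" for y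
  using that cc cdom_carrier[OF c] by auto
 have val: "?M (y, t) w \<bullet> b = ext_deriv A (\<alpha> t) (cinv c y) (coord_inv A c (cinv c y) w) (coord_inv A c (cinv c y) b)
   + \<alpha> t (cinv c y) (coord_inv A c (cinv c y) w) * \<alpha> t (cinv c y) (coord_inv A c (cinv c y) b)"
  if "y\<in>cimg c" "t\<in>I" "b\<in>Basis" for y t w b
  using that pt[OF that(1)] c1
  by (simp add: inner_sum_left inner_Basis if_distrib fcoef_def ext_deriv_chart[OF form_smooth[OF that(2)] open_carrier _ c] cong: if_cong)
 have lin1: "linear (%w. fcoef c (\<alpha> t) w y)" if "y\<in>cimg c" "t\<in>I" for y t
  unfolding fcoef_def
  using linear_compose[OF coord_inv_linear[OF c1 pt(1)[OF that(1)]] form_linear[OF that(2) pt(2)[OF that(1)]]] by (simp add: o_def)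
 have lin2: "linear (%w. dcoef c (\<alpha> t) y w b)" if "y\<in>cimg c" "t\<in>I" for y t b
  using dcoef_bilinear(1)[OF form_smooth[OF that(2)] open_carrier c pt(4)[OF that(1)]] by (simp add: bilinear_def)
 show "linear (?M x)" if xI: "x\<in>cimg c \<times> I" for x
 proof -
  obtain y t where x: "x = (y, t)" "y\<in>cimg c" "t\<in>I" using xI by blast
  show ?thesis unfolding x(1) prod.case using lin1[OF x(2,3)] lin2[OF x(2,3)]
   by (intro linearI) (simp_all add: linear_iff sum.distrib[symmetric] scaleR_sum_right algebra_simps)
 qed
 show "w = 0" if x: "x\<in>cimg c \<times> I" and z: "?M x w = 0" for x w
 proof -
  obtain y t where xy: "x = (y, t)" "y\<in>cimg c" "t\<in>I" using x by blast
  let ?p = "cinv c y" and ?w = "coord_inv A c (cinv c y) w"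
  have z': "ext_deriv A (\<alpha> t) ?p ?w (coord_inv A c ?p b) + \<alpha> t ?p ?w * \<alpha> t ?p (coord_inv A c ?p b) = 0" if "b\<in>Basis" for b
   using val[OF xy(2,3) that, of w] z xy(1) by simp
  have l: "linear (%v. ext_deriv A (\<alpha> t) ?p ?w v + \<alpha> t ?p ?w * \<alpha> t ?p v)"
   using ext_deriv_bilinear(1)[OF xy(3) pt(2)[OF xy(2)]] form_linear[OF xy(3) pt(2)[OF xy(2)]]
   by (simp add: bilinear_def linear_iff algebra_simps)
  have "(%v. ext_deriv A (\<alpha> t) ?p ?w v + \<alpha> t ?p ?w * \<alpha> t ?p v) (coord_inv A c ?p v) = 0" for v
   using linear_eq_stdbasis[OF linear_compose[OF coord_inv_linear[OF c1 pt(1)[OF xy(2)]] l] linear_zero] z'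
   by (simp add: o_def fun_eq_iff)
  hence "ext_deriv A (\<alpha> t) ?p ?w v + \<alpha> t ?p ?w * \<alpha> t ?p v = 0" for v
   using coord_inv_coord[OF c1 pt(1)[OF xy(2)], of v] by metis
  hence "?w = 0" by (rule solve(1)[OF xy(3) pt(2)[OF xy(2)]])
  thus "w = 0" using coord_coord_inv[OF c1 pt(1)[OF xy(2)], of w] linear_0[OF coord_linear[OF c1 pt(1)[OF xy(2)]]] by simp
 qed
 show "Cn_on n (%x. ?M x b) (cimg c \<times> I)" for b
 proof -
  have "Cn_on n (%x. \<Sum>b'\<in>Basis. ((%(y, t). dcoef c (\<alpha> t) y b b') x + (%(y, t). fcoef c (\<alpha> t) b y) x * (%(y, t). fcoef c (\<alpha> t) b' y) x) *\<^sub>R b') (cimg c \<times> I)"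
   by (intro Cn_on_sum Cn_on_scaleR Cn_on_add Cn_on_mult dcoef_smooth form_coef_smooth open_cimg_I c Cn_on_const)
  thus ?thesis by (simp add: case_prod_unfold)
 qed
 have "Cn_on n (%x. \<Sum>b\<in>Basis. g b x *\<^sub>R b) (cimg c \<times> I)"
  by (intro Cn_on_sum Cn_on_scaleR Cn_on_const open_cimg_I c g)
 thus "Cn_on n (%x. ?M x (case x of (y, t) => coord A c (cinv c y) (Z t (cinv c y)))) (cimg c \<times> I)"
 proof (rule Cn_on_cong_imp[OF open_cimg_I[OF c], rotated])
  fix x assume "x\<in>cimg c \<times> I"
  then obtain y t where x: "x = (y, t)" "y\<in>cimg c" "t\<in>I" by blast
  show "(\<Sum>b\<in>Basis. g b x *\<^sub>R b) = ?M x (case x of (y, t) => coord A c (cinv c y) (Z t (cinv c y)))"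
  proof (rule euclidean_eqI)
   fix b :: 'e assume b: "b\<in>Basis"
   have "?M x (case x of (y, t) => coord A c (cinv c y) (Z t (cinv c y))) \<bullet> b = g b (y, t)"
    using val[OF x(2,3) b, of "coord A c (cinv c y) (Z t (cinv c y))"]
     Z[OF pt(1)[OF x(2)] x(3), of "coord_inv A c (cinv c y) b"] pt[OF x(2)] c1 by (simp add: x(1))
   thus "(\<Sum>b\<in>Basis. g b x *\<^sub>R b) \<bullet> b = ?M x (case x of (y, t) => coord A c (cinv c y) (Z t (cinv c y))) \<bullet> b"
    using b x(1) by (simp add: inner_sum_left inner_Basis if_distrib cong: if_cong)
  qed
 qed
qed

lemma Reeb_smooth: "c\<in>A ==> Cn_on n (%(y, t). coord A c (cinv c y) (Reeb t (cinv c y))) (cimg c \<times> I)"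
proof (rule solution_smooth[where g="%v (y, t). fcoef c (\<alpha> t) v y"])
 assume c: "c\<in>A"
 fix p t v assume pt: "p\<in>cdom c" "t\<in>I"
 have "p\<in>carrier A" "cinv c (cmap c p) = p" using pt c cdom_carrier is_chartD(3)[OF is_chart[OF c]] by auto
 thus "ext_deriv A (\<alpha> t) p (Reeb t p) v + \<alpha> t p (Reeb t p) * \<alpha> t p v = (case (cmap c p, t) of (y, t) => fcoef c (\<alpha> t) (coord A c p v) y)"
  using Reeb_eq[OF pt(2)] atlas_charts[OF c] pt(1) by (simp add: fcoef_def)
qed (auto intro: form_coef_smooth)

end

locale hamiltonian = contact_family A \<zeta> I \<alpha>
 for A :: "('a::t2_space, 'e::euclidean_space) chart set" and \<zeta> I \<alpha> +
 fixes h :: "'a \<times> real => real"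
 assumes h: "!!n. mfun (prod_atlas A I) n h (carrier A \<times> I)"
begin

definition ht :: "real => 'a => real" where "ht t p = h (p, t)"

lemma h_chart: "c\<in>A ==> Cn_on n (%(y, t). ht t (cinv c y)) (cimg c \<times> I)"
proof -
 assume c: "c\<in>A"
 have "Cn_on n (%x. h (cinv (pchart I c) x)) (cimg c \<times> I)"
  using h[of n] c cdom_carrier[OF c] unfolding mfun_def prod_atlas_eq
  by (auto simp: pchart_image Times_Int_Times Int_absorb1)
 thus ?thesis
  by (rule Cn_on_cong_imp[OF open_cimg_I[OF c], rotated]) (auto simp: ht_def pchart_cinv[OF is_chart[OF c]])
qed

lemma ht_smooth: "t\<in>I ==> mfun A n (ht t) (carrier A)"
 unfolding mfun_def
proof
 fix c assume t: "t\<in>I" and c: "c\<in>A"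
 from Cn_on_slice[OF h_chart[OF c] is_chartD(2)[OF is_chart[OF c]] I t]
 show "Cn_on n (%y. ht t (cinv c y)) (cmap c ` (carrier A Int cdom c))"
  using cdom_carrier[OF c] by (simp add: Int_absorb1)
qed

abbreviation "Dh t p \<equiv> Dfun A (ht t) p"

lemma Dh_linear: "t\<in>I ==> p\<in>carrier A ==> linear (Dh t p)"
 using Dfun_linear[OF ht_smooth open_carrier] .

text \<open>The contact Hamiltonian field: \<open>\<alpha> (X) = h\<close> and \<open>d\<alpha> (X, -) = dh (Reeb) \<alpha> - dh\<close>, combined into one
 equation.\<close>

definition X :: "real => 'a => 'e" where
 "X t p = (SOME w. \<forall>v. ext_deriv A (\<alpha> t) p w v + \<alpha> t p w * \<alpha> t p v
   = Dh t p (Reeb t p) * \<alpha> t p v - Dh t p v + ht t p * \<alpha> t p v)"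

lemma X_eq:
 assumes "t\<in>I" "p\<in>carrier A"
 shows "ext_deriv A (\<alpha> t) p (X t p) v + \<alpha> t p (X t p) * \<alpha> t p v
   = Dh t p (Reeb t p) * \<alpha> t p v - Dh t p v + ht t p * \<alpha> t p v"
proof -
 have "linear (%v. Dh t p (Reeb t p) * \<alpha> t p v - Dh t p v + ht t p * \<alpha> t p v)"
  using Dh_linear[OF assms] form_linear[OF assms] by (simp add: linear_iff algebra_simps)
 from someI_ex[OF solve(2)[OF assms this]] show ?thesis unfolding X_def by blast
qed

lemma X:
 assumes "t\<in>I" "p\<in>carrier A"
 shows "\<alpha> t p (X t p) = ht t p" "ext_deriv A (\<alpha> t) p (X t p) v = Dh t p (Reeb t p) * \<alpha> t p v - Dh t p v"
  "Dh t p (X t p) = ht t p * Dh t p (Reeb t p)"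
proof -
 have "ext_deriv A (\<alpha> t) p (X t p) (Reeb t p) = 0"
  using ext_deriv_bilinear(2)[OF assms, of "X t p" "Reeb t p"] Reeb(2)[OF assms] by simp
 thus 1: "\<alpha> t p (X t p) = ht t p" using X_eq[OF assms, of "Reeb t p"] Reeb(1)[OF assms] by simp
 show 2: "ext_deriv A (\<alpha> t) p (X t p) v = Dh t p (Reeb t p) * \<alpha> t p v - Dh t p v" for v
  using X_eq[OF assms, of v] 1 by simp
 have "ext_deriv A (\<alpha> t) p (X t p) (X t p) = 0" using ext_deriv_bilinear(2)[OF assms, of "X t p" "X t p"] by simp
 thus "Dh t p (X t p) = ht t p * Dh t p (Reeb t p)" using 2[of "X t p"] 1 by (simp add: mult.commute)
qed

lemma Dh_chart:
 assumes c: "c\<in>A" "p\<in>cdom c" "t\<in>I"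
 shows "Dh t p v = FD (%(y, t). ht t (cinv c y)) (cmap c p, t) (coord A c p v, 0)"
proof -
 have p: "p\<in>carrier A" using c cdom_carrier by blast
 have "(%(y, t). ht t (cinv c y)) differentiable (at (cmap c p, t))"
  by (rule differentiableI[OF Cn_on_deriv[OF h_chart[OF c(1)]]]) (use c(2,3) in auto)
 from frechet_derivative_fst(2)[OF this, of "coord A c p v"] show ?thesis
  using Dfun_chart(1)[OF ht_smooth[OF c(3)] open_carrier p atlas_charts[OF c(1)] c(2)] by simp
qed

lemma X_smooth: "c\<in>A ==> Cn_on n (%(y, t). coord A c (cinv c y) (X t (cinv c y))) (cimg c \<times> I)"
proof -
 assume c: "c\<in>A"
 note cc = chartD[OF c]
 let ?h = "%(y, t). ht t (cinv c y)" and ?R = "%(y, t). coord A c (cinv c y) (Reeb t (cinv c y))"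
 let ?g = "%v x. FD ?h x (?R x, 0) * (%(y, t). fcoef c (\<alpha> t) v y) x
   - FD ?h x (v, 0) + ?h x * (%(y, t). fcoef c (\<alpha> t) v y) x"
 show ?thesis
 proof (rule solution_smooth[OF c, where g="?g"])
  show "Cn_on n (?g v) (cimg c \<times> I)" for v
   by (intro Cn_on_add Cn_on_diff Cn_on_mult Cn_on_frechet_apply Cn_on_Pair Cn_on_const h_chart c Reeb_smooth
     form_coef_smooth open_cimg_I)
  fix p t v assume pt: "p\<in>cdom c" "t\<in>I"
  have p: "p\<in>carrier A" "cinv c (cmap c p) = p" using pt c cdom_carrier cc(3) by auto
  have f: "fcoef c (\<alpha> t) (coord A c p v) (cmap c p) = \<alpha> t p v"
   using p(2) atlas_charts[OF c] pt(1) by (simp add: fcoef_def)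
  show "ext_deriv A (\<alpha> t) p (X t p) v + \<alpha> t p (X t p) * \<alpha> t p v = ?g (coord A c p v) (cmap c p, t)"
   using X_eq[OF pt(2) p(1), of v] Dh_chart[OF c pt] p(2) f by simp
 qed
qed

lemma X_family_smooth: "W <= carrier A \<times> I ==> smooth_vector_field_family A W X"
 unfolding smooth_vector_field_family_def Ck_on_def
proof (intro ballI allI impI)
 fix c n assume W: "W <= carrier A \<times> I" and c: "c\<in>A"
 show "Cn_on n (%(y, t). coord A c (cinv c y) (X t (cinv c y))) {(y, t). y\<in>cimg c & (cinv c y, t)\<in>W}"
  by (rule Cn_on_subset[OF X_smooth[OF c]]) (use W in auto)
qed

lemma X_smooth_t: "t\<in>I ==> c\<in>A ==> Cn_on n (%y. coord A c (cinv c y) (X t (cinv c y))) (cimg c)"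
proof -
 assume t: "t\<in>I" and c: "c\<in>A"
 from Cn_on_slice[OF X_smooth[OF c] is_chartD(2)[OF is_chart[OF c]] I t] show ?thesis by simp
qed

text \<open>Cartan's formula \<open>L\<^sub>X \<alpha> = d\<alpha> (X, -) + d (\<alpha> (X))\<close> in a chart, where it is the product rule.\<close>

lemma lie_deriv_X:
 assumes t: "t\<in>I" and p: "p\<in>carrier A"
 shows "lie_deriv A (X t) (\<alpha> t) p v = Dh t p (Reeb t p) * \<alpha> t p v"
proof -
 let ?c = "chart_at A p" and ?y = "cmap (chart_at A p) p"
 have c: "?c\<in>A" "p\<in>cdom ?c" using chart_at[OF p] by auto
 note cc = chartD[OF c(1)]
 let ?Y = "%y. coord A ?c (cinv ?c y) (X t (cinv ?c y))"
 have y: "?y\<in>cimg ?c" "?y\<in>cmap ?c ` (carrier A Int cdom ?c)" using c p by auto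
 have DY: "(?Y has_derivative FD ?Y ?y) (at ?y)"
  by (rule Cn_on_deriv[OF X_smooth_t[OF t c(1), of "Suc 0"] y(1)])
 have Da: "(fcoef ?c (\<alpha> t) b has_derivative FD (fcoef ?c (\<alpha> t) b) ?y) (at ?y)" for b
  by (rule Cn_on_deriv[OF smooth_formD(2)[OF form_smooth[OF t] c(1) open_carrier, of "Suc 0"] y(2)])
 have Yp: "?Y ?y = X t p" using cc(3)[OF c(2)] coord_chart_at[OF p] by simp
 have "((%y. \<Sum>b\<in>Basis. (?Y y \<bullet> b) * fcoef ?c (\<alpha> t) b y) has_derivative
   (%v. \<Sum>b\<in>Basis. (?Y ?y \<bullet> b) * FD (fcoef ?c (\<alpha> t) b) ?y v + (FD ?Y ?y v \<bullet> b) * fcoef ?c (\<alpha> t) b ?y)) (at ?y)"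
  by (intro has_derivative_sum has_derivative_mult has_derivative_inner_left DY Da)
 hence "((%y. ht t (cinv ?c y)) has_derivative
   (%v. \<Sum>b\<in>Basis. (?Y ?y \<bullet> b) * FD (fcoef ?c (\<alpha> t) b) ?y v + (FD ?Y ?y v \<bullet> b) * fcoef ?c (\<alpha> t) b ?y)) (at ?y)"
 proof (rule has_derivative_local[OF _ cc(2) y(1)])
  fix z assume z: "z\<in>cimg ?c"
  have q: "cinv ?c z\<in>cdom ?c" "cinv ?c z\<in>carrier A" using cc(5)[OF z] cdom_carrier[OF c(1)] by auto
  have "(\<Sum>b\<in>Basis. (?Y z \<bullet> b) * fcoef ?c (\<alpha> t) b z) = fcoef ?c (\<alpha> t) (?Y z) z"
   by (rule fcoef_sum[symmetric]) (use form_linear[OF t q(2)] c(1) z in simp_all)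
  also have "\<dots> = ht t (cinv ?c z)"
   using X(1)[OF t q(2)] q(1) atlas_charts[OF c(1)] by (simp add: fcoef_def)
  finally show "(\<Sum>b\<in>Basis. (?Y z \<bullet> b) * fcoef ?c (\<alpha> t) b z) = ht t (cinv ?c z)" .
 qed
 from FD_eqI[OF this, of v]
 have "Dh t p v = (\<Sum>b\<in>Basis. (X t p \<bullet> b) * FD (fcoef ?c (\<alpha> t) b) ?y v) + (\<Sum>b\<in>Basis. (FD ?Y ?y v \<bullet> b) * fcoef ?c (\<alpha> t) b ?y)"
  unfolding Dfun_def Yp sum.distrib .
 also have "(\<Sum>b\<in>Basis. (X t p \<bullet> b) * FD (fcoef ?c (\<alpha> t) b) ?y v) = FD (fcoef ?c (\<alpha> t) (X t p)) ?y v"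
  by (rule fcoef_frechet_sum[OF form_smooth[OF t] open_carrier c(1) y(2), symmetric])
 also have "(\<Sum>b\<in>Basis. (FD ?Y ?y v \<bullet> b) * fcoef ?c (\<alpha> t) b ?y) = fcoef ?c (\<alpha> t) (FD ?Y ?y v) ?y"
  by (rule fcoef_sum[symmetric]) (use form_linear[OF t p] cc(3)[OF c(2)] c y in simp_all)
 also have "\<dots> = \<alpha> t p (FD ?Y ?y v)"
  using cc(3)[OF c(2)] coord_inv_chart_at[OF p] by (simp add: fcoef_def)
 finally have "\<alpha> t p (FD ?Y ?y v) = Dh t p v - FD (fcoef ?c (\<alpha> t) (X t p)) ?y v" by simp
 moreover have "lie_deriv A (X t) (\<alpha> t) p v = FD (fcoef ?c (\<alpha> t) v) ?y (X t p) + \<alpha> t p (FD ?Y ?y v)"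
  by (simp add: lie_deriv_def Let_def fcoef_def[abs_def])
 moreover have "ext_deriv A (\<alpha> t) p (X t p) v = FD (fcoef ?c (\<alpha> t) v) ?y (X t p) - FD (fcoef ?c (\<alpha> t) (X t p)) ?y v"
  by (simp add: ext_deriv_def Let_def fcoef_def[abs_def])
 ultimately show ?thesis using X(2)[OF t p, of v] by simp
qed

lemma X_contact:
 assumes t: "t\<in>I" and U: "open U" "U <= carrier A"
 shows "contact_vector_field A \<zeta> U (X t)"
 unfolding contact_vector_field_def
proof (intro conjI allI impI)
 have "Cn_on n (%(y, s::real). coord A c (cinv c y) (X t (cinv c y))) {(y, s). y\<in>cimg c & (cinv c y, s)\<in>U \<times> UNIV}" if c: "c\<in>A" for n c
 proof -
  have "Cn_on n (%x. (%y. coord A c (cinv c y) (X t (cinv c y))) (fst x)) (cimg c \<times> (UNIV::real set))"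
  proof (rule Cn_on_compose[OF _ is_chartD(2)[OF is_chart[OF c]] _ X_smooth_t[OF t c]])
   show o: "open (cimg c \<times> (UNIV::real set))" by (rule open_Times[OF is_chartD(2)[OF is_chart[OF c]] open_UNIV])
   show "Cn_on n fst (cimg c \<times> (UNIV::real set))" by (rule Cn_on_fst[OF o Cn_on_id])
  qed auto
  from Cn_on_subset[OF this, of "{(y, s). y\<in>cimg c & (cinv c y, s)\<in>U \<times> UNIV}"]
  show ?thesis by (simp add: case_prod_unfold subset_iff mem_Times_iff)
 qed
 hence "smooth_vector_field_family A (U \<times> UNIV) (%_. X t)"
  unfolding smooth_vector_field_family_def Ck_on_def by blast
 thus "smooth_vector_field_on A U (X t)"
  unfolding smooth_vector_field_on_def smooth_vector_field_family_on_def
  using U by (auto intro!: exI[of _ "U \<times> UNIV"] exI[of _ "%_. X t"] open_Times)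
 fix W \<alpha>' assume W: "open W & W <= U & contact_form_on A W \<zeta> \<alpha>'"
 hence oW: "open W" and WU: "W <= carrier A" and \<alpha>': "smooth_form A W \<alpha>'"
  and ker: "!!q. q\<in>W ==> \<zeta> q = {v. \<alpha>' q v = 0} & \<zeta> q \<noteq> UNIV" using U by (auto simp: contact_form_on_def)
 define g where "g q = \<alpha>' q (Reeb t q)" for q
 have propor: "\<alpha>' q v = g q * \<alpha> t q v" if q: "q\<in>W" for q v
 proof -
  have qc: "q\<in>carrier A" using q WU by blast
  have "\<alpha> t q (v - \<alpha> t q v *\<^sub>R Reeb t q) = 0"
   using linear_diff[OF form_linear[OF t qc]] linear_cmul[OF form_linear[OF t qc]] Reeb(1)[OF t qc] by simp
  hence "\<alpha>' q (v - \<alpha> t q v *\<^sub>R Reeb t q) = 0" using ker[OF q] form_kernel[OF t qc] by auto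
  thus ?thesis
   using linear_diff[OF smooth_formD(1)[OF \<alpha>' q]] linear_cmul[OF smooth_formD(1)[OF \<alpha>' q]] by (simp add: g_def)
 qed
 have "\<exists>k. \<forall>v. lie_deriv A (X t) \<alpha>' p v = k * \<alpha>' p v" if p: "p\<in>W" for p
 proof -
  have pc: "p\<in>carrier A" using p WU by blast
  have g0: "g p \<noteq> 0" using ker[OF p] propor[OF p] by auto
  let ?c = "chart_at A p" and ?y = "cmap (chart_at A p) p"
  have c: "?c\<in>A" "p\<in>cdom ?c" using chart_at[OF pc] by auto
  note cc = chartD[OF c(1)]
  let ?Y = "%y. coord A ?c (cinv ?c y) (X t (cinv ?c y))" and ?R = "%y. coord A ?c (cinv ?c y) (Reeb t (cinv ?c y))"
  let ?S = "cmap ?c ` (W Int cdom ?c)"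
  have oS: "open ?S" by (rule open_image[OF c(1) oW])
  have yS: "?y\<in>?S" using p c by auto
  have "C1_on ?R (cimg ?c)" using Cn_on_slice[OF Reeb_smooth[OF c(1)] cc(2) I t] by simp
  hence R1: "C1_on ?R ?S" by (rule Cn_on_subset) auto
  have "C1_on (%y. \<Sum>b\<in>Basis. (?R y \<bullet> b) * fcoef ?c \<alpha>' b y) ?S"
   using R1 by (intro Cn_on_sum Cn_on_mult Cn_on_inner Cn_on_const smooth_formD(2)[OF \<alpha>' c(1) oW] oS)
  hence G1: "C1_on (%y. g (cinv ?c y)) ?S"
  proof (rule Cn_on_cong_imp[OF oS, rotated])
   fix z assume z: "z\<in>?S"
   hence q: "cinv ?c z\<in>W" "cinv ?c z\<in>cdom ?c" "z\<in>cimg ?c" using cc(3) by auto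
   show "(\<Sum>b\<in>Basis. (?R z \<bullet> b) * fcoef ?c \<alpha>' b z) = g (cinv ?c z)"
    using fcoef_sum[of \<alpha>' ?c z "?R z"] smooth_formD(1)[OF \<alpha>' q(1)] c(1) q(2,3) atlas_charts[OF c(1)]
    by (simp add: fcoef_def g_def)
  qed
  let ?G = "%y. g (cinv ?c y)"
  have DG: "(?G has_derivative FD ?G ?y) (at ?y)" by (rule Cn_on_deriv[OF G1 yS])
  have Da: "(fcoef ?c (\<alpha> t) v has_derivative FD (fcoef ?c (\<alpha> t) v) ?y) (at ?y)" for v
   by (rule Cn_on_deriv[OF smooth_formD(2)[OF form_smooth[OF t] c(1) open_carrier, of "Suc 0"]]) (use pc c in auto)
  have "FD (fcoef ?c \<alpha>' v) ?y u = g p * FD (fcoef ?c (\<alpha> t) v) ?y u + FD ?G ?y u * \<alpha> t p v" for u v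
  proof -
   have "((%y. ?G y * fcoef ?c (\<alpha> t) v y) has_derivative (%u. ?G ?y * FD (fcoef ?c (\<alpha> t) v) ?y u + FD ?G ?y u * fcoef ?c (\<alpha> t) v ?y)) (at ?y)"
    by (rule has_derivative_mult[OF DG Da])
   hence "(fcoef ?c \<alpha>' v has_derivative (%u. ?G ?y * FD (fcoef ?c (\<alpha> t) v) ?y u + FD ?G ?y u * fcoef ?c (\<alpha> t) v ?y)) (at ?y)"
    by (rule has_derivative_local[OF _ oS yS]) (use propor cc(3) in \<open>auto simp: fcoef_def\<close>)
   from FD_eqI[OF this, of u] show ?thesis
    using cc(3)[OF c(2)] coord_inv_chart_at[OF pc] by (simp add: fcoef_def)
  qed
  hence lie: "lie_deriv A (X t) \<alpha>' p v = g p * lie_deriv A (X t) (\<alpha> t) p v + FD ?G ?y (X t p) * \<alpha> t p v" for v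
   using propor[OF p] by (simp add: lie_deriv_def Let_def fcoef_def[abs_def] algebra_simps)
  show ?thesis
   by (rule exI[of _ "Dh t p (Reeb t p) + FD ?G ?y (X t p) / g p"])
    (use g0 in "simp add: lie lie_deriv_X[OF t pc] propor[OF p] field_simps")
 qed
 thus "\<exists>f. \<forall>p\<in>W. \<forall>v. lie_deriv A (X t) \<alpha>' p v = f p * \<alpha>' p v" by metis
qed

end


section \<open>Tangent spaces\<close>

lemma derivative_in_subspace:
 fixes f :: "'a::real_normed_vector => 'b::euclidean_space"
 assumes f: "(f has_derivative D) (at y)" and W: "subspace W" "f y\<in>W"
  and \<delta>: "\<delta> > 0" "!!s. 0 < s ==> s < \<delta> ==> f (y + s *\<^sub>R w)\<in>W"
 shows "D w\<in>W"
proof -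
 have lin: "linear D" using f has_derivative_linear by blast
 have "((%s. y + s *\<^sub>R w) has_derivative (%s. s *\<^sub>R w)) (at 0)"
  by (auto intro!: derivative_eq_intros)
 hence "((%s. f (y + s *\<^sub>R w)) has_derivative (%s. D (s *\<^sub>R w))) (at 0)"
  by (rule has_derivative_compose) (use f in simp)
 hence "((%s. (1 / norm (s - 0)) *\<^sub>R (f (y + s *\<^sub>R w) - (f (y + 0 *\<^sub>R w) + D ((s - 0) *\<^sub>R w)))) \<longlongrightarrow> 0) (at_right 0)"
  using has_derivative_at_withinI[of "%s. f (y + s *\<^sub>R w)"] unfolding has_derivative_within by fast
 from tendsto_add[OF this tendsto_const[of "D w"]]
 have lim: "((%s. (1 / norm s) *\<^sub>R (f (y + s *\<^sub>R w) - (f y + D (s *\<^sub>R w))) + D w) \<longlongrightarrow> D w) (at_right 0)" by simp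
 show ?thesis
 proof (rule Lim_in_closed_set[OF closed_subspace[OF W(1)] _ _ lim])
  have "(1 / norm s) *\<^sub>R (f (y + s *\<^sub>R w) - (f y + D (s *\<^sub>R w))) + D w\<in>W" if s: "0 < s" "s < \<delta>" for s
  proof -
   have "(1 / norm s) *\<^sub>R (f (y + s *\<^sub>R w) - (f y + D (s *\<^sub>R w))) + D w = (1 / s) *\<^sub>R (f (y + s *\<^sub>R w) - f y)"
    using s by (simp add: linear_cmul[OF lin] algebra_simps)
   thus ?thesis using W \<delta>(2)[OF s] by (simp add: subspace_scale subspace_diff)
  qed
  thus "\<forall>\<^sub>F s in at_right 0. (1 / norm s) *\<^sub>R (f (y + s *\<^sub>R w) - (f y + D (s *\<^sub>R w))) + D w\<in>W"
   unfolding eventually_at_right_field using \<delta>(1) by (intro exI[of _ \<delta>]) simp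
 qed simp
qed

lemma derivative_zero_direction:
 fixes f :: "'a::real_normed_vector => 'b::euclidean_space"
 assumes "(f has_derivative D) (at y)" "\<delta> > 0" "!!s. 0 < s ==> s < \<delta> ==> f (y + s *\<^sub>R w) = f y"
 shows "D w = 0"
proof -
 have "((%x. f x - f y) has_derivative D) (at y)"
  using has_derivative_diff[OF assms(1) has_derivative_const[of "f y"]] by simp
 from derivative_in_subspace[OF this, of "{0}" \<delta> w] assms(2,3) show ?thesis by auto
qed

lemma half_space_directions:
 fixes W :: "'e::euclidean_space set"
 assumes lin: "linear D" and P: "subspace P" and u: "subspace W"
  and pos: "!!w. w\<in>W ==> 0 <= w \<bullet> u ==> D w\<in>P" and w: "w\<in>W"
 shows "D w\<in>P"
proof (cases "0 <= w \<bullet> u")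
 case False
 hence "D (- w)\<in>P" using pos[of "- w"] w subspace_neg[OF u] by simp
 thus ?thesis using subspace_neg[OF P] linear_neg[OF lin, of w] by fastforce
qed (use pos w in simp)

lemma in_open_direction:
 fixes y :: "'e::real_normed_vector"
 assumes "open S" "y\<in>S"
 obtains \<delta> where "\<delta> > 0" "!!s. 0 < s ==> s < \<delta> ==> y + s *\<^sub>R w\<in>S"
proof -
 obtain e where e: "e > 0" "ball y e <= S" using assms open_contains_ball by blast
 show ?thesis
 proof (rule that[of "e / (norm w + 1)"])
  show "e / (norm w + 1) > 0" using e by (simp add: add_nonneg_pos)
  fix s assume s: "0 < s" "s < e / (norm w + 1)"
  have "s * norm w <= s * (norm w + 1)" using s by simp
  also have "\<dots> < e" using s by (simp add: pos_less_divide_eq add_nonneg_pos)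
  finally show "y + s *\<^sub>R w\<in>S" using e s by (auto simp: subset_iff dist_norm)
 qed
qed

text \<open>Interior and boundary points of a submanifold are treated alike: the first alternative is a slice, the second
 a half-slice, and both have the subspace \<open>W\<close> as tangent space.\<close>

definition flat_chart :: "('a::topological_space, 'e::euclidean_space) chart set => enat => nat => 'a set => 'a => ('a, 'e) chart => 'e set => bool" where
 "flat_chart A k d S p c W \<longleftrightarrow> slice_chart A k d S p c W \<or> (\<exists>u. bdry_chart A k d S p c W u)"

context manifold begin

lemma Dfun_chart_C1:
 assumes f: "mfun A (Suc 0) f U" "open U" "p\<in>U" and c: "c\<in>charts 1 A" "p\<in>cdom c"
 shows "((%y. f (cinv c y)) has_derivative (%w. Dfun A f p (coord_inv A c p w))) (at (cmap c p))"
proof -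
 have p: "p\<in>carrier A" using c charts_cdom by blast
 let ?d = "chart_at A p"
 have d: "?d\<in>A" "p\<in>cdom ?d" using chart_at[OF p] by auto
 note cd = chartD[OF d(1)] and cc = charts_chartD[OF c(1)]
 have 1: "((%y. f (cinv ?d y)) has_derivative Dfun A f p) (at (cmap ?d p))"
  using Dfun_chart(2)[OF f atlas_charts[OF d(1)] d(2)] by (simp add: Dfun_def[abs_def])
 have "((cmap ?d o cinv c) has_derivative coord_inv A c p) (at (cmap c p))"
  unfolding coord_inv_eq_tr by (rule tr_derivative[OF c(1) atlas_charts[OF d(1)] c(2) d(2)])
 hence "((%y. f (cinv ?d ((cmap ?d o cinv c) y))) has_derivative (%w. Dfun A f p (coord_inv A c p w))) (at (cmap c p))"
  by (rule has_derivative_compose) (use 1 cc(3)[OF c(2)] in simp)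
 thus ?thesis
  by (rule has_derivative_local[OF _ chart_open_image[OF charts_is_chart[OF c(1)] cd(1)]]) (use c d cd cc in auto)
qed

lemma flat_chart_directions:
 fixes f :: "'a => 'b::euclidean_space"
 assumes fl: "flat_chart A k d S p c W" and p: "p\<in>S" and f: "((%y. f (cinv c y)) has_derivative D) (at (cmap c p))"
  and P: "subspace P" "f p\<in>P" and U: "open U" "p\<in>U" "!!q. q\<in>S Int U ==> f q\<in>P" and w: "w\<in>W"
 shows "D w\<in>P"
proof -
 have c: "c\<in>charts k A" "p\<in>cdom c" "subspace W" using fl by (auto simp: flat_chart_def slice_chart_def bdry_chart_def)
 note cc = charts_chartD[OF c(1)]
 have fp: "f (cinv c (cmap c p)) = f p" using cc(3)[OF c(2)] by simp
 have oU: "open (cmap c ` (U Int cdom c))" by (rule chart_open_image[OF charts_is_chart[OF c(1)] U(1)])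
 have key: "D w\<in>P" if dir: "!!s. 0 < s ==> cmap c p + s *\<^sub>R w\<in>cimg c ==> cmap c p + s *\<^sub>R w\<in>cmap c ` (S Int cdom c)" for w
 proof (rule in_open_direction[OF oU, of "cmap c p" w])
  show "cmap c p\<in>cmap c ` (U Int cdom c)" using U c by auto
  fix \<delta> assume \<delta>: "\<delta> > 0" "!!s. 0 < s ==> s < \<delta> ==> cmap c p + s *\<^sub>R w\<in>cmap c ` (U Int cdom c)"
  show "D w\<in>P"
  proof (rule derivative_in_subspace[OF f P(1) _ \<delta>(1)])
   show "f (cinv c (cmap c p))\<in>P" using fp P by simp
   fix s assume s: "0 < s" "s < \<delta>"
   then obtain q where q: "q\<in>U" "q\<in>cdom c" "cmap c p + s *\<^sub>R w = cmap c q" using \<delta>(2) by blast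
   hence "cmap c q\<in>cmap c ` (S Int cdom c)" using dir[OF s(1)] by auto
   hence "q\<in>S" using q cc(3) by (metis IntE imageE)
   thus "f (cinv c (cmap c p + s *\<^sub>R w))\<in>P" using U(3) q cc(3) by auto
  qed
 qed
 show ?thesis using fl unfolding flat_chart_def
 proof
  assume sl: "slice_chart A k d S p c W"
  hence img: "cmap c ` (S Int cdom c) = W Int cimg c" by (simp add: slice_chart_def)
  have "cmap c p\<in>W" using img p c by blast
  thus ?thesis using w c(3) img by (intro key) (auto intro!: subspace_add subspace_scale)
 next
  assume "\<exists>u. bdry_chart A k d S p c W u"
  then obtain u where b: "bdry_chart A k d S p c W u" ..
  hence img: "cmap c ` (S Int cdom c) = {x\<in>W. 0 <= x \<bullet> u} Int cimg c" and pu: "cmap c p \<bullet> u = 0" by (simp_all add: bdry_chart_def)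
  have "cmap c p\<in>W" using img p c by blast
  hence "D w\<in>P" if "w\<in>W" "0 <= w \<bullet> u" for w
   using that c(3) img pu by (intro key) (auto intro!: subspace_add subspace_scale simp: inner_add_left)
  thus ?thesis by (rule half_space_directions[OF has_derivative_linear[OF f] P(1) c(3) _ w]) 
 qed
qed

lemma tangent_space_flat: "v\<in>tangent_space A S p \<longleftrightarrow> (\<exists>d c W. coord A c p v\<in>W & flat_chart A 1 d S p c W)"
 by (auto simp: tangent_space_def flat_chart_def)

lemma tangent_zero:
 assumes f: "mfun A (Suc 0) f U" "open U" "p\<in>U" and S: "p\<in>S" "!!q. q\<in>S Int U ==> f q = k"
  and v: "v\<in>tangent_space A S p"
 shows "Dfun A f p v = 0"
proof -
 obtain d c W where c: "coord A c p v\<in>W" "flat_chart A 1 d S p c W" using v tangent_space_flat by blast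
 hence cc: "c\<in>charts 1 A" "p\<in>cdom c" by (auto simp: flat_chart_def slice_chart_def bdry_chart_def)
 have f': "((%y. (%q. f q - k) (cinv c y)) has_derivative (%w. Dfun A f p (coord_inv A c p w))) (at (cmap c p))"
  using has_derivative_diff[OF Dfun_chart_C1[OF f cc] has_derivative_const[of k]] by simp
 have "(%w. Dfun A f p (coord_inv A c p w)) (coord A c p v)\<in>{0}"
  by (rule flat_chart_directions[OF c(2) S(1) f' _ _ f(2,3) _ c(1)]) (use S f in auto)
 thus ?thesis using cc by simp
qed

lemma flat_chart_mono: "flat_chart A k d S p c W ==> l <= k ==> flat_chart A l d S p c W"
 unfolding flat_chart_def slice_chart_def bdry_chart_def using charts_mono by blast

lemma pchart_charts:
 assumes d: "d\<in>charts \<infinity> A" and I: "open I" shows "pchart I d\<in>charts \<infinity> (prod_atlas A I)"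
 unfolding charts_def
proof (intro CollectI conjI ballI)
 have ch: "is_chart d" by (rule charts_is_chart[OF d])
 show "is_chart (pchart I d)" by (rule is_chart_pchart[OF ch I])
 show "cdom (pchart I d) <= carrier (prod_atlas A I)" using charts_cdom[OF d] by (auto simp: carrier_prod)
 have tr: "transition_Ck \<infinity> (pchart I c) (pchart I e)" if c: "c\<in>charts \<infinity> A" and e: "e\<in>charts \<infinity> A" for c e
  unfolding transition_Ck_def Ck_on_def
 proof (intro allI impI)
  fix n
  have ic: "is_chart c" "is_chart e" using charts_is_chart c e by auto
  let ?U = "cmap c ` (cdom c Int cdom e)"
  have oU: "open ?U" using chart_open_image[OF ic(1) is_chartD(1)[OF ic(2)]] by (simp add: Int_commute)
  have o: "open (?U \<times> I)" using oU I by (rule open_Times)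
  have f: "Cn_on n fst (?U \<times> I)" "Cn_on n snd (?U \<times> I)"
   by (intro Cn_on_fst[OF o] Cn_on_id Cn_on_snd[OF o])+
  have "Cn_on n (%q. ((cmap e o cinv c) (fst q), snd q)) (?U \<times> I)"
   by (intro Cn_on_Pair o f Cn_on_compose[OF o oU f(1) Cn_transition[OF c e]]) auto
  hence "Cn_on n (cmap (pchart I e) o cinv (pchart I c)) (?U \<times> I)"
   by (rule Cn_on_cong_imp[OF o, rotated]) (use is_chartD(3)[OF ic(1)] in \<open>auto simp: pchart_cinv[OF ic(1)]\<close>)
  moreover have "cmap (pchart I c) ` (cdom (pchart I c) Int cdom (pchart I e)) = ?U \<times> I"
   using pchart_image[of I c "cdom c Int cdom e" I] by (simp add: Times_Int_Times)
  ultimately show "Cn_on n (cmap (pchart I e) o cinv (pchart I c)) (cmap (pchart I c) ` (cdom (pchart I c) Int cdom (pchart I e)))" by simp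
 qed
 fix e assume "e\<in>prod_atlas A I"
 then obtain c where "c\<in>A" "e = pchart I c" by (auto simp: prod_atlas_eq)
 thus "transition_Ck \<infinity> (pchart I d) e" "transition_Ck \<infinity> e (pchart I d)" using tr d atlas_charts[of c \<infinity>] by auto
qed

end

section \<open>Families of Weinstein hypersurfaces\<close>

text \<open>The geometric part of an isotopy of Weinstein hypersurfaces, with \<open>L\<close> for the skeleta.
 Closedness of their total space makes them compact over compact sets of parameters.\<close>

locale weinstein_family = contact_family A \<zeta> I \<alpha>
 for A :: "('a::t2_space, 'e::euclidean_space) chart set" and \<zeta> I \<alpha> +
 fixes H :: "real => 'a set" and V :: "real => 'a => 'e" and L :: "real => 'a set"
 assumes H_compact: "!!t. t\<in>I ==> compact (H t)"
  and H_sub: "!!t. t\<in>I ==> submanifold_with_boundary A \<infinity> (DIM('e) - 1) (H t)"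
  and H_nd: "!!t p u. t\<in>I ==> p\<in>H t ==> u\<in>tangent_space A (H t) p ==>
    (!!v. v\<in>tangent_space A (H t) p ==> ext_deriv A (\<alpha> t) p u v = 0) ==> u = 0"
  and V_tangent: "!!t p. t\<in>I ==> p\<in>H t ==> V t p\<in>tangent_space A (H t) p"
  and V_dual: "!!t p v. t\<in>I ==> p\<in>H t ==> v\<in>tangent_space A (H t) p ==> ext_deriv A (\<alpha> t) p (V t p) v = \<alpha> t p v"
  and V_out: "!!t. t\<in>I ==> outward_transverse A (DIM('e) - 1) (H t) (V t)"
  and H_family: "smooth_subset_family A I H"
  and L_skeleton: "!!t. t\<in>I ==> skeleton A (H t) (V t) = L t"
  and L_closed: "closedin (top_of_set (carrier A \<times> I)) (total_space I L)"
begin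

lemma H_carrier: "t\<in>I ==> H t <= carrier A"
 using H_sub by (auto simp: submanifold_with_boundary_def)

lemma H_flat_chart:
 assumes "t\<in>I" "p\<in>H t" obtains c W where "flat_chart A \<infinity> (DIM('e) - 1) (H t) p c W"
 using H_sub[OF assms(1)] assms(2) unfolding submanifold_with_boundary_def flat_chart_def by blast

lemma flat_chartD:
 assumes "flat_chart A k d S p c W"
 shows "c\<in>charts k A" "p\<in>cdom c" "subspace W" "dim W = d" "cmap c ` (S Int cdom c) <= W"
 using assms by (auto simp: flat_chart_def slice_chart_def bdry_chart_def)

lemma flat_tangent:
 assumes "flat_chart A \<infinity> d S p c W" "coord A c p v\<in>W" shows "v\<in>tangent_space A S p"
 using flat_chart_mono[OF assms(1), of 1] assms(2) tangent_space_flat by auto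

text \<open>The tangent space of the hypersurface is the kernel of any function that vanishes on it and is
  not critical.\<close>

lemma tangent_kernel:
 assumes fl: "flat_chart A \<infinity> (DIM('e) - 1) S p c W" and p: "p\<in>S"
  and f: "mfun A (Suc 0) f U" "open U" "p\<in>U" "!!q. q\<in>S Int U ==> f q = 0" and nz: "Dfun A f p v \<noteq> 0"
 shows "W = {w. Dfun A f p (coord_inv A c p w) = 0}"
  and "tangent_space A S p = {u. Dfun A f p u = 0}"
proof -
 note c = flat_chartD[OF fl]
 have c1: "c\<in>charts 1 A" using charts_mono[OF c(1), of 1] by simp
 have pc: "p\<in>carrier A" using charts_cdom[OF c1] c(2) by blast
 have tz: "Dfun A f p u = 0" if "u\<in>tangent_space A S p" for u
  by (rule tangent_zero[OF f(1-3) p f(4) that])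
 let ?D = "%w. Dfun A f p (coord_inv A c p w)"
 have lin: "linear ?D"
  using linear_compose[OF coord_inv_linear[OF c1 c(2)] Dfun_linear[OF f(1-3) pc]] by (simp add: o_def)
 have sub: "subspace {w. ?D w = 0}" using linear_subspace_kernel[OF lin] by simp
 have "coord A c p v\<notin>{w. ?D w = 0}" using nz coord_inv_coord[OF c1 c(2), of v] by simp
 hence "{w. ?D w = 0} \<noteq> UNIV" by blast
 hence "dim {w. ?D w = 0} < DIM('e)"
  using dim_psubset[of "{w. ?D w = 0}" UNIV] sub by (auto simp: psubset_eq span_eq_iff[THEN iffD2])
 moreover have WD: "W <= {w. ?D w = 0}"
  using tz flat_tangent[OF fl] c1 c(2) by auto
 ultimately show W: "W = {w. ?D w = 0}" using subspace_dim_equal[OF c(3) sub WD] c(4) by simp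
 show "tangent_space A S p = {u. Dfun A f p u = 0}"
 proof
  show "{u. Dfun A f p u = 0} <= tangent_space A S p"
   using flat_tangent[OF fl] c1 c(2) by (auto simp: W)
 qed (use tz in auto)
qed

text \<open>At a boundary point the Liouville field points outwards, so its trajectory leaves the hypersurface at
 once, while trajectories from the skeleton never leave. Points of the skeleton are therefore interior.\<close>

lemma L_slice_chart:
 assumes t: "t\<in>I" and p: "p\<in>L t"
 obtains c W where "slice_chart A \<infinity> (DIM('e) - 1) (H t) p c W" and "p\<in>H t"
proof -
 have "p\<in>flow_image A (H t) (V t) (-1) (H t)" using L_skeleton[OF t] p unfolding skeleton_def by (metis INT_D greaterThan_iff zero_less_one)
 then obtain \<gamma> where \<gamma>: "integral_curve A (H t) (V t) (-1) \<gamma>" "\<gamma> (-1) = p" by (auto simp: flow_image_def)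
 have seg: "closed_segment 0 (-1) = {-1..0::real}" by (simp add: closed_segment_eq_real_ivl)
 have cont: "continuous_on {-1..0} \<gamma>" and inH: "!!r. r\<in>{-1..0} ==> \<gamma> r\<in>H t"
  and der: "((%h. cmap (chart_at A p) (\<gamma> h)) has_vector_derivative V t p) (at (-1) within {-1..0})"
  using \<gamma> unfolding integral_curve_def seg by auto
 have pH: "p\<in>H t" using inH[of "-1"] \<gamma> by simp
 have pc: "p\<in>carrier A" using pH H_carrier[OF t] by blast
 have "\<not> bdry_chart A \<infinity> (DIM('e) - 1) (H t) p c W u" for c W u
 proof
  assume b: "bdry_chart A \<infinity> (DIM('e) - 1) (H t) p c W u"
  hence c: "c\<in>charts \<infinity> A" "p\<in>cdom c" "cmap c p \<bullet> u = 0"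
   and img: "cmap c ` (H t Int cdom c) <= {x. 0 <= x \<bullet> u}" by (auto simp: bdry_chart_def)
  have c1: "c\<in>charts 1 A" using charts_mono[OF c(1), of 1] by simp
  have out: "coord A c p (V t p) \<bullet> u < 0" using V_out[OF t] b pH unfolding outward_transverse_def by blast
  have "((%h. cmap c (\<gamma> h)) has_vector_derivative tr (chart_at A p) c p (V t p)) (at (-1) within {-1..0})"
   using change_chart[OF chart_at_1[OF pc] c1 cont, of "-1" "V t p"] der \<gamma>(2) c(2) chart_at[OF pc] by simp
  hence "((%h. cmap c (\<gamma> h) \<bullet> u) has_vector_derivative coord A c p (V t p) \<bullet> u) (at (-1) within {-1..0})"
   unfolding coord_eq_tr by (rule bounded_linear.has_vector_derivative[OF bounded_linear_inner_left])
  hence lim: "((%h. (cmap c (\<gamma> h) \<bullet> u - cmap c (\<gamma> (-1)) \<bullet> u) / (h - (-1))) \<longlongrightarrow> coord A c p (V t p) \<bullet> u) (at (-1) within {-1..0})"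
   by (simp add: has_real_derivative_iff_has_vector_derivative[symmetric] has_field_derivative_iff)
  obtain \<delta> where \<delta>: "\<delta> > 0" "!!h. h\<in>{-1..0} ==> \<bar>h - (-1)\<bar> < \<delta> ==> \<gamma> h\<in>cdom c"
   by (rule continuous_on_nhd[OF cont _ is_chartD(1)[OF charts_is_chart[OF c(1)]], of "-1"]) (use \<gamma> c in "auto intro: that")
  have "0 <= coord A c p (V t p) \<bullet> u"
  proof (rule tendsto_lowerbound[OF lim])
   show "\<forall>\<^sub>F h in at (-1) within {-1..0}. 0 <= (cmap c (\<gamma> h) \<bullet> u - cmap c (\<gamma> (-1)) \<bullet> u) / (h - (-1))"
    unfolding eventually_at
   proof (intro exI[of _ \<delta>] conjI ballI impI)
    fix h :: real assume h: "h\<in>{-1..0}" "h \<noteq> -1 & dist h (-1) < \<delta>"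
    hence "\<gamma> h\<in>H t Int cdom c" using \<delta> inH by (auto simp: dist_real_def)
    hence "0 <= cmap c (\<gamma> h) \<bullet> u" using img by blast
    thus "0 <= (cmap c (\<gamma> h) \<bullet> u - cmap c (\<gamma> (-1)) \<bullet> u) / (h - (-1))" using c(3) \<gamma>(2) h by simp
   qed (rule \<delta>)
   show "at (-1) within {-1..0::real} \<noteq> bot" by (simp add: trivial_limit_within islimpt_Icc)
  qed
  thus False using out by simp
 qed
 then obtain c W where "slice_chart A \<infinity> (DIM('e) - 1) (H t) p c W"
  using H_sub[OF t] pH unfolding submanifold_with_boundary_def by blast
 thus ?thesis using that pH by blast
qed

end


section \<open>The inverse function theorem in class $C^1$\<close>

text \<open>The inverse is differentiable by the classical theorem; its derivative solves a linear system with
 continuous coefficients, so it is continuous.\<close>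

lemma C1_inverse_function:
 fixes f :: "'a::euclidean_space => 'a"
 assumes U: "open U" "x0\<in>U" and f: "C1_on f U"
  and inj: "!!w. FD f x0 w = 0 ==> w = 0"
 obtains U' V g where "open U'" "U' <= U" "x0\<in>U'" "open V" "f x0\<in>V" "homeomorphism U' V f g" "C1_on g V"
proof -
 let ?D = "BD f"
 note der = BD_has_derivative[OF f] and cont = BD_continuous[OF f] and D = BD_apply[OF f]
 have bl: "bounded_linear (FD f x)" if "x\<in>U" for x
  using blinfun.bounded_linear_right[of "?D x"] D[OF that] by simp
 have lin: "linear (FD f x0)" using bl[OF U(2)] bounded_linear.linear by blast
 have injf: "inj (FD f x0)"
  using inj linear_injective_0[OF lin] by blast
 obtain L where L: "linear L" "!!x. L (FD f x0 x) = x"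
  using linear_injective_left_inverse[OF lin injf] by (metis comp_apply id_apply)
 have "Blinfun L o\<^sub>L ?D x0 = id_blinfun"
  using L D[OF U(2)] by (intro blinfun_eqI) (simp add: bounded_linear_Blinfun_apply linear_conv_bounded_linear)
 from inverse_function_theorem[OF U(1) der cont U(2) this]
 obtain U' V g g' where I: "open U'" "U' <= U" "x0\<in>U'" "open V" "f x0\<in>V" "homeomorphism U' V f g"
  and g: "!!y. y\<in>V ==> (g has_derivative (g' y)) (at y)"
   "!!y. y\<in>V ==> g' y = inv (blinfun_apply (?D (g y)))"
   "!!y. y\<in>V ==> bij (blinfun_apply (?D (g y)))"
  by blast
 have gU: "g y\<in>U" if "y\<in>V" for y using I that by (auto simp: homeomorphism_def)
 have fg: "FD f (g y) (FD g y w) = w" if y: "y\<in>V" for y w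
  using D[OF gU[OF y]] g[OF y] FD_eqI[OF g(1)[OF y], of w]
  by (metis bij_is_surj surj_f_inv_f)
 have "Cn_on 0 (%y. FD g y w) V" for w
 proof (rule Cn_on_linear_solve[OF I(4), where M="%y. FD f (g y)"])
  show "linear (FD f (g y))" if "y\<in>V" for y
   using bl[OF gU[OF that]] bounded_linear.linear by blast
  show "v = 0" if "y\<in>V" "FD f (g y) v = 0" for y v
   using that D[OF gU[OF that(1)]] g(3)[OF that(1)] blinfun.zero_right[of "?D (g y)"]
   by (metis bij_is_inj injD)
  show "Cn_on 0 (%y. FD f (g y) b) V" for b
  proof -
   have "continuous_on U (%x. FD f x b)" using f by simp
   moreover have "continuous_on V g" using I(6) by (simp add: homeomorphism_def)
   ultimately have "continuous_on V (%y. FD f (g y) b)"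
    by (rule continuous_on_comp) (use gU in auto)
   thus ?thesis by simp
  qed
  show "Cn_on 0 (%y. FD f (g y) (FD g y w)) V"
   by (rule Cn_on_cong_imp[OF I(4), of "%_. w"]) (simp_all add: fg)
 qed
 hence "C1_on g V" using g(1) by (auto simp: differentiable_def)
 thus ?thesis using I that by blast
qed

context weinstein_family begin

abbreviation "P \<equiv> prod_atlas A I"

lemma P_atlas: "smooth_atlas P" by (rule smooth_atlas_prod[OF I])

end

sublocale weinstein_family \<subseteq> P: manifold "prod_atlas A I"
 by unfold_locales (rule smooth_atlas_prod[OF I])

context weinstein_family begin

section \<open>Straightening a family of hypersurfaces\<close>

text \<open>The trivialisation is a map on a set that need not be open. It has smooth extensions near every point; \<open>u\<close> and
 \<open>v\<close> are such extensions, of the inverse and of the trivialisation, in charts.\<close>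

lemma H_local_flat:
 assumes t: "t\<in>I" and p: "p\<in>H t" and e: "e\<in>charts \<infinity> A" "p\<in>cdom e"
 obtains t0 q d D u v N M where "flat_chart A \<infinity> (DIM('e) - 1) (H t0) q d D" "q\<in>H t0"
  "open N" "N <= cimg e \<times> I" "(cmap e p, t)\<in>N" "!!n. Cn_on n u N" "u (cmap e p, t) = cmap d q"
  "open M" "M <= cimg d \<times> I" "(cmap d q, t)\<in>M" "!!n. Cn_on n v M" 
  "!!y s. (y, s)\<in>N ==> cinv e y\<in>H s ==> u (y, s)\<in>cmap d ` (H t0 Int cdom d) & (u (y, s), s)\<in>M & v (u (y, s), s) = y"
  "!!z s. (z, s)\<in>M ==> z\<in>cmap d ` (H t0 Int cdom d) ==>
    v (z, s)\<in>cimg e & cinv e (v (z, s))\<in>H s & ((v (z, s), s)\<in>N --> u (v (z, s), s) = z)"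
proof -
 obtain t0 \<Psi> \<Psi>' where t0: "t0\<in>I" and \<Psi>: "Ck_map_on P A \<infinity> (H t0 \<times> I) \<Psi>"
  and \<Psi>': "Ck_map_on P A \<infinity> (total_space I H) \<Psi>'"
  and inv: "!!s x. s\<in>I ==> x\<in>H t0 ==> \<Psi> (x, s)\<in>H s & \<Psi>' (\<Psi> (x, s), s) = x"
   "!!s y. s\<in>I ==> y\<in>H s ==> \<Psi>' (y, s)\<in>H t0 & \<Psi> (\<Psi>' (y, s), s) = y"
  using H_family unfolding smooth_subset_family_def by blast
 define q where "q = \<Psi>' (p, t)"
 have q: "q\<in>H t0" "\<Psi> (q, t) = p" using inv(2)[OF t p] by (auto simp: q_def)
 have pt: "(p, t)\<in>total_space I H" using t p by (simp add: total_space_def)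
 obtain d D where d: "flat_chart A \<infinity> (DIM('e) - 1) (H t0) q d D" using H_flat_chart[OF t0 q(1)] .
 note dd = flat_chartD[OF d]
 note ce = charts_chartD[OF e(1)] and cd = charts_chartD[OF dd(1)]
 obtain W F where W: "open W" "(q, t)\<in>W" "W <= carrier P" "Ck_map P A \<infinity> W F" "\<forall>x\<in>(H t0 \<times> I) Int W. F x = \<Psi> x"
  using \<Psi> q t unfolding Ck_map_on_def by blast
 obtain W' F' where W': "open W'" "(p, t)\<in>W'" "W' <= carrier P" "Ck_map P A \<infinity> W' F'" "\<forall>x\<in>total_space I H Int W'. F' x = \<Psi>' x"
  using \<Psi>' pt unfolding Ck_map_on_def by blast
 have pe: "pchart I e\<in>charts \<infinity> P" "pchart I d\<in>charts \<infinity> P" using pchart_charts[OF _ I] e(1) dd(1) by auto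
 have inf: "enat n <= \<infinity>" for n by simp
 define v where "v = cmap e o F o cinv (pchart I d)"
 define u where "u = cmap d o F' o cinv (pchart I e)"
 define M0 where "M0 = {x\<in>W Int cdom (pchart I d). F x\<in>cdom e}"
 define N0 where "N0 = {x\<in>W' Int cdom (pchart I e). F' x\<in>cdom d}"
 define M where "M = cmap (pchart I d) ` M0"
 define N1 where "N1 = cmap (pchart I e) ` N0"
 have M0: "open M0" unfolding M0_def by (rule Ck_mapD(2)[OF P_atlas atlas W(4,1) pe(2) e(1) inf[of 0]])
 have N0: "open N0" unfolding N0_def by (rule Ck_mapD(2)[OF P_atlas atlas W'(4,1) pe(1) dd(1) inf[of 0]])
 have v: "Cn_on n v M" for n unfolding v_def M_def M0_def by (rule Ck_mapD(1)[OF P_atlas atlas W(4,1) pe(2) e(1) inf])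
 have u: "Cn_on n u N1" for n unfolding u_def N1_def N0_def by (rule Ck_mapD(1)[OF P_atlas atlas W'(4,1) pe(1) dd(1) inf])
 have eM: "M0 Int cdom (pchart I d) = M0" and eN: "N0 Int cdom (pchart I e) = N0" by (auto simp: M0_def N0_def)
 have oM: "open M" using chart_open_image[OF P.charts_is_chart[OF pe(2)] M0] unfolding M_def eM .
 have oN1: "open N1" using chart_open_image[OF P.charts_is_chart[OF pe(1)] N0] unfolding N1_def eN .
 have Mv: "v (z, s) = cmap e (F (cinv d z, s))" "(cinv d z, s)\<in>W" "F (cinv d z, s)\<in>cdom e" "z\<in>cimg d" "s\<in>I"
  if "(z, s)\<in>M" for z s
  using that cd by (auto simp: M_def M0_def v_def pchart_cinv[OF charts_is_chart[OF dd(1)]])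
 have Nu: "u (y, s) = cmap d (F' (cinv e y, s))" "(cinv e y, s)\<in>W'" "F' (cinv e y, s)\<in>cdom d" "y\<in>cimg e" "s\<in>I"
  if "(y, s)\<in>N1" for y s
  using that ce by (auto simp: N1_def N0_def u_def pchart_cinv[OF charts_is_chart[OF e(1)]])
 define N where "N = {x\<in>N1. (u x, snd x)\<in>M}"
 have "continuous_on N1 (%x. (u x, snd x))"
  using Cn_on_continuous[OF u] by (intro continuous_intros)
 hence oN: "open N" using continuous_open_preimage[OF _ oN1 oM] by (simp add: N_def Int_def vimage_def)
 have Fq: "F (q, t) = p" using W q t by auto
 have F'p: "F' (p, t) = q" using W' pt by (auto simp: q_def)
 have qM: "(cmap d q, t)\<in>M"
  unfolding M_def by (rule image_eqI[of _ _ "(q, t)"]) (use W q t e dd Fq in "auto simp: M0_def")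
 have pN1: "(cmap e p, t)\<in>N1"
  unfolding N1_def by (rule image_eqI[of _ _ "(p, t)"]) (use W' p t e dd F'p in "auto simp: N0_def")
 have up: "u (cmap e p, t) = cmap d q" using Nu(1)[OF pN1] ce(3)[OF e(2)] F'p by simp
 show ?thesis
 proof (rule that[OF d q(1) oN, of u M v])
  show "N <= cimg e \<times> I" using Nu(4,5) by (auto simp: N_def)
  show "M <= cimg d \<times> I" using Mv(4,5) by auto
  show "(cmap e p, t)\<in>N" using pN1 up qM by (simp add: N_def)
  show "Cn_on n u N" for n by (rule Cn_on_subset[OF u]) (auto simp: N_def)
  fix y s assume ys: "(y, s)\<in>N" "cinv e y\<in>H s"
  hence N: "(y, s)\<in>N1" "(u (y, s), s)\<in>M" by (auto simp: N_def)
  note nu = Nu[OF N(1)]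
  have "F' (cinv e y, s) = \<Psi>' (cinv e y, s)" using nu ys W'(5) by (auto simp: total_space_def)
  hence x: "F' (cinv e y, s)\<in>H t0" "\<Psi> (F' (cinv e y, s), s) = cinv e y" using inv(2)[OF nu(5) ys(2)] by auto
  have i: "cinv d (u (y, s)) = F' (cinv e y, s)" using nu(1,3) cd(3) by simp
  have "F (cinv d (u (y, s)), s) = cinv e y"
   using Mv(2)[OF N(2)] W(5) x nu(5) unfolding i by auto
  hence "v (u (y, s), s) = y" using Mv(1)[OF N(2)] nu(4) ce by simp
  thus "u (y, s)\<in>cmap d ` (H t0 Int cdom d) & (u (y, s), s)\<in>M & v (u (y, s), s) = y"
   using N(2) nu x(1) by auto
 next
  fix z s assume zs: "(z, s)\<in>M" "z\<in>cmap d ` (H t0 Int cdom d)"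
  note mv = Mv[OF zs(1)]
  have z: "cinv d z\<in>H t0" using zs(2) cd(3) by auto
  have F: "F (cinv d z, s) = \<Psi> (cinv d z, s)" using mv W(5) z by auto
  have vz: "cinv e (v (z, s)) = \<Psi> (cinv d z, s)" using mv(1,3) F ce(3) by simp
  have Hs: "cinv e (v (z, s))\<in>H s" unfolding vz using inv(1)[OF mv(5) z] by simp
  have "u (v (z, s), s) = z" if "(v (z, s), s)\<in>N"
  proof -
   have N1: "(v (z, s), s)\<in>N1" using that by (simp add: N_def)
   have "F' (cinv e (v (z, s)), s) = \<Psi>' (\<Psi> (cinv d z, s), s)"
    using Nu(2)[OF N1] W'(5) Hs mv(5) unfolding vz by (auto simp: total_space_def)
   thus ?thesis using Nu(1)[OF N1] inv(1)[OF mv(5) z] mv(4) cd by simp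
  qed
  thus "v (z, s)\<in>cimg e & cinv e (v (z, s))\<in>H s & ((v (z, s), s)\<in>N --> u (v (z, s), s) = z)"
   using mv Hs by auto
 qed (fact up oM qM v)+
qed

end


text \<open>Near a point of the skeleton: \<open>u\<close> straightens the hypersurfaces to the fixed subspace \<open>D\<close>, and \<open>v\<close> undoes
 this on \<open>D\<close>. Both are defined on open sets but inverse to each other only along the hypersurfaces.\<close>

locale H_box =
 fixes A :: "('a::t2_space, 'e::euclidean_space) chart set" and I :: "real set" and H t p e E N M
  and D :: "'e set" and u v :: "'e \<times> real => 'e"
 assumes e: "slice_chart A \<infinity> (DIM('e) - 1) (H t) p e E" and pH: "p\<in>H t"
  and D: "subspace D" "dim D = DIM('e) - 1"
  and N: "open N" "N <= cimg e \<times> I" "(cmap e p, t)\<in>N" "!!n. Cn_on n u N" "u (cmap e p, t)\<in>D"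
  and M: "open M" "(u (cmap e p, t), t)\<in>M" "!!n. Cn_on n v M"
  and uv: "!!y s. (y, s)\<in>N ==> cinv e y\<in>H s ==> u (y, s)\<in>D & (u (y, s), s)\<in>M & v (u (y, s), s) = y"
  and vu: "!!z s. (z, s)\<in>M ==> z\<in>D ==>
    v (z, s)\<in>cimg e & cinv e (v (z, s))\<in>H s & ((v (z, s), s)\<in>N --> u (v (z, s), s) = z)"
  and uD: "!!w. w\<in>E ==> FD u (cmap e p, t) (w, 0)\<in>D"
  and did: "!!w. w\<in>E ==> FD v (u (cmap e p, t), t) (FD u (cmap e p, t) (w, 0), 0) = w"
  and dE: "!!z. z\<in>D ==> FD v (u (cmap e p, t), t) (z, 0)\<in>E"

context weinstein_family begin

lemma slice_flat: "slice_chart A k d S p c W ==> flat_chart A k d S p c W"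
 by (simp add: flat_chart_def)

text \<open>Along the skeleton the trivialisation takes interior points to interior points: at a boundary
  point of the fibre its differential, composed with that of its inverse, would have rank less than the
  dimension of the hypersurface.\<close>

lemma H_local:
 assumes t: "t\<in>I" and p: "p\<in>L t"
 obtains e E N M D u v where "H_box A I H t p e E N M D u v"
proof -
 obtain e E where e: "slice_chart A \<infinity> (DIM('e) - 1) (H t) p e E" and pH: "p\<in>H t"
  by (rule L_slice_chart[OF t p])
 note ec = flat_chartD[OF slice_flat[OF e]]
 note ce = charts_chartD[OF ec(1)]
 have eimg: "cmap e ` (H t Int cdom e) = E Int cimg e" using e by (simp add: slice_chart_def)
 obtain t0 q d D u v N M where fl: "flat_chart A \<infinity> (DIM('e) - 1) (H t0) q d D" "q\<in>H t0"
  and N: "open N" "N <= cimg e \<times> I" "(cmap e p, t)\<in>N" "!!n. Cn_on n u N" "u (cmap e p, t) = cmap d q"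
  and M: "open M" "M <= cimg d \<times> I" "(cmap d q, t)\<in>M" "!!n. Cn_on n v M" 
  and uv: "!!y s. (y, s)\<in>N ==> cinv e y\<in>H s ==> u (y, s)\<in>cmap d ` (H t0 Int cdom d) & (u (y, s), s)\<in>M & v (u (y, s), s) = y"
  and vu: "!!z s. (z, s)\<in>M ==> z\<in>cmap d ` (H t0 Int cdom d) ==>
    v (z, s)\<in>cimg e & cinv e (v (z, s))\<in>H s & ((v (z, s), s)\<in>N --> u (v (z, s), s) = z)"
  by (rule H_local_flat[OF t pH ec(1,2)]) (rule that)
 note dd = flat_chartD[OF fl(1)]
 note cd = charts_chartD[OF dd(1)]
 let ?y = "cmap e p" and ?z = "cmap d q"
 let ?u' = "%w. FD u (?y, t) (w, 0)" and ?v' = "%z. FD v (?z, t) (z, 0)"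
 have du: "((%y. u (y, t)) has_derivative ?u') (at ?y)"
 proof -
  have "((%y. (y, t)) has_derivative (%w. (w, 0))) (at ?y)" by (auto intro!: derivative_eq_intros)
  thus ?thesis by (rule has_derivative_compose) (rule Cn_on_deriv[OF N(4) N(3)])
 qed
 have dv: "((%z. v (z, t)) has_derivative ?v') (at ?z)"
 proof -
  have "((%z. (z, t)) has_derivative (%w. (w, 0))) (at ?z)" by (auto intro!: derivative_eq_intros)
  thus ?thesis by (rule has_derivative_compose) (rule Cn_on_deriv[OF M(4) M(3)])
 qed
 define Nt where "Nt = {y. (y, t)\<in>N}"
 have oNt: "open Nt" unfolding Nt_def
  using continuous_open_preimage[of UNIV "%y. (y, t)" N] N(1) by (simp add: vimage_def continuous_intros)
 have yNt: "?y\<in>Nt" using N(3) by (simp add: Nt_def)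
 have yE: "?y\<in>E" using eimg pH ec(2) by blast
 have line: "(?y + s *\<^sub>R w, t)\<in>N & cinv e (?y + s *\<^sub>R w)\<in>H t" if "w\<in>E" "?y + s *\<^sub>R w\<in>Nt" for w s
 proof -
  have "?y + s *\<^sub>R w\<in>E" using that(1) yE ec(3) by (simp add: subspace_add subspace_scale)
  moreover have "?y + s *\<^sub>R w\<in>cimg e" using that(2) N(2) by (auto simp: Nt_def)
  ultimately have "?y + s *\<^sub>R w\<in>E Int cimg e" by blast
  hence "?y + s *\<^sub>R w\<in>cmap e ` (H t Int cdom e)" using eimg by simp
  hence "cinv e (?y + s *\<^sub>R w)\<in>H t" using ce(3) by auto
  thus ?thesis using that by (simp add: Nt_def)
 qed
 have dE: "?v' z\<in>E" if z: "z\<in>D" for z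
 proof -
  have oMt: "open {z. (z, t)\<in>M}"
   using continuous_open_preimage[of UNIV "%y. (y, t)" M] M(1) by (simp add: vimage_def continuous_intros)
  define G where "G = {x\<in>cdom d. (cmap d x, t)\<in>M}"
  have oG: "open G"
   using continuous_open_preimage[OF cd(6,1) oMt] by (simp add: G_def Int_def vimage_def)
  have "((%z. (%x. v (cmap d x, t)) (cinv d z)) has_derivative ?v') (at ?z)"
   by (rule has_derivative_local[OF dv cd(2)]) (use dd(2) cd in auto)
  thus ?thesis
  proof (rule flat_chart_directions[OF fl _ ec(3) _ oG _ _ z])
   show "v (cmap d q, t)\<in>E" using uv[OF N(3)] ce(3)[OF ec(2)] pH N(5) yE by simp
   show "q\<in>G" using dd(2) M(3) by (simp add: G_def)
   fix x assume x: "x\<in>H t0 Int G"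
   hence "(cmap d x, t)\<in>M" "cmap d x\<in>cmap d ` (H t0 Int cdom d)" by (auto simp: G_def)
   from vu[OF this] have "v (cmap d x, t)\<in>cmap e ` (H t Int cdom e)"
    using ce by (metis IntI image_eqI)
   thus "v (cmap d x, t)\<in>E" using eimg by blast
  qed
 qed
 have dD: "?u' w\<in>D" if w: "w\<in>E" for w
 proof (rule in_open_direction[OF oNt yNt, of w])
  fix \<delta> assume \<delta>: "0 < \<delta>" "!!s. 0 < s ==> s < \<delta> ==> ?y + s *\<^sub>R w\<in>Nt"
  show ?thesis
  proof (rule derivative_in_subspace[OF du dd(3) _ \<delta>(1)])
   show "u (?y, t)\<in>D" using N(5) dd(5) fl(2) dd(2) by auto
   show "u (?y + s *\<^sub>R w, t)\<in>D" if "0 < s" "s < \<delta>" for s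
    using line[OF w \<delta>(2)[OF that]] uv dd(5) by blast
  qed
 qed
 have did: "?v' (?u' w) = w" if w: "w\<in>E" for w
 proof (rule in_open_direction[OF oNt yNt, of w])
  fix \<delta> assume \<delta>: "0 < \<delta>" "!!s. 0 < s ==> s < \<delta> ==> ?y + s *\<^sub>R w\<in>Nt"
  have "((%y. v (u (y, t), t)) has_derivative (%w. ?v' (?u' w))) (at ?y)"
   by (rule has_derivative_compose[OF du]) (use dv N(5) in simp)
  hence "((%y. v (u (y, t), t) - y) has_derivative (%w. ?v' (?u' w) - w)) (at ?y)"
   by (intro has_derivative_diff has_derivative_ident)
  hence "?v' (?u' w) - w = 0"
  proof (rule derivative_zero_direction[OF _ \<delta>(1)])
   fix s assume "0 < s" "s < \<delta>"
   hence "v (u (?y + s *\<^sub>R w, t), t) = ?y + s *\<^sub>R w" using line[OF w \<delta>(2)] uv by blast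
   moreover have "v (u (?y, t), t) = ?y" using uv[OF N(3)] ce(3)[OF ec(2)] pH by simp
   ultimately show "v (u (?y + s *\<^sub>R w, t), t) - (?y + s *\<^sub>R w) = v (u (?y, t), t) - ?y" by simp
  qed
  thus ?thesis by simp
 qed
 have sl: "slice_chart A \<infinity> (DIM('e) - 1) (H t0) q d D"
 proof (rule ccontr)
  assume "\<not> ?thesis"
  then obtain b where b: "bdry_chart A \<infinity> (DIM('e) - 1) (H t0) q d D b" using fl(1) by (auto simp: flat_chart_def)
  hence bD: "b\<in>D" "b \<noteq> 0" "?z \<bullet> b = 0" and img: "cmap d ` (H t0 Int cdom d) <= {x. 0 <= x \<bullet> b}" by (auto simp: bdry_chart_def)
  have ub: "?u' w \<bullet> b = 0" if w: "w\<in>E" for w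
  proof -
   have "((%s. ?y + s *\<^sub>R w) has_derivative (%s. s *\<^sub>R w)) (at 0)" by (auto intro!: derivative_eq_intros)
   hence "((%s. u (?y + s *\<^sub>R w, t)) has_derivative (%s. ?u' (s *\<^sub>R w))) (at 0)"
    by (rule has_derivative_compose) (use du in simp)
   hence "((%s. u (?y + s *\<^sub>R w, t) \<bullet> b) has_derivative (%s. ?u' (s *\<^sub>R w) \<bullet> b)) (at 0)"
    by (rule has_derivative_inner_left)
   moreover have "(%s. ?u' (s *\<^sub>R w) \<bullet> b) = (*) (?u' w \<bullet> b)"
    using linear_cmul[OF has_derivative_linear[OF du]] by (auto simp: mult.commute)
   ultimately have D: "DERIV (%s. u (?y + s *\<^sub>R w, t) \<bullet> b) 0 :> ?u' w \<bullet> b" by (simp add: has_field_derivative_def)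
   obtain \<delta>1 where 1: "0 < \<delta>1" "!!s. 0 < s ==> s < \<delta>1 ==> ?y + s *\<^sub>R w\<in>Nt" by (rule in_open_direction[OF oNt yNt]) (rule that)
   obtain \<delta>2 where 2: "0 < \<delta>2" "!!s. 0 < s ==> s < \<delta>2 ==> ?y + s *\<^sub>R (- w)\<in>Nt" by (rule in_open_direction[OF oNt yNt]) (rule that)
   have "u (?y + 0 *\<^sub>R w, t) \<bullet> b <= u (?y + s *\<^sub>R w, t) \<bullet> b" if s: "\<bar>0 - s\<bar> < min \<delta>1 \<delta>2" for s
   proof -
    have "?y + s *\<^sub>R w\<in>Nt"
    proof (cases "0 < s \<or> s = 0")
     case True thus ?thesis using 1(2)[of s] s yNt by auto
    next
     case False thus ?thesis using 2(2)[of "- s"] s by auto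
    qed
    hence "u (?y + s *\<^sub>R w, t)\<in>cmap d ` (H t0 Int cdom d)" using line[OF w] uv by blast
    thus ?thesis using img bD(3) N(5) by auto
   qed
   thus ?thesis using DERIV_local_min[OF D, of "min \<delta>1 \<delta>2"] 1 2 by auto
  qed
  have "?u' ` E <= D Int {x. b \<bullet> x = 0}" using dD ub by (auto simp: inner_commute)
  moreover have "b\<notin>D Int {x. b \<bullet> x = 0}" using bD(2) by simp
  hence "D Int {x. b \<bullet> x = 0} \<subset> D" using bD(1) by blast
  moreover have sub: "subspace (D Int {x. b \<bullet> x = 0})" using dd(3) subspace_hyperplane subspace_inter by blast
  ultimately have "dim (?u' ` E) < dim D"
   using dim_subset[of "?u' ` E" "D Int {x. b \<bullet> x = 0}"] dim_psubset[of "D Int {x. b \<bullet> x = 0}" D] span_eq_iff[THEN iffD2, OF sub] span_eq_iff[THEN iffD2, OF dd(3)]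
   by simp
  moreover have "dim (?u' ` E) = dim E"
  proof (rule dim_image_eq[OF has_derivative_linear[OF du]])
   have "inj_on ?u' E" by (rule inj_on_inverseI[where g="?v'"]) (rule did)
   moreover have "span E = E" using ec(3) by (simp only: span_eq_iff)
   ultimately show "inj_on ?u' (span E)" by (simp only:)
  qed
  ultimately show False using dd(4) ec(4) by simp
 qed
 hence dimg: "cmap d ` (H t0 Int cdom d) = D Int cimg d" by (simp add: slice_chart_def)
 show ?thesis
 proof (rule that, unfold_locales)
  show "?u' w\<in>D" if "w\<in>E" for w by (rule dD[OF that])
  show "FD v (u (?y, t), t) (?u' w, 0) = w" if "w\<in>E" for w using did[OF that] N(5) by simp
  show "FD v (u (?y, t), t) (z, 0)\<in>E" if "z\<in>D" for z using dE[OF that] N(5) by simp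
  show "u (?y, t)\<in>D" using N(5) fl(2) dd by auto
  show "(u (?y, t), t)\<in>M" using M(3) N(5) by simp
  show "u (y, s)\<in>D & (u (y, s), s)\<in>M & v (u (y, s), s) = y" if "(y, s)\<in>N" "cinv e y\<in>H s" for y s
   using uv[OF that] dimg by blast
  show "v (z, s)\<in>cimg e & cinv e (v (z, s))\<in>H s & ((v (z, s), s)\<in>N --> u (v (z, s), s) = z)" if "(z, s)\<in>M" "z\<in>D" for z s
   by (rule vu[OF that(1)]) (use that M(2) dimg in auto)
 qed (fact e pH dd(3) dd(4) N(1) N(2) N(3) N(4) M(1) M(4))+
qed

section \<open>Functions vanishing on a family of hypersurfaces\<close>

lemma slice_open: "open U ==> open {x. (x, s)\<in>U}" for U :: "('x::topological_space \<times> 'y::topological_space) set"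
 using continuous_open_preimage[of UNIV "%y. (y, s)" U] by (simp add: vimage_def continuous_intros)

lemma mfun_pchart:
 assumes "mfun P n f U" "open U" "c\<in>charts \<infinity> A"
 shows "Cn_on n (%(y, s). f (cinv c y, s)) (cmap (pchart I c) ` (U Int cdom (pchart I c)))"
  and "open (cmap (pchart I c) ` (U Int cdom (pchart I c)))"
proof -
 have c: "pchart I c\<in>charts \<infinity> P" by (rule pchart_charts[OF assms(3) I])
 show o: "open (cmap (pchart I c) ` (U Int cdom (pchart I c)))" by (rule chart_open_image[OF P.charts_is_chart[OF c] assms(2)])
 show "Cn_on n (%(y, s). f (cinv c y, s)) (cmap (pchart I c) ` (U Int cdom (pchart I c)))"
  by (rule Cn_on_cong_imp[OF o _ P.mfunD[OF assms(1,2) c]]) (auto simp: pchart_cinv[OF charts_is_chart[OF assms(3)]])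
qed

lemma mfun_slice:
 assumes f: "mfun P n f U" "open U" and s: "s\<in>I" shows "mfun A n (%x. f (x, s)) {x. (x, s)\<in>U}"
 unfolding mfun_def
proof
 fix c assume c: "c\<in>A"
 note m = mfun_pchart[OF f atlas_charts[OF c]]
 let ?S = "cmap c ` ({x. (x, s)\<in>U} Int cdom c)"
 have o: "open ?S" by (rule open_image[OF c slice_open[OF f(2)]])
 have "Cn_on n (%y. (%(y, s). f (cinv c y, s)) (y, s)) ?S"
 proof (rule Cn_on_compose[OF o m(2) _ m(1)])
  show "Cn_on n (%y. (y, s)) ?S" by (intro Cn_on_Pair o Cn_on_id Cn_on_const)
  show "(%y. (y, s)) ` ?S <= cmap (pchart I c) ` (U Int cdom (pchart I c))"
  proof
   fix z assume "z\<in>(%y. (y, s)) ` ?S"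
   then obtain x where "z = (cmap c x, s)" "(x, s)\<in>U" "x\<in>cdom c" by auto
   thus "z\<in>cmap (pchart I c) ` (U Int cdom (pchart I c))" using s by (intro image_eqI[of _ _ "(x, s)"]) auto
  qed
 qed
 thus "Cn_on n (%y. f (cinv c y, s)) ?S" by simp
qed

lemma Reeb_derivative_smooth:
 assumes f: "mfun P (Suc n) f U" "open U"
 shows "mfun P n (%(x, s). Dfun A (%x. f (x, s)) x (Reeb s x)) U"
 unfolding mfun_def prod_atlas_eq
proof
 fix c' assume "c'\<in>pchart I ` A"
 then obtain c where c: "c\<in>A" "c' = pchart I c" by blast
 note m = mfun_pchart[OF f atlas_charts[OF c(1)]]
 note cc = chartD[OF c(1)]
 let ?S = "cmap (pchart I c) ` (U Int cdom (pchart I c))" and ?F = "%(y, s). f (cinv c y, s)"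
  and ?R = "%(y, s). coord A c (cinv c y) (Reeb s (cinv c y))"
 have S: "?S <= cimg c \<times> I" by auto
 have "Cn_on n (%x. FD ?F x (?R x, 0)) ?S"
  by (intro Cn_on_frechet_apply m Cn_on_Pair Cn_on_const Cn_on_subset[OF Reeb_smooth[OF c(1)] S])
 thus "Cn_on n (%y. case cinv c' y of (x, s) => Dfun A (%x. f (x, s)) x (Reeb s x)) (cmap c' ` (U Int cdom c'))"
  unfolding c(2)
 proof (rule Cn_on_cong_imp[OF m(2), rotated])
  fix z assume zS: "z\<in>?S"
  then obtain x s where x: "z = (cmap c x, s)" "(x, s)\<in>U" "x\<in>cdom c" "s\<in>I" by auto
  have "?F differentiable (at (cmap c x, s))"
   by (rule differentiableI[OF Cn_on_deriv[OF m(1)]]) (use zS x(1) in simp)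
  from frechet_derivative_fst(2)[OF this]
  have "FD (%y. f (cinv c y, s)) (cmap c x) w = FD ?F z (w, 0)" for w
   using x(1) by simp
  hence "Dfun A (%x. f (x, s)) x (Reeb s x) = FD ?F z (coord A c x (Reeb s x), 0)"
   using Dfun_chart(1)[OF mfun_slice[OF P.mfun_le[OF f(1)] f(2) x(4)] slice_open[OF f(2)] _ atlas_charts[OF c(1)] x(3)] x(2) by simp
  thus "FD ?F z (?R z, 0) = (case cinv (pchart I c) z of (x, s) => Dfun A (%x. f (x, s)) x (Reeb s x))"
   using x cc(3) by (simp add: pchart_cinv[OF is_chart[OF c(1)]])
 qed
qed

lemma Reeb_not_tangent:
 assumes "t\<in>I" "p\<in>H t" shows "Reeb t p\<notin>tangent_space A (H t) p"
proof
 assume "Reeb t p\<in>tangent_space A (H t) p"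
 have p: "p\<in>carrier A" using assms H_carrier by blast
 have "Reeb t p = 0" by (rule H_nd[OF assms \<open>Reeb t p\<in>_\<close>]) (rule Reeb(2)[OF assms(1) p])
 thus False using Reeb(1)[OF assms(1) p] linear_0[OF form_linear[OF assms(1) p]] by simp
qed

end


lemma linear_retraction:
 fixes D :: "'e::euclidean_space set"
 assumes "subspace D" obtains \<pi> where "linear \<pi>" "!!x. \<pi> x\<in>D" "!!x. x\<in>D ==> \<pi> x = x"
proof -
 have "\<exists>g. range g <= D & linear g & (\<forall>v\<in>D. g (id v) = v)"
  by (rule linear_exists_left_inverse_on[OF linear_id assms]) simp
 thus ?thesis using that by auto
qed

lemma dual_vector:
 fixes E :: "'e::euclidean_space set"
 assumes E: "subspace E" and R: "R\<notin>E" obtains n where "n \<bullet> R = 1" "!!x. x\<in>E ==> n \<bullet> x = 0"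
proof -
 obtain a b where ab: "a\<in>span E" "!!w. w\<in>span E ==> orthogonal b w" "R = a + b"
  using orthogonal_subspace_decomp_exists[of E R] by metis
 have sE: "span E = E" using E by (simp only: span_eq_iff)
 have b: "b \<bullet> x = 0" if "x\<in>E" for x using ab(2) that sE by (simp add: orthogonal_def)
 have "b \<noteq> 0" using ab(1,3) R sE by auto
 hence "(b /\<^sub>R (b \<bullet> b)) \<bullet> R = 1" using b[of a] ab(1,3) sE by (simp add: inner_add_right)
 thus ?thesis using b that[of "b /\<^sub>R (b \<bullet> b)"] by simp
qed

context weinstein_family begin

lemma chart_preimage_open:
 assumes c: "is_chart c" and S: "open (S :: ('e \<times> real) set)" 
 shows "open {(x, s). x\<in>cdom c & (cmap c x, s)\<in>S}"
proof -
 note cc = is_chartD[OF c]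
 have "continuous_on (cdom c \<times> (UNIV::real set)) (%q. (cmap c (fst q), snd q))"
  by (intro continuous_intros continuous_on_comp[OF cc(6)]) auto
 from continuous_open_preimage[OF this open_Times[OF cc(1) open_UNIV] S]
 have "open ((cdom c \<times> UNIV) Int (%q. (cmap c (fst q), snd q)) -` S)" .
 moreover have "(cdom c \<times> UNIV) Int (%q. (cmap c (fst q), snd q)) -` S = {(x, s). x\<in>cdom c & (cmap c x, s)\<in>S}" by auto
 ultimately show ?thesis by simp
qed

text \<open>A point near the hypersurface is projected to it along the trivialisation, and the difference is
  measured in a direction transverse to the hypersurface.\<close>

lemma local_hamiltonian:
 assumes t: "t\<in>I" and p: "p\<in>L t"
 obtains f U where "open U" "(p, t)\<in>U" "U <= carrier A \<times> I" "!!n. mfun P n f U"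
  "!!x s. (x, s)\<in>U ==> x\<in>H s ==> f (x, s) = 0"
  "!!x s. (x, s)\<in>U ==> 3/4 < Dfun A (%x. f (x, s)) x (Reeb s x)"
proof -
 obtain e E N M D u v where box: "H_box A I H t p e E N M D u v" by (rule H_local[OF t p]) (rule that)
 interpret H_box A I H t p e E N M D u v by (rule box)
 note ec = flat_chartD[OF slice_flat[OF e]]
 note ce = charts_chartD[OF ec(1)]
 let ?y = "cmap e p" and ?z = "u (cmap e p, t)" and ?R = "coord A e p (Reeb t p)"
 have "?R\<notin>E" using Reeb_not_tangent[OF t pH] flat_tangent[OF slice_flat[OF e]] by blast
 then obtain n where n: "n \<bullet> ?R = 1" "!!x. x\<in>E ==> n \<bullet> x = 0" by (rule dual_vector[OF ec(3)]) (rule that)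
 obtain \<pi> where \<pi>: "linear \<pi>" "!!x. \<pi> x\<in>D" "!!x. x\<in>D ==> \<pi> x = x" by (rule linear_retraction[OF D(1)]) (rule that)
 define k where "k x = (\<pi> (u x), snd x)" for x
 have ks: "Cn_on m k N" for m
  unfolding k_def by (intro Cn_on_Pair Cn_on_compose_linear[OF N(1) N(4) \<pi>(1)] Cn_on_snd Cn_on_id N(1))
 define N1 where "N1 = {x\<in>N. k x\<in>M}"
 have oN1: "open N1"
  using continuous_open_preimage[OF Cn_on_continuous[OF ks] N(1) M(1)] by (simp add: N1_def Int_def vimage_def)
 have kp: "k (?y, t) = (?z, t)" using \<pi>(3) N(5) by (simp add: k_def)
 have yN1: "(?y, t)\<in>N1" using N(3) M(2) kp by (simp add: N1_def)
 define g where "g x = n \<bullet> (fst x - v (k x))" for x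
 have vk: "Cn_on m (%x. v (k x)) N1" for m
  by (rule Cn_on_compose[OF oN1 M(1) Cn_on_subset[OF ks] M(3)]) (auto simp: N1_def)
 have g: "Cn_on m g N1" for m
  unfolding g_def by (intro Cn_on_inner Cn_on_const Cn_on_diff Cn_on_fst Cn_on_id oN1 vk)
 define f where "f q = g (cmap e (fst q), snd q)" for q
 define U0 where "U0 = {(x, s). x\<in>cdom e & (cmap e x, s)\<in>N1}"
 have oU0: "open U0" unfolding U0_def by (rule chart_preimage_open[OF charts_is_chart[OF ec(1)] oN1])
 have U0: "U0 <= carrier A \<times> I" using charts_cdom[OF ec(1)] N(2) by (auto simp: U0_def N1_def)
 have fs: "mfun P m f U0" for m
 proof (rule P.mfunI)
  fix q assume q: "q\<in>U0"
  have "Cn_on m (%y. f (cinv (pchart I e) y)) (cmap (pchart I e) ` (U0 Int cdom (pchart I e)))"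
  proof (rule Cn_on_cong_imp[OF chart_open_image[OF is_chart_pchart[OF charts_is_chart[OF ec(1)] I] oU0]])
   show "Cn_on m g (cmap (pchart I e) ` (U0 Int cdom (pchart I e)))"
    by (rule Cn_on_subset[OF g]) (auto simp: U0_def)
  qed (use ce(3) in \<open>auto simp: f_def pchart_cinv[OF charts_is_chart[OF ec(1)]]\<close>)
  thus "\<exists>a U. a\<in>charts \<infinity> P & open U & q\<in>U & q\<in>cdom a & Cn_on m (%y. f (cinv a y)) (cmap a ` (U Int cdom a))"
   using pchart_charts[OF ec(1) I] oU0 q U0 by (intro exI[of _ "pchart I e"] exI[of _ U0]) (auto simp: U0_def)
 qed
 define G where "G = (%(x, s). Dfun A (%x. f (x, s)) x (Reeb s x))"
 have Gs: "mfun P 0 G U0" unfolding G_def by (rule Reeb_derivative_smooth[OF fs oU0])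
 have Gc: "continuous_on U0 G" by (rule P.mfun_continuous[OF Gs oU0]) (use U0 carrier_prod in simp)
 have oU: "open {q\<in>U0. 3/4 < G q}"
  using continuous_open_preimage[OF Gc oU0 open_greaterThan[of "3/4"]] by (simp add: Int_def vimage_def greaterThan_def)
 have pU0: "(p, t)\<in>U0" using yN1 ec(2) by (simp add: U0_def)
 have Gp: "G (p, t) = 1"
 proof -
  let ?u' = "FD u (?y, t)" and ?v' = "FD v (?z, t)"
  have 1: "((%y. (y, t)) has_derivative (%w. (w, 0))) (at ?y)" by (auto intro!: derivative_eq_intros)
  have "((%y. u (y, t)) has_derivative (%w. ?u' (w, 0))) (at ?y)"
   by (rule has_derivative_compose[OF 1 Cn_on_deriv[OF N(4) N(3)]])
  from has_derivative_compose[OF this linear_imp_has_derivative[OF \<pi>(1)]]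
  have "((%y. (\<pi> (u (y, t)), t)) has_derivative (%w. (\<pi> (?u' (w, 0)), 0))) (at ?y)"
   by (intro has_derivative_Pair has_derivative_const) (simp add: o_def)
  hence "((%y. v (\<pi> (u (y, t)), t)) has_derivative (%w. ?v' (\<pi> (?u' (w, 0)), 0))) (at ?y)"
  proof (rule has_derivative_compose)
   show "(v has_derivative ?v') (at (\<pi> (u (?y, t)), t))"
    using Cn_on_deriv[OF M(3) M(2)] \<pi>(3) N(5) by simp
  qed
  hence "((%y. n \<bullet> (y - v (\<pi> (u (y, t)), t))) has_derivative (%w. n \<bullet> (w - ?v' (\<pi> (?u' (w, 0)), 0)))) (at ?y)"
   by (intro has_derivative_inner_right has_derivative_diff has_derivative_ident)
  hence "((%y. f (cinv e y, t)) has_derivative (%w. n \<bullet> (w - ?v' (\<pi> (?u' (w, 0)), 0)))) (at ?y)"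
   by (rule has_derivative_local[OF _ ce(2)]) (use ec(2) ce in \<open>auto simp: f_def g_def k_def\<close>)
  from FD_eqI[OF this, of ?R]
  have "FD (%y. f (cinv e y, t)) ?y ?R = 1"
   using n dE[OF \<pi>(2)] by (simp add: inner_diff_right)
  thus ?thesis
   using Dfun_chart(1)[OF mfun_slice[OF fs oU0 t] slice_open[OF oU0] _ ec(1,2)] pU0 by (simp add: G_def)
 qed
 show ?thesis
 proof (rule that[OF oU])
  show "(p, t)\<in>{q\<in>U0. 3/4 < G q}" using pU0 Gp by simp
  show "{q\<in>U0. 3/4 < G q} <= carrier A \<times> I" using U0 by auto
  show "mfun P m f {q\<in>U0. 3/4 < G q}" for m by (rule P.mfun_subset[OF fs]) auto
  show "3/4 < Dfun A (%x. f (x, s)) x (Reeb s x)" if "(x, s)\<in>{q\<in>U0. 3/4 < G q}" for x s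
   using that by (simp add: G_def)
  show "f (x, s) = 0" if "(x, s)\<in>{q\<in>U0. 3/4 < G q}" "x\<in>H s" for x s
  proof -
   have x: "x\<in>cdom e" "(cmap e x, s)\<in>N" using that by (auto simp: U0_def N1_def)
   thus ?thesis using uv[OF x(2)] that(2) ce(3) \<pi>(3) by (simp add: f_def g_def k_def)
  qed
 qed
qed

text \<open>Conversely, a function that vanishes on the family of hypersurfaces and is not critical vanishes
  nowhere else: together with the trivialisation and the parameter it gives local coordinates.\<close>

lemma zero_set:
 assumes t: "t\<in>I" and p: "p\<in>L t" and f: "mfun P (Suc 0) f U" "open U" "(p, t)\<in>U"
  and f0: "!!x s. (x, s)\<in>U ==> x\<in>H s ==> f (x, s) = 0"
  and df: "Dfun A (%x. f (x, t)) p v0 \<noteq> 0"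
 obtains N where "open N" "(p, t)\<in>N" "N <= U" "!!x s. (x, s)\<in>N ==> f (x, s) = 0 ==> x\<in>H s"
proof -
 obtain e E N M D u v where box: "H_box A I H t p e E N M D u v" by (rule H_local[OF t p]) (rule that)
 interpret H_box A I H t p e E N M D u v by (rule box)
 note ec = flat_chartD[OF slice_flat[OF e]]
 note ce = charts_chartD[OF ec(1)]
 let ?y = "cmap e p" and ?z = "u (cmap e p, t)" 
 obtain \<pi> where \<pi>: "linear \<pi>" "!!x. \<pi> x\<in>D" "!!x. x\<in>D ==> \<pi> x = x" by (rule linear_retraction[OF D(1)]) (rule that)
 obtain n where n: "n \<noteq> 0" "!!x. x\<in>D ==> n \<bullet> x = 0"
 proof (rule orthogonal_to_subspace_exists[of D])
  show "dim D < DIM('e)" using D(2) DIM_positive[where 'a='e] by simp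
  fix x assume "x \<noteq> 0" "!!y. y\<in>span D ==> orthogonal x y"
  thus ?thesis using that[of x] span_base[of _ D] by (auto simp: orthogonal_def)
 qed
 let ?S = "cmap (pchart I e) ` (U Int cdom (pchart I e))"
 define \<phi> where "\<phi> = (%(y, s). f (cinv e y, s))"
 note m = mfun_pchart[OF f(1,2) ec(1), folded \<phi>_def]
 define S where "S = N Int ?S"
 have oS: "open S" using N(1) m(2) by (auto simp: S_def)
 have yS: "(?y, t)\<in>S" using N(3) f(3) ec(2) t by (auto simp: S_def intro!: image_eqI[of _ _ "(p, t)"])
 have SU: "(cinv e y, s)\<in>U" "y\<in>cimg e" if "(y, s)\<in>S" for y s using that ce by (auto simp: S_def)
 have u1: "C1_on u S" by (rule Cn_on_subset[OF N(4)]) (auto simp only: S_def)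
 have \<phi>1: "C1_on \<phi> S" by (rule Cn_on_subset[OF m(1)]) (auto simp only: S_def)
 define G where "G x = (\<pi> (u x) + \<phi> x *\<^sub>R n, snd x)" for x
 have G1: "C1_on G S"
  unfolding G_def by (intro Cn_on_Pair Cn_on_add Cn_on_scaleR Cn_on_const Cn_on_snd Cn_on_id oS \<phi>1 Cn_on_compose_linear[OF oS u1 \<pi>(1)])
 let ?u' = "FD u (?y, t)" and ?\<phi>' = "FD \<phi> (?y, t)" and ?v' = "FD v (?z, t)"
 have du: "(u has_derivative ?u') (at (?y, t))" by (rule Cn_on_deriv[OF u1 yS])
 have dphi: "(\<phi> has_derivative ?\<phi>') (at (?y, t))" by (rule Cn_on_deriv[OF \<phi>1 yS])
 have "(G has_derivative (%w. (\<pi> (?u' w) + ?\<phi>' w *\<^sub>R n, snd w))) (at (?y, t))"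
  unfolding G_def
  by (intro has_derivative_Pair has_derivative_add has_derivative_scaleR_left dphi has_derivative_snd has_derivative_ident
    has_derivative_compose[OF du linear_imp_has_derivative[OF \<pi>(1)], unfolded o_def])
 note G' = FD_eqI[OF this]
 have inj: "w = 0" if "FD G (?y, t) w = 0" for w
 proof -
  obtain a \<sigma> where w: "w = (a, \<sigma>)" by (cases w)
  have 0: "\<pi> (?u' (a, \<sigma>)) + ?\<phi>' (a, \<sigma>) *\<^sub>R n = 0" "\<sigma> = 0" using that unfolding G' w by (auto simp: zero_prod_def)
  have "n \<bullet> (\<pi> (?u' (a, 0)) + ?\<phi>' (a, 0) *\<^sub>R n) = 0" using 0 by simp
  hence \<phi>0: "?\<phi>' (a, 0) = 0" using n(1) n(2)[OF \<pi>(2)] by (simp add: inner_add_right)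
  have "\<phi> differentiable at (?y, t)" by (rule differentiableI[OF dphi])
  from frechet_derivative_fst(2)[OF this, of a] \<phi>0
  have "FD (%y. f (cinv e y, t)) ?y a = 0" by (simp add: \<phi>_def)
  moreover have c1: "e\<in>charts 1 A" using charts_mono[OF ec(1), of 1] by simp
  ultimately have "Dfun A (%x. f (x, t)) p (coord_inv A e p a) = 0"
   using Dfun_chart(1)[OF mfun_slice[OF f(1,2) t] slice_open[OF f(2)] _ ec(1,2)] f(3) ec(2) by simp
  hence aE: "a\<in>E"
   using tangent_kernel(1)[OF slice_flat[OF e] pH mfun_slice[OF f(1,2) t] slice_open[OF f(2)] _ _ df] f(3) f0 by simp
  hence "?u' (a, 0) = 0" using uD[OF aE] \<pi>(3) 0 \<phi>0 by simp
  hence "a = ?v' (0, 0)" using did[OF aE] by simp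
  also have "\<dots> = 0"
   using linear_0[OF has_derivative_linear[OF Cn_on_deriv[OF M(3) M(2)]]] by (simp add: zero_prod_def)
  finally show ?thesis using w 0(2) by (simp add: zero_prod_def)
 qed
 obtain U' V g where U': "open U'" "U' <= S" "(?y, t)\<in>U'" and hom: "homeomorphism U' V G g"
  by (rule C1_inverse_function[OF oS yS G1 inj]) (assumption | rule that)+
 define k where "k x = (\<pi> (u x), snd x)" for x
 have ks: "continuous_on U' k"
  using Cn_on_continuous[OF u1] U'(2) linear_continuous_on[OF linear_conv_bounded_linear[THEN iffD1, OF \<pi>(1)], of UNIV]
  unfolding k_def by (intro continuous_intros continuous_on_comp[of UNIV \<pi> U' u]) (auto intro: continuous_on_subset)
 define Q where "Q = {x\<in>M. (v x, snd x)\<in>U'}"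
 have oQ: "open Q"
 proof -
  have "continuous_on M (%x. (v x, snd x))" using Cn_on_continuous[OF M(3)] by (intro continuous_intros)
  from continuous_open_preimage[OF this M(1) U'(1)] show ?thesis by (simp add: Q_def Int_def vimage_def)
 qed
 define N2 where "N2 = {x\<in>U'. k x\<in>Q}"
 have oN2: "open N2" using continuous_open_preimage[OF ks U'(1) oQ] by (simp add: N2_def Int_def vimage_def)
 have "v (?z, t) = ?y" using uv[OF N(3)] ce(3)[OF ec(2)] pH by simp
 hence yN2: "(?y, t)\<in>N2" using U'(3) M(2) \<pi>(3) N(5) by (simp add: N2_def k_def Q_def)
 have fin: "cinv e y\<in>H s" if ys: "(y, s)\<in>N2" and z: "\<phi> (y, s) = 0" for y s
 proof -
  let ?zz = "\<pi> (u (y, s))"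
  have 1: "(y, s)\<in>U'" "(?zz, s)\<in>M" "(v (?zz, s), s)\<in>U'" using ys by (auto simp: N2_def k_def Q_def)
  note V = vu[OF 1(2) \<pi>(2)]
  have S': "(v (?zz, s), s)\<in>S" using 1(3) U'(2) by blast
  hence "u (v (?zz, s), s) = ?zz" using V by (simp add: S_def)
  moreover have "\<phi> (v (?zz, s), s) = 0" using f0[OF SU(1)[OF S']] V by (simp add: \<phi>_def)
  ultimately have "G (v (?zz, s), s) = G (y, s)" using \<pi>(3)[OF \<pi>(2)] z by (simp add: G_def)
  hence "(v (?zz, s), s) = (y, s)" using hom 1 by (metis homeomorphism_def)
  thus ?thesis using V by simp
 qed
 show ?thesis
 proof (rule that)
  show "open {(x, s). x\<in>cdom e & (cmap e x, s)\<in>N2}" by (rule chart_preimage_open[OF charts_is_chart[OF ec(1)] oN2])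
  show "(p, t)\<in>{(x, s). x\<in>cdom e & (cmap e x, s)\<in>N2}" using yN2 ec(2) by simp
  have S: "(cmap e x, s)\<in>S" if "(cmap e x, s)\<in>N2" for x s using that U'(2) by (auto simp: N2_def)
  show "{(x, s). x\<in>cdom e & (cmap e x, s)\<in>N2} <= U"
   using SU(1)[OF S] ce(3) by fastforce
  show "x\<in>H s" if "(x, s)\<in>{(x, s). x\<in>cdom e & (cmap e x, s)\<in>N2}" "f (x, s) = 0" for x s
   using fin[of "cmap e x" s] that ce(3)[of x] by (simp add: \<phi>_def)
 qed
qed

end


section \<open>Exhaustion of an open set of parameters\<close>

text \<open>Proper on \<open>I\<close>: bounded values keep the parameter bounded and away from the complement of \<open>I\<close>.\<close>

definition exhaustion :: "real set => real => real" where
 "exhaustion I t = \<bar>t\<bar> + 1 / infdist t (- I)"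

lemma exhaustion:
 assumes I: "open I"
 shows "continuous_on I (exhaustion I)" "0 <= exhaustion I t" "compact {t\<in>I. exhaustion I t <= r}"
proof -
 have pos: "- I = {} \<or> infdist t (- I) > 0" if "t\<in>I" for t
  using in_closed_iff_infdist_zero[of "- I" t] I that infdist_nonneg[of t "- I"] by force
 show "continuous_on I (exhaustion I)"
 proof (cases "- I = {}")
  case True thus ?thesis unfolding exhaustion_def[abs_def] by (simp add: infdist_def continuous_intros)
 next
  case False thus ?thesis unfolding exhaustion_def[abs_def] using pos by (intro continuous_intros) force
 qed
 show "0 <= exhaustion I t" using infdist_nonneg[of t "- I"] by (simp add: exhaustion_def)
 show "compact {t\<in>I. exhaustion I t <= r}"
 proof (cases "- I = {}")
  case True
  hence "{t\<in>I. exhaustion I t <= r} = {- r..r}" by (auto simp: exhaustion_def infdist_def)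
  thus ?thesis by simp
 next
  case False
  have eq: "{t\<in>I. exhaustion I t <= r} = {- r..r} Int {t. 1 <= (r - \<bar>t\<bar>) * infdist t (- I)}"
  proof (intro set_eqI iffI)
   fix t assume "t\<in>{t\<in>I. exhaustion I t <= r}"
   hence t: "t\<in>I" "1 / infdist t (- I) <= r - \<bar>t\<bar>" "infdist t (- I) > 0" using pos False by (auto simp: exhaustion_def)
   have "0 <= 1 / infdist t (- I)" using t(3) by simp
   hence "\<bar>t\<bar> <= r" using t(2) by linarith
   moreover have "1 <= (r - \<bar>t\<bar>) * infdist t (- I)" using t(2,3) by (simp add: pos_divide_le_eq)
   ultimately show "t\<in>{- r..r} Int {t. 1 <= (r - \<bar>t\<bar>) * infdist t (- I)}" by auto
  next
   fix t assume t: "t\<in>{- r..r} Int {t. 1 <= (r - \<bar>t\<bar>) * infdist t (- I)}"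
   hence "infdist t (- I) \<noteq> 0" by auto
   hence "infdist t (- I) > 0" "t\<in>I" using infdist_nonneg[of t "- I"] infdist_zero[of t "- I"] by (simp, metis ComplI)
   moreover have "1 / infdist t (- I) <= r - \<bar>t\<bar>"
    using t \<open>infdist t (- I) > 0\<close> by (simp add: pos_divide_le_eq)
   ultimately show "t\<in>{t\<in>I. exhaustion I t <= r}" by (simp add: exhaustion_def)
  qed
  have "closed {t. 1 <= (r - \<bar>t\<bar>) * infdist t (- I)}" by (intro closed_Collect_le continuous_intros)
  thus ?thesis unfolding eq by (intro compact_Int_closed) auto
 qed
qed

lemma Ck_map_on_continuous:
 fixes f :: "'b::t2_space => 'a::topological_space"
 assumes "Ck_map_on B A k S f" shows "continuous_on S f"
proof (rule continuous_on_locally)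
 fix x assume "x\<in>S"
 then obtain W F where W: "open W" "x\<in>W" "Ck_map B A k W F" "\<forall>q\<in>S Int W. F q = f q"
  using assms unfolding Ck_map_on_def by blast
 have "continuous_on (S Int W) F" using W(3) by (auto simp: Ck_map_def intro: continuous_on_subset)
 hence "continuous_on (S Int W) f" by (rule continuous_on_eq) (use W(4) in blast)
 thus "\<exists>U. open U & x\<in>U & continuous_on (S Int U) f" using W by blast
qed

context manifold begin

lemma has_derivative_Dfun:
 assumes "mfun A (Suc 0) f U" "open U" "p\<in>U" "p\<in>carrier A"
 shows "((%y. f (cinv (chart_at A p) y)) has_derivative Dfun A f p) (at (cmap (chart_at A p) p))"
 using Dfun_chart(2)[OF assms(1-3) atlas_charts] chart_at[OF assms(4)] by (simp add: Dfun_def[abs_def])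

lemma Dfun_eqI:
 "((%y. f (cinv (chart_at A p) y)) has_derivative D) (at (cmap (chart_at A p) p)) ==> Dfun A f p v = D v"
 unfolding Dfun_def by (rule FD_eqI)

lemma cinv_chart_at: "p\<in>carrier A ==> cinv (chart_at A p) (cmap (chart_at A p) p) = p"
 using chart_at[of p] is_chartD(3)[OF is_chart] by blast

lemma Dfun_cong:
 assumes f: "mfun A (Suc 0) f U" and U: "open U" "p\<in>U" "p\<in>carrier A" and eq: "!!q. q\<in>U ==> f q = g q"
 shows "Dfun A f p = Dfun A g p"
proof
 fix v
 have c: "chart_at A p\<in>A" "p\<in>cdom (chart_at A p)" using chart_at[OF U(3)] by auto
 have "((%y. g (cinv (chart_at A p) y)) has_derivative Dfun A f p) (at (cmap (chart_at A p) p))"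
  by (rule has_derivative_local[OF has_derivative_Dfun[OF f U] open_image[OF c(1) U(1)]])
   (use U(2) c eq is_chartD(3)[OF is_chart[OF c(1)]] in auto)
 from Dfun_eqI[OF this] show "Dfun A f p v = Dfun A g p v" by simp
qed

lemma Dfun_mult:
 assumes f: "mfun A (Suc 0) f U" and g: "mfun A (Suc 0) g U" and U: "open U" "p\<in>U" "p\<in>carrier A"
 shows "Dfun A (%q. f q * g q) p v = f p * Dfun A g p v + Dfun A f p v * g p"
 using Dfun_eqI[OF has_derivative_mult[OF has_derivative_Dfun[OF f U] has_derivative_Dfun[OF g U]], of v] U(3)
 by (simp add: cinv_chart_at)

lemma Dfun_sum:
 assumes f: "!!i. i\<in>F ==> mfun A (Suc 0) (f i) U" and U: "open U" "p\<in>U" "p\<in>carrier A"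
 shows "Dfun A (%q. \<Sum>i\<in>F. f i q) p v = (\<Sum>i\<in>F. Dfun A (f i) p v)"
 by (rule Dfun_eqI) (intro has_derivative_sum has_derivative_Dfun[OF f U])

end

section \<open>A Hamiltonian for the family of hypersurfaces\<close>

context weinstein_family begin

abbreviation "LI \<equiv> total_space I L"

lemma L_subset_H: "t\<in>I ==> L t <= H t"
 using L_slice_chart by blast

text \<open>The trivialisation carries the compact set \<open>H t0 \<times> J\<close> onto it.\<close>

lemma total_space_compact:
 assumes J: "compact J" "J <= I" shows "compact (total_space J H)"
proof -
 obtain t0 \<Psi> \<Psi>' where t0: "t0\<in>I" and \<Psi>: "Ck_map_on P A \<infinity> (H t0 \<times> I) \<Psi>"
  and inv: "!!s x. s\<in>I ==> x\<in>H t0 ==> \<Psi> (x, s)\<in>H s & \<Psi>' (\<Psi> (x, s), s) = x"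
   "!!s y. s\<in>I ==> y\<in>H s ==> \<Psi>' (y, s)\<in>H t0 & \<Psi> (\<Psi>' (y, s), s) = y"
  using H_family unfolding smooth_subset_family_def by blast
 have "continuous_on (H t0 \<times> J) (%q. (\<Psi> q, snd q))"
  using Ck_map_on_continuous[OF \<Psi>] J by (intro continuous_intros) (auto intro: continuous_on_subset)
 hence "compact ((%q. (\<Psi> q, snd q)) ` (H t0 \<times> J))"
  by (rule compact_continuous_image) (intro compact_Times H_compact t0 J)
 also have "(%q. (\<Psi> q, snd q)) ` (H t0 \<times> J) = total_space J H"
 proof
  show "(%q. (\<Psi> q, snd q)) ` (H t0 \<times> J) <= total_space J H" using inv(1) J by (auto simp: total_space_def)
  show "total_space J H <= (%q. (\<Psi> q, snd q)) ` (H t0 \<times> J)"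
  proof
   fix q assume "q\<in>total_space J H"
   then obtain y s where q: "q = (y, s)" "s\<in>J" "y\<in>H s" by (auto simp: total_space_def)
   thus "q\<in>(%q. (\<Psi> q, snd q)) ` (H t0 \<times> J)"
    using inv(2)[of s y] J by (intro image_eqI[of _ _ "(\<Psi>' (y, s), s)"]) auto
  qed
 qed
 finally show ?thesis .
qed

lemma LI_carrier: "LI <= carrier A \<times> I"
 using L_subset_H H_carrier by (fastforce simp: total_space_def)

lemma LI_compact:
 assumes J: "compact J" "J <= I" shows "compact (total_space J L)"
proof -
 obtain T where T: "closed T" "LI = carrier A \<times> I Int T" using L_closed unfolding closedin_closed by blast
 have "total_space J L = total_space J H Int T"
  using T(2) L_subset_H H_carrier J by (fastforce simp: total_space_def)
 thus ?thesis using total_space_compact[OF J] T(1) by (simp add: compact_Int_closed)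
qed

lemma P_exhaustion:
 shows "LI <= carrier P" "continuous_on (carrier P) (%q. exhaustion I (snd q))" "0 <= exhaustion I (snd q)"
  "compact (LI Int {q\<in>carrier P. exhaustion I (snd q) <= r})"
proof -
 show "LI <= carrier P" using LI_carrier carrier_prod by simp
 show "continuous_on (carrier P) (%q. exhaustion I (snd q))"
  by (rule continuous_on_comp[OF exhaustion(1)[OF I]]) (auto simp: carrier_prod intro: continuous_intros)
 show "0 <= exhaustion I (snd q)" by (rule exhaustion(2)[OF I])
 have "LI Int {q\<in>carrier P. exhaustion I (snd q) <= r} = total_space {t\<in>I. exhaustion I t <= r} L"
  using LI_carrier by (auto simp: total_space_def carrier_prod)
 thus "compact (LI Int {q\<in>carrier P. exhaustion I (snd q) <= r})"
  using LI_compact[OF exhaustion(3)[OF I], of r] by auto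
qed

lemma cutoff_near_skeleta:
 assumes O: "open O'" "LI <= O'"
 obtains \<beta> :: "'a \<times> real => real" and G where "!!n. mfun P n \<beta> (carrier P)" "!!q. 0 <= \<beta> q" "!!q. \<beta> q <= 1"
  "open G" "LI <= G" "G <= O' Int carrier P" "!!q. q\<in>G ==> \<beta> q = 1"
  "!!J. compact J ==> J <= I ==> \<exists>K. compact K & K <= O' Int carrier P & (\<forall>q. snd q\<in>J --> q\<notin>K --> \<beta> q = 0)"
proof -
 have cover: "open O' & z\<in>O'" if "z\<in>LI" for z using O that by blast
 obtain S \<theta> C G where part: "subordinate_partition P LI (%q. exhaustion I (snd q)) (%_. O') S \<theta> C G"
  by (rule P.partition_near[where O'="%_. O'", OF P_exhaustion(1,2,3,4) cover]) (assumption | rule that)+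
 interpret S: subordinate_partition P LI "%q. exhaustion I (snd q)" "%_. O'" S \<theta> C G by (rule part)
 note G = S.G and C = S.C and \<theta> = S.\<theta> and loc = S.loc and one = S.one
 define \<beta> where "\<beta> q = (\<Sum>k\<in>{k\<in>S. q\<in>C k}. \<theta> k q)" for q
 have \<beta>s: "mfun P n \<beta> (carrier P)" for n
  unfolding \<beta>_def[abs_def] by (rule P.mfun_locally_finite_sum[OF \<theta>(1,3) loc])
 have nz: "\<exists>k\<in>S. q\<in>C k" if "\<beta> q \<noteq> 0" for q
 proof (rule ccontr)
  assume "\<not> ?thesis"
  hence "{k\<in>S. q\<in>C k} = {}" by blast
  hence "\<beta> q = 0" unfolding \<beta>_def by (simp only: sum.empty)
  thus False using that by simp
 qed
 show ?thesis
 proof (rule that[OF \<beta>s _ _ G(1,2)])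
  show "0 <= \<beta> q" for q unfolding \<beta>_def by (intro sum_nonneg \<theta>(2))
  show "\<beta> q <= 1" for q using S.le by (simp add: \<beta>_def)
  show "\<beta> q = 1" if "q\<in>G" for q using one[OF that] by (simp add: \<beta>_def)
  show "G <= O' Int carrier P"
  proof
   fix q assume q: "q\<in>G"
   hence "\<beta> q \<noteq> 0" using one[OF q] by (simp add: \<beta>_def)
   thus "q\<in>O' Int carrier P" using nz C by blast
  qed
  fix J assume J: "compact J" "J <= I"
  have "compact (exhaustion I ` J)" by (rule compact_continuous_image[OF continuous_on_subset[OF exhaustion(1)[OF I] J(2)] J(1)])
  then obtain r where r: "!!t. t\<in>J ==> exhaustion I t <= r"
   using compact_imp_bounded bounded_real by (metis abs_le_D1 imageI)
  let ?F = "{k\<in>S. \<exists>q\<in>C k. exhaustion I (snd q) <= r}"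
  show "\<exists>K. compact K & K <= O' Int carrier P & (\<forall>q. snd q\<in>J --> q\<notin>K --> \<beta> q = 0)"
  proof (intro exI conjI allI impI)
   show "compact (\<Union>k\<in>?F. C k)" by (rule compact_UN[OF S.fin]) (use C in blast)
   show "(\<Union>k\<in>?F. C k) <= O' Int carrier P" using C by blast
   fix q assume q: "snd q\<in>J" "q\<notin>(\<Union>k\<in>?F. C k)"
   show "\<beta> q = 0" using nz[of q] q r by blast
  qed
 qed
qed

text \<open>A partition of unity glues the local functions. All of them vanish on the hypersurfaces, so along these
 only the local functions are differentiated and the derivative along the Reeb field stays above \<open>1/2\<close>; dividing
 by this derivative normalises it to one.\<close>

lemma global_hamiltonian:
 obtains h O' where "!!n. mfun P n h (carrier A \<times> I)" "open O'" "LI <= O'" "O' <= carrier A \<times> I"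
  "!!x s. (x, s)\<in>O' ==> h (x, s) = 0 \<longleftrightarrow> x\<in>H s"
  "!!x s. (x, s)\<in>O' ==> 1/2 < Dfun A (%x. h (x, s)) x (Reeb s x)"
  "!!x s. (x, s)\<in>O' ==> x\<in>H s ==> Dfun A (%x. h (x, s)) x (Reeb s x) = 1"
proof -
 define good where "good z f U \<longleftrightarrow> open U & z\<in>U & U <= carrier A \<times> I & (\<forall>n. mfun P n f U) &
   (\<forall>x s. (x, s)\<in>U --> x\<in>H s --> f (x, s) = 0) & (\<forall>x s. (x, s)\<in>U --> 3/4 < Dfun A (%x. f (x, s)) x (Reeb s x))"
  for z :: "'a \<times> real" and f :: "'a \<times> real => real" and U
 have "\<exists>f U. good z f U" if zL: "z\<in>LI" for z
 proof -
  obtain p t where z: "z = (p, t)" "t\<in>I" "p\<in>L t" using zL by (auto simp: total_space_def)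
  show ?thesis
  proof (rule local_hamiltonian[OF z(2,3)], goal_cases)
   case (1 f U)
   show ?case unfolding good_def z(1) by (rule exI[of _ f], rule exI[of _ U]) (use 1 in blast)
  qed
 qed
 then obtain F U where good: "!!z. z\<in>LI ==> good z (F z) (U z)" by metis
 have cover: "open (U z) & z\<in>U z" if "z\<in>LI" for z using good[OF that] by (simp add: good_def)
 obtain S \<theta> C G where part: "subordinate_partition P LI (%q. exhaustion I (snd q)) U S \<theta> C G"
  by (rule P.partition_near[where O'="U", OF P_exhaustion(1,2,3,4) cover]) (assumption | rule that)+
 interpret S: subordinate_partition P LI "%q. exhaustion I (snd q)" "U" S \<theta> C G by (rule part)
 note G = S.G and C = S.C and \<theta> = S.\<theta> and loc = S.loc and one = S.one
 have cP: "carrier P = carrier A \<times> I" by (rule carrier_prod)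
 define g where "g k q = \<theta> k q * F (snd k) q" for k q
 have gS: "good (snd k) (F (snd k)) (U (snd k))" if "k\<in>S" for k using good C[OF that] by blast
 have gz: "g k q = 0" if "k\<in>S" "q\<notin>C k" for k q using \<theta>(3)[OF that] by (simp add: g_def)
 have gs: "mfun P n (g k) W" if k: "k\<in>S" for n k W
 proof (rule P.mfun_zero_extension[where W="U (snd k)" and C="C k"])
  show "mfun P n (g k) (U (snd k))" unfolding g_def
   by (rule P.mfun_mult[OF \<theta>(1)[OF k]]) (use gS[OF k] in "auto simp: good_def")
 qed (use gS[OF k] C[OF k] gz[OF k] compact_imp_closed in "auto simp: good_def")
 define h0 where "h0 q = (\<Sum>k\<in>{k\<in>S. q\<in>C k}. g k q)" for q
 have h0s: "mfun P n h0 (carrier P)" for n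
  unfolding h0_def[abs_def] by (rule P.mfun_locally_finite_sum[OF gs gz loc])
 have h0H: "h0 (x, s) = 0" if "x\<in>H s" for x s
  unfolding h0_def
 proof (rule sum.neutral, rule ballI)
  fix k assume "k\<in>{k\<in>S. (x, s)\<in>C k}"
  hence k: "k\<in>S" "(x, s)\<in>C k" by auto
  have "(x, s)\<in>U (snd k)" using C[OF k(1)] k(2) by blast
  hence "F (snd k) (x, s) = 0" using gS[OF k(1)] that unfolding good_def by blast
  thus "g k (x, s) = 0" by (simp add: g_def)
 qed
 define R where "R f q = Dfun A (%x. f (x, snd q)) (fst q) (Reeb (snd q) (fst q))" for f :: "'a \<times> real => real" and q
 have oP: "open (carrier P)" by (rule P.open_carrier)
 have Rs: "mfun P n (R f) (carrier P)" if "!!n. mfun P n f (carrier P)" for f n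
  using Reeb_derivative_smooth[OF that oP, of n] by (simp add: R_def[abs_def] case_prod_unfold)
 have R_gt: "1/2 < R h0 (x, s)" if q: "(x, s)\<in>G" and xH: "x\<in>H s" for x s
 proof -
  have qP: "(x, s)\<in>carrier P" using q G(3) by blast
  hence s: "s\<in>I" and x: "x\<in>carrier A" using cP by auto
  obtain V F' where V: "open V" "(x, s)\<in>V" "finite F'" "F' <= S" "\<forall>q'\<in>V. \<forall>k\<in>S. q'\<in>C k --> k\<in>F'"
   using loc[OF qP] by (elim exE conjE) (rule that)
  let ?V = "V Int carrier P"
  have oV: "open ?V" using V(1) oP by blast
  let ?r = "Reeb s x"
  let ?d = "%k. Dfun A (%x. F (snd k) (x, s)) x ?r"
  note sl = mfun_slice[OF _ _ s]
  have "Dfun A (%x. h0 (x, s)) x = Dfun A (%x. \<Sum>k\<in>F'. g k (x, s)) x"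
  proof (rule Dfun_cong[OF sl[OF P.mfun_subset[OF h0s] oV]])
   fix y assume "y\<in>{x. (x, s)\<in>?V}"
   thus "h0 (y, s) = (\<Sum>k\<in>F'. g k (y, s))"
    unfolding h0_def by (intro sum.mono_neutral_left V(3)) (use V(4,5) gz in blast)+
  qed (use slice_open[OF oV] V(2) qP x in auto)
  moreover have "Dfun A (%x. \<Sum>k\<in>F'. g k (x, s)) x ?r = (\<Sum>k\<in>F'. Dfun A (%x. g k (x, s)) x ?r)"
   by (rule Dfun_sum[OF sl[OF gs oV] slice_open[OF oV]]) (use V(2,4) qP x in blast)+
  ultimately have R: "R h0 (x, s) = (\<Sum>k\<in>F'. Dfun A (%x. g k (x, s)) x ?r)" by (simp add: R_def)
  have "\<theta> k (x, s) * (3/4) <= Dfun A (%x. g k (x, s)) x ?r" if "k\<in>F'" for k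
  proof -
   have k: "k\<in>S" using V(4) that by blast
   note gk = gS[OF k, unfolded good_def]
   show ?thesis
   proof (cases "(x, s)\<in>C k")
    case True
    hence U: "open (U (snd k))" "(x, s)\<in>U (snd k)" "mfun P (Suc 0) (F (snd k)) (U (snd k))" "F (snd k) (x, s) = 0" "3/4 < ?d k"
     using C[OF k] gk xH by auto
    hence "\<theta> k (x, s) * (3/4) <= \<theta> k (x, s) * ?d k" using \<theta>(2) by (intro mult_left_mono) auto
    thus ?thesis
     using Dfun_mult[OF sl[OF \<theta>(1)[OF k] U(1)] sl[OF U(3,1)] slice_open[OF U(1)] _ x, of ?r] U(2,4) by (simp add: g_def)
   next
    case False
    have o: "open (- C k)" using C[OF k] compact_imp_closed by auto
    have "Dfun A (%x. g k (x, s)) x = Dfun A (%x. 0) x"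
     by (rule Dfun_cong[OF sl[OF gs[OF k] o] slice_open[OF o]]) (use gz[OF k] False x in auto)
    moreover have "Dfun A (%x. 0) x ?r = 0" by (rule Dfun_eqI[of _ _ "%_. 0"]) simp
    ultimately show ?thesis using \<theta>(3)[OF k False] by simp
   qed
  qed
  hence "(\<Sum>k\<in>F'. \<theta> k (x, s)) * (3/4) <= R h0 (x, s)" unfolding R sum_distrib_right by (intro sum_mono)
  moreover have "(\<Sum>k\<in>F'. \<theta> k (x, s)) = (\<Sum>k\<in>{k\<in>S. (x, s)\<in>C k}. \<theta> k (x, s))"
   by (intro sum.mono_neutral_right V(3)) (use V(2,4,5) \<theta>(3) in blast)+
  ultimately show ?thesis using one[OF q] by simp
 qed
 \<comment> \<open>where \<open>h0\<close> vanishes, the derivative of \<open>h\<close> along the Reeb field is \<open>R h0 * (1 / R h0)\<close>\<close>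
 define h where "h q = h0 q * cutoff_inverse (R h0 q)" for q
 have cs: "mfun P n (%q. cutoff_inverse (R h0 q)) (carrier P)" for n
  by (rule P.mfun_compose[OF Rs[OF h0s] oP Cn_on_cutoff_inverse])
 have hs: "mfun P n h (carrier P)" for n
  unfolding h_def by (rule P.mfun_mult[OF h0s cs oP])
 have hH: "h (x, s) = 0" if "x\<in>H s" for x s using h0H[OF that] by (simp add: h_def)
 have Rh: "R h (x, s) = 1" if q: "(x, s)\<in>G" and xH: "x\<in>H s" for x s
 proof -
  have qP: "(x, s)\<in>carrier P" using q G(3) by blast
  hence s: "s\<in>I" and x: "x\<in>carrier A" using cP by auto
  have "R h (x, s) = h0 (x, s) * Dfun A (%x. cutoff_inverse (R h0 (x, s))) x (Reeb s x) + R h0 (x, s) * cutoff_inverse (R h0 (x, s))"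
   using Dfun_mult[OF mfun_slice[OF h0s oP s] mfun_slice[OF cs oP s] slice_open[OF oP] _ x, of "Reeb s x"] qP
   by (simp add: R_def h_def)
  thus ?thesis using h0H[OF xH] R_gt[OF q xH] by (simp add: cutoff_inverse_eq)
 qed
 define O2 where "O2 = {q\<in>carrier P. 1/2 < R h q} Int G"
 have "open {q\<in>carrier P. 1/2 < R h q}"
  using continuous_open_preimage[OF P.mfun_continuous[OF Rs[OF hs, of 0] oP order_refl] oP open_greaterThan[of "1/2"]]
  by (simp add: Int_def vimage_def greaterThan_def)
 hence oO2: "open O2" using G(1) by (auto simp: O2_def)
 have LO2: "LI <= O2"
 proof
  fix q assume q: "q\<in>LI"
  then obtain x s where xs: "q = (x, s)" "s\<in>I" "x\<in>H s" using L_subset_H by (auto simp: total_space_def)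
  thus "q\<in>O2" using Rh[of x s] q G by (auto simp: O2_def)
 qed
 define Z where "Z = \<Union>{N. open N & (\<forall>x s. (x, s)\<in>N --> h (x, s) = 0 --> x\<in>H s)}"
 have oZ: "open Z" unfolding Z_def by blast
 have LZ: "LI <= Z"
 proof
  fix q assume q: "q\<in>LI"
  then obtain p t where pt: "q = (p, t)" "t\<in>I" "p\<in>L t" by (auto simp: total_space_def)
  have "1/2 < R h (p, t)" using LO2 q pt(1) by (auto simp: O2_def)
  hence nz: "Dfun A (%x. h (x, t)) p (Reeb t p) \<noteq> 0" by (auto simp: R_def)
  have qP: "(p, t)\<in>carrier P" using q pt(1) LI_carrier cP by blast
  obtain N where "open N" "(p, t)\<in>N" "N <= carrier P" "!!x s. (x, s)\<in>N ==> h (x, s) = 0 ==> x\<in>H s"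
   by (rule zero_set[OF pt(2,3) hs oP qP hH nz]) (assumption | rule that)+
  thus "q\<in>Z" unfolding Z_def pt(1) by blast
 qed
 show ?thesis
 proof (rule that[of h "O2 Int Z"])
  show "mfun P n h (carrier A \<times> I)" for n using hs cP by simp
  show "open (O2 Int Z)" "LI <= O2 Int Z" using oO2 oZ LO2 LZ by auto
  show "O2 Int Z <= carrier A \<times> I" using cP by (auto simp: O2_def)
  show "h (x, s) = 0 \<longleftrightarrow> x\<in>H s" if "(x, s)\<in>O2 Int Z" for x s
   using that hH unfolding Z_def by blast
  show "1/2 < Dfun A (%x. h (x, s)) x (Reeb s x)" if "(x, s)\<in>O2 Int Z" for x s
   using that by (simp add: O2_def R_def)
  show "Dfun A (%x. h (x, s)) x (Reeb s x) = 1" if "(x, s)\<in>O2 Int Z" "x\<in>H s" for x s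
   using Rh[of x s] that by (simp add: O2_def R_def)
 qed
qed

end


section \<open>Continuous majorants\<close>

text \<open>A bound that is valid on a neighbourhood of every parameter is dominated by a continuous one: the
  supremum of truncated cones is 1-Lipschitz, and its reciprocal works.\<close>

lemma continuous_majorant:
 fixes r m :: "real => real"
 assumes rm: "!!t. t\<in>I ==> 0 < r t & 1 <= m t"
 obtains N where "continuous_on I N" "!!t. t\<in>I ==> 1 <= N t" "!!t. t\<in>I ==> \<exists>a\<in>I. \<bar>t - a\<bar> < r a & m a <= N t"
proof -
 define g where "g a t = min (1 / m a) (r a - \<bar>t - a\<bar>)" for a t
 define f where "f t = (SUP a\<in>I. g a t)" for t
 have g1: "g a t <= 1" if "a\<in>I" for a t using rm[OF that] by (simp add: g_def min_le_iff_disj)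
 have bd: "bdd_above ((%a. g a t) ` I)" for t using g1 by (auto intro!: bdd_aboveI)
 have pos: "0 < f t" "f t <= 1" if t: "t\<in>I" for t
 proof -
  have "0 < g t t" using rm[OF t] by (simp add: g_def)
  also have "g t t <= f t" unfolding f_def by (rule cSUP_upper[OF t bd])
  finally show "0 < f t" .
  show "f t <= 1" unfolding f_def by (rule cSUP_least) (use t g1 in auto)
 qed
 have le: "f t <= f s + \<bar>t - s\<bar>" if I: "I \<noteq> {}" for t s
  unfolding f_def[of t]
 proof (rule cSUP_least[OF I])
  fix a assume a: "a\<in>I"
  have "g a t <= g a s + \<bar>t - s\<bar>" by (auto simp: g_def min_def)
  also have "g a s <= f s" unfolding f_def by (rule cSUP_upper[OF a bd])
  finally show "g a t <= f s + \<bar>t - s\<bar>" by simp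
 qed
 have cf: "continuous_on I f"
  unfolding continuous_on_iff
 proof (intro ballI allI impI)
  fix t e :: real assume t: "t\<in>I" "0 < e"
  hence "I \<noteq> {}" by blast
  hence "dist (f s) (f t) <= \<bar>s - t\<bar>" for s using le[of s t] le[of t s] by (simp add: dist_real_def abs_le_iff abs_minus_commute)
  thus "\<exists>d>0. \<forall>s\<in>I. dist s t < d --> dist (f s) (f t) < e"
   using t(2) by (intro exI[of _ e]) (auto simp: dist_real_def intro: le_less_trans)
 qed
 show ?thesis
 proof (rule that[of "%t. 2 / f t"])
  show "continuous_on I (%t. 2 / f t)" using pos by (intro continuous_intros cf) force
  fix t assume t: "t\<in>I"
  show "1 <= 2 / f t" using pos[OF t] by simp
  have "f t / 2 < f t" using pos[OF t] by simp
  then obtain a where a: "a\<in>I" "f t / 2 < g a t" using less_cSUP_iff[OF _ bd, of "f t / 2" t] t unfolding f_def by blast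
  hence 1: "f t / 2 < 1 / m a" "f t / 2 < r a - \<bar>t - a\<bar>" by (auto simp: g_def)
  have "m a <= 2 / f t" using 1(1) rm[OF a(1)] pos[OF t] by (simp add: field_simps)
  thus "\<exists>a\<in>I. \<bar>t - a\<bar> < r a & m a <= 2 / f t" using a(1) 1(2) pos[OF t] by (intro bexI[of _ a]) auto
 qed
qed

section \<open>Level sets\<close>

context manifold begin

lemma chart_compose:
 assumes c: "c\<in>A" and U: "open U" "U <= cimg c" "open V" and hom: "homeomorphism U V \<Theta> G"
  and C1: "C1_on \<Theta> U" "C1_on G V"
 defines "d \<equiv> \<lparr>cdom = {x\<in>cdom c. cmap c x\<in>U}, cmap = \<Theta> o cmap c\<rparr>"
 shows "d\<in>charts 1 A" "cimg d = V"
proof -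
 note cc = chartD[OF c]
 have h: "!!y. y\<in>U ==> \<Theta> y\<in>V & G (\<Theta> y) = y" "!!z. z\<in>V ==> G z\<in>U & \<Theta> (G z) = z"
  "continuous_on U \<Theta>" "continuous_on V G"
  using hom by (auto simp: homeomorphism_def)
 have dom: "cdom d = {x\<in>cdom c. cmap c x\<in>U}" and map: "cmap d x = \<Theta> (cmap c x)" for x by (simp_all add: d_def)
 have V: "cinv c (G z)\<in>cdom d" "cmap d (cinv c (G z)) = z" if "z\<in>V" for z
  using h(2)[OF that] U(2) cc by (auto simp: dom map)
 show img: "cimg d = V"
 proof
  show "V <= cimg d" using V by (metis imageI subsetI)
 qed (use h in "auto simp: dom map")
 have inj: "inj_on (cmap d) (cdom d)"
  by (rule inj_on_inverseI[where g="%z. cinv c (G z)"]) (use h cc in "auto simp: dom map")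
 have inv: "cinv d z = cinv c (G z)" if "z\<in>V" for z
  unfolding cinv_def[of d] using inv_into_f_f[OF inj V(1)[OF that]] V(2)[OF that] by simp
 have od: "open (cdom d)"
  using continuous_open_preimage[OF cc(6) cc(1) U(1)] by (simp add: dom Int_def vimage_def)
 have ch: "is_chart d"
  unfolding is_chart_def
 proof (intro conjI od)
  show "open (cimg d)" using U(3) img by simp
  show "homeomorphism (cdom d) (cimg d) (cmap d) (cinv d)"
   unfolding img
  proof (rule homeomorphismI)
   show "continuous_on (cdom d) (cmap d)"
    unfolding map using cc(6) by (intro continuous_on_comp[OF h(3)]) (auto simp: dom intro: continuous_on_subset)
   have "continuous_on V (%z. cinv c (G z))" by (rule continuous_on_comp[OF cc(7) h(4)]) (use h U in auto)
   thus "continuous_on V (cinv d)" by (rule continuous_on_eq) (simp add: inv)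
   show "cmap d ` cdom d <= V" using img by simp
   show "cinv d ` V <= cdom d" using V inv by auto
   show "cinv d (cmap d x) = x" if "x\<in>cdom d" for x using that h cc(3) inv by (auto simp: dom map)
   show "cmap d (cinv d y) = y" if "y\<in>V" for y using V(2)[OF that] inv[OF that] by simp
  qed
 qed
 have n: "n <= Suc 0" if "enat n <= 1" for n using that by (simp add: one_enat_def)
 have tr: "transition_Ck 1 d e & transition_Ck 1 e d" if e: "e\<in>A" for e
  unfolding transition_Ck_def Ck_on_def
 proof (intro conjI allI impI)
  fix k assume k: "enat k <= 1"
  note ce = chartD[OF e]
  have o1: "open (cmap d ` (cdom d Int cdom e))" using chart_open_image[OF ch ce(1)] by (simp add: Int_commute)
  have o2: "open (cmap e ` (cdom e Int cdom d))" using open_image[OF e od] by (simp add: Int_commute)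
  have oc: "open (cmap c ` (cdom c Int cdom e))" using open_image[OF c ce(1)] by (simp add: Int_commute)
  have G: "Cn_on k G (cmap d ` (cdom d Int cdom e))"
   by (rule Cn_on_subset[OF Cn_on_le[OF C1(2) n[OF k]]]) (use img in auto)
  have "Cn_on k (%z. (cmap e o cinv c) (G z)) (cmap d ` (cdom d Int cdom e))"
   by (rule Cn_on_compose[OF o1 oc G Cn_transition_A[OF c e]]) (use h in "auto simp: dom map")
  thus "Cn_on k (cmap e o cinv d) (cmap d ` (cdom d Int cdom e))"
   by (rule Cn_on_cong_imp[OF o1, rotated]) (use img inv in auto)
  have T: "Cn_on k (cmap c o cinv e) (cmap e ` (cdom e Int cdom d))"
   by (rule Cn_on_subset[OF Cn_transition_A[OF e c]]) (auto simp: dom)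
  have "Cn_on k (%z. \<Theta> ((cmap c o cinv e) z)) (cmap e ` (cdom e Int cdom d))"
   by (rule Cn_on_compose[OF o2 U(1) T Cn_on_le[OF C1(1) n[OF k]]]) (use ce(3) in \<open>auto simp: dom\<close>)
  thus "Cn_on k (cmap d o cinv e) (cmap e ` (cdom e Int cdom d))"
   by (rule Cn_on_cong_imp[OF o2, rotated]) (simp add: map)
 qed
 show "d\<in>charts 1 A"
  unfolding charts_def using ch tr cdom_carrier[OF c] by (auto simp: dom)
qed

text \<open>A given chart is changed along the gradient only, so that the coordinate in this direction becomes the function
 itself; the change is the identity to first order, hence invertible.\<close>

lemma level_slice_chart:
 assumes f: "mfun A (Suc 0) f U" "open U" "U <= carrier A" "p\<in>U" and df: "Dfun A f p v \<noteq> 0"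
  and S: "S Int U = {x\<in>U. f x = f p}"
 shows "\<exists>c W. slice_chart A 1 (DIM('e) - 1) S p c W"
proof -
 let ?c = "chart_at A p"
 have p: "p\<in>carrier A" using f by blast
 have c: "?c\<in>A" "p\<in>cdom ?c" using chart_at[OF p] by auto
 note cc = chartD[OF c(1)]
 define y0 where "y0 = cmap ?c p"
 define g where "g y = f (cinv ?c y)" for y
 define n where "n = (\<Sum>b\<in>Basis. Dfun A f p b *\<^sub>R b)"
 have lin: "linear (Dfun A f p)" by (rule Dfun_linear[OF f(1,2,4) p])
 have n: "Dfun A f p w = n \<bullet> w" for w
  using linear_eq_sum_Basis[OF lin, of w] by (simp add: n_def inner_sum_left inner_commute[of w] mult.commute)
 have n0: "n \<noteq> 0" using df n by auto
 let ?S = "cmap ?c ` (U Int cdom ?c)"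
 have oS: "open ?S" by (rule open_image[OF c(1) f(2)])
 have yS: "y0\<in>?S" using f(4) c(2) by (auto simp: y0_def)
 have g1: "C1_on g ?S" using f(1) c(1) unfolding g_def[abs_def] mfun_def by blast
 define \<Theta> where "\<Theta> y = (y - y0) + (g y - g y0 - n \<bullet> (y - y0)) *\<^sub>R (n /\<^sub>R (n \<bullet> n))" for y
 have \<Theta>1: "C1_on \<Theta> ?S"
  unfolding \<Theta>_def by (intro Cn_on_add Cn_on_diff Cn_on_scaleR Cn_on_inner Cn_on_const Cn_on_id g1 oS)
 have n\<Theta>: "n \<bullet> \<Theta> y = g y - g y0" for y using n0 by (simp add: \<Theta>_def inner_add_right mult.assoc)
 have "(g has_derivative (%w. n \<bullet> w)) (at y0)"
  using has_derivative_Dfun[OF f(1,2,4) p] unfolding n[abs_def] g_def[abs_def] y0_def by simp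
 hence "(\<Theta> has_derivative (%w. (w - 0) + ((n \<bullet> w - 0) - n \<bullet> (w - 0)) *\<^sub>R (n /\<^sub>R (n \<bullet> n)))) (at y0)"
  unfolding \<Theta>_def
  by (intro has_derivative_add has_derivative_diff has_derivative_const has_derivative_ident has_derivative_scaleR_left has_derivative_inner_right)
 hence inj: "w = 0" if "FD \<Theta> y0 w = 0" for w
  using that FD_eqI[of \<Theta> _ y0 w] by simp
 obtain U' V G where U': "open U'" "U' <= ?S" "y0\<in>U'" "open V" "\<Theta> y0\<in>V" and hom: "homeomorphism U' V \<Theta> G" and G1: "C1_on G V"
  by (rule C1_inverse_function[OF oS yS \<Theta>1 inj]) (assumption | rule that)+
 define d where "d = \<lparr>cdom = {x\<in>cdom ?c. cmap ?c x\<in>U'}, cmap = \<Theta> o cmap ?c\<rparr>"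
 have sub: "U' <= cimg ?c" using U'(2) by auto
 note D = chart_compose[OF c(1) U'(1) sub U'(4) hom Cn_on_subset[OF \<Theta>1 U'(2)] G1, folded d_def]
 have dU: "x\<in>U" if "x\<in>cdom d" for x
 proof -
  have "x\<in>cdom ?c" "cmap ?c x\<in>?S" using that U'(2) by (auto simp: d_def)
  then obtain x' where "x'\<in>U" "x'\<in>cdom ?c" "cmap ?c x = cmap ?c x'" by auto
  thus ?thesis using cc(3) \<open>x\<in>cdom ?c\<close> by metis
 qed
 have key: "x\<in>S \<longleftrightarrow> n \<bullet> cmap d x = 0" if x: "x\<in>cdom d" for x
 proof -
  have "g (cmap ?c x) = f x" "g y0 = f p" using x cc(3) c(2) by (auto simp: d_def g_def y0_def)
  hence "n \<bullet> cmap d x = f x - f p" using n\<Theta> by (simp add: d_def)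
  thus ?thesis using S dU[OF x] by auto
 qed
 have "slice_chart A 1 (DIM('e) - 1) S p d {x. n \<bullet> x = 0}"
  unfolding slice_chart_def
 proof (intro conjI D(1) subspace_hyperplane dim_hyperplane n0)
  show "p\<in>cdom d" using c(2) U'(3) by (simp add: d_def y0_def)
  show "cmap d ` (S Int cdom d) = {x. n \<bullet> x = 0} Int cimg d" using key by auto
 qed
 thus ?thesis by blast
qed

lemma differential_eq:
 assumes f: "mfun A (Suc 0) f U" "open U" "p\<in>U" "p\<in>carrier A"
 shows "differential A U f p v = Dfun A f p v"
proof -
 let ?c = "chart_at A p"
 have c: "?c\<in>A" "p\<in>cdom ?c" using chart_at[OF f(4)] by auto
 have "at (cmap ?c p) within cmap ?c ` (U Int cdom ?c) = at (cmap ?c p)"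
  by (rule at_within_open[OF _ open_image[OF c(1) f(2)]]) (use f(3) c(2) in auto)
 moreover have d: "((f o cinv ?c) has_derivative Dfun A f p) (at (cmap ?c p))"
  using has_derivative_Dfun[OF f] by (simp add: o_def)
 ultimately have "differential A U f p = Dfun A f p"
  unfolding differential_def Let_def by (intro some_equality) (auto dest: has_derivative_unique[OF _ d])
 thus ?thesis by simp
qed

section \<open>Integral curves in a manifold and in a product\<close>

lemma derivative_along_icurve:
 assumes f: "mfun A (Suc 0) f U" "open U" and \<gamma>: "icurve A Y J \<gamma>" "s\<in>J" "\<gamma> s\<in>U"
 shows "((%h. f (\<gamma> h)) has_real_derivative Dfun A f (\<gamma> s) (Y (\<gamma> s))) (at s within J)"
proof -
 have p: "\<gamma> s\<in>carrier A" and cont: "continuous_on J \<gamma>" using \<gamma> by (auto simp: icurve_def)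
 let ?c = "chart_at A (\<gamma> s)"
 have c: "?c\<in>A" "\<gamma> s\<in>cdom ?c" using chart_at[OF p] by auto
 note cc = chartD[OF c(1)]
 have 1: "((%h. cmap ?c (\<gamma> h)) has_vector_derivative Y (\<gamma> s)) (at s within J)"
  using \<gamma> c coord_chart_at[OF p] unfolding icurve_def by metis
 have "((%y. f (cinv ?c y)) o (%h. cmap ?c (\<gamma> h)) has_vector_derivative Dfun A f (\<gamma> s) (Y (\<gamma> s))) (at s within J)"
  by (rule vector_derivative_diff_chain_within[OF 1 has_derivative_at_withinI[OF has_derivative_Dfun[OF f \<gamma>(3) p]]])
 hence 2: "((%h. f (cinv ?c (cmap ?c (\<gamma> h)))) has_vector_derivative Dfun A f (\<gamma> s) (Y (\<gamma> s))) (at s within J)"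
  by (simp add: o_def)
 obtain \<delta> where \<delta>: "\<delta> > 0" "!!h. h\<in>J ==> \<bar>h - s\<bar> < \<delta> ==> \<gamma> h\<in>cdom ?c"
  by (rule continuous_on_nhd[OF cont \<gamma>(2) cc(1) c(2)]) (rule that)
 have "((%h. f (\<gamma> h)) has_vector_derivative Dfun A f (\<gamma> s) (Y (\<gamma> s))) (at s within J)"
  by (rule has_vector_derivative_transform_near[OF 2 \<gamma>(2) \<delta>(1)]) (use \<delta>(2) cc(3) in auto)
 thus ?thesis by (simp add: has_real_derivative_iff_has_vector_derivative)
qed

lemma icurve_field_cong:
 "icurve A Y J \<gamma> ==> (!!s. s\<in>J ==> Y (\<gamma> s) = Y' (\<gamma> s)) ==> icurve A Y' J \<gamma>"
 by (simp add: icurve_def)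

lemma integral_curve_iff:
 assumes "S <= carrier A"
 shows "integral_curve A S Y s \<gamma> \<longleftrightarrow> icurve A Y (closed_segment 0 s) \<gamma> & (\<forall>r\<in>closed_segment 0 s. \<gamma> r\<in>S)"
proof
 assume l: "integral_curve A S Y s \<gamma>"
 have "icurve A Y (closed_segment 0 s) \<gamma>"
 proof (rule icurveI)
  fix r assume "r\<in>closed_segment 0 s"
  hence r: "\<gamma> r\<in>carrier A" "((%h. cmap (chart_at A (\<gamma> r)) (\<gamma> h)) has_vector_derivative Y (\<gamma> r)) (at r within closed_segment 0 s)"
   using l assms by (auto simp: integral_curve_def)
  thus "\<exists>c\<in>A. \<gamma> r\<in>cdom c & ((%h. cmap c (\<gamma> h)) has_vector_derivative coord A c (\<gamma> r) (Y (\<gamma> r))) (at r within closed_segment 0 s)"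
   using chart_at[OF r(1)] coord_chart_at[OF r(1)] by metis
 qed (use l in "simp add: integral_curve_def")
 thus "icurve A Y (closed_segment 0 s) \<gamma> & (\<forall>r\<in>closed_segment 0 s. \<gamma> r\<in>S)" using l by (simp add: integral_curve_def)
next
 assume r: "icurve A Y (closed_segment 0 s) \<gamma> & (\<forall>r\<in>closed_segment 0 s. \<gamma> r\<in>S)"
 hence "((%h. cmap (chart_at A (\<gamma> r)) (\<gamma> h)) has_vector_derivative Y (\<gamma> r)) (at r within closed_segment 0 s)" if "r\<in>closed_segment 0 s" for r
  using that chart_at[of "\<gamma> r"] coord_chart_at[of "\<gamma> r"] unfolding icurve_def by metis
 thus "integral_curve A S Y s \<gamma>" using r by (simp add: integral_curve_def icurve_def)
qed

end

context weinstein_family begin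

lemma tr_pchart:
 assumes c: "c\<in>A" "x\<in>cdom c" and d: "d\<in>A" "x\<in>cdom d" and t: "t\<in>I"
 shows "tr (pchart I d) (pchart I c) (x, t) w = (tr d c x (fst w), snd w)"
proof -
 note cd = chartD[OF d(1)]
 have ch: "c\<in>charts 1 A" "d\<in>charts 1 A" using c d atlas_charts by auto
 have "((cmap c o cinv d) has_derivative tr d c x) (at (fst (cmap d x, t)))" using tr_derivative[OF ch(2,1) d(2) c(2)] by simp
 hence "((%q. (cmap c o cinv d) (fst q)) has_derivative (%w. tr d c x (fst w))) (at (cmap d x, t))"
  by (rule has_derivative_compose[OF has_derivative_fst[OF has_derivative_ident]])
 hence "((%q. ((cmap c o cinv d) (fst q), snd q)) has_derivative (%w. (tr d c x (fst w), snd w))) (at (cmap d x, t))"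
  by (intro has_derivative_Pair has_derivative_snd has_derivative_ident)
 hence "((cmap (pchart I c) o cinv (pchart I d)) has_derivative (%w. (tr d c x (fst w), snd w))) (at (cmap d x, t))"
  by (rule has_derivative_local[OF _ open_cimg_I[OF d(1)]])
   (use d(2) t in \<open>auto simp: pchart_cinv[OF is_chart[OF d(1)]]\<close>)
 from FD_eqI[OF this] show ?thesis by (simp add: tr_def)
qed

text \<open>Integral curves of the lifted field keep the parameter, so its flow consists of the flows on the fibres.\<close>

definition lift_field :: "('a \<times> real => 'e) => 'a \<times> real => 'e \<times> real" where
 "lift_field Z q = coord_inv P (pchart I (chart_at A (fst q))) q (Z q, 0)"

lemma coord_lift:
 assumes c: "c\<in>A" "x\<in>cdom c" and t: "t\<in>I"
 shows "coord P (pchart I c) (x, t) (lift_field Z (x, t)) = (coord A c x (Z (x, t)), 0)"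
proof -
 have x: "x\<in>carrier A" using c cdom_carrier by blast
 have d: "chart_at A x\<in>A" "x\<in>cdom (chart_at A x)" using chart_at[OF x] by auto
 have P: "(x, t)\<in>carrier P" using x t carrier_prod by simp
 have in1: "pchart I e\<in>charts 1 P" if "e\<in>A" for e
  using that by (intro P.atlas_charts) (auto simp: prod_atlas_eq)
 show ?thesis
  unfolding lift_field_def coord_eq_tr coord_inv_eq_tr
  using P.tr_chain[OF in1[OF d(1)] P.chart_at_1[OF P] in1[OF c(1)], of "(x, t)"] P.chart_at[OF P] c d t
  by (simp add: tr_pchart)
qed

lemma icurve_lift:
 assumes t: "t\<in>I"
 shows "icurve P (lift_field Z) J (%s. (\<gamma> s, t)) \<longleftrightarrow> icurve A (%x. Z (x, t)) J \<gamma>"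
proof
 assume l: "icurve P (lift_field Z) J (%s. (\<gamma> s, t))"
 show "icurve A (%x. Z (x, t)) J \<gamma>"
  unfolding icurve_def
 proof (intro conjI ballI impI)
  show "continuous_on J \<gamma>" using l continuous_on_fst[of J "%s. (\<gamma> s, t)"] by (simp add: icurve_def)
  fix s assume s: "s\<in>J"
  show "\<gamma> s\<in>carrier A" using l s carrier_prod by (auto simp: icurve_def)
  fix c assume c: "c\<in>A" "\<gamma> s\<in>cdom c"
  have "((%h. cmap (pchart I c) (\<gamma> h, t)) has_vector_derivative coord P (pchart I c) (\<gamma> s, t) (lift_field Z (\<gamma> s, t))) (at s within J)"
   using l s c t by (auto simp: icurve_def prod_atlas_eq)
  from bounded_linear.has_vector_derivative[OF bounded_linear_fst this]
  show "((%h. cmap c (\<gamma> h)) has_vector_derivative coord A c (\<gamma> s) (Z (\<gamma> s, t))) (at s within J)"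
   by (simp add: coord_lift[OF c t])
 qed
next
 assume r: "icurve A (%x. Z (x, t)) J \<gamma>"
 show "icurve P (lift_field Z) J (%s. (\<gamma> s, t))"
  unfolding icurve_def
 proof (intro conjI ballI impI)
  show "continuous_on J (%s. (\<gamma> s, t))" using r by (auto simp: icurve_def intro!: continuous_intros)
  fix s assume s: "s\<in>J"
  show "(\<gamma> s, t)\<in>carrier P" using r s t carrier_prod by (auto simp: icurve_def)
  fix c' assume "c'\<in>P" "(\<gamma> s, t)\<in>cdom c'"
  then obtain c where c: "c' = pchart I c" "c\<in>A" "\<gamma> s\<in>cdom c" by (auto simp: prod_atlas_eq)
  have "((%h. cmap c (\<gamma> h)) has_vector_derivative coord A c (\<gamma> s) (Z (\<gamma> s, t))) (at s within J)"
   using r s c by (simp add: icurve_def)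
  hence "((%h. (cmap c (\<gamma> h), t)) has_vector_derivative (coord A c (\<gamma> s) (Z (\<gamma> s, t)), 0)) (at s within J)"
   unfolding has_vector_derivative_def using has_derivative_Pair[OF _ has_derivative_const[of t]] by fastforce
  thus "((%h. cmap c' (\<gamma> h, t)) has_vector_derivative coord P c' (\<gamma> s, t) (lift_field Z (\<gamma> s, t))) (at s within J)"
   by (simp add: c(1) coord_lift[OF c(2,3) t])
 qed
qed

lemma icurve_lift_fibre:
 assumes \<gamma>: "icurve P (lift_field Z) J \<gamma>" "is_interval J" "r\<in>J" "s\<in>J"
 shows "snd (\<gamma> s) = snd (\<gamma> r)"
proof -
 have "((%h. snd (\<gamma> h)) has_vector_derivative 0) (at u within J)" if u: "u\<in>J" for u
 proof -
  obtain x t where xt: "\<gamma> u = (x, t)" by (cases "\<gamma> u")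
  have P: "x\<in>carrier A" "t\<in>I" using \<gamma>(1) u xt carrier_prod by (force simp: icurve_def)+
  then obtain c where c: "c\<in>A" "x\<in>cdom c" using carrierE by blast
  have "((%h. cmap (pchart I c) (\<gamma> h)) has_vector_derivative coord P (pchart I c) (\<gamma> u) (lift_field Z (\<gamma> u))) (at u within J)"
   using \<gamma>(1) u c P xt by (auto simp: icurve_def prod_atlas_eq)
  from bounded_linear.has_vector_derivative[OF bounded_linear_snd this]
  have "((%h. snd (cmap (pchart I c) (\<gamma> h))) has_vector_derivative 0) (at u within J)" by (simp only: xt coord_lift[OF c P(2)] snd_conv)
  moreover have "snd (cmap (pchart I c) q) = snd q" for q by (cases q) simp
  ultimately show ?thesis by simp
 qed
 then obtain k where "!!u. u\<in>J ==> snd (\<gamma> u) = k"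
  by (rule has_vector_derivative_zero_constant[OF is_interval_convex[OF \<gamma>(2)]]) (assumption | rule that)+
 thus ?thesis using \<gamma>(3,4) by simp
qed

lemma Ck_map_fibre:
 assumes F: "Ck_map P P 1 (carrier P) F" and t: "t\<in>I" and f: "!!x. x\<in>carrier A ==> F (x, t) = (f x, t)"
 shows "Ck_map A A 1 (carrier A) f"
proof (rule Ck_mapI[OF atlas atlas open_carrier order_refl])
 fix p assume p: "p\<in>carrier A"
 have cP: "carrier P = carrier A \<times> I" by (rule carrier_prod)
 have FP: "F ` carrier P <= carrier P" using F by (simp add: Ck_map_def)
 have "(p, t)\<in>carrier P" using p t cP by simp
 hence "F (p, t)\<in>carrier P" using FP by blast
 hence fp: "f p\<in>carrier A" using f[OF p] cP by simp
 obtain c where c: "c\<in>A" "p\<in>cdom c" using p by (rule carrierE)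
 obtain d where d: "d\<in>A" "f p\<in>cdom d" using fp by (rule carrierE)
 note cc = chartD[OF c(1)] and cd = chartD[OF d(1)]
 have pc: "pchart I c\<in>charts \<infinity> P" "pchart I d\<in>charts \<infinity> P" using pchart_charts[OF atlas_charts I] c d by auto
 let ?X = "{q\<in>carrier P Int cdom (pchart I c). F q\<in>cdom (pchart I d)}"
 note D = Ck_mapD[OF P_atlas P_atlas F P.open_carrier pc]
 have oX: "open ?X" by (rule D(2)[of 0]) (simp add: zero_enat_def[symmetric])
 define U where "U = {x. (x, t)\<in>?X}"
 have oU: "open U" unfolding U_def by (rule slice_open[OF oX])
 have pU: "p\<in>U" using p c d t f[OF p] cP by (simp add: U_def)
 have eq: "U Int cdom c = U" by (auto simp: U_def)
 have fd: "f x\<in>cdom d" "x\<in>carrier A" if "x\<in>U" for x using that f[of x] cP by (auto simp: U_def)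
 have oi: "open (cmap (pchart I c) ` ?X)" 
  using chart_open_image[OF P.charts_is_chart[OF pc(1)] oX] by (simp add: Int_def conj_commute conj_left_commute)
 have "Cn_on n (cmap d o f o cinv c) (cmap c ` (U Int cdom c))" if n: "enat n <= 1" for n
  unfolding eq
 proof -
  have oc: "open (cmap c ` U)" using open_image[OF c(1) oU] eq by simp
  have i: "Cn_on n (%y. (y, t)) (cmap c ` U)" by (intro Cn_on_Pair oc Cn_on_id Cn_on_const)
  have "Cn_on n (%y. (cmap (pchart I d) o F o cinv (pchart I c)) (y, t)) (cmap c ` U)"
  proof (rule Cn_on_compose[OF oc oi i D(1)[OF n]])
   show "(%y. (y, t)) ` cmap c ` U <= cmap (pchart I c) ` ?X"
   proof
    fix z assume "z\<in>(%y. (y, t)) ` cmap c ` U"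
    then obtain x where x: "x\<in>U" "z = (cmap c x, t)" by blast
    show "z\<in>cmap (pchart I c) ` ?X" by (rule image_eqI[of _ _ "(x, t)"]) (use x in "auto simp: U_def")
   qed
  qed
  from Cn_on_fst[OF oc this] show "Cn_on n (cmap d o f o cinv c) (cmap c ` U)"
  proof (rule Cn_on_cong_imp[OF oc, rotated])
   fix y assume "y\<in>cmap c ` U"
   then obtain x where x: "x\<in>U" "y = cmap c x" by blast
   have xc: "x\<in>cdom c" using x(1) eq by blast
   thus "fst ((cmap (pchart I d) o F o cinv (pchart I c)) (y, t)) = (cmap d o f o cinv c) y"
    using x cc(3)[OF xc] f[OF fd(2)[OF x(1)]] pchart_cinv[OF is_chart[OF c(1)], of y t I] t by (simp add: image_eqI)
  qed
 qed
 moreover have "f ` (U Int cdom c) <= cdom d" using fd by auto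
 ultimately show "\<exists>c\<in>charts \<infinity> A. \<exists>d\<in>charts \<infinity> A. \<exists>U. open U & p\<in>U & p\<in>cdom c & f ` (U Int cdom c) <= cdom d &
   (\<forall>n. enat n <= 1 --> Cn_on n (cmap d o f o cinv c) (cmap c ` (U Int cdom c)))"
  using atlas_charts[OF c(1), of \<infinity>] atlas_charts[OF d(1), of \<infinity>] c(2) oU pU by blast
qed

end


section \<open>Dynamics near the skeleta\<close>

text \<open>Nested neighbourhoods \<open>G2 \<subseteq> G1 \<subseteq> O'\<close> of the skeleta: the Hamiltonian is controlled on \<open>O'\<close>, the cut off field
 is the contact field on \<open>G1\<close>, and \<open>\<xi>\<close> vanishes on \<open>G2\<close> but nowhere outside \<open>G1\<close>.\<close>

locale tube = weinstein_family A \<zeta> I \<alpha> H V L + hamiltonian A \<zeta> I \<alpha> h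
 for A :: "('a::t2_space, 'e::euclidean_space) chart set" and \<zeta> I \<alpha> H V L h +
 fixes O' G1 G2 :: "('a \<times> real) set" and \<beta> \<xi> :: "'a \<times> real => real"
 assumes h_zero: "!!x s. (x, s)\<in>O' ==> h (x, s) = 0 \<longleftrightarrow> x\<in>H s"
  and Dh_gt: "!!x s. (x, s)\<in>O' ==> 1/2 < Dfun A (%x. h (x, s)) x (Reeb s x)"
  and Dh_1: "!!x s. (x, s)\<in>O' ==> x\<in>H s ==> Dfun A (%x. h (x, s)) x (Reeb s x) = 1"
  and \<beta>: "!!n. mfun P n \<beta> (carrier P)" "!!q. q\<in>G1 ==> \<beta> q = 1"
  and \<beta>_support: "!!J. compact J ==> J <= I ==> \<exists>K. compact K & K <= carrier P & (\<forall>q. snd q\<in>J --> q\<notin>K --> \<beta> q = 0)"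
  and G1: "open G1" "G1 <= O'" and O': "O' <= carrier A \<times> I"
  and \<xi>: "!!n. mfun P n \<xi> (carrier P)" "!!q. 0 <= \<xi> q" "!!q. \<xi> q <= 1" "!!q. q\<in>G2 ==> \<xi> q = 0"
   "!!q. q\<in>carrier P ==> \<xi> q = 0 ==> q\<in>G1"
  and \<xi>_support: "!!J. compact J ==> J <= I ==> \<exists>K. compact K & K <= carrier P & (\<forall>q. snd q\<in>J --> q\<notin>K --> \<xi> q = 1)"
  and G2: "open G2" "LI <= G2" "G2 <= G1"
begin

lemma ht_eq: "ht t = (%x. h (x, t))"
 by (simp add: ht_def fun_eq_iff)

text \<open>Both fields are tangent to the hypersurface and dual to the same one-form on it.\<close>

lemma X_eq_V:
 assumes t: "(p, t)\<in>G1" and p: "p\<in>H t"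
 shows "X t p = V t p"
proof -
 have pt: "(p, t)\<in>O'" using t G1 by blast
 hence I: "t\<in>I" "p\<in>carrier A" using O' by auto
 let ?U = "{x. (x, t)\<in>G1}"
 have oU: "open ?U" by (rule slice_open[OF G1(1)])
 have s: "mfun A (Suc 0) (ht t) ?U" by (rule mfun_subset[OF ht_smooth[OF I(1)]]) (use G1 O' in blast)
 have D1: "Dh t p (Reeb t p) = 1" using Dh_1[OF pt p] by (simp add: ht_eq)
 obtain c W where fl: "flat_chart A \<infinity> (DIM('e) - 1) (H t) p c W" by (rule H_flat_chart[OF I(1) p])
 have T: "tangent_space A (H t) p = {u. Dh t p u = 0}"
  by (rule tangent_kernel(2)[OF fl p s oU, where v="Reeb t p"]) (use t D1 h_zero G1 in "auto simp: ht_eq")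
 have h0: "ht t p = 0" using h_zero[OF pt] p by (simp add: ht_eq)
 have XT: "X t p\<in>tangent_space A (H t) p" unfolding T using X(3)[OF I] h0 by simp
 have lin: "linear (Dh t p)" by (rule Dh_linear[OF I])
 have "X t p - V t p = 0"
 proof (rule H_nd[OF I(1) p])
  show "X t p - V t p\<in>tangent_space A (H t) p"
   using XT V_tangent[OF I(1) p] unfolding T by (simp add: linear_diff[OF lin])
  fix v assume v: "v\<in>tangent_space A (H t) p"
  have "ext_deriv A (\<alpha> t) p (X t p) v = \<alpha> t p v" using X(2)[OF I, of v] D1 v T by simp
  thus "ext_deriv A (\<alpha> t) p (X t p - V t p) v = 0"
   unfolding bilinear_lsub[OF ext_deriv_bilinear(1)[OF I]] using V_dual[OF I(1) p v] by simp
 qed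
 thus ?thesis by simp
qed

definition rad :: "real => real" where "rad a = (SOME r. 0 < r & cball a (2 * r) <= I)"

lemma rad: assumes "a\<in>I" shows "0 < rad a" "cball a (2 * rad a) <= I"
proof -
 obtain e where e: "0 < e" "cball a e <= I" using I assms open_contains_cball by blast
 hence "\<exists>r. 0 < r & cball a (2 * r) <= I" by (intro exI[of _ "e / 2"]) simp
 from someI_ex[OF this] show "0 < rad a" "cball a (2 * rad a) <= I" unfolding rad_def by auto
qed

text \<open>Cut off in the direction of the parameter, the field on the product has compact support. Its flow over
  the parameters close to \<open>a\<close> does not depend on \<open>a\<close>.\<close>

definition cut :: "real => real => real" where
 "cut a t = (if a\<in>I then ball_bump a (rad a) t else 0)"

definition fibre_field :: "real => 'a => 'e" where
 "fibre_field t x = \<beta> (x, t) *\<^sub>R X t x"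

definition cut_field :: "real => 'a \<times> real => 'e \<times> real" where
 "cut_field a = lift_field (%(x, t). cut a t *\<^sub>R fibre_field t x)"

definition support :: "real => ('a \<times> real) set" where
 "support a = (if a\<in>I then SOME K. compact K & K <= carrier P & (\<forall>q. snd q\<in>cball a (2 * rad a) --> q\<notin>K --> \<beta> q = 0) else {})"

lemma support:
 shows "compact (support a)" "support a <= carrier P"
  "a\<in>I ==> snd q\<in>cball a (2 * rad a) ==> q\<notin>support a ==> \<beta> q = 0"
proof -
 let ?Q = "%K. compact K & K <= carrier P & (\<forall>q. snd q\<in>cball a (2 * rad a) --> q\<notin>K --> \<beta> q = 0)"
 have Q: "?Q (support a)" if a: "a\<in>I"
 proof -
  have eq: "support a = (SOME K. ?Q K)" using a unfolding support_def by (rule if_P)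
  show ?thesis unfolding eq by (rule someI_ex[OF \<beta>_support[OF compact_cball rad(2)[OF a]]])
 qed
 have "support a = {}" if "a\<notin>I" using that unfolding support_def by (rule if_not_P)
 hence "compact (support a) & support a <= carrier P" using Q by (cases "a\<in>I") auto
 thus "compact (support a)" "support a <= carrier P" by blast+
 show "a\<in>I ==> snd q\<in>cball a (2 * rad a) ==> q\<notin>support a ==> \<beta> q = 0" using Q by blast
qed

lemma cut_field_cs: "cs_field P (cut_field a) (support a)"
proof (unfold_locales)
 show "compact (support a)" "support a <= carrier P" by (rule support)+
 fix q assume q: "q\<in>carrier P" "q\<notin>support a"
 obtain x t where xt: "q = (x, t)" by (cases q)
 have P: "x\<in>carrier A" "t\<in>I" using q(1) xt carrier_prod by auto
 have "cut a t = 0 \<or> \<beta> q = 0"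
 proof (cases "a\<in>I & dist t a <= 2 * rad a")
  case True
  hence "\<beta> q = 0" by (intro support(3)[OF _ _ q(2)]) (auto simp: xt dist_commute)
  thus ?thesis ..
 next
  case False thus ?thesis using ball_bump_0[OF rad(1), of a t] by (auto simp: cut_def)
 qed
 hence z: "cut a t *\<^sub>R fibre_field t x = 0" by (auto simp: fibre_field_def xt)
 have d: "chart_at A x\<in>A" "x\<in>cdom (chart_at A x)" using chart_at[OF P(1)] by auto
 have "pchart I (chart_at A x)\<in>charts 1 P" using d by (intro P.atlas_charts) (auto simp: prod_atlas_eq)
 from linear_0[OF P.coord_inv_linear[OF this, of q]] show "cut_field a q = 0"
  using d P unfolding cut_field_def lift_field_def xt fst_conv prod.case z by (simp add: zero_prod_def)
next
 fix c' assume "c'\<in>P"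
 then obtain c where c: "c' = pchart I c" "c\<in>A" by (auto simp: prod_atlas_eq)
 note cc = chartD[OF c(2)]
 have o: "open (cimg c \<times> I)" by (rule open_cimg_I[OF c(2)])
 have b: "Cn_on n (%(y, t). \<beta> (cinv c y, t)) (cimg c \<times> I)" for n
  using mfun_pchart(1)[OF \<beta>(1) P.open_carrier atlas_charts[OF c(2)]] cdom_carrier[OF c(2)]
  by (simp add: carrier_prod pchart_image Int_absorb1 Times_Int_Times)
 have k: "Cn_on n (%q. cut a (snd q)) (cimg c \<times> I)" for n
 proof (cases "a\<in>I")
  case True
  have "Cn_on n (%q. ball_bump a (rad a) (snd q)) (cimg c \<times> I)"
   by (rule Cn_on_compose[OF o open_UNIV Cn_on_snd[OF o Cn_on_id] Cn_on_ball_bump]) auto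
  thus ?thesis using True by (simp add: cut_def)
 qed (simp add: cut_def Cn_on_const)
 have "Cn_on n (%q. ((cut a (snd q) * (%(y, t). \<beta> (cinv c y, t)) q) *\<^sub>R (%(y, t). coord A c (cinv c y) (X t (cinv c y))) q, 0::real)) (cimg c \<times> I)" for n
  by (intro Cn_on_Pair Cn_on_const Cn_on_scaleR Cn_on_mult k b X_smooth[OF c(2)] o)
 hence "Cn_on n (vf_coord P (cut_field a) c') (cimg c \<times> I)" for n
 proof (rule Cn_on_cong_imp[OF o, rotated])
  fix q assume "q\<in>cimg c \<times> I"
  then obtain y t where q: "q = (y, t)" "y\<in>cimg c" "t\<in>I" by blast
  have x: "cinv c y\<in>cdom c" using cc(5)[OF q(2)] .
  show "((cut a (snd q) * (%(y, t). \<beta> (cinv c y, t)) q) *\<^sub>R (%(y, t). coord A c (cinv c y) (X t (cinv c y))) q, 0) = vf_coord P (cut_field a) c' q"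
   using linear_cmul[OF coord_linear[OF atlas_charts[OF c(2)] x]]
   by (simp add: vf_coord_def c(1) q pchart_cinv[OF is_chart[OF c(2)]] cut_field_def coord_lift[OF c(2) x q(3)] fibre_field_def)
 qed
 thus "Cn_on (Suc (Suc 0)) (vf_coord P (cut_field a) c') (cimg c')"
  by (simp only: c(1) pchart_simps pchart_image)
qed

lemma cut_field_discounted: "discounted P (cut_field a) (support a) \<xi>"
 by (rule discounted.intro[OF cut_field_cs discounted_axioms.intro]) (use \<xi> in auto)

end


sublocale tube \<subseteq> D: discounted "prod_atlas A I" "cut_field a" "support a" \<xi> for a
 by (rule cut_field_discounted)

context tube begin

text \<open>The cutoff centred at the parameter itself is used; by \<open>\<Phi>_near\<close>, nearby centres give the same flow.\<close>

definition \<Phi> :: "real => real => 'a => 'a" where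
 "\<Phi> t s x = fst (D.flow t s (x, t))"

lemma cut_1: "a\<in>I ==> \<bar>t - a\<bar> <= rad a ==> cut a t = 1"
 using ball_bump_1[OF rad(1), of a t] by (simp add: cut_def dist_real_def)

lemma cut_self: "t\<in>I ==> cut t t = 1"
 using cut_1[of t t] rad(1)[of t] by simp

lemma flow_fibre:
 assumes "t\<in>I" "x\<in>carrier A" shows "D.flow a s (x, t) = (fst (D.flow a s (x, t)), t)"
proof -
 have P: "(x, t)\<in>carrier P" using assms carrier_prod by simp
 have "snd (D.flow a s (x, t)) = snd (D.flow a 0 (x, t))"
  by (rule icurve_lift_fibre[OF D.flow_icurve[OF P, of a, unfolded cut_field_def[of a]], folded cut_field_def]) auto
 thus ?thesis using D.flow_0[OF P] by (simp add: prod_eq_iff)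
qed

lemma flow_icurve_fibre:
 assumes t: "t\<in>I" "x\<in>carrier A" and a: "cut a t = 1"
 shows "icurve A (fibre_field t) UNIV (%s. fst (D.flow a s (x, t)))"
proof -
 have P: "(x, t)\<in>carrier P" using t carrier_prod by simp
 have "icurve P (cut_field a) UNIV (%s. (fst (D.flow a s (x, t)), t))"
  using D.flow_icurve[OF P, of a] flow_fibre[OF t, of a] by simp
 hence "icurve A (%x. cut a t *\<^sub>R fibre_field t x) UNIV (%s. fst (D.flow a s (x, t)))"
  unfolding cut_field_def icurve_lift[OF t(1)] by simp
 thus ?thesis by (simp add: a)
qed

lemma \<Phi>_icurve: "t\<in>I ==> x\<in>carrier A ==> icurve A (fibre_field t) UNIV (%s. \<Phi> t s x)"
 unfolding \<Phi>_def by (rule flow_icurve_fibre) (simp_all add: cut_self)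

lemma \<Phi>_unique:
 assumes t: "t\<in>I" and \<gamma>: "icurve A (fibre_field t) J \<gamma>" "is_interval J" "0\<in>J" "s\<in>J" "\<gamma> 0 = x"
 shows "\<Phi> t s x = \<gamma> s"
proof -
 have "icurve P (cut_field t) J (%s. (\<gamma> s, t))"
  unfolding cut_field_def icurve_lift[OF t] using \<gamma>(1) by (simp add: cut_self[OF t])
 from D.flow_eq[OF this \<gamma>(2-4), of "(x, t)"] show ?thesis using \<gamma>(5) by (simp add: \<Phi>_def)
qed

lemma \<Phi>_near:
 assumes t: "t\<in>I" "x\<in>carrier A" and a: "a\<in>I" "\<bar>t - a\<bar> <= rad a"
 shows "D.flow a s (x, t) = (\<Phi> t s x, t)"
proof -
 have "D.flow a 0 (x, t) = (x, t)" using t carrier_prod by (intro D.flow_0) simp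
 hence "\<Phi> t s x = fst (D.flow a s (x, t))"
  by (intro \<Phi>_unique[OF t(1) flow_icurve_fibre[OF t cut_1[OF a]]]) auto
 thus ?thesis using flow_fibre[OF t, of a s] by simp
qed

lemma \<Phi>_self: "t\<in>I ==> x\<in>carrier A ==> D.flow t s (x, t) = (\<Phi> t s x, t)"
 by (rule \<Phi>_near) (use rad(1)[of t] in auto)

lemma \<Phi>_carrier: "t\<in>I ==> x\<in>carrier A ==> \<Phi> t s x\<in>carrier A"
 using \<Phi>_icurve unfolding icurve_def by blast

lemma \<Phi>_0: "t\<in>I ==> x\<in>carrier A ==> \<Phi> t 0 x = x"
 using D.flow_0[of "(x, t)" t] carrier_prod by (simp add: \<Phi>_def)

lemma \<Phi>_add: "t\<in>I ==> x\<in>carrier A ==> \<Phi> t (s + r) x = \<Phi> t s (\<Phi> t r x)"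
 using D.flow_add[of "(x, t)" t s r] carrier_prod by (simp add: \<Phi>_self \<Phi>_carrier)

lemma \<Phi>_cont: "t\<in>I ==> x\<in>carrier A ==> continuous_on S (%s. \<Phi> t s x)"
 using \<Phi>_icurve[of t x] continuous_on_subset unfolding icurve_def by blast

lemma \<Phi>_C1: "t\<in>I ==> Ck_map A A 1 (carrier A) (\<Phi> t s)"
 by (rule Ck_map_fibre[OF D.flow_C1[of t s]]) (assumption | rule \<Phi>_self)+

definition R :: "real => real => 'a => real" where
 "R N t x = D.rho t N (x, t)"

lemma R_near:
 assumes "t\<in>I" "x\<in>carrier A" "a\<in>I" "\<bar>t - a\<bar> <= rad a"
 shows "D.rho a N (x, t) = R N t x"
proof -
 have "D.W a N (x, t) = D.W t N (x, t)"
  by (rule ext) (simp add: D.W_def \<Phi>_near[OF assms] \<Phi>_self[OF assms(1,2)])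
 thus ?thesis by (simp add: R_def D.rho_def)
qed

lemma R_nonneg: "t\<in>I ==> x\<in>carrier A ==> 0 < N ==> 0 <= R N t x"
 unfolding R_def by (rule D.rho_nonneg) (simp_all add: carrier_prod)

lemma R_flow:
 assumes "t\<in>I" "x\<in>carrier A" "0 < N" "!!s. s\<in>closed_segment 0 r ==> \<xi> (\<Phi> t s x, t) = 0"
 shows "R N t (\<Phi> t r x) = exp (N * r) * R N t x"
 using D.rho_flow_free[of "(x, t)" N r t] assms by (simp add: R_def \<Phi>_self carrier_prod)

lemma R_eq_0: "t\<in>I ==> x\<in>carrier A ==> 0 < N ==> R N t x = 0 \<longleftrightarrow> (\<forall>s\<ge>0. \<xi> (\<Phi> t s x, t) = 0)"
 using D.rho_eq_0_iff[of "(x, t)" N t] by (simp add: R_def \<Phi>_self carrier_prod)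

text \<open>A curve that agrees with the flow as long as it stays in an open set, agrees with it for as long as the
  flow stays in that set.\<close>

lemma interval_continuation:
 fixes \<eta> \<gamma> :: "real => 'x::t2_space"
 assumes c: "continuous_on J \<eta>" "continuous_on J \<gamma>" and J: "is_interval J" "a\<in>J" "\<eta> a = \<gamma> a"
  and op: "!!r. r\<in>J ==> \<eta> r = \<gamma> r ==> \<exists>\<delta>>0. \<forall>s\<in>J. \<bar>s - r\<bar> < \<delta> --> \<eta> s = \<gamma> s" and s: "s\<in>J"
 shows "\<eta> s = \<gamma> s"
proof -
 let ?E = "{r\<in>J. \<eta> r = \<gamma> r}"
 have "continuous_on J (%r. (\<gamma> r, \<eta> r))" using c(2,1) by (rule continuous_on_Pair)
 from continuous_closedin_preimage[OF this closed_diagonal]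
 have 1: "closedin (top_of_set J) ?E" by (simp add: Int_def vimage_def)
 have 2: "openin (top_of_set J) ?E"
  unfolding openin_euclidean_subtopology_iff
 proof (intro conjI ballI)
  fix r assume "r\<in>?E"
  then obtain \<delta> where "\<delta> > 0" "\<forall>s\<in>J. \<bar>s - r\<bar> < \<delta> --> \<eta> s = \<gamma> s" using op by blast
  thus "\<exists>e>0. \<forall>x'\<in>J. dist x' r < e --> x'\<in>?E" by (auto simp: dist_real_def)
 qed auto
 have "connected J" using J(1) by (simp add: is_interval_connected_1)
 hence "?E = {} \<or> ?E = J" using 1 2 unfolding connected_clopen by blast
 thus ?thesis using J s by blast
qed

lemma V_curve_follows_flow:
 assumes t: "t\<in>I" and \<eta>: "icurve A (V t) {0..T} \<eta>" "!!r. r\<in>{0..T} ==> \<eta> r\<in>H t"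
  and G: "!!r. r\<in>{0..T} ==> (\<Phi> t r (\<eta> 0), t)\<in>G1" and s: "s\<in>{0..T}"
 shows "\<eta> s = \<Phi> t s (\<eta> 0)"
proof (rule interval_continuation[where J="{0..T}" and \<eta>=\<eta> and \<gamma>="%r. \<Phi> t r (\<eta> 0)" and a=0])
 have x: "\<eta> 0\<in>carrier A" using \<eta>(2)[of 0] s H_carrier[OF t] by auto
 show c: "continuous_on {0..T} \<eta>" using \<eta>(1) by (simp add: icurve_def)
 show "continuous_on {0..T} (%r. \<Phi> t r (\<eta> 0))" by (rule \<Phi>_cont[OF t x])
 show "is_interval {0..T}" by (rule is_interval_cc)
 show "0\<in>{0..T}" using s by simp
 show "\<eta> 0 = \<Phi> t 0 (\<eta> 0)" using \<Phi>_0[OF t x] by simp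
 fix r assume r: "r\<in>{0..T}" "\<eta> r = \<Phi> t r (\<eta> 0)"
 have o: "open {x. (x, t)\<in>G1}" by (rule slice_open[OF G1(1)])
 obtain \<delta> where \<delta>: "\<delta> > 0" "!!u. u\<in>{0..T} ==> \<bar>u - r\<bar> < \<delta> ==> \<eta> u\<in>{x. (x, t)\<in>G1}"
  by (rule continuous_on_nhd[OF c r(1) o]) (use G[OF r(1)] r(2) in \<open>auto intro: that\<close>)
 let ?J = "{u. u + r\<in>{0..T} & \<bar>u\<bar> < \<delta>}"
 have "icurve A (V t) ?J (%u. \<eta> (u + r))" by (rule icurve_shift[OF \<eta>(1)]) auto
 hence "icurve A (fibre_field t) ?J (%u. \<eta> (u + r))"
 proof (rule icurve_field_cong)
  fix u assume u: "u\<in>?J"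
  hence "(\<eta> (u + r), t)\<in>G1" "\<eta> (u + r)\<in>H t" using \<delta>(2)[of "u + r"] \<eta>(2)[of "u + r"] by auto
  thus "V t (\<eta> (u + r)) = fibre_field t (\<eta> (u + r))"
   using X_eq_V by (simp add: fibre_field_def \<beta>(2))
 qed
 moreover have "is_interval ?J" unfolding is_interval_1 by auto
 ultimately have u: "\<Phi> t u (\<eta> r) = \<eta> (u + r)" if "u\<in>?J" for u
  using \<Phi>_unique[OF t, of ?J "%u. \<eta> (u + r)" u "\<eta> r"] that r \<delta>(1) by simp
 show "\<exists>\<delta>>0. \<forall>s\<in>{0..T}. \<bar>s - r\<bar> < \<delta> --> \<eta> s = \<Phi> t s (\<eta> 0)"
 proof (intro exI[of _ \<delta>] conjI ballI impI \<delta>(1))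
  fix s assume "s\<in>{0..T}" "\<bar>s - r\<bar> < \<delta>"
  hence "\<Phi> t (s - r) (\<eta> r) = \<eta> s" using u[of "s - r"] by simp
  thus "\<eta> s = \<Phi> t s (\<eta> 0)" using \<Phi>_add[OF t x, of "s - r" r] r(2) by simp
 qed
qed (rule s)

text \<open>The skeleton consists of the points from which the Liouville trajectory exists for all positive times.\<close>

lemma L_iff:
 assumes t: "t\<in>I"
 shows "p\<in>L t \<longleftrightarrow> (\<forall>T>0. \<exists>\<eta>. icurve A (V t) {0..T} \<eta> & (\<forall>r\<in>{0..T}. \<eta> r\<in>H t) & \<eta> 0 = p)"
proof -
 have "p\<in>flow_image A (H t) (V t) (- T) (H t) \<longleftrightarrow> (\<exists>\<eta>. icurve A (V t) {0..T} \<eta> & (\<forall>r\<in>{0..T}. \<eta> r\<in>H t) & \<eta> 0 = p)" if T: "T > 0" for T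
 proof
  assume "p\<in>flow_image A (H t) (V t) (- T) (H t)"
  then obtain \<gamma> where \<gamma>: "icurve A (V t) {-T..0} \<gamma>" "\<forall>r\<in>{-T..0}. \<gamma> r\<in>H t" "\<gamma> (- T) = p"
   using T unfolding flow_image_def integral_curve_iff[OF H_carrier[OF t]] by (auto simp: closed_segment_eq_real_ivl)
  have "icurve A (V t) {0..T} (%r. \<gamma> (r + - T))" by (rule icurve_shift[OF \<gamma>(1)]) auto
  moreover have "\<forall>r\<in>{0..T}. \<gamma> (r + - T)\<in>H t" using \<gamma>(2) by auto
  ultimately show "\<exists>\<eta>. icurve A (V t) {0..T} \<eta> & (\<forall>r\<in>{0..T}. \<eta> r\<in>H t) & \<eta> 0 = p"
   using \<gamma>(3) by (intro exI[of _ "%r. \<gamma> (r + - T)"]) simp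
 next
  assume "\<exists>\<eta>. icurve A (V t) {0..T} \<eta> & (\<forall>r\<in>{0..T}. \<eta> r\<in>H t) & \<eta> 0 = p"
  then obtain \<eta> where \<eta>: "icurve A (V t) {0..T} \<eta>" "\<forall>r\<in>{0..T}. \<eta> r\<in>H t" "\<eta> 0 = p" by blast
  have "icurve A (V t) {-T..0} (%r. \<eta> (r + T))" by (rule icurve_shift[OF \<eta>(1)]) auto
  moreover have "\<forall>r\<in>{-T..0}. \<eta> (r + T)\<in>H t" using \<eta>(2) by auto
  ultimately show "p\<in>flow_image A (H t) (V t) (- T) (H t)"
   unfolding flow_image_def integral_curve_iff[OF H_carrier[OF t]]
   using T \<eta>(3) by (auto simp: closed_segment_eq_real_ivl intro!: exI[of _ "%r. \<eta> (r + T)"])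
 qed
 moreover have "p\<in>L t \<longleftrightarrow> (\<forall>T>0. p\<in>flow_image A (H t) (V t) (- T) (H t))"
  unfolding L_skeleton[OF t, symmetric] skeleton_def by auto
 ultimately show ?thesis by simp
qed

lemma L_carrier: "t\<in>I ==> p\<in>L t ==> p\<in>carrier A"
 using L_subset_H H_carrier by blast

lemma L_G2: "t\<in>I ==> p\<in>L t ==> (p, t)\<in>G2"
 using G2(2) by (auto simp: total_space_def)

text \<open>The flow preserves the skeleton. As the skeleton is compact, it stays near it for a time that does
  not depend on the starting point, and meanwhile it coincides with the Liouville trajectory.\<close>

lemma L_invariant_short:
 assumes t: "t\<in>I" obtains \<epsilon> where "\<epsilon> > 0" "!!p s. p\<in>L t ==> s\<in>{0..\<epsilon>} ==> (\<Phi> t s p, t)\<in>G1"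
proof -
 have K: "compact (total_space {t} L)" using LI_compact[of "{t}"] t by simp
 let ?F = "%(s, q). D.flow t s q"
 have "continuous_on (UNIV \<times> carrier P) ?F" by (rule D.flow_continuous)
 moreover have "open (UNIV \<times> carrier P :: (real \<times> 'a \<times> real) set)" using P.open_carrier by (intro open_Times) auto
 ultimately have oX: "open ((UNIV \<times> carrier P) Int ?F -` G1)" using G1(1) by (rule continuous_open_preimage)
 let ?X = "(UNIV \<times> carrier P) Int ?F -` G1"
 have "{0::real} \<times> total_space {t} L <= ?X"
 proof
  fix z assume "z\<in>{0::real} \<times> total_space {t} L"
  then obtain p where p: "z = (0, p, t)" "p\<in>L t" by (auto simp: total_space_def)
  have P: "(p, t)\<in>carrier P" using L_carrier[OF t p(2)] t carrier_prod by simp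
  thus "z\<in>?X" using L_G2[OF t p(2)] G2(3) by (auto simp: p(1))
 qed
 have "\<exists>\<epsilon>>0. ball 0 \<epsilon> \<times> total_space {t} L <= ?X"
 proof -
  obtain U where U: "0\<in>U" "open U" "U \<times> total_space {t} L <= ?X"
   using Elementary_Topology.tube_lemma[OF K oX \<open>{0::real} \<times> total_space {t} L <= ?X\<close>] by blast
  obtain e where "0 < e" "ball 0 e <= U" using U(1,2) open_contains_ball by blast
  thus ?thesis using U(3) by (intro exI[of _ e]) blast
 qed
 then obtain \<epsilon> where \<epsilon>: "\<epsilon> > 0" "ball 0 \<epsilon> \<times> total_space {t} L <= ?X" by blast
 show ?thesis
 proof (rule that[of "\<epsilon> / 2"])
  show "\<epsilon> / 2 > 0" using \<epsilon> by simp
  fix p s assume ps: "p\<in>L t" "s\<in>{0..\<epsilon> / 2}"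
  hence "(s, p, t)\<in>ball 0 \<epsilon> \<times> total_space {t} L" using \<epsilon>(1) by (auto simp: total_space_def)
  hence "(s, p, t)\<in>?X" by (rule set_mp[OF \<epsilon>(2)])
  hence "D.flow t s (p, t)\<in>G1" by simp
  thus "(\<Phi> t s p, t)\<in>G1" using \<Phi>_self[OF t L_carrier[OF t ps(1)]] by simp
 qed
qed

text \<open>The time step of the short statement is uniform, so it can be repeated indefinitely.\<close>

lemma L_invariant:
 assumes t: "t\<in>I" and p: "p\<in>L t" and s: "0 <= s" shows "\<Phi> t s p\<in>L t"
proof -
 obtain \<epsilon> where \<epsilon>: "\<epsilon> > 0" "!!p s. p\<in>L t ==> s\<in>{0..\<epsilon>} ==> (\<Phi> t s p, t)\<in>G1"
  by (rule L_invariant_short[OF t]) (rule that)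
 have short: "\<Phi> t s p\<in>L t" if p: "p\<in>L t" and s: "s\<in>{0..\<epsilon>}" for s p
  unfolding L_iff[OF t]
 proof (intro allI impI)
  fix T :: real assume T: "T > 0"
  have "s + T > 0" using s T by auto
  then obtain \<eta> where \<eta>: "icurve A (V t) {0..s + T} \<eta>" "!!r. r\<in>{0..s + T} ==> \<eta> r\<in>H t" "\<eta> 0 = p"
   using p unfolding L_iff[OF t] by meson
  have "\<eta> s = \<Phi> t s (\<eta> 0)"
  proof (rule V_curve_follows_flow[OF t, of s])
   show "icurve A (V t) {0..s} \<eta>" by (rule icurve_subset[OF \<eta>(1)]) (use T in auto)
   show "(\<Phi> t r (\<eta> 0), t)\<in>G1" if "r\<in>{0..s}" for r using \<epsilon>(2)[OF p, of r] that s \<eta>(3) by simp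
  qed (use \<eta>(2) T s in auto)
  moreover have "icurve A (V t) {0..T} (%r. \<eta> (r + s))" by (rule icurve_shift[OF \<eta>(1)]) (use s in auto)
  moreover have "\<forall>r\<in>{0..T}. \<eta> (r + s)\<in>H t" using \<eta>(2) s by auto
  ultimately show "\<exists>\<eta>. icurve A (V t) {0..T} \<eta> & (\<forall>r\<in>{0..T}. \<eta> r\<in>H t) & \<eta> 0 = \<Phi> t s p"
   using \<eta>(3) by (intro exI[of _ "%r. \<eta> (r + s)"]) simp
 qed
 have step: "\<Phi> t (real n * \<epsilon>) p\<in>L t" for n
 proof (induction n)
  case 0 thus ?case using p \<Phi>_0[OF t L_carrier[OF t p]] by simp
 next
  case (Suc n)
  have "\<Phi> t (\<epsilon> + real n * \<epsilon>) p = \<Phi> t \<epsilon> (\<Phi> t (real n * \<epsilon>) p)" by (rule \<Phi>_add[OF t L_carrier[OF t p]])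
  thus ?case using short[OF Suc, of \<epsilon>] \<epsilon>(1) by (simp add: algebra_simps)
 qed
 define n where "n = nat \<lfloor>s / \<epsilon>\<rfloor>"
 have "real n <= s / \<epsilon>" "s / \<epsilon> < real n + 1" using s \<epsilon>(1) unfolding n_def by (simp_all add: of_nat_floor)
 hence n: "s - real n * \<epsilon>\<in>{0..\<epsilon>}" using \<epsilon>(1) by (simp add: field_simps)
 have "\<Phi> t ((s - real n * \<epsilon>) + real n * \<epsilon>) p = \<Phi> t (s - real n * \<epsilon>) (\<Phi> t (real n * \<epsilon>) p)" by (rule \<Phi>_add[OF t L_carrier[OF t p]])
 thus ?thesis using short[OF step n] by simp
qed

lemma fibre_field_G1: "(x, t)\<in>G1 ==> fibre_field t x = X t x"
 by (simp add: fibre_field_def \<beta>(2))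

text \<open>Along a trajectory that never leaves the region where \<open>\<xi>\<close> vanishes, the Hamiltonian would grow
  exponentially unless it is zero; but that region is relatively compact in every fibre.\<close>

lemma staying_in_L:
 assumes t: "t\<in>I" and x: "x\<in>carrier A" and B: "!!s. 0 <= s ==> \<xi> (\<Phi> t s x, t) = 0"
 shows "x\<in>L t"
proof -
 let ?u = "%s. ht t (\<Phi> t s x)"
 have cP: "carrier P = carrier A \<times> I" by (rule carrier_prod)
 have in1: "(\<Phi> t s x, t)\<in>G1" if "0 <= s" for s
  using \<xi>(5) B[OF that] \<Phi>_carrier[OF t x] t cP by simp
 note cv = \<Phi>_icurve[OF t x]
 let ?D = "%s. Dh t (\<Phi> t s x) (Reeb t (\<Phi> t s x))"
 have der: "(?u has_real_derivative ?u s * ?D s) (at s)" if s: "0 <= s" for s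
 proof -
  have "(?u has_real_derivative Dh t (\<Phi> t s x) (fibre_field t (\<Phi> t s x))) (at s)"
   by (rule derivative_along_icurve[OF ht_smooth[OF t] open_carrier cv]) (use s \<Phi>_carrier[OF t x] in auto)
  thus ?thesis using X(3)[OF t \<Phi>_carrier[OF t x]] by (simp add: fibre_field_G1[OF in1[OF s]])
 qed
 have D: "1/2 < ?D s" if "0 <= s" for s using Dh_gt[of "\<Phi> t s x" t] in1[OF that] G1(2) by (auto simp: ht_eq)
 have "?u s = 0" if s: "0 <= s" for s
 proof (rule ccontr)
  assume nz: "?u s \<noteq> 0"
  obtain K where K: "compact K" "K <= carrier P" "\<forall>q. snd q\<in>{t} --> q\<notin>K --> \<xi> q = 1"
   using \<xi>_support[of "{t}"] t by auto
  have "continuous_on K h" 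
   by (rule continuous_on_subset[OF P.mfun_continuous[OF h[of 0, folded cP] P.open_carrier order_refl] K(2)])
  hence "bounded (h ` K)" using K(1) compact_continuous_image compact_imp_bounded by blast
  then obtain M where M: "!!q. q\<in>K ==> \<bar>h q\<bar> <= M" by (auto simp: bounded_iff)
  have bd: "\<bar>?u r\<bar> <= M" if "0 <= r" for r
   using M[of "(\<Phi> t r x, t)"] K(3) B[OF that] by (force simp: ht_def)
  \<comment> \<open>nondecreasing, since \<open>u' = D u\<close> with \<open>D > 1/2\<close>, but squeezed to \<open>0\<close> if \<open>u\<close> is bounded\<close>
  define w where "w r = exp (- r) * (?u r)\<^sup>2" for r
  have wder: "(w has_real_derivative exp (- r) * (?u r)\<^sup>2 * (2 * ?D r - 1)) (at r)" if "0 <= r" for r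
   unfolding w_def by (rule derivative_eq_intros der[OF that] refl)+ (simp add: algebra_simps power2_eq_square)
  have mono: "w s <= w r" if "s <= r" for r
  proof (rule DERIV_nonneg_imp_increasing_open[OF that])
   fix z assume z: "s < z" "z < r"
   have "0 <= exp (- z) * (?u z)\<^sup>2 * (2 * ?D z - 1)" using D[of z] z s by (intro mult_nonneg_nonneg) auto
   thus "\<exists>y. (w has_real_derivative y) (at z) & 0 <= y" using wder[of z] z s by auto
  next
   show "continuous_on {s..r} w"
    by (rule DERIV_continuous_on[OF DERIV_subset[OF wder]]) (use s in auto)
  qed
  have ws: "0 < w s" using nz by (simp add: w_def)
  have "w s <= exp (- r) * M\<^sup>2" if "s <= r" for r
  proof -
   have "(?u r)\<^sup>2 <= M\<^sup>2" using bd[of r] that s by (simp add: abs_le_square_iff[symmetric])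
   hence "w r <= exp (- r) * M\<^sup>2" by (simp add: w_def)
   thus ?thesis using mono[OF that] by simp
  qed
  moreover have "((%r::real. exp (- r) * M\<^sup>2) \<longlongrightarrow> 0 * M\<^sup>2) at_top"
   by (intro tendsto_mult tendsto_const filterlim_compose[OF exp_at_bot] filterlim_uminus_at_bot_at_top)
  hence "\<forall>\<^sub>F r in at_top. exp (- r) * M\<^sup>2 < w s" using order_tendstoD(2)[OF _ ws] by simp
  hence "\<forall>\<^sub>F r in at_top. exp (- r) * M\<^sup>2 < w s & s <= r" using eventually_ge_at_top eventually_conj by blast
  then obtain r where "exp (- r) * M\<^sup>2 < w s" "s <= r" using eventually_happens[of _ "at_top :: real filter"] by fastforce
  ultimately show False by fastforce
 qed
 hence inH: "\<Phi> t s x\<in>H t" if "0 <= s" for s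
  using h_zero[of "\<Phi> t s x" t] in1[OF that] G1(2) that by (auto simp: ht_def)
 have "icurve A (V t) {0..} (%s. \<Phi> t s x)"
  by (rule icurve_field_cong[OF icurve_subset[OF cv]]) (use in1 inH X_eq_V fibre_field_G1 in auto)
 thus ?thesis
  unfolding L_iff[OF t] using inH \<Phi>_0[OF t x]
  by (intro allI impI exI[of _ "%s. \<Phi> t s x"] conjI ballI) (auto intro: icurve_subset)
qed

lemma R_zero_set: "t\<in>I ==> x\<in>carrier A ==> 0 < N ==> R N t x = 0 \<longleftrightarrow> x\<in>L t"
 using R_eq_0 staying_in_L L_invariant L_G2 \<xi>(4) by blast

end


section \<open>Convex tubular neighborhoods\<close>

context tube begin

text \<open>One discount rate serves all parameters near \<open>a\<close>, because \<open>R\<close> is there the restriction of one function on the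
 product.\<close>

lemma R_C1_near:
 assumes a: "a\<in>I"
 shows "\<exists>N0\<ge>1. \<forall>N\<ge>N0. \<forall>t. \<bar>t - a\<bar> <= rad a -->
  (\<exists>U. open U & U <= carrier A & {x\<in>carrier A. \<xi> (x, t) \<noteq> 1} <= U & mfun A (Suc 0) (R N t) U)"
proof -
 obtain K where K: "compact K" "K <= carrier P" "\<forall>q. snd q\<in>cball a (2 * rad a) --> q\<notin>K --> \<xi> q = 1"
  using \<xi>_support[OF compact_cball rad(2)[OF a]] by blast
 have K': "compact (support a \<union> K)" "support a <= support a \<union> K" "support a \<union> K <= carrier P"
  using support[of a] K by (auto intro: compact_Un)
 obtain N0 \<Omega> where \<Omega>: "0 < N0" "open \<Omega>" "support a \<union> K <= \<Omega>" "\<Omega> <= carrier P" "!!N. N0 <= N ==> mfun P 1 (D.rho a N) \<Omega>"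
  by (rule D.rho_C1[OF K']) (rule that)
 show ?thesis
 proof (intro exI[of _ "max 1 N0"] conjI allI impI)
  fix N t assume N: "max 1 N0 <= N" and t: "\<bar>t - a\<bar> <= rad a"
  have r: "0 < rad a" by (rule rad(1)[OF a])
  have tI: "t\<in>cball a (2 * rad a)" using t r by (auto simp: dist_real_def)
  hence t': "t\<in>I" using rad(2)[OF a] by blast
  let ?U = "{x. (x, t)\<in>\<Omega>}"
  have o: "open ?U" by (rule slice_open[OF \<Omega>(2)])
  have U: "?U <= carrier A" using \<Omega>(4) carrier_prod by auto
  have s: "mfun P (Suc 0) (D.rho a N) \<Omega>" using \<Omega>(5)[of N] N by simp
  have "mfun A (Suc 0) (R N t) ?U"
   by (rule mfun_cong[OF mfun_slice[OF s \<Omega>(2) t'] o]) (use R_near[OF t' _ a t] U in auto)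
  moreover have "{x\<in>carrier A. \<xi> (x, t) \<noteq> 1} <= ?U" using K(3) \<Omega>(3) tI by auto
  ultimately show "\<exists>U. open U & U <= carrier A & {x\<in>carrier A. \<xi> (x, t) \<noteq> 1} <= U & mfun A (Suc 0) (R N t) U"
   using o U by blast
 qed simp
qed

lemma R_cont:
 assumes N: "continuous_on I N" "!!t. t\<in>I ==> 1 <= N t"
 shows "continuous_on (carrier A \<times> I) (%q. R (N (snd q)) (snd q) (fst q))"
proof (rule continuous_on_locally)
 fix q assume q: "q\<in>carrier A \<times> I"
 define a where "a = snd q"
 have a: "a\<in>I" using q by (auto simp: a_def)
 let ?U = "UNIV \<times> ball a (rad a) :: ('a \<times> real) set" and ?S = "(carrier A \<times> I) Int (UNIV \<times> ball a (rad a))"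
 have 1: "continuous_on ?S (%q. (N (snd q), q))"
  by (intro continuous_intros continuous_on_comp[OF N(1)]) auto
 have "continuous_on ?S (%q. (%(N, q). D.rho a N q) (N (snd q), q))"
  by (rule continuous_on_comp[OF D.rho_continuous 1]) (use N(2) in \<open>fastforce simp: carrier_prod\<close>)
 hence "continuous_on ?S (%q. R (N (snd q)) (snd q) (fst q))"
 proof (rule continuous_on_eq)
  fix p assume "p\<in>?S"
  thus "(case (N (snd p), p) of (N, q) => D.rho a N q) = R (N (snd p)) (snd p) (fst p)"
   using R_near[of "snd p" "fst p" a "N (snd p)"] a by (auto simp: dist_real_def)
 qed
 moreover have "open ?U" "q\<in>?U" using rad(1)[OF a] by (auto simp: a_def open_Times mem_Times_iff)
 ultimately show "\<exists>U. open U & q\<in>U & continuous_on ((carrier A \<times> I) Int U) (%q. R (N (snd q)) (snd q) (fst q))" by blast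
qed

text \<open>Outside \<open>G2\<close> the function is positive on a compact set of points and parameters, hence bounded below.\<close>

lemma R_pos_outside_G2:
 assumes a: "a\<in>I" and N: "continuous_on I N" "!!t. t\<in>I ==> 1 <= N t"
 shows "\<exists>m\<ge>1. \<forall>t x. \<bar>t - a\<bar> <= rad a --> x\<in>carrier A --> (x, t)\<notin>G2 --> \<xi> (x, t) \<noteq> 1 --> 1 < m * R (N t) t x"
proof -
 let ?F = "%q. R (N (snd q)) (snd q) (fst q)"
 have r: "0 < rad a" by (rule rad(1)[OF a])
 have J: "cball a (rad a) <= I" using rad[OF a] by (auto simp: subset_iff)
 obtain K where K: "compact K" "K <= carrier P" "\<forall>q. snd q\<in>cball a (rad a) --> q\<notin>K --> \<xi> q = 1"
  using \<xi>_support[OF compact_cball J] by blast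
 define C where "C = K Int (UNIV \<times> cball a (rad a)) - G2"
 have C: "compact C" unfolding C_def
  by (intro compact_diff compact_Int_closed closed_Times K(1) G2(1)) auto
 have CP: "C <= carrier A \<times> I" using K(2) J by (auto simp: C_def carrier_prod)
 have inC: "(x, t)\<in>C" if "\<bar>t - a\<bar> <= rad a" "(x, t)\<notin>G2" "\<xi> (x, t) \<noteq> 1" for x t
 proof -
  have "snd (x, t)\<in>cball a (rad a)" using that(1) by (simp add: dist_real_def abs_minus_commute)
  thus ?thesis using K(3) that(2,3) unfolding C_def by fastforce
 qed
 show ?thesis
 proof (cases "C = {}")
  case True thus ?thesis using inC by (intro exI[of _ 1]) auto
 next
  case False
  obtain q where q: "q\<in>C" "!!p. p\<in>C ==> ?F q <= ?F p"
   using continuous_attains_inf[OF C False continuous_on_subset[OF R_cont[OF N] CP]] by blast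
  have qI: "snd q\<in>I" "fst q\<in>carrier A" using q(1) CP by auto
  have N0: "0 < N (snd q)" using N(2)[OF qI(1)] by simp
  have "fst q\<notin>L (snd q)" using q(1) L_G2[OF qI(1), of "fst q"] by (auto simp: C_def)
  hence b: "0 < ?F q" using R_zero_set[OF qI N0] R_nonneg[OF qI N0] by simp
  show ?thesis
  proof (intro exI[of _ "max 1 (2 / ?F q)"] conjI allI impI)
   fix t x assume tx: "\<bar>t - a\<bar> <= rad a" "(x, t)\<notin>G2" "\<xi> (x, t) \<noteq> 1"
   have F: "?F q <= R (N t) t x" using q(2)[OF inC[OF tx]] by simp
   have "1 < 2 / ?F q * ?F q" using b by simp
   also have "\<dots> <= max 1 (2 / ?F q) * R (N t) t x" using F b by (intro mult_mono) auto
   finally show "1 < max 1 (2 / ?F q) * R (N t) t x" .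
  qed simp
 qed
qed

end

text \<open>The gap between the skeleton and the region where \<open>\<xi>\<close> is positive is expressed by \<open>gap\<close>: points outside \<open>G2\<close> have
 value above one, unless they are so far away that \<open>\<xi>\<close> is one.\<close>

locale tube_fibre = tube A \<zeta> I \<alpha> H V L h O' G1 G2 \<beta> \<xi>
 for A :: "('a::t2_space, 'e::euclidean_space) chart set" and \<zeta> I \<alpha> H V L h O' G1 G2 \<beta> \<xi> +
 fixes t N M :: real and U0
 assumes t: "t\<in>I" and N: "1 <= N" and M: "1 <= M"
  and U0: "open U0" "{x\<in>carrier A. \<xi> (x, t) \<noteq> 1} <= U0" "mfun A (Suc 0) (R N t) U0"
  and gap: "!!x. x\<in>carrier A ==> (x, t)\<notin>G2 ==> \<xi> (x, t) \<noteq> 1 ==> 1 < M * R N t x"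
begin

definition \<rho> :: "'a => real" where "\<rho> x = M * R N t x"
definition U :: "'a set" where "U = {x\<in>carrier A. (x, t)\<in>G2 & \<rho> x < 1}"

lemma N0: "0 < N" and M0: "0 < M" using N M by auto

lemma \<rho>_nonneg: "x\<in>carrier A ==> 0 <= \<rho> x"
 using R_nonneg[OF t _ N0] M0 by (simp add: \<rho>_def)

lemma \<rho>_eq_0: "x\<in>carrier A ==> \<rho> x = 0 \<longleftrightarrow> x\<in>L t"
 using R_zero_set[OF t _ N0] M0 by (simp add: \<rho>_def)

lemma \<rho>_cont: "continuous_on (carrier A) \<rho>"
proof -
 have "continuous_on (carrier A) (%x. (%q. R N (snd q) (fst q)) (x, t))"
  by (rule continuous_on_comp[OF R_cont[OF continuous_on_const]]) (use t N in "auto intro!: continuous_intros")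
 thus ?thesis unfolding \<rho>_def[abs_def] by (intro continuous_intros) simp
qed

lemma U_carrier: "U <= carrier A" by (auto simp: U_def)

lemma sublevel_open: "open {x\<in>carrier A. (x, t)\<in>G2 & \<rho> x < r}"
proof -
 have "open (carrier A Int \<rho> -` {..<r})" by (rule continuous_open_preimage[OF \<rho>_cont open_carrier]) simp
 hence "open (carrier A Int \<rho> -` {..<r} Int {x. (x, t)\<in>G2})" using slice_open[OF G2(1)] by blast
 thus ?thesis by (simp add: Int_def vimage_def conj_ac)
qed

lemma U_open: "open U" unfolding U_def by (rule sublevel_open)

lemma U_\<xi>: "x\<in>U ==> \<xi> (x, t) = 0" using \<xi>(4) by (simp add: U_def)

lemma U_U0: "U <= U0" using U_\<xi> U_carrier U0(2) by force

lemma \<rho>_C1: "mfun A (Suc 0) \<rho> U"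
 using mfun_mult[OF mfun_const mfun_subset[OF U0(3) U_U0] U_open] by (simp add: \<rho>_def[abs_def])

lemma closed_box:
 obtains K where "closed K" "K <= carrier A" "U <= K" "!!x. x\<in>K ==> \<xi> (x, t) = 0"
proof -
 obtain K where K: "compact K" "K <= carrier P" "\<forall>q. snd q\<in>{t} --> q\<notin>K --> \<xi> q = 1"
  using \<xi>_support[of "{t}"] t by auto
 define K' where "K' = fst ` (K Int (UNIV \<times> {t}))"
 have "compact K'" unfolding K'_def
  by (intro compact_continuous_image compact_Int_closed closed_Times K(1) continuous_intros)
 hence cK: "closed K'" by (rule compact_imp_closed)
 have KA: "K' <= carrier A" using K(2) by (auto simp: K'_def carrier_prod)
 have "continuous_on K' (%x. \<xi> (x, t))"
  by (rule continuous_on_comp[OF P.mfun_continuous[OF \<xi>(1)[of 0] P.open_carrier order_refl]])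
   (use KA t in "auto simp: carrier_prod intro!: continuous_intros")
 hence "closed (K' Int (%x. \<xi> (x, t)) -` {0})" by (rule continuous_closed_preimage[OF _ cK]) simp
 moreover have "U <= K' Int (%x. \<xi> (x, t)) -` {0}"
 proof
  fix x assume x: "x\<in>U"
  hence "(x, t)\<in>K" using K(3) U_\<xi>[OF x] by force
  thus "x\<in>K' Int (%x. \<xi> (x, t)) -` {0}" using U_\<xi>[OF x] by (auto simp: K'_def intro!: image_eqI[of _ _ "(x, t)"])
 qed
 ultimately show ?thesis using that KA by blast
qed

lemma closure_U: "x\<in>closure U ==> x\<in>carrier A & (\<rho> x < 1 --> x\<in>U)"
proof -
 assume x: "x\<in>closure U"
 obtain K where K: "closed K" "K <= carrier A" "U <= K" "!!x. x\<in>K ==> \<xi> (x, t) = 0" by (rule closed_box) (rule that)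
 have "x\<in>K" using closure_minimal[OF K(3,1)] x by blast
 hence "x\<in>carrier A" "\<xi> (x, t) \<noteq> 1" using K by auto
 moreover have "(x, t)\<in>G2" if "\<rho> x < 1"
  by (rule ccontr) (use gap[of x] that calculation in "simp add: \<rho>_def")
 ultimately show ?thesis by (simp add: U_def)
qed

text \<open>The times at which the trajectory has stayed in \<open>U\<close> with the predicted value form an open and closed subset of
 the interval of admissible times: a limit point lies in the closure of \<open>U\<close>, and its value below one puts it back in \<open>U\<close>.\<close>

lemma \<rho>_flow:
 assumes x: "x\<in>U" and s: "exp (N * s) * \<rho> x < 1"
 shows "\<Phi> t s x\<in>U" "\<rho> (\<Phi> t s x) = exp (N * s) * \<rho> x"
proof -
 have xc: "x\<in>carrier A" using x U_carrier by blast
 let ?J = "{u. exp (N * u) * \<rho> x < 1}"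
 let ?E = "{u\<in>?J. \<Phi> t u x\<in>U & \<rho> (\<Phi> t u x) = exp (N * u) * \<rho> x}"
 have "is_interval ?J" unfolding is_interval_1
 proof (intro ballI allI impI)
  fix a b i assume "b\<in>?J" "a <= i & i <= b"
  hence "exp (N * i) * \<rho> x <= exp (N * b) * \<rho> x" "exp (N * b) * \<rho> x < 1" using N0 \<rho>_nonneg[OF xc] by (auto intro: mult_right_mono)
  thus "i\<in>?J" by simp
 qed
 hence con: "connected ?J" by (simp add: is_interval_connected_1)
 note cont = \<Phi>_cont[OF t xc]
 have op: "openin (top_of_set ?J) ?E"
  unfolding openin_euclidean_subtopology_iff
 proof (intro conjI ballI)
  fix u assume u: "u\<in>?E"
  obtain \<delta> where \<delta>: "\<delta> > 0" "!!v. v\<in>UNIV ==> \<bar>v - u\<bar> < \<delta> ==> \<Phi> t v x\<in>U"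
   by (rule continuous_on_nhd[OF cont UNIV_I U_open]) (use u in "auto intro: that")
  show "\<exists>e>0. \<forall>v\<in>?J. dist v u < e --> v\<in>?E"
  proof (intro exI[of _ \<delta>] conjI ballI impI \<delta>(1))
   fix v assume v: "v\<in>?J" "dist v u < \<delta>"
   have add: "\<Phi> t (r + u) x = \<Phi> t r (\<Phi> t u x)" for r by (rule \<Phi>_add[OF t xc])
   have "R N t (\<Phi> t (v - u) (\<Phi> t u x)) = exp (N * (v - u)) * R N t (\<Phi> t u x)"
   proof (rule R_flow[OF t \<Phi>_carrier[OF t xc] N0])
    fix r assume "r\<in>closed_segment 0 (v - u)"
    hence "\<bar>(r + u) - u\<bar> < \<delta>" using v(2) by (auto simp: closed_segment_eq_real_ivl dist_real_def split: if_splits)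
    hence "\<Phi> t (r + u) x\<in>U" using \<delta>(2) by blast
    thus "\<xi> (\<Phi> t r (\<Phi> t u x), t) = 0" using U_\<xi> add by simp
   qed
   hence "\<rho> (\<Phi> t v x) = exp (N * (v - u)) * \<rho> (\<Phi> t u x)" using add[of "v - u"] by (simp add: \<rho>_def)
   also have "\<dots> = exp (N * v) * \<rho> x" using u by (simp add: exp_add[symmetric] algebra_simps)
   finally show "v\<in>?E" using v \<delta>(2)[of v] by (simp add: dist_real_def)
  qed
 qed auto
 have eq: "?E = {u\<in>?J. \<Phi> t u x\<in>closure U} Int {u\<in>?J. \<rho> (\<Phi> t u x) - exp (N * u) * \<rho> x = 0}"
  using closure_U closure_subset[of U] by fastforce
 have c1: "closedin (top_of_set ?J) {u\<in>?J. \<Phi> t u x\<in>closure U}"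
  using continuous_closedin_preimage[OF cont[of ?J] closed_closure[of U]] by (simp add: Int_def vimage_def)
 have "continuous_on ?J (%u. \<rho> (\<Phi> t u x) - exp (N * u) * \<rho> x)"
  by (intro continuous_intros continuous_on_comp[OF \<rho>_cont cont]) (use \<Phi>_carrier[OF t xc] in auto)
 hence c2: "closedin (top_of_set ?J) {u\<in>?J. \<rho> (\<Phi> t u x) - exp (N * u) * \<rho> x = 0}"
  using continuous_closedin_preimage[of ?J "%u. \<rho> (\<Phi> t u x) - exp (N * u) * \<rho> x" "{0}"] by (simp add: Int_def vimage_def)
 have cl: "closedin (top_of_set ?J) ?E" unfolding eq by (rule closedin_Int[OF c1 c2])
 have "0\<in>?E" using x \<Phi>_0[OF t xc] by (auto simp: U_def)
 moreover have "?E = {} \<or> ?E = ?J" using con op cl unfolding connected_clopen by blast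
 ultimately have "?E = ?J" by blast
 hence "s\<in>?E" using s by blast
 thus "\<Phi> t s x\<in>U" "\<rho> (\<Phi> t s x) = exp (N * s) * \<rho> x" by auto
qed

lemma \<rho>_derivative: assumes p: "p\<in>U" shows "Dfun A \<rho> p (X t p) = N * \<rho> p"
proof -
 have pc: "p\<in>carrier A" using p U_carrier by blast
 have X: "fibre_field t p = X t p" using p G2(3) by (intro fibre_field_G1) (auto simp: U_def)
 have 1: "((%s. \<rho> (\<Phi> t s p)) has_real_derivative Dfun A \<rho> p (X t p)) (at 0)"
  using derivative_along_icurve[OF \<rho>_C1 U_open \<Phi>_icurve[OF t pc], of 0] p \<Phi>_0[OF t pc] X by simp
 have o: "open {s. exp (N * s) * \<rho> p < 1}" by (intro open_Collect_less continuous_intros)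
 have "((%s. exp (N * s) * \<rho> p) has_real_derivative N * \<rho> p) (at 0)" by (auto intro!: derivative_eq_intros)
 hence "((%s. \<rho> (\<Phi> t s p)) has_real_derivative N * \<rho> p) (at 0)"
  by (rule has_field_derivative_transform_within_open[OF _ o]) (use p \<rho>_flow(2)[OF p] in \<open>auto simp: U_def\<close>)
 thus ?thesis by (rule DERIV_unique[OF 1])
qed

text \<open>A point of the level set is a limit of lower points: these lie behind it on its trajectory.\<close>

lemma frontier_sublevel:
 assumes r: "0 < r" "r < 1" shows "frontier (sublevel U \<rho> r) = {x\<in>U. \<rho> x = r}"
proof -
 have eq: "sublevel U \<rho> r = {x\<in>carrier A. (x, t)\<in>G2 & \<rho> x < r}" using r by (auto simp: sublevel_def U_def)
 have fr: "frontier (sublevel U \<rho> r) = closure (sublevel U \<rho> r) - sublevel U \<rho> r"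
  using sublevel_open[of r] by (simp add: frontier_def eq interior_open)
 obtain K where K: "closed K" "K <= carrier A" "U <= K" "!!x. x\<in>K ==> \<xi> (x, t) = 0" by (rule closed_box) (rule that)
 have "closed (K Int \<rho> -` {..r})"
  by (rule continuous_closed_preimage[OF continuous_on_subset[OF \<rho>_cont K(2)] K(1)]) simp
 moreover have "sublevel U \<rho> r <= K Int \<rho> -` {..r}" using K(3) by (auto simp: sublevel_def)
 ultimately have le: "closure (sublevel U \<rho> r) <= K Int \<rho> -` {..r}" by (metis closure_minimal)
 have clU: "closure (sublevel U \<rho> r) <= closure U" by (rule closure_mono) (auto simp: sublevel_def)
 show ?thesis
 proof
  show "frontier (sublevel U \<rho> r) <= {x\<in>U. \<rho> x = r}"
  proof
   fix x assume "x\<in>frontier (sublevel U \<rho> r)"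
   hence x: "x\<in>closure U" "\<rho> x <= r" "x\<notin>sublevel U \<rho> r" using fr le clU by auto
   hence "x\<in>U" using closure_U[of x] r by auto
   thus "x\<in>{x\<in>U. \<rho> x = r}" using x by (auto simp: sublevel_def)
  qed
  show "{x\<in>U. \<rho> x = r} <= frontier (sublevel U \<rho> r)"
  proof
   fix x assume "x\<in>{x\<in>U. \<rho> x = r}"
   hence x: "x\<in>U" "\<rho> x = r" and xc: "x\<in>carrier A" using U_carrier by auto
   have "x\<in>closure (sublevel U \<rho> r)"
    unfolding closure_iff_nhds_not_empty
   proof (intro allI impI)
    fix B T assume T: "T <= B" "open T" "x\<in>T"
    obtain \<delta> where \<delta>: "\<delta> > 0" "!!v. v\<in>UNIV ==> \<bar>v - 0\<bar> < \<delta> ==> \<Phi> t v x\<in>T"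
     by (rule continuous_on_nhd[OF \<Phi>_cont[OF t xc] UNIV_I T(2), of 0]) (use T(3) \<Phi>_0[OF t xc] in \<open>auto intro: that\<close>)
    have e: "exp (N * (- (\<delta> / 2))) * \<rho> x < r" using \<delta>(1) N0 r(1) by (simp add: x(2))
    have "\<Phi> t (- (\<delta> / 2)) x\<in>sublevel U \<rho> r"
     using \<rho>_flow[OF x(1), of "- (\<delta> / 2)"] e r(2) by (simp add: sublevel_def)
    moreover have "\<Phi> t (- (\<delta> / 2)) x\<in>T" using \<delta> by auto
    ultimately show "sublevel U \<rho> r Int B \<noteq> {}" using T(1) by blast
   qed
   thus "x\<in>frontier (sublevel U \<rho> r)" unfolding fr using x by (auto simp: sublevel_def)
  qed
 qed
qed

text \<open>The flow for time \<open>ln (s / r) / N\<close> carries one level set to the other.\<close>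

lemma level_diffeomorphic:
 assumes r: "0 < r" "r < 1" and s: "0 < s" "s < 1"
 shows "Ck_diffeomorphic A 1 {x\<in>U. \<rho> x = r} {x\<in>U. \<rho> x = s}"
proof -
 define T where "T = ln (s / r) / N"
 have T: "exp (N * T) = s / r" "exp (N * (- T)) = r / s" using r s N0 by (simp_all add: T_def exp_minus)
 have C1: "Ck_map_on A A 1 S (\<Phi> t u)" if "S <= carrier A" for S u
  unfolding Ck_map_on_def using that open_carrier \<Phi>_C1[OF t, of u] by blast
 have inv: "\<Phi> t (- u) (\<Phi> t u x) = x" if "x\<in>carrier A" for x u
  using \<Phi>_add[OF t that, of "- u" u] \<Phi>_0[OF t that] by simp
 have 1: "\<Phi> t T x\<in>U & \<rho> (\<Phi> t T x) = s" if "x\<in>U" "\<rho> x = r" for x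
  using \<rho>_flow[OF that(1), of T] that T r s by simp
 have 2: "\<Phi> t (- T) x\<in>U & \<rho> (\<Phi> t (- T) x) = r" if "x\<in>U" "\<rho> x = s" for x
  using \<rho>_flow[OF that(1), of "- T"] that T(2) r s by (simp only:) simp
 show ?thesis
  unfolding Ck_diffeomorphic_def
 proof (rule exI[of _ "\<Phi> t T"], rule exI[of _ "\<Phi> t (- T)"], intro conjI ballI)
  show "Ck_map_on A A 1 {x\<in>U. \<rho> x = r} (\<Phi> t T)" "Ck_map_on A A 1 {x\<in>U. \<rho> x = s} (\<Phi> t (- T))"
   using U_carrier by (auto intro!: C1)
  fix x assume "x\<in>{x\<in>U. \<rho> x = r}"
  thus "\<Phi> t T x\<in>{x\<in>U. \<rho> x = s}" "\<Phi> t (- T) (\<Phi> t T x) = x" using 1 inv U_carrier by auto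
 next
  fix y assume "y\<in>{x\<in>U. \<rho> x = s}"
  thus "\<Phi> t (- T) y\<in>{x\<in>U. \<rho> x = r}" "\<Phi> t T (\<Phi> t (- T) y) = y" using 2 inv[of y "- T"] U_carrier by auto
 qed
qed

theorem convex: "convex_tubular_neighborhood A \<zeta> (1/2) (L t) U \<rho> (X t)"
proof -
 have fr: "carrier A Int frontier (sublevel U \<rho> r) = {x\<in>U. \<rho> x = r}" if "r\<in>{0<..<1}" for r
  using frontier_sublevel[of r] that U_carrier by auto
 have LU: "x\<in>U & \<rho> x = 0" if "x\<in>L t" for x
 proof -
  have "\<rho> x = 0" using \<rho>_eq_0[OF L_carrier[OF t that]] that by simp
  thus ?thesis using L_carrier[OF t that] L_G2[OF t that] by (simp add: U_def)
 qed
 show ?thesis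
  unfolding convex_tubular_neighborhood_def
 proof (intro conjI ballI)
  show "Ck_map_on A std_atlas 1 U \<rho>"
  proof -
   have "mfun A n \<rho> U" if "enat n <= 1" for n
    by (rule mfun_le[OF \<rho>_C1]) (use that in "simp add: one_enat_def")
   hence "Ck_map A std_atlas 1 U \<rho>" using Ck_map_std_iff[OF U_open U_carrier] by blast
   thus ?thesis unfolding Ck_map_on_def using U_open U_carrier by blast
  qed
  show "(\<Inter>r\<in>{0<..<1}. sublevel U \<rho> r) = L t"
  proof
   show "(\<Inter>r\<in>{0<..<1}. sublevel U \<rho> r) <= L t"
   proof
    fix x assume x: "x\<in>(\<Inter>r\<in>{0<..<1}. sublevel U \<rho> r)"
    hence "x\<in>sublevel U \<rho> (1/2)" by (rule INT_D) simp
    hence xU: "x\<in>carrier A" "\<rho> x < 1" using U_carrier by (auto simp: sublevel_def)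
    have "\<rho> x = 0"
    proof (rule ccontr)
     assume "\<rho> x \<noteq> 0"
     hence "\<rho> x\<in>{0<..<1}" using \<rho>_nonneg[OF xU(1)] xU(2) by simp
     hence "x\<in>sublevel U \<rho> (\<rho> x)" by (rule INT_D[OF x])
     thus False by (simp add: sublevel_def)
    qed
    thus "x\<in>L t" using \<rho>_eq_0[OF xU(1)] by simp
   qed
  qed (use LU in "auto simp: sublevel_def")
  fix r :: real assume r: "r\<in>{0<..<1}"
  thus "carrier A Int frontier (sublevel U \<rho> r) <= U" using fr by auto
  show "submanifold A 1 (DIM('e) - 1) (carrier A Int frontier (sublevel U \<rho> r))"
   unfolding fr[OF r] submanifold_def
  proof (intro conjI ballI)
   show "{x\<in>U. \<rho> x = r} <= carrier A" using U_carrier by blast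
   fix p assume p: "p\<in>{x\<in>U. \<rho> x = r}"
   hence df: "Dfun A \<rho> p (X t p) \<noteq> 0" using \<rho>_derivative[of p] N0 r by simp
   show "\<exists>c W. slice_chart A 1 (DIM('e) - 1) {x\<in>U. \<rho> x = r} p c W"
    by (rule level_slice_chart[OF \<rho>_C1 U_open U_carrier _ df]) (use p in auto)
  qed
  show "Ck_diffeomorphic A 1 (carrier A Int frontier (sublevel U \<rho> r)) (carrier A Int frontier (sublevel U \<rho> s))"
   if "s\<in>{0<..<1}" for s
   unfolding fr[OF r] fr[OF that] using level_diffeomorphic r that by simp
  show "X t p\<notin>tangent_space A (carrier A Int frontier (sublevel U \<rho> r)) p"
   if p: "p\<in>carrier A Int frontier (sublevel U \<rho> r)" for p
  proof
   assume "X t p\<in>tangent_space A (carrier A Int frontier (sublevel U \<rho> r)) p"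
   hence "X t p\<in>tangent_space A {x\<in>U. \<rho> x = r} p" unfolding fr[OF r] .
   moreover have p': "p\<in>{x\<in>U. \<rho> x = r}" using p fr[OF r] by blast
   ultimately have "Dfun A \<rho> p (X t p) = 0"
    by (intro tangent_zero[OF \<rho>_C1 U_open, of p "{x\<in>U. \<rho> x = r}" r]) auto
   thus False using \<rho>_derivative[of p] p' N0 r by simp
  qed
 next
  show "differential A U \<rho> p (X t p) > 1/2 * \<rho> p" if p: "p\<in>U - L t" for p
  proof -
   have pc: "p\<in>carrier A" using p U_carrier by blast
   have "0 < \<rho> p" using \<rho>_nonneg[OF pc] \<rho>_eq_0[OF pc] p by auto
   moreover have "1 * \<rho> p <= N * \<rho> p" using N \<rho>_nonneg[OF pc] by (rule mult_right_mono)
   ultimately show ?thesis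
    using differential_eq[OF \<rho>_C1 U_open _ pc] \<rho>_derivative[of p] p by simp
  qed
 qed (use U_open U_carrier LU \<rho>_nonneg X_contact[OF t U_open U_carrier] in "auto simp: U_def")
qed

end

context tube begin

theorem convex_isotopy: "\<exists>U \<rho> Y. convex_tubular_isotopy A \<zeta> I L U \<rho> Y"
proof -
 let ?P = "%N t. \<exists>U. open U & U <= carrier A & {x\<in>carrier A. \<xi> (x, t) \<noteq> 1} <= U & mfun A (Suc 0) (R N t) U"
 have "\<exists>N0. \<forall>a\<in>I. 1 <= N0 a & (\<forall>N\<ge>N0 a. \<forall>t. \<bar>t - a\<bar> <= rad a --> ?P N t)"
  by (rule bchoice, rule ballI) (rule R_C1_near)
 then obtain N0 where N0: "\<forall>a\<in>I. 1 <= N0 a & (\<forall>N\<ge>N0 a. \<forall>t. \<bar>t - a\<bar> <= rad a --> ?P N t)" by (rule exE)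
 have r1: "0 < rad a & 1 <= N0 a" if "a\<in>I" for a using rad(1)[OF that] N0 that by simp
 obtain N where N: "continuous_on I N" "!!t. t\<in>I ==> 1 <= N t" "!!t. t\<in>I ==> \<exists>a\<in>I. \<bar>t - a\<bar> < rad a & N0 a <= N t"
  by (rule continuous_majorant[of I rad N0, OF r1]) (assumption | rule that)+
 have C1: "?P (N t) t" if t: "t\<in>I" for t
 proof -
  obtain a where a: "a\<in>I" "\<bar>t - a\<bar> < rad a" "N0 a <= N t" using N(3)[OF t] by blast
  hence "\<bar>t - a\<bar> <= rad a" by simp
  thus ?thesis using N0[rule_format, OF a(1), THEN conjunct2, rule_format, OF a(3)] by blast
 qed
 let ?G = "%a m. \<forall>t x. \<bar>t - a\<bar> <= rad a --> x\<in>carrier A --> (x, t)\<notin>G2 --> \<xi> (x, t) \<noteq> 1 --> 1 < m * R (N t) t x"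
 have "\<exists>m. \<forall>a\<in>I. 1 <= m a & ?G a (m a)"
  by (rule bchoice, rule ballI) (rule R_pos_outside_G2[OF _ N(1,2)])
 then obtain m where m: "\<forall>a\<in>I. 1 <= m a & ?G a (m a)" by (rule exE)
 have r2: "0 < rad a & 1 <= m a" if "a\<in>I" for a using rad(1)[OF that] m that by simp
 obtain M where M: "continuous_on I M" "!!t. t\<in>I ==> 1 <= M t" "!!t. t\<in>I ==> \<exists>a\<in>I. \<bar>t - a\<bar> < rad a & m a <= M t"
  by (rule continuous_majorant[of I rad m, OF r2]) (assumption | rule that)+
 have gap: "1 < M t * R (N t) t x" if tx: "t\<in>I" "x\<in>carrier A" "(x, t)\<notin>G2" "\<xi> (x, t) \<noteq> 1" for t x
 proof -
  obtain a where a: "a\<in>I" "\<bar>t - a\<bar> < rad a" "m a <= M t" using M(3)[OF tx(1)] by blast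
  have "1 < m a * R (N t) t x" using m[rule_format, OF a(1), THEN conjunct2, rule_format, of t x] a(2) tx by simp
  also have "\<dots> <= M t * R (N t) t x"
   using a(3) R_nonneg[OF tx(1,2)] N(2)[OF tx(1)] by (intro mult_right_mono) auto
  finally show ?thesis .
 qed
 define \<rho> where "\<rho> t x = M t * R (N t) t x" for t x
 define U where "U t = {x\<in>carrier A. (x, t)\<in>G2 & \<rho> t x < 1}" for t
 have cv: "convex_tubular_neighborhood A \<zeta> (1/2) (L t) (U t) (\<rho> t) (X t)" if t: "t\<in>I" for t
 proof -
  obtain U0 where U0: "open U0" "U0 <= carrier A" "{x\<in>carrier A. \<xi> (x, t) \<noteq> 1} <= U0" "mfun A (Suc 0) (R (N t) t) U0"
   using C1[OF t] by blast
  interpret F: tube_fibre A \<zeta> I \<alpha> H V L h O' G1 G2 \<beta> \<xi> t "N t" "M t" U0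
   by (unfold_locales) (use t N(2) M(2) U0 gap in auto)
  show ?thesis using F.convex by (simp add: F.U_def[abs_def] F.\<rho>_def[abs_def] U_def \<rho>_def[abs_def])
 qed
 have cP: "carrier P = carrier A \<times> I" by (rule carrier_prod)
 have cont: "continuous_on (carrier A \<times> I) (%q. \<rho> (snd q) (fst q))"
  unfolding \<rho>_def by (intro continuous_on_mult R_cont[OF N(1,2)] continuous_on_comp[OF M(1)]) (auto intro!: continuous_intros)
 have tot: "total_space I U = (carrier A \<times> I) Int (%q. \<rho> (snd q) (fst q)) -` {..<1} Int G2"
  by (auto simp: total_space_def U_def)
 have "open (carrier A \<times> I)" using open_carrier I by (rule open_Times)
 hence "open ((carrier A \<times> I) Int (%q. \<rho> (snd q) (fst q)) -` {..<1})" using cont by (intro continuous_open_preimage) auto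
 hence "open (total_space I U)" unfolding tot using G2(1) by blast
 moreover have "smooth_vector_field_family A (total_space I U) X" by (rule X_family_smooth) (auto simp: tot)
 moreover have "continuous_on (total_space I U) (%(x, t). \<rho> t x)"
  using continuous_on_subset[OF cont, of "total_space I U"] by (auto simp: tot case_prod_unfold)
 ultimately have "convex_tubular_isotopy A \<zeta> I L U \<rho> X"
  unfolding convex_tubular_isotopy_def using cv by (intro conjI exI[of _ "1/2"]) auto
 thus ?thesis by blast
qed

end

text \<open>Both cutoffs come from the same construction, first within the domain of the Hamiltonian and then within the set
 where the first one equals one.\<close>

theorem (in weinstein_family) convex_isotopy_exists: "\<exists>U \<rho> Y. convex_tubular_isotopy A \<zeta> I L U \<rho> Y"
proof -
 obtain h :: "'a \<times> real => real" and O' where hs: "!!n. mfun P n h (carrier A \<times> I)" "open O'" "LI <= O'" "O' <= carrier A \<times> I"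
  and h0: "!!x s. (x, s)\<in>O' ==> h (x, s) = 0 \<longleftrightarrow> x\<in>H s"
  and Dh: "!!x s. (x, s)\<in>O' ==> 1/2 < Dfun A (%x. h (x, s)) x (Reeb s x)"
   "!!x s. (x, s)\<in>O' ==> x\<in>H s ==> Dfun A (%x. h (x, s)) x (Reeb s x) = 1"
  by (rule global_hamiltonian) (rule that)
 obtain \<beta> :: "'a \<times> real => real" and G1 where bs: "!!n. mfun P n \<beta> (carrier P)" "!!q. 0 <= \<beta> q" "!!q. \<beta> q <= 1"
  "open G1" "LI <= G1" "G1 <= O' Int carrier P" "!!q. q\<in>G1 ==> \<beta> q = 1"
  "!!J. compact J ==> J <= I ==> \<exists>K. compact K & K <= O' Int carrier P & (\<forall>q. snd q\<in>J --> q\<notin>K --> \<beta> q = 0)"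
  by (rule cutoff_near_skeleta[OF hs(2,3)]) (rule that)
 obtain \<kappa> :: "'a \<times> real => real" and G2 where \<kappa>: "!!n. mfun P n \<kappa> (carrier P)" "!!q. 0 <= \<kappa> q" "!!q. \<kappa> q <= 1"
  "open G2" "LI <= G2" "G2 <= G1 Int carrier P" "!!q. q\<in>G2 ==> \<kappa> q = 1"
  "!!J. compact J ==> J <= I ==> \<exists>K. compact K & K <= G1 Int carrier P & (\<forall>q. snd q\<in>J --> q\<notin>K --> \<kappa> q = 0)"
  by (rule cutoff_near_skeleta[OF bs(4,5)]) (rule that)
 interpret hamiltonian A \<zeta> I \<alpha> h by unfold_locales (rule hs(1))
 interpret tube A \<zeta> I \<alpha> H V L h O' G1 G2 \<beta> "%q. 1 - \<kappa> q"
 proof unfold_locales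
  show "mfun P n (%q. 1 - \<kappa> q) (carrier P)" for n
   by (rule P.mfun_diff[OF P.mfun_const \<kappa>(1) P.open_carrier])
  show "q\<in>G1" if q: "q\<in>carrier P" "1 - \<kappa> q = 0" for q
  proof -
   have "{snd q} <= I" using q(1) carrier_prod by auto
   then obtain K where "K <= G1 Int carrier P" "\<forall>p. snd p\<in>{snd q} --> p\<notin>K --> \<kappa> p = 0" using \<kappa>(8)[of "{snd q}"] by auto
   moreover have "\<kappa> q \<noteq> 0" using q(2) by simp
   ultimately show ?thesis by blast
  qed
  show "\<exists>K. compact K & K <= carrier P & (\<forall>q. snd q\<in>J --> q\<notin>K --> \<beta> q = 0)" if "compact J" "J <= I" for J
   using bs(8)[OF that] by blast
  show "\<exists>K. compact K & K <= carrier P & (\<forall>q. snd q\<in>J --> q\<notin>K --> 1 - \<kappa> q = 1)" if J: "compact J" "J <= I" for J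
  proof -
   obtain K where "compact K" "K <= G1 Int carrier P" "\<forall>q. snd q\<in>J --> q\<notin>K --> \<kappa> q = 0" using \<kappa>(8)[OF J] by blast
   thus ?thesis by (intro exI[of _ K]) simp
  qed
  show "O' <= carrier A \<times> I" by (rule hs(4))
 qed (use h0 Dh bs \<kappa> in auto)
 show ?thesis by (rule convex_isotopy)
qed

theorem proposition1p10:
  fixes A :: "('a::{t2_space, second_countable_topology}, 'e::euclidean_space) chart set"
    and \<xi> :: "'a \<Rightarrow> 'e set"
    and I :: "real set"
    and LI :: "('a \<times> real) set"
  assumes "smooth_atlas A"
    and "contact_structure A \<xi>"
    and "open I" and "is_interval I" and "I \<noteq> {}"
    and "legendrian_isotopy A \<xi> I LI"
    and "\<exists>\<alpha> R. contact_form A \<xi> \<alpha> \<and> reeb_vector_field A \<alpha> R \<and>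
           uniformly_displaceable A R I (slice_at LI)"
    and "\<exists>\<alpha> H V \<phi>. weinstein_isotopy A \<xi> I \<alpha> H V \<phi> \<and>
           (\<forall>t\<in>I. skeleton A (H t) (V t) = slice_at LI t)"
  shows "\<exists>U \<rho> X. convex_tubular_isotopy A \<xi> I (slice_at LI) U \<rho> X"
proof -
  obtain \<alpha> H V \<phi> where W: "weinstein_isotopy A \<xi> I \<alpha> H V \<phi>" and sk: "\<forall>t\<in>I. skeleton A (H t) (V t) = slice_at LI t"
    using assms(8) by blast
  have hyp: "weinstein_hypersurface A \<xi> (\<alpha> t) (H t) (V t) (\<phi> t)" if "t \<in> I" for t
    using W that by (simp add: weinstein_isotopy_def)
  have cl: "closedin (top_of_set (carrier A \<times> I)) LI" using assms(6) by (simp add: legendrian_isotopy_def)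
  then have LI: "total_space I (slice_at LI) = LI"
    using closedin_imp_subset by (force simp: total_space_def slice_at_def)
  interpret weinstein_family A \<xi> I \<alpha> H V "slice_at LI"
  proof unfold_locales
    fix t p u assume tp: "t \<in> I" "p \<in> H t"
    note w = hyp[OF tp(1), unfolded weinstein_hypersurface_def]
    show "V t p \<in> tangent_space A (H t) p" using w tp(2) by blast
    show "ext_deriv A (\<alpha> t) p (V t p) v = \<alpha> t p v" if "v \<in> tangent_space A (H t) p" for v using w tp(2) that by blast
    show "u = 0" if "u \<in> tangent_space A (H t) p" "\<And>v. v \<in> tangent_space A (H t) p \<Longrightarrow> ext_deriv A (\<alpha> t) p u v = 0"
      using w tp(2) that by blast
  next
    fix t assume t: "t \<in> I"
    note w = hyp[OF t, unfolded weinstein_hypersurface_def]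
    show "contact_form A \<xi> (\<alpha> t)" "compact (H t)" "submanifold_with_boundary A \<infinity> (DIM('e) - 1) (H t)"
      "outward_transverse A (DIM('e) - 1) (H t) (V t)" using w by blast+
    show "skeleton A (H t) (V t) = slice_at LI t" using sk t by blast
  qed (use assms(1,3) W cl LI in \<open>auto simp: weinstein_isotopy_def\<close>)
  show ?thesis by (rule convex_isotopy_exists)
qed

end
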